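(* Let $\chi$ be an irreducible character of $W$ and let $0\ne v_\chi\in V_\chi$. (1) The $\mathcal{H}$-module $L(\chi)$ is finite-dimensional if and only if there exists an integer $m\ge 0$ such that $(E^m.v_\chi,\,P)=0$ for all $P\in M_{2m}(\chi)[\chi]$. (2) For every $m\ge0$, $\dim M_{2m}(\chi)[\chi]<\infty$, and for every fixed $P\in M_{2m}(\chi)[\chi]$ the value $(E^m.v_\chi,P)$ is a polynomial in the $k_\alpha$, $\alpha\in R^+$. Consequently, if $\{P_1,\dots,P_s\}$ is a basis of $M_{2m}(\chi)[\chi]$, the condition $E^m.v_\chi\in R_{2m}(\chi)$ is equivalent to the vanishing of the $s$ polynomials $(E^m.v_\chi,P_j)$, $1\le j\le s$.
   Context: Let $\mathfrak{a}_{\mathbb{R}}$ be a real vector space of dimension $\ell\ge 1$, $R\subset\mathfrak{a}_{\mathbb{R}}^*$ a reduced root system, $W$ its Weyl group, $\mathfrak{a}=\mathbb{C}\otimes_{\mathbb{R}}\mathfrak{a}_{\mathbb{R}}$. For $\alpha\in R$ let $r_\alpha$ be the reflection and $\alpha^\vee\in\mathfrak{a}$ the coroot. Fix $k:R\to\mathbb{C}$, $\alpha\mapsto k_\alpha$, with $k_{w(\alpha)}=k_\alpha$ for all $w\in W$. Let $\mathcal{P}=S(\mathfrak{a}^* )=\bigoplus_{n\ge0}\mathcal{P}_n$, $\mathcal{P}_n=S^n(\mathfrak{a}^* )$, $\mathcal{P}_+=\bigoplus_{n\ge1}\mathcal{P}_n$, with its natural $W$-action. For $y\in\mathfrak{a}$,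 the Dunkl operator is $T_y=T_y(k)=\partial_y+\sum_{\alpha\in R^+}k_\alpha\frac{\langle\alpha,y\rangle}{\alpha}(1-r_\alpha)\in\mathrm{End}_{\mathbb{C}}(\mathcal{P})$, where $R^+$ is a system of positive roots. The rational Cherednik algebra $\mathcal{H}=\mathcal{H}(k)$ is the subalgebra of $\mathrm{End}_{\mathbb{C}}(\mathcal{P})$ generated by all $w\in W$, all multiplications by $x\in\mathfrak{a}^*$ and all $T_y$, $y\in\mathfrak{a}$. The map $y\mapsto T_y$ extends to an algebra isomorphism $T$ from $S(\mathfrak{a})$ onto $\mathcal{S}=\mathbb{C}[T_y:y\in\mathfrak{a}]$; put $\mathcal{S}_+=\bigoplus_{n\ge1}T(S^n(\mathfrak{a}))$. Multiplication gives $\mathcal{H}=\mathcal{P}\otimes\mathbb{C}W\otimes\mathcal{S}$ as vector spaces; $\mathcal{S}\otimes\mathbb{C}W$ denotes the subalgebra generated by $\mathcal{S}$ and $W$. For an irreducible character $\chi$ of $W$ let $V_\chi$ be an irreducible $W$-module of character $\chi$, made into an $\mathcal{S}\otimes\mathbb{C}W$-module by $\mathcal{S}_+V_\chi=0$. The Verma module is $M(\chi)=\mathcal{H}\otimes_{\mathcal{S}\otimes\mathbb{C}W}V_\chi$, identified with $\mathcal{P}\otimes V_\chi$ (an identification under which the $W$-action is the tensor product action, independent of $k$) and graded by $M_n(\chi)=\mathcal{P}_n\otimes V_\chi$. $M_n(\chi)[\chi]$ denotes the $\chi$-isotypic component of the $W$-module $M_n(\chi)$. $M(\chi)$ has a unique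 simple quotient $L(\chi)$. Let $B^*(x,z)=\sum_{\alpha\in R}\langle\alpha^\vee,x\rangle\langle\alpha^\vee,z\rangle$ on $\mathfrak{a}^*$ and let $B:\mathfrak{a}^*\to\mathfrak{a}$ be the isomorphism with $B^*(x,z)=\langle B(x),z\rangle$. There is an involutive anti-automorphism $\sigma$ of $\mathcal{H}$ with $\sigma(x)=T_{B(x)}$, $\sigma(T_y)=B^{-1}(y)$, $\sigma(w)=w^{-1}$. Let $\pi:\mathcal{H}\to\mathbb{C}W$ be the projection along $\mathcal{P}_+\mathcal{H}+\mathcal{H}\mathcal{S}_+$ (one has $\mathcal{H}=\mathbb{C}W\oplus(\mathcal{P}_+\mathcal{H}+\mathcal{H}\mathcal{S}_+)$) and $\beta(a,b)=\pi(\sigma(a)b)$. Fix a nondegenerate symmetric $W$-invariant bilinear form $(\cdot\mid\cdot)$ on $V_\chi$ and $0\neq v_\chi\in V_\chi$ (independent of $k$); then $(a.v_\chi,b.v_\chi)=(v_\chi\mid\beta(a,b).v_\chi)$, $a,b\in\mathcal{H}$, is a well-defined symmetric bilinear form $(\cdot,\cdot)$ on $M(\chi)=\mathcal{H}.v_\chi$. Let $R(\chi)$ be its radical (a graded $\mathcal{H}$-submodule) and $R_n(\chi)=R(\chi)\cap M_n(\chi)$. Let $z_1,\dots,z_\ell$ be a basis of $\mathfrak{a}_{\mathbb{R}}^*$ orthonormal for $B^*$; $E=\frac12\sum_{i=1}^\ell z_i^2\in\mathcal{P}_2\subset\mathcal{H}$. *)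

theory Defs
  imports "HOL-Analysis.Analysis" "HOL-Library.Poly_Mapping" "HOL-Library.Function_Algebras"
begin

text \<open>
  A basis of the real vector space is fixed, so that the space and its dual are both
  \<^typ>\<open>real^'n\<close> with pairing \<^term>\<open>(\<bullet>)\<close>, the complexifications are
  \<^typ>\<open>complex^'n\<close>, and the symmetric algebra of the dual is the polynomial ring in
  variables indexed by \<^typ>\<open>'n\<close>.  Elements of the dual come first in pairings.
\<close>

type_synonym 'x mpoly = "('x \<Rightarrow>\<^sub>0 nat) \<Rightarrow>\<^sub>0 complex"
type_synonym 'n oper = "'n mpoly \<Rightarrow> 'n mpoly"
type_synonym 'n lin = "real^'n \<Rightarrow> real^'n"
type_synonym ('n, 'd) rep = "'n lin \<Rightarrow> complex^'d \<Rightarrow> complex^'d"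
type_synonym ('n, 'd) vpoly = "('n mpoly)^'d"


section \<open>Complex vector space structures\<close>

definition pm_scale :: "complex \<Rightarrow> ('x \<Rightarrow>\<^sub>0 complex) \<Rightarrow> ('x \<Rightarrow>\<^sub>0 complex)"
  where "pm_scale c f = Poly_Mapping.map ((*) c) f"

lemma lookup_pm_scale: "Poly_Mapping.lookup (pm_scale c f) x = c * Poly_Mapping.lookup f x"
  by (cases "Poly_Mapping.lookup f x = 0") (simp_all add: pm_scale_def Poly_Mapping.map.rep_eq)

global_interpretation pm: vector_space pm_scale
  by unfold_locales (auto intro!: poly_mapping_eqI simp: lookup_pm_scale lookup_add algebra_simps)

definition op_scale :: "complex \<Rightarrow> 'n oper \<Rightarrow> 'n oper"
  where "op_scale c f = (\<lambda>p. pm_scale c (f p))"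

global_interpretation opr: vector_space op_scale
  by unfold_locales (auto simp: op_scale_def fun_eq_iff pm.scale_right_distrib pm.scale_left_distrib)

definition vp_scale :: "complex \<Rightarrow> ('n, 'd::finite) vpoly \<Rightarrow> ('n, 'd) vpoly"
  where "vp_scale c u = (\<chi> i. pm_scale c (u $ i))"

global_interpretation vp: vector_space vp_scale
  by unfold_locales (auto simp: vp_scale_def vec_eq_iff pm.scale_right_distrib pm.scale_left_distrib)


section \<open>Root systems\<close>

definition hyp_refl :: "real^'n::finite \<Rightarrow> real^'n \<Rightarrow> 'n lin"
  where "hyp_refl \<alpha> h = (\<lambda>x. x - (x \<bullet> h) *\<^sub>R \<alpha>)"

text \<open>Bourbaki's definition, in particular with integrality.\<close>

definition reduced_root_system :: "(real^'n::finite) set \<Rightarrow> bool"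
  where "reduced_root_system R \<longleftrightarrow>
    finite R \<and> 0 \<notin> R \<and> span R = UNIV \<and>
    (\<forall>\<alpha>\<in>R. \<exists>h. \<alpha> \<bullet> h = 2 \<and> hyp_refl \<alpha> h ` R = R \<and> (\<forall>\<beta>\<in>R. \<beta> \<bullet> h \<in> \<int>)) \<and>
    (\<forall>\<alpha>\<in>R. \<forall>c. c *\<^sub>R \<alpha> \<in> R \<longrightarrow> c = 1 \<or> c = -1)"

text \<open>In a root system such an \<open>h\<close> is unique, because \<open>R\<close> is finite and spans.\<close>

definition coroot :: "(real^'n::finite) set \<Rightarrow> real^'n \<Rightarrow> real^'n"
  where "coroot R \<alpha> = (THE h. \<alpha> \<bullet> h = 2 \<and> hyp_refl \<alpha> h ` R = R)"

definition root_refl :: "(real^'n::finite) set \<Rightarrow> real^'n \<Rightarrow> 'n lin"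
  where "root_refl R \<alpha> = hyp_refl \<alpha> (coroot R \<alpha>)"

text \<open>The generators are involutions, so the monoid they generate is a group.\<close>

inductive_set weyl_group :: "(real^'n::finite) set \<Rightarrow> 'n lin set" for R
  where
    weyl_id: "id \<in> weyl_group R"
  | weyl_refl: "\<alpha> \<in> R \<Longrightarrow> w \<in> weyl_group R \<Longrightarrow> root_refl R \<alpha> \<circ> w \<in> weyl_group R"

definition positive_system :: "(real^'n::finite) set \<Rightarrow> (real^'n) set \<Rightarrow> bool"
  where "positive_system R Rp \<longleftrightarrow>
    (\<exists>y. (\<forall>\<alpha>\<in>R. \<alpha> \<bullet> y \<noteq> 0) \<and> Rp = {\<alpha> \<in> R. \<alpha> \<bullet> y > 0})"

definition invariant_mult :: "(real^'n::finite) set \<Rightarrow> (real^'n \<Rightarrow> complex) \<Rightarrow> bool"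
  where "invariant_mult R k \<longleftrightarrow> (\<forall>w\<in>weyl_group R. \<forall>\<alpha>\<in>R. k (w \<alpha>) = k \<alpha>)"

definition cplx :: "real^'n::finite \<Rightarrow> complex^'n"
  where "cplx x = (\<chi> i. of_real (x $ i))"

definition pairing :: "complex^'n::finite \<Rightarrow> complex^'n \<Rightarrow> complex"
  where "pairing x y = (\<Sum>i\<in>UNIV. x $ i * y $ i)"

text \<open>\<open>B_form\<close> is the form \<open>B\<^sup>*\<close>, and \<open>B_map\<close> the map \<open>B\<close> determined by
  \<open>pairing z (B_map R x) = B_form R x z\<close>.\<close>

definition B_form :: "(real^'n::finite) set \<Rightarrow> complex^'n \<Rightarrow> complex^'n \<Rightarrow> complex"
  where "B_form R x z =
    (\<Sum>\<alpha>\<in>R. pairing x (cplx (coroot R \<alpha>)) * pairing z (cplx (coroot R \<alpha>)))"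

definition B_map :: "(real^'n::finite) set \<Rightarrow> complex^'n \<Rightarrow> complex^'n"
  where "B_map R x = (\<chi> i. B_form R x (axis i 1))"


section \<open>Polynomials\<close>

definition mdeg :: "('x::finite \<Rightarrow>\<^sub>0 nat) \<Rightarrow> nat"
  where "mdeg m = (\<Sum>i\<in>UNIV. Poly_Mapping.lookup m i)"

definition hom_polys :: "nat \<Rightarrow> ('n::finite) mpoly set"
  where "hom_polys n = {p. \<forall>m\<in>Poly_Mapping.keys p. mdeg m = n}"

definition pos_polys :: "('n::finite) mpoly set"
  where "pos_polys = pm.span (\<Union>n\<in>{1..}. hom_polys n)"

definition const_poly :: "complex \<Rightarrow> 'n mpoly"
  where "const_poly c = Poly_Mapping.single 0 c"

definition lin_poly :: "complex^'n::finite \<Rightarrow> 'n mpoly"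
  where "lin_poly x = (\<Sum>i\<in>UNIV. Poly_Mapping.single (Poly_Mapping.single i 1) (x $ i))"

text \<open>The algebra endomorphism extending the linear map \<open>w\<close> of the degree one part.\<close>

definition poly_act :: "'n lin \<Rightarrow> ('n::finite) oper"
  where "poly_act w p =
    (\<Sum>m\<in>Poly_Mapping.keys p. const_poly (Poly_Mapping.lookup p m) *
       (\<Prod>i\<in>UNIV. lin_poly (cplx (w (axis i 1))) ^ Poly_Mapping.lookup m i))"

text \<open>For \<open>Poly_Mapping.lookup m i = 0\<close> the exponent below is truncated, but the coefficient vanishes.\<close>

definition partial_deriv :: "'n \<Rightarrow> ('n::finite) oper"
  where "partial_deriv i p =
    (\<Sum>m\<in>Poly_Mapping.keys p. Poly_Mapping.single (m - Poly_Mapping.single i 1)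
                   (of_nat (Poly_Mapping.lookup m i) * Poly_Mapping.lookup p m))"

definition dir_deriv :: "complex^'n::finite \<Rightarrow> 'n oper"
  where "dir_deriv y p = (\<Sum>i\<in>UNIV. pm_scale (y $ i) (partial_deriv i p))"

definition exact_div :: "'n mpoly \<Rightarrow> 'n mpoly \<Rightarrow> 'n mpoly"
  where "exact_div p q = (THE r. q * r = p)"

definition poly_eval :: "('x \<Rightarrow> complex) \<Rightarrow> 'x mpoly \<Rightarrow> complex"
  where "poly_eval f p = (\<Sum>m\<in>Poly_Mapping.keys p. Poly_Mapping.lookup p m * (\<Prod>x\<in>Poly_Mapping.keys m. f x ^ Poly_Mapping.lookup m x))"

definition poly_vars :: "'x mpoly \<Rightarrow> 'x set"
  where "poly_vars p = (\<Union>m\<in>Poly_Mapping.keys p. Poly_Mapping.keys m)"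


section \<open>The rational Cherednik algebra\<close>

definition mult_op :: "'n mpoly \<Rightarrow> 'n oper"
  where "mult_op p = (\<lambda>q. p * q)"

definition dunkl ::
  "(real^'n::finite) set \<Rightarrow> (real^'n) set \<Rightarrow> (real^'n \<Rightarrow> complex) \<Rightarrow> complex^'n \<Rightarrow> 'n oper"
  where "dunkl R Rp k y p = dir_deriv y p +
    (\<Sum>\<alpha>\<in>Rp. pm_scale (k \<alpha> * pairing (cplx \<alpha>) y)
       (exact_div (p - poly_act (root_refl R \<alpha>) p) (lin_poly (cplx \<alpha>))))"

inductive_set cherednik ::
  "(real^'n::finite) set \<Rightarrow> (real^'n) set \<Rightarrow> (real^'n \<Rightarrow> complex) \<Rightarrow> 'n oper set"
  for R Rp k
  where
    cherednik_weyl: "w \<in> weyl_group R \<Longrightarrow> poly_act w \<in> cherednik R Rp k"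
  | cherednik_lin: "mult_op (lin_poly x) \<in> cherednik R Rp k"
  | cherednik_dunkl: "dunkl R Rp k y \<in> cherednik R Rp k"
  | cherednik_add: "a \<in> cherednik R Rp k \<Longrightarrow> b \<in> cherednik R Rp k \<Longrightarrow> a + b \<in> cherednik R Rp k"
  | cherednik_scale: "a \<in> cherednik R Rp k \<Longrightarrow> op_scale c a \<in> cherednik R Rp k"
  | cherednik_comp: "a \<in> cherednik R Rp k \<Longrightarrow> b \<in> cherednik R Rp k \<Longrightarrow> a \<circ> b \<in> cherednik R Rp k"

text \<open>The span of the products \<open>T(y\<^sub>1) \<dots> T(y\<^sub>n)\<close>, that is, the image of the
  \<open>n\<close>-th symmetric power under the algebra homomorphism extending \<open>y \<mapsto> T(y)\<close>.\<close>

definition dunkl_hom ::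
  "(real^'n::finite) set \<Rightarrow> (real^'n) set \<Rightarrow> (real^'n \<Rightarrow> complex) \<Rightarrow> nat \<Rightarrow> 'n oper set"
  where "dunkl_hom R Rp k n =
    opr.span {foldr (\<circ>) (map (dunkl R Rp k) ys) id | ys. length ys = n}"

definition dunkl_pos ::
  "(real^'n::finite) set \<Rightarrow> (real^'n) set \<Rightarrow> (real^'n \<Rightarrow> complex) \<Rightarrow> 'n oper set"
  where "dunkl_pos R Rp k = opr.span (\<Union>n\<in>{1..}. dunkl_hom R Rp k n)"

definition is_sigma ::
  "(real^'n::finite) set \<Rightarrow> (real^'n) set \<Rightarrow> (real^'n \<Rightarrow> complex) \<Rightarrow> ('n oper \<Rightarrow> 'n oper) \<Rightarrow> bool"
  where "is_sigma R Rp k s \<longleftrightarrow>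
    (\<forall>a\<in>cherednik R Rp k. s a \<in> cherednik R Rp k \<and> s (s a) = a \<and>
       (\<forall>c. s (op_scale c a) = op_scale c (s a)) \<and>
       (\<forall>b\<in>cherednik R Rp k. s (a + b) = s a + s b \<and> s (a \<circ> b) = s b \<circ> s a)) \<and>
    (\<forall>x. s (mult_op (lin_poly x)) = dunkl R Rp k (B_map R x)) \<and>
    (\<forall>y. s (dunkl R Rp k y) = mult_op (lin_poly (inv (B_map R) y))) \<and>
    (\<forall>w\<in>weyl_group R. s (poly_act w) = poly_act (inv w))"

text \<open>The values on generators determine the map on the algebra; its values elsewhere are
  never used.\<close>

definition ch_sigma ::
  "(real^'n::finite) set \<Rightarrow> (real^'n) set \<Rightarrow> (real^'n \<Rightarrow> complex) \<Rightarrow> 'n oper \<Rightarrow> 'n oper"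
  where "ch_sigma R Rp k = (SOME s. is_sigma R Rp k s)"

text \<open>The subspace \<open>P\<^sub>+ H + H S\<^sub>+\<close>.\<close>

definition pi_kernel ::
  "(real^'n::finite) set \<Rightarrow> (real^'n) set \<Rightarrow> (real^'n \<Rightarrow> complex) \<Rightarrow> 'n oper set"
  where "pi_kernel R Rp k = opr.span
    ({mult_op p \<circ> h | p h. p \<in> pos_polys \<and> h \<in> cherednik R Rp k} \<union>
     {h \<circ> s | h s. h \<in> cherednik R Rp k \<and> s \<in> dunkl_pos R Rp k})"

text \<open>Elements of the group algebra of \<open>W\<close> are given by their coefficient functions.\<close>

definition grp_alg :: "(real^'n::finite) set \<Rightarrow> ('n lin \<Rightarrow> complex) set"
  where "grp_alg R = {f. \<forall>w. w \<notin> weyl_group R \<longrightarrow> f w = 0}"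

definition grp_alg_op :: "(real^'n::finite) set \<Rightarrow> ('n lin \<Rightarrow> complex) \<Rightarrow> 'n oper"
  where "grp_alg_op R f = (\<Sum>w\<in>weyl_group R. op_scale (f w) (poly_act w))"

definition pi_proj ::
  "(real^'n::finite) set \<Rightarrow> (real^'n) set \<Rightarrow> (real^'n \<Rightarrow> complex) \<Rightarrow> 'n oper \<Rightarrow> 'n lin \<Rightarrow> complex"
  where "pi_proj R Rp k h =
    (THE f. f \<in> grp_alg R \<and> h - grp_alg_op R f \<in> pi_kernel R Rp k)"

definition ch_beta ::
  "(real^'n::finite) set \<Rightarrow> (real^'n) set \<Rightarrow> (real^'n \<Rightarrow> complex) \<Rightarrow>
    'n oper \<Rightarrow> 'n oper \<Rightarrow> 'n lin \<Rightarrow> complex"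
  where "ch_beta R Rp k a b = pi_proj R Rp k (ch_sigma R Rp k a \<circ> b)"


section \<open>Representations of the Weyl group\<close>

definition is_rep :: "(real^'n::finite) set \<Rightarrow> ('n, 'd::finite) rep \<Rightarrow> bool"
  where "is_rep R \<rho> \<longleftrightarrow>
    (\<forall>w\<in>weyl_group R. Vector_Spaces.linear (*s) (*s) (\<rho> w)) \<and>
    \<rho> id = id \<and>
    (\<forall>w\<in>weyl_group R. \<forall>w'\<in>weyl_group R. \<rho> (w \<circ> w') = \<rho> w \<circ> \<rho> w')"

definition irreducible_rep :: "(real^'n::finite) set \<Rightarrow> ('n, 'd::finite) rep \<Rightarrow> bool"
  where "irreducible_rep R \<rho> \<longleftrightarrow> is_rep R \<rho> \<and>
    (\<forall>U. vec.subspace U \<and> (\<forall>w\<in>weyl_group R. \<rho> w ` U \<subseteq> U) \<longrightarrow> U = {0} \<or> U = UNIV)"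

definition has_character ::
  "(real^'n::finite) set \<Rightarrow> ('n, 'd::finite) rep \<Rightarrow> ('n lin \<Rightarrow> complex) \<Rightarrow> bool"
  where "has_character R \<rho> ch \<longleftrightarrow> (\<forall>w\<in>weyl_group R. ch w = trace (matrix (\<rho> w)))"

definition grp_alg_act ::
  "(real^'n::finite) set \<Rightarrow> ('n, 'd::finite) rep \<Rightarrow> ('n lin \<Rightarrow> complex) \<Rightarrow> complex^'d \<Rightarrow> complex^'d"
  where "grp_alg_act R \<rho> f v = (\<Sum>w\<in>weyl_group R. f w *s \<rho> w v)"

definition nondeg_sym_inv_form ::
  "(real^'n::finite) set \<Rightarrow> ('n, 'd::finite) rep \<Rightarrow> (complex^'d \<Rightarrow> complex^'d \<Rightarrow> complex) \<Rightarrow> bool"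
  where "nondeg_sym_inv_form R \<rho> b \<longleftrightarrow>
    (\<forall>u. Vector_Spaces.linear (*s) (*) (b u)) \<and>
    (\<forall>u v. b u v = b v u) \<and>
    (\<forall>u. (\<forall>v. b u v = 0) \<longrightarrow> u = 0) \<and>
    (\<forall>w\<in>weyl_group R. \<forall>u v. b (\<rho> w u) (\<rho> w v) = b u v)"


section \<open>Verma modules\<close>

text \<open>The tensor product of the polynomial ring with \<^typ>\<open>complex^'d\<close> is
  \<^typ>\<open>('n, 'd) vpoly\<close>, with pure tensors \<open>tens\<close>.\<close>

definition tens :: "'n mpoly \<Rightarrow> complex^'d::finite \<Rightarrow> ('n, 'd) vpoly"
  where "tens p v = (\<chi> i. pm_scale (v $ i) p)"

definition tens_act :: "('n::finite, 'd::finite) rep \<Rightarrow> 'n lin \<Rightarrow> ('n, 'd) vpoly \<Rightarrow> ('n, 'd) vpoly"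
  where "tens_act \<rho> w u = (\<Sum>j\<in>UNIV. tens (poly_act w (u $ j)) (\<rho> w (axis j 1)))"

definition M_hom :: "nat \<Rightarrow> ('n::finite, 'd::finite) vpoly set"
  where "M_hom n = vp.span {tens p v | p v. p \<in> hom_polys n}"

text \<open>The sum of all \<open>W\<close>-submodules of \<open>M_hom n\<close> that are isomorphic to \<open>\<rho>\<close>.\<close>

definition M_isotypic ::
  "(real^'n::finite) set \<Rightarrow> ('n, 'd::finite) rep \<Rightarrow> nat \<Rightarrow> ('n, 'd) vpoly set"
  where "M_isotypic R \<rho> n = vp.span (\<Union>{range f | f :: complex^'d \<Rightarrow> ('n, 'd) vpoly.
    Vector_Spaces.linear (*s) vp_scale f \<and> inj f \<and> range f \<subseteq> M_hom n \<and>
    (\<forall>w\<in>weyl_group R. \<forall>v. f (\<rho> w v) = tens_act \<rho> w (f v))})"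

text \<open>The induced module \<open>H \<otimes>\<^bsub>S \<otimes> CW\<^esub> V\<close> is the free vector space on the symbols \<open>(h, v)\<close>
  with \<open>h \<in> H\<close>, modulo \<open>ind_rels\<close>.  The algebra \<open>S \<otimes> CW\<close> is generated
  by \<open>S\<^sub>+\<close>, which acts by zero on \<open>V\<close>, and by \<open>W\<close>, so balancing over these is enough.\<close>

type_synonym ('n, 'd) free_ind = "('n oper \<times> (complex^'d)) \<Rightarrow>\<^sub>0 complex"

definition isym :: "'n oper \<Rightarrow> complex^'d::finite \<Rightarrow> ('n, 'd) free_ind"
  where "isym h v = Poly_Mapping.single (h, v) 1"

definition ind_rels ::
  "(real^'n::finite) set \<Rightarrow> (real^'n) set \<Rightarrow> (real^'n \<Rightarrow> complex) \<Rightarrow> ('n, 'd::finite) rep \<Rightarrow>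
    ('n, 'd) free_ind set"
  where "ind_rels R Rp k \<rho> = pm.span
    ({isym (g + h) v - isym g v - isym h v | g h v. g \<in> cherednik R Rp k \<and> h \<in> cherednik R Rp k} \<union>
     {isym (op_scale c h) v - pm_scale c (isym h v) | c h v. h \<in> cherednik R Rp k} \<union>
     {isym h (u + v) - isym h u - isym h v | h u v. h \<in> cherednik R Rp k} \<union>
     {isym h (c *s v) - pm_scale c (isym h v) | c h v. h \<in> cherednik R Rp k} \<union>
     {isym (h \<circ> s) v | h s v. h \<in> cherednik R Rp k \<and> s \<in> dunkl_pos R Rp k} \<union>
     {isym (h \<circ> poly_act w) v - isym h (\<rho> w v) | h w v. h \<in> cherednik R Rp k \<and> w \<in> weyl_group R})"

definition ind_left :: "'n oper \<Rightarrow> ('n, 'd::finite) free_ind \<Rightarrow> ('n, 'd) free_ind"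
  where "ind_left h t = 
    (\<Sum>(g, v)\<in>Poly_Mapping.keys t. pm_scale (Poly_Mapping.lookup t (g, v)) (isym (h \<circ> g) v))"

definition ind_embed :: "('n, 'd::finite) vpoly \<Rightarrow> ('n, 'd) free_ind"
  where "ind_embed u = (\<Sum>i\<in>UNIV. isym (mult_op (u $ i)) (axis i 1))"

text \<open>Modulo \<open>ind_rels\<close>, the map \<open>ind_embed\<close> is the bijection \<open>p \<otimes> v \<mapsto> p \<otimes> v\<close> identifying the
  Verma module with \<^typ>\<open>('n, 'd) vpoly\<close>; \<open>verma_act\<close> is the action transported along it.\<close>

definition verma_act ::
  "(real^'n::finite) set \<Rightarrow> (real^'n) set \<Rightarrow> (real^'n \<Rightarrow> complex) \<Rightarrow> ('n, 'd::finite) rep \<Rightarrow>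
    'n oper \<Rightarrow> ('n, 'd) vpoly \<Rightarrow> ('n, 'd) vpoly"
  where "verma_act R Rp k \<rho> h u =
    (THE u'. ind_left h (ind_embed u) - ind_embed u' \<in> ind_rels R Rp k \<rho>)"

definition verma_submodule ::
  "(real^'n::finite) set \<Rightarrow> (real^'n) set \<Rightarrow> (real^'n \<Rightarrow> complex) \<Rightarrow> ('n, 'd::finite) rep \<Rightarrow>
    ('n, 'd) vpoly set \<Rightarrow> bool"
  where "verma_submodule R Rp k \<rho> U \<longleftrightarrow>
    vp.subspace U \<and> (\<forall>h\<in>cherednik R Rp k. verma_act R Rp k \<rho> h ` U \<subseteq> U)"

definition simple_quotient ::
  "(real^'n::finite) set \<Rightarrow> (real^'n) set \<Rightarrow> (real^'n \<Rightarrow> complex) \<Rightarrow> ('n, 'd::finite) rep \<Rightarrow>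
    ('n, 'd) vpoly set \<Rightarrow> bool"
  where "simple_quotient R Rp k \<rho> J \<longleftrightarrow>
    verma_submodule R Rp k \<rho> J \<and> J \<noteq> UNIV \<and>
    (\<forall>U. verma_submodule R Rp k \<rho> U \<and> J \<subseteq> U \<longrightarrow> U = J \<or> U = UNIV)"

text \<open>The simple module \<open>L\<close> is the quotient of the Verma module by \<open>L_kernel\<close>; it is finite-dimensional when
  the classes of finitely many vectors span it.\<close>

definition L_kernel ::
  "(real^'n::finite) set \<Rightarrow> (real^'n) set \<Rightarrow> (real^'n \<Rightarrow> complex) \<Rightarrow> ('n, 'd::finite) rep \<Rightarrow>
    ('n, 'd) vpoly set"
  where "L_kernel R Rp k \<rho> = (THE J. simple_quotient R Rp k \<rho> J)"

definition L_finite_dim ::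
  "(real^'n::finite) set \<Rightarrow> (real^'n) set \<Rightarrow> (real^'n \<Rightarrow> complex) \<Rightarrow> ('n, 'd::finite) rep \<Rightarrow> bool"
  where "L_finite_dim R Rp k \<rho> \<longleftrightarrow>
    (\<exists>F. finite F \<and> (\<forall>u. \<exists>f\<in>vp.span F. u - f \<in> L_kernel R Rp k \<rho>))"

definition verma_form ::
  "(real^'n::finite) set \<Rightarrow> (real^'n) set \<Rightarrow> (real^'n \<Rightarrow> complex) \<Rightarrow> ('n, 'd::finite) rep \<Rightarrow>
    (complex^'d \<Rightarrow> complex^'d \<Rightarrow> complex) \<Rightarrow> complex^'d \<Rightarrow>
    ('n, 'd) vpoly \<Rightarrow> ('n, 'd) vpoly \<Rightarrow> complex"
  where "verma_form R Rp k \<rho> b v x y =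
    (THE c. \<exists>a\<in>cherednik R Rp k. \<exists>a'\<in>cherednik R Rp k.
       x = verma_act R Rp k \<rho> a (tens 1 v) \<and> y = verma_act R Rp k \<rho> a' (tens 1 v) \<and>
       c = b v (grp_alg_act R \<rho> (ch_beta R Rp k a a') v))"

definition form_radical ::
  "(real^'n::finite) set \<Rightarrow> (real^'n) set \<Rightarrow> (real^'n \<Rightarrow> complex) \<Rightarrow> ('n, 'd::finite) rep \<Rightarrow>
    (complex^'d \<Rightarrow> complex^'d \<Rightarrow> complex) \<Rightarrow> complex^'d \<Rightarrow> ('n, 'd) vpoly set"
  where "form_radical R Rp k \<rho> b v = {x. \<forall>y. verma_form R Rp k \<rho> b v x y = 0}"

definition B_orthonormal_basis :: "(real^'n::finite) set \<Rightarrow> ('n \<Rightarrow> real^'n) \<Rightarrow> bool"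
  where "B_orthonormal_basis R z \<longleftrightarrow> span (range z) = UNIV \<and>
    (\<forall>i j. B_form R (cplx (z i)) (cplx (z j)) = (if i = j then 1 else 0))"

definition E_poly :: "('n::finite \<Rightarrow> real^'n) \<Rightarrow> 'n mpoly"
  where "E_poly z = pm_scale (1/2) (\<Sum>i\<in>UNIV. lin_poly (cplx (z i)) ^ 2)"

definition E_power_vec ::
  "(real^'n::finite) set \<Rightarrow> (real^'n) set \<Rightarrow> (real^'n \<Rightarrow> complex) \<Rightarrow> ('n, 'd::finite) rep \<Rightarrow>
    ('n \<Rightarrow> real^'n) \<Rightarrow> nat \<Rightarrow> complex^'d \<Rightarrow> ('n, 'd) vpoly"
  where "E_power_vec R Rp k \<rho> z m v = verma_act R Rp k \<rho> (mult_op (E_poly z ^ m)) (tens 1 v)"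

end

(*
  Rewriting brings every element of an algebra with the Cherednik relations into the normal form
  P CW S.  In the polynomial representation normal forms are independent: commuting repeatedly
  with W-invariant polynomials turns Dunkl operators into derivatives of these polynomials, and
  evaluation at points in general position separates the group elements.  This gives the algebra
  H a universal property, from which come the anti-involution sigma (target: the opposite algebra)
  and the action on P tensor V, which identifies the induced module.

  The form becomes (p tensor u, y) = (u | y'(0)) with y' = sigma(p) y.  Put F = sigma(E).  By Schur's
  lemma [F, E] acts on degree n as the scalar n + c.  Hence the radical is the largest proper
  submodule, and if E^m v lies in it, then E^m M does, and the sl2-relations bring the exponent
  down to 0 in large degrees, so L is finite-dimensional; the converse holds for degree reasons.
  The map theta = (evaluation at 0) o F^m from degree 2m to V is equivariant, so by averaging a
  section its vanishing is tested on the isotypic component.  Finally F^m is a polynomial in k.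
*)

theory Submission
  imports Defs "HOL-Computational_Algebra.Fundamental_Theorem_Algebra"
begin

text \<open>\<open>cherednik\<close> is a bare set of operators, so a map prescribed on its
  generators makes sense only if all relations between these operators follow from the Cherednik
  relations; hence independence of normal forms precedes every construction. The familiar proof of
  independence passes to functions regular off the reflection hyperplanes. Commutators with
  invariants replace it without leaving the polynomials: for invariant f, [T_y, f] is multiplication
  by the derivative of f along y.

  Commutativity of Dunkl operators is not computed either. Their commutator commutes with all
  multiplications and annihilates the generating vectors, an argument that applies to P and to P
  tensor V alike.

  The constant c is half the dimension plus the scalar by which the sum of k_\<alpha> r_\<alpha>
  over the positive roots acts on V. As a complex number it can make the coefficient n + c + l in
  the sl2-relation vanish, though only for n \<le> |c|; this confines the descent of the exponent to
  large degrees.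

  Polynomiality in k comes from reading (E^m v, P) as (v | theta P): theta is built from Dunkl
  operators, which are affine in k.\<close>

declare One_nat_def [simp del]

section \<open>Rings of additive maps, opposite rings and products\<close>

class unital_ring = ring + monoid_mult

text \<open>Composition has to be the ring product here, whereas on function types the product is
  pointwise. The ring is zero over a trivial group, hence a class without 0 \<noteq> 1. Only
  additivity is demanded; scalars enter as ring elements.\<close>

typedef (overloaded) ('v::ab_group_add) endo = "{f :: 'v \<Rightarrow> 'v. \<forall>x y. f (x + y) = f x + f y}"
  morphisms app Endo
  by (rule exI[of _ id]) simp

setup_lifting type_definition_endo

lemma app_add [simp]: "app f (x + y) = app f x + app f y"
  using app[of f] by simp

lemma app_zero [simp]: "app f 0 = 0"
  using app_add[of f 0 0] by simp

lemma app_minus [simp]: "app f (- x) = - app f x"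
  using app_add[of f x "- x"] by (simp add: eq_neg_iff_add_eq_0 add.commute)

lemma app_diff [simp]: "app f (x - y) = app f x - app f y"
  using app_add[of f x "- y"] by simp

lemma app_sum: "app f (sum g A) = (\<Sum>x\<in>A. app f (g x))"
  by (induction A rule: infinite_finite_induct) auto

instantiation endo :: (ab_group_add) unital_ring
begin
lift_definition zero_endo :: "'a endo" is "\<lambda>_. 0" by simp
lift_definition one_endo :: "'a endo" is "\<lambda>x. x" by simp
lift_definition plus_endo :: "'a endo \<Rightarrow> 'a endo \<Rightarrow> 'a endo" is "\<lambda>f g x. f x + g x" by simp
lift_definition minus_endo :: "'a endo \<Rightarrow> 'a endo \<Rightarrow> 'a endo" is "\<lambda>f g x. f x - g x" by simp
lift_definition uminus_endo :: "'a endo \<Rightarrow> 'a endo" is "\<lambda>f x. - f x" by simp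
lift_definition times_endo :: "'a endo \<Rightarrow> 'a endo \<Rightarrow> 'a endo" is "\<lambda>f g x. f (g x)" by simp
instance
  by standard (transfer; simp add: fun_eq_iff algebra_simps)+
end

lemma endo_eqI: "(\<And>x. app f x = app g x) \<Longrightarrow> f = g"
  by transfer auto

lemma app_Endo: "(\<And>x y. f (x + y) = f x + f y) \<Longrightarrow> app (Endo f) = f"
  by (rule Endo_inverse) simp

lemma app_simps [simp]:
  "app 0 x = 0" "app 1 x = x" "app (f + g) x = app f x + app g x"
  "app (f - g) x = app f x - app g x" "app (- f) x = - app f x" "app (f * g) x = app f (app g x)"
  by (transfer; simp)+

lemma app_sum_left: "app (sum f A) x = (\<Sum>i\<in>A. app (f i) x)"
  by (induction A rule: infinite_finite_induct) auto

text \<open>An anti-homomorphism is a homomorphism into the opposite ring; in this way \<sigma>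
  becomes an instance of the universal property.\<close>

datatype 'a opp = Opp (unopp: 'a)

instantiation opp :: (unital_ring) unital_ring
begin
definition "0 = Opp 0"
definition "1 = Opp 1"
definition "a + b = Opp (unopp a + unopp b)"
definition "a - b = Opp (unopp a - unopp b)"
definition "- a = Opp (- unopp a)"
definition "a * b = Opp (unopp b * unopp a)"
instance
  by standard (simp_all add: zero_opp_def one_opp_def plus_opp_def minus_opp_def uminus_opp_def
      times_opp_def algebra_simps)
end

lemma unopp_simps [simp]:
  "unopp 0 = 0" "unopp 1 = 1" "unopp (a + b) = unopp a + unopp b" "unopp (a - b) = unopp a - unopp b"
  "unopp (- a) = - unopp a" "unopp (a * b) = unopp b * unopp a"
  by (simp_all add: zero_opp_def one_opp_def plus_opp_def minus_opp_def uminus_opp_def times_opp_def)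

lemma opp_eqI: "unopp a = unopp b \<Longrightarrow> a = b"
  by (rule opp.expand)

lemma unopp_sum: "unopp (sum f A) = (\<Sum>i\<in>A. unopp (f i))"
  by (induction A rule: infinite_finite_induct) auto

text \<open>The componentwise product turns two representations into a single one, so that both can
  be expanded with the same normal form coefficients.\<close>

instantiation prod :: (times, times) times
begin
definition "a * b = (fst a * fst b, snd a * snd b)"
instance ..
end

instantiation prod :: (one, one) one
begin
definition "1 = (1, 1)"
instance ..
end

lemma fst_snd_mult [simp]:
  "fst (a * b) = fst a * fst b" "snd (a * b) = snd a * snd b" "fst 1 = 1" "snd 1 = 1"
  by (simp_all add: times_prod_def one_prod_def)

instance prod :: (unital_ring, unital_ring) unital_ring
  by standard (auto simp: prod_eq_iff algebra_simps)


section \<open>Polynomials\<close>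

abbreviation pvar :: "'n \<Rightarrow> 'n mpoly"
  where "pvar i \<equiv> Poly_Mapping.single (Poly_Mapping.single i 1) 1"

lemma poly_mapping_sum_single:
  "p = (\<Sum>m\<in>Poly_Mapping.keys p. Poly_Mapping.single m (Poly_Mapping.lookup p m))"
  by (rule poly_mapping_eqI)
     (auto simp: lookup_sum lookup_single when_def if_distrib sum.If_cases in_keys_iff cong: if_cong)

lemma mdeg_0 [simp]: "mdeg 0 = 0"
  by (simp add: mdeg_def)

lemma mdeg_add: "mdeg (m + m') = mdeg m + mdeg m'"
  by (simp add: mdeg_def lookup_add sum.distrib)

lemma mdeg_single [simp]: "mdeg (Poly_Mapping.single i n) = n"
  by (simp add: mdeg_def lookup_single when_def)

lemma mdeg_eq_0_iff: "mdeg m = 0 \<longleftrightarrow> m = 0"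
  by (auto simp: mdeg_def intro!: poly_mapping_eqI)

lemma monomial_induct [case_names zero step]:
  fixes m :: "'n::finite \<Rightarrow>\<^sub>0 nat"
  assumes "P 0" and "\<And>i m. P m \<Longrightarrow> P (Poly_Mapping.single i 1 + m)"
  shows "P m"
proof (induction "mdeg m" arbitrary: m)
  case 0
  then show ?case using assms(1) mdeg_eq_0_iff by metis
next
  case (Suc n)
  then have "m \<noteq> 0" by auto
  then obtain i where i: "Poly_Mapping.lookup m i \<noteq> 0"
    by (metis lookup_zero poly_mapping_eqI)
  define m' where "m' = m - Poly_Mapping.single i 1"
  have m: "m = Poly_Mapping.single i 1 + m'"
    using i by (intro poly_mapping_eqI) (auto simp: m'_def lookup_add lookup_minus lookup_single when_def)
  then have "n = mdeg m'" using Suc(2) by (simp add: mdeg_add)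
  then show ?case using Suc(1) assms(2) m by simp
qed

text \<open>Most identities below are additive and can be propagated through multiplication by one
  variable, so this induction replaces computations with coefficients.\<close>

lemma mpoly_induct [case_names const add var]:
  fixes p :: "'n::finite mpoly"
  assumes c: "\<And>c. P (const_poly c)" and a: "\<And>p q. P p \<Longrightarrow> P q \<Longrightarrow> P (p + q)"
    and v: "\<And>i p. P p \<Longrightarrow> P (pvar i * p)"
  shows "P p"
proof -
  have s: "P (Poly_Mapping.single m c)" for m c
  proof (induction m rule: monomial_induct)
    case zero
    then show ?case using c[of c] by (simp add: const_poly_def)
  next
    case (step i m)
    then show ?case using v[OF step] by (simp add: mult_single)
  qed
  have "finite A \<Longrightarrow> P (\<Sum>m\<in>A. Poly_Mapping.single m (Poly_Mapping.lookup p m))" for A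
  proof (induction A rule: finite_induct)
    case empty
    then show ?case using c[of 0] by (simp add: const_poly_def)
  qed (simp add: a s)
  then show ?thesis using poly_mapping_sum_single[of p] by (metis finite_keys)
qed

lemma const_poly_simps [simp]:
  "const_poly 0 = 0" "const_poly 1 = 1" "const_poly (c + d) = const_poly c + const_poly d"
  "const_poly (c * d) = const_poly c * const_poly d"
  by (simp_all add: const_poly_def single_add mult_single)

lemma pm_scale_eq: "pm_scale c p = const_poly c * (p :: 'n mpoly)"
  by (simp add: pm_scale_def const_poly_def mult_map_scale_conv_mult)

lemma single_eq_var: "Poly_Mapping.single m c = const_poly c * Poly_Mapping.single m 1"
  by (simp add: const_poly_def mult_single)

text \<open>Evaluation in a noncommutative ring: the enumeration of the variables chosen here is irrelevant when
  the \<open>a i\<close> commute.\<close>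

definition mon_ev :: "('n::finite \<Rightarrow> 'r::unital_ring) \<Rightarrow> ('n \<Rightarrow>\<^sub>0 nat) \<Rightarrow> 'r"
  where "mon_ev a m = prod_list (map (\<lambda>i. a i ^ Poly_Mapping.lookup m i) (SOME xs. set xs = UNIV \<and> distinct xs))"

definition cev :: "(complex \<Rightarrow> 'r::unital_ring) \<Rightarrow> ('n::finite \<Rightarrow> 'r) \<Rightarrow> 'n mpoly \<Rightarrow> 'r"
  where "cev \<kappa> a p = (\<Sum>m\<in>Poly_Mapping.keys p. \<kappa> (Poly_Mapping.lookup p m) * mon_ev a m)"

locale scalar_hom =
  fixes \<kappa> :: "complex \<Rightarrow> 'r::unital_ring"
  assumes \<kappa>_add: "\<kappa> (c + d) = \<kappa> c + \<kappa> d" and \<kappa>_mult: "\<kappa> (c * d) = \<kappa> c * \<kappa> d" and \<kappa>_one: "\<kappa> 1 = 1"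
begin

lemma \<kappa>_zero: "\<kappa> 0 = 0"
  using \<kappa>_add[of 0 0] by simp

lemma \<kappa>_minus: "\<kappa> (- c) = - \<kappa> c"
  using \<kappa>_add[of c "- c"] by (simp add: \<kappa>_zero eq_neg_iff_add_eq_0 add.commute)

end

lemma mon_ev_0 [simp]: "mon_ev a 0 = 1"
proof -
  have "prod_list (map (\<lambda>i. a i ^ Poly_Mapping.lookup 0 i) xs) = 1" for xs by (induction xs) auto
  then show ?thesis unfolding mon_ev_def by blast
qed

lemma mon_ev_step:
  fixes a :: "'n::finite \<Rightarrow> 'r::unital_ring"
  assumes comm: "\<And>i j. a i * a j = a j * a i"
  shows "mon_ev a (Poly_Mapping.single i 1 + m) = a i * mon_ev a m"
proof -
  have pc: "a i * a j ^ n = a j ^ n * a i" for i j n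
    using power_commuting_commutes[OF comm[of j i]] by metis
  have out: "i \<notin> set xs \<Longrightarrow> map (\<lambda>j. a j ^ Poly_Mapping.lookup (Poly_Mapping.single i 1 + m) j) xs
      = map (\<lambda>j. a j ^ Poly_Mapping.lookup m j) xs" for xs
    by (auto simp: lookup_add lookup_single when_def)
  have *: "distinct xs \<Longrightarrow> i \<in> set xs \<Longrightarrow>
    prod_list (map (\<lambda>j. a j ^ Poly_Mapping.lookup (Poly_Mapping.single i 1 + m) j) xs)
      = a i * prod_list (map (\<lambda>j. a j ^ Poly_Mapping.lookup m j) xs)" for xs
  proof (induction xs)
    case (Cons x xs)
    show ?case
    proof (cases "x = i")
      case True
      then have "i \<notin> set xs" using Cons.prems by auto
      then have "map (\<lambda>j. a j ^ Poly_Mapping.lookup (Poly_Mapping.single i 1 + m) j) xs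
         = map (\<lambda>j. a j ^ Poly_Mapping.lookup m j) xs" by (rule out)
      then show ?thesis unfolding list.map prod_list.Cons True by (simp only: lookup_add lookup_single_eq power_add power_one_right mult.assoc)
    next
      case False
      then have IH: "prod_list (map (\<lambda>j. a j ^ Poly_Mapping.lookup (Poly_Mapping.single i 1 + m) j) xs)
        = a i * prod_list (map (\<lambda>j. a j ^ Poly_Mapping.lookup m j) xs)"
        using Cons by auto
      have x: "Poly_Mapping.lookup (Poly_Mapping.single i 1 + m) x = Poly_Mapping.lookup m x"
        using False by (simp add: lookup_add lookup_single when_def)
      show ?thesis unfolding list.map prod_list.Cons IH x mult.assoc[symmetric] pc ..
    qed
  qed simp
  have ex: "\<exists>xs. set xs = (UNIV :: 'n set) \<and> distinct xs"
    using finite_distinct_list[OF finite_class.finite_UNIV] by blast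
  show ?thesis unfolding mon_ev_def using someI_ex[OF ex] by (intro *) simp_all
qed

text \<open>The images of the variables commute with one another and with the scalars; this makes
  evaluation multiplicative although the ring is noncommutative.\<close>

locale comm_eval = scalar_hom \<kappa> for \<kappa> :: "complex \<Rightarrow> 'r::unital_ring" +
  fixes a :: "'n::finite \<Rightarrow> 'r"
  assumes comm: "a i * a j = a j * a i" and \<kappa>_comm: "\<kappa> c * a i = a i * \<kappa> c"
begin

lemma mon_ev_Suc: "mon_ev a (Poly_Mapping.single i 1 + m) = a i * mon_ev a m"
  by (rule mon_ev_step[OF comm])

lemma cev_add: "cev \<kappa> a (p + q) = cev \<kappa> a p + cev \<kappa> a q"
  unfolding cev_def by (rule setsum_keys_plus_distrib) (auto simp: \<kappa>_zero \<kappa>_add algebra_simps)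

lemma cev_single: "cev \<kappa> a (Poly_Mapping.single m c) = \<kappa> c * mon_ev a m"
  by (simp add: cev_def \<kappa>_zero)

lemma cev_const: "cev \<kappa> a (const_poly c) = \<kappa> c"
  by (simp add: const_poly_def cev_single)

lemma cev_zero: "cev \<kappa> a 0 = 0" and cev_one: "cev \<kappa> a 1 = 1"
  using cev_const[of 0] cev_const[of 1] by (simp_all add: \<kappa>_zero \<kappa>_one)

lemma cev_sum: "cev \<kappa> a (sum f A) = (\<Sum>x\<in>A. cev \<kappa> a (f x))"
  by (induction A rule: infinite_finite_induct) (auto simp: cev_zero cev_add)

lemma cev_cmult: "cev \<kappa> a (const_poly c * p) = \<kappa> c * cev \<kappa> a p"
proof -
  have "const_poly c * p = (\<Sum>m\<in>Poly_Mapping.keys p. Poly_Mapping.single m (c * Poly_Mapping.lookup p m))"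
    by (subst poly_mapping_sum_single[of p], simp add: sum_distrib_left const_poly_def mult_single)
  then have "cev \<kappa> a (const_poly c * p) = (\<Sum>m\<in>Poly_Mapping.keys p. \<kappa> (c * Poly_Mapping.lookup p m) * mon_ev a m)"
    by (simp only: cev_sum cev_single)
  then show ?thesis
    unfolding cev_def[of \<kappa> a p] sum_distrib_left by (simp only: \<kappa>_mult mult.assoc)
qed

lemma cev_vmult: "cev \<kappa> a (pvar i * p) = a i * cev \<kappa> a p"
proof -
  have "pvar i * p = (\<Sum>m\<in>Poly_Mapping.keys p. Poly_Mapping.single (Poly_Mapping.single i 1 + m) (Poly_Mapping.lookup p m))"
    by (subst poly_mapping_sum_single[of p], simp add: sum_distrib_left mult_single)
  then have "cev \<kappa> a (pvar i * p) = (\<Sum>m\<in>Poly_Mapping.keys p. \<kappa> (Poly_Mapping.lookup p m) * (a i * mon_ev a m))"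
    by (simp only: cev_sum cev_single mon_ev_Suc)
  also have "\<dots> = a i * cev \<kappa> a p"
    unfolding cev_def sum_distrib_left by (simp only: mult.assoc[symmetric] \<kappa>_comm)
  finally show ?thesis .
qed

lemma cev_mult: "cev \<kappa> a (p * q) = cev \<kappa> a p * cev \<kappa> a q"
proof (induction p rule: mpoly_induct)
  case (const c)
  then show ?case by (simp add: cev_cmult cev_const)
next
  case (add p q)
  then show ?case by (simp add: cev_add algebra_simps)
next
  case (var i p)
  then show ?case by (simp add: cev_vmult mult.assoc)
qed

lemma cev_var: "cev \<kappa> a (pvar i) = a i"
  using cev_vmult[of i 1] by (simp add: cev_one)

lemma cev_power: "cev \<kappa> a (p ^ n) = cev \<kappa> a p ^ n"
  by (induction n) (auto simp: cev_one cev_mult)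


lemma cev_lin_poly: "cev \<kappa> a (lin_poly x) = (\<Sum>i\<in>UNIV. \<kappa> (x $ i) * a i)"
proof -
  have *: "Poly_Mapping.single (Poly_Mapping.single i 1) (x $ i) = const_poly (x $ i) * pvar i" for i :: 'n
    by (rule single_eq_var)
  show ?thesis unfolding lin_poly_def cev_sum * cev_cmult cev_var ..
qed

lemma cev_unique:
  assumes "\<And>c. f (const_poly c) = \<kappa> c" "\<And>p q. f (p + q) = f p + f q" "\<And>i p. f (pvar i * p) = a i * f p"
  shows "f p = cev \<kappa> a p"
  by (induction p rule: mpoly_induct) (auto simp: assms cev_const cev_add cev_vmult)

end

instance complex :: unital_ring ..
instance poly_mapping :: (comm_monoid_add, comm_ring_1) unital_ring ..

lemma mon_ev_prod:
  fixes a :: "'n::finite \<Rightarrow> 'r::{unital_ring, comm_monoid_mult}"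
  shows "mon_ev a m = (\<Prod>i\<in>UNIV. a i ^ Poly_Mapping.lookup m i)"
proof (induction m rule: monomial_induct)
  case (step i m)
  have "(\<Prod>j\<in>UNIV. a j ^ Poly_Mapping.lookup (Poly_Mapping.single i 1 + m) j)
     = (\<Prod>j\<in>UNIV. (if j = i then a i else 1) * a j ^ Poly_Mapping.lookup m j)"
    by (intro prod.cong) (auto simp: lookup_add lookup_single when_def power_add)
  then show ?case
    by (subst mon_ev_step) (auto simp: mult.commute step prod.distrib)
qed simp

lemma comm_eval_complex: "comm_eval (\<lambda>c. c) (a :: 'n::finite \<Rightarrow> complex)"
  by unfold_locales (auto simp: algebra_simps)

lemma comm_eval_mpoly: "comm_eval const_poly (a :: 'n::finite \<Rightarrow> 'n mpoly)"
  by unfold_locales (auto simp: algebra_simps)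

section \<open>Evaluation at real points and zero sets\<close>

definition pev :: "real^'n::finite \<Rightarrow> 'n mpoly \<Rightarrow> complex"
  where "pev x = cev (\<lambda>c. c) (\<lambda>i. cplx x $ i)"

lemma pev_simps [simp]:
  "pev x (const_poly c) = c" "pev x (p + q) = pev x p + pev x q" "pev x (p * q) = pev x p * pev x q"
  "pev x 0 = 0" "pev x 1 = 1" "pev x (sum f A) = (\<Sum>i\<in>A. pev x (f i))"
  "pev x (pvar i) = complex_of_real (x $ i)" "pev x (p ^ n) = pev x p ^ n"
  unfolding pev_def
  by (simp_all add: comm_eval.cev_const[OF comm_eval_complex] comm_eval.cev_add[OF comm_eval_complex]
      comm_eval.cev_mult[OF comm_eval_complex] comm_eval.cev_zero[OF comm_eval_complex]
      comm_eval.cev_one[OF comm_eval_complex] comm_eval.cev_sum[OF comm_eval_complex]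
      comm_eval.cev_var[OF comm_eval_complex] comm_eval.cev_power[OF comm_eval_complex] cplx_def)

lemma pev_minus [simp]: "pev x (- p) = - pev x p"
  using pev_simps(2)[of x p "- p"] by (simp add: eq_neg_iff_add_eq_0 add.commute del: pev_simps(2))

lemma pev_diff [simp]: "pev x (p - q) = pev x p - pev x q"
  using pev_simps(2)[of x p "- q"] by simp

lemma pev_prod [simp]: "pev x (prod f A) = (\<Prod>i\<in>A. pev x (f i))"
  by (induction A rule: infinite_finite_induct) auto

lemma pev_lin_poly [simp]: "pev x (lin_poly y) = pairing y (cplx x)"
  unfolding pev_def pairing_def by (simp add: comm_eval.cev_lin_poly[OF comm_eval_complex])

lemma pairing_cplx: "pairing (cplx x) (cplx y) = of_real (x \<bullet> y)"
  by (simp add: pairing_def cplx_def inner_vec_def)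

text \<open>A hyperplane has empty interior, so removing the hyperplanes one at a time keeps an open
  nonempty set.\<close>

lemma finite_hyperplanes_avoid:
  fixes U :: "'a::euclidean_space set"
  assumes "finite A" "0 \<notin> A" "open U" "U \<noteq> {}"
  shows "\<exists>x\<in>U. \<forall>a\<in>A. a \<bullet> x \<noteq> 0"
  using assms
proof (induction A arbitrary: U rule: finite_induct)
  case (insert a A)
  let ?U = "U \<inter> {x. a \<bullet> x \<noteq> 0}"
  have "open {x. a \<bullet> x \<noteq> 0}" by (intro open_Collect_neq continuous_intros)
  then have o: "open ?U" using insert by blast
  have "interior {x. a \<bullet> x = 0} = {}" using insert.prems by (simp add: interior_hyperplane)
  then have "?U \<noteq> {}" using insert.prems(2,3) interior_maximal[of U "{x. a \<bullet> x = 0}"] by blast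
  with o insert.IH[of ?U] insert.prems show ?case by auto
qed auto

text \<open>Dividing by the exponential with the largest exponent and letting t tend to infinity
  isolates the coefficient of that exponential.\<close>

lemma exp_sum_nonzero:
  fixes e :: "'a \<Rightarrow> real" and c :: "'a \<Rightarrow> complex"
  assumes "finite K" "K \<noteq> {}" "inj_on e K" "\<And>m. m \<in> K \<Longrightarrow> c m \<noteq> 0"
  shows "\<exists>t::real. (\<Sum>m\<in>K. c m * of_real (exp (t * e m))) \<noteq> 0"
proof (rule ccontr)
  assume "\<not> ?thesis"
  then have z: "(\<Sum>m\<in>K. c m * of_real (exp (t * e m))) = 0" for t by blast
  have "Max (e ` K) \<in> e ` K" using assms by simp
  then obtain k where k: "k \<in> K" "e k = Max (e ` K)" by (metis imageE)
  have lt: "e m < e k" if "m \<in> K" "m \<noteq> k" for m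
    using that k assms by (metis Max_ge finite_imageI imageI inj_onD order_le_less)
  have "((\<lambda>t. \<Sum>m\<in>K. c m * of_real (exp (t * (e m - e k)))) \<longlongrightarrow> (\<Sum>m\<in>K. c m * of_real (if m = k then 1 else 0))) at_top"
  proof (intro tendsto_sum tendsto_mult tendsto_const tendsto_of_real)
    fix m assume m: "m \<in> K"
    show "((\<lambda>t. exp (t * (e m - e k))) \<longlongrightarrow> (if m = k then 1 else 0)) at_top"
    proof (cases "m = k")
      case False
      then have "e m - e k < 0" using lt m by simp
      then have "LIM t at_top. t * (e m - e k) :> at_bot"
        by (intro filterlim_tendsto_neg_mult_at_bot[OF tendsto_const _ filterlim_ident, THEN filterlim_cong[THEN iffD1, rotated -1]]) (auto simp: mult.commute)
      then show ?thesis using False by (auto intro: filterlim_compose[OF exp_at_bot])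
    qed simp
  qed
  moreover have "(\<Sum>m\<in>K. c m * of_real (exp (t * (e m - e k)))) = 0" for t
  proof -
    have "(\<Sum>m\<in>K. c m * of_real (exp (t * (e m - e k)))) = (\<Sum>m\<in>K. c m * of_real (exp (t * e m))) * of_real (exp (- t * e k))"
      unfolding sum_distrib_right mult.assoc of_real_mult[symmetric] exp_add[symmetric]
      by (simp add: algebra_simps)
    then show ?thesis using z by simp
  qed
  ultimately have "(\<Sum>m\<in>K. c m * of_real (if m = k then 1 else 0)) = 0"
    by (simp add: tendsto_const_iff)
  then have "c k = 0" using k assms(1) by (simp add: if_distrib sum.delta cong: if_cong)
  then show False using assms k by blast
qed

lemma pev_expand: "pev x p = (\<Sum>m\<in>Poly_Mapping.keys p. Poly_Mapping.lookup p m * (\<Prod>i\<in>UNIV. of_real (x $ i) ^ Poly_Mapping.lookup m i))"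
  by (simp add: pev_def cev_def mon_ev_prod cplx_def)

text \<open>Under the substitution x_i = exp(t s_i) the monomial m becomes exp(t (m \<bullet> s)).
  For generic s these exponents are distinct, so a nonzero polynomial becomes an exponential sum
  that cannot vanish for all t.\<close>

lemma pev_nonzero:
  assumes "p \<noteq> 0" shows "\<exists>x. pev x p \<noteq> 0"
proof -
  let ?K = "Poly_Mapping.keys p"
  define v where "v m = (\<chi> i. real (Poly_Mapping.lookup m i))" for m :: "'a \<Rightarrow>\<^sub>0 nat"
  have vi: "v m = v m' \<longleftrightarrow> m = m'" for m m'
    by (auto simp: v_def vec_eq_iff intro!: poly_mapping_eqI)
  define A where "A = (\<lambda>(m, m'). v m - v m') ` (?K \<times> ?K) - {0}"
  have "finite A" "0 \<notin> A" by (auto simp: A_def)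
  then obtain s where s: "\<And>a. a \<in> A \<Longrightarrow> a \<bullet> s \<noteq> 0"
    using finite_hyperplanes_avoid[of A UNIV] by auto
  have inj: "inj_on (\<lambda>m. v m \<bullet> s) ?K"
  proof (rule inj_onI, rule ccontr)
    fix m m' assume "m \<in> ?K" "m' \<in> ?K" "v m \<bullet> s = v m' \<bullet> s" "m \<noteq> m'"
    moreover from this have "v m - v m' \<in> A" unfolding A_def by (auto simp: vi)
    ultimately show False using s[of "v m - v m'"] by (simp add: inner_diff_left)
  qed
  have "?K \<noteq> {}" using assms by simp
  then obtain t where t: "(\<Sum>m\<in>?K. Poly_Mapping.lookup p m * of_real (exp (t * (v m \<bullet> s)))) \<noteq> 0"
    using exp_sum_nonzero[OF finite_keys _ inj, of "Poly_Mapping.lookup p"] by (auto simp: in_keys_iff)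
  define x :: "real^'a" where "x = (\<chi> i. exp (t * s $ i))"
  have "(\<Prod>i\<in>UNIV. complex_of_real (x $ i) ^ Poly_Mapping.lookup m i) = of_real (exp (t * (v m \<bullet> s)))" for m
  proof -
    have "(\<Prod>i\<in>UNIV. x $ i ^ Poly_Mapping.lookup m i) = exp (\<Sum>i\<in>UNIV. real (Poly_Mapping.lookup m i) * (t * s $ i))"
      by (simp add: x_def exp_sum exp_of_nat_mult)
    also have "(\<Sum>i\<in>UNIV. real (Poly_Mapping.lookup m i) * (t * s $ i)) = t * (v m \<bullet> s)"
      by (simp add: v_def inner_vec_def sum_distrib_left algebra_simps)
    finally show ?thesis by (metis (no_types, lifting) of_real_prod of_real_power prod.cong)
  qed
  then have "pev x p \<noteq> 0" using t by (simp add: pev_expand)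
  then show ?thesis ..
qed

lemma continuous_pev: "continuous_on UNIV (\<lambda>x. pev x p)"
  unfolding pev_expand by (intro continuous_intros)

lemma pev_nonzero_generic:
  assumes "p \<noteq> 0" "finite A" "0 \<notin> A"
  shows "\<exists>x. pev x p \<noteq> 0 \<and> (\<forall>a\<in>A. a \<bullet> x \<noteq> 0)"
proof -
  have "open {x. pev x p \<noteq> 0}"
    using continuous_pev by (intro open_Collect_neq continuous_intros) auto
  moreover have "{x. pev x p \<noteq> 0} \<noteq> {}" using pev_nonzero[OF assms(1)] by auto
  ultimately show ?thesis using finite_hyperplanes_avoid[OF assms(2,3)] by blast
qed

text \<open>Evaluation at a point off the hyperplane of \<alpha> takes the place of an argument with
  zero divisors. It makes the quotient in \<open>exact_div\<close> by a root well
  determined.\<close>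

lemma lin_poly_cancel:
  assumes "\<alpha> \<noteq> 0" "lin_poly (cplx \<alpha>) * p = lin_poly (cplx \<alpha>) * q"
  shows "p = q"
proof (rule ccontr)
  assume "p \<noteq> q"
  then obtain x where "pev x (p - q) \<noteq> 0" "\<alpha> \<bullet> x \<noteq> 0"
    using pev_nonzero_generic[of "p - q" "{\<alpha>}"] assms(1) by auto
  moreover have "pev x (lin_poly (cplx \<alpha>) * (p - q)) = 0" using assms(2) by (simp add: algebra_simps)
  ultimately show False by (simp only: pev_simps) (simp add: pairing_cplx)
qed

lemma exact_div_eq:
  assumes "\<alpha> \<noteq> 0" "lin_poly (cplx \<alpha>) * r = p"
  shows "exact_div p (lin_poly (cplx \<alpha>)) = r"
  unfolding exact_div_def using assms lin_poly_cancel[OF assms(1)] by (intro the_equality) auto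


section \<open>The action of linear maps\<close>

lemma poly_act_cev: "poly_act w = cev const_poly (\<lambda>i. lin_poly (cplx (w (axis i 1))))"
  by (rule ext) (simp add: poly_act_def cev_def mon_ev_prod)

lemma poly_act_simps [simp]:
  "poly_act w (const_poly c) = const_poly c" "poly_act w (p + q) = poly_act w p + poly_act w q"
  "poly_act w (p * q) = poly_act w p * poly_act w q" "poly_act w 0 = 0" "poly_act w 1 = 1"
  "poly_act w (sum f A) = (\<Sum>i\<in>A. poly_act w (f i))" "poly_act w (p ^ n) = poly_act w p ^ n"
  and poly_act_var: "poly_act w (pvar i) = lin_poly (cplx (w (axis i 1)))"
  unfolding poly_act_cev
  by (simp_all add: comm_eval.cev_const[OF comm_eval_mpoly] comm_eval.cev_add[OF comm_eval_mpoly]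
      comm_eval.cev_mult[OF comm_eval_mpoly] comm_eval.cev_zero[OF comm_eval_mpoly]
      comm_eval.cev_one[OF comm_eval_mpoly] comm_eval.cev_sum[OF comm_eval_mpoly]
      comm_eval.cev_var[OF comm_eval_mpoly] comm_eval.cev_power[OF comm_eval_mpoly])

lemma poly_act_minus [simp]: "poly_act w (- p) = - poly_act w p"
  using poly_act_simps(2)[of w p "- p"] by (simp add: eq_neg_iff_add_eq_0 add.commute del: poly_act_simps(2))

lemma poly_act_diff [simp]: "poly_act w (p - q) = poly_act w p - poly_act w q"
  using poly_act_simps(2)[of w p "- q"] by simp

text \<open>The complex linear extension of a linear w to the complexified dual.\<close>

definition cact :: "'n lin \<Rightarrow> complex^'n::finite \<Rightarrow> complex^'n"
  where "cact w x = (\<chi> j. \<Sum>i\<in>UNIV. x $ i * of_real (w (axis i 1) $ j))"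

text \<open>The transpose of \<open>cact w\<close>; for w in the Weyl group this is the natural
  action of the inverse of w on the complexified space. It spares inverses in the commutation of w
  with derivatives and Dunkl operators.\<close>

definition tact :: "'n lin \<Rightarrow> complex^'n::finite \<Rightarrow> complex^'n"
  where "tact w y = (\<chi> i. pairing (cplx (w (axis i 1))) y)"

lemma pairing_simps:
  "pairing (x + x') y = pairing x y + pairing x' y" "pairing x (y + y') = pairing x y + pairing x y'"
  "pairing (c *s x) y = c * pairing x y" "pairing x (c *s y) = c * pairing x y"
  "pairing (x - x') y = pairing x y - pairing x' y" "pairing x (y - y') = pairing x y - pairing x y'"
  by (simp_all add: pairing_def algebra_simps sum.distrib sum_distrib_left sum_subtractf)

lemma pairing_sum: "pairing (sum f A) y = (\<Sum>i\<in>A. pairing (f i) y)" "pairing x (sum f A) = (\<Sum>i\<in>A. pairing x (f i))"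
  by (induction A rule: infinite_finite_induct) (simp_all add: pairing_simps, simp_all add: pairing_def)

lemma pairing_axis [simp]: "pairing (axis i 1) y = y $ i" "pairing x (axis i 1) = x $ i"
  by (simp_all add: pairing_def axis_def if_distrib if_distribR cong: if_cong)

lemma pairing_eqI: "(\<And>x. pairing x y = pairing x y') \<Longrightarrow> y = y'"
  by (metis pairing_axis(1) vec_eq_iff)

lemma pairing_cact: "pairing (cact w x) y = pairing x (tact w y)"
proof -
  have "pairing (cact w x) y = (\<Sum>j\<in>UNIV. \<Sum>i\<in>UNIV. x $ i * (of_real (w (axis i 1) $ j) * y $ j))"
    by (simp add: pairing_def cact_def sum_distrib_right mult.assoc)
  also have "\<dots> = (\<Sum>i\<in>UNIV. \<Sum>j\<in>UNIV. x $ i * (of_real (w (axis i 1) $ j) * y $ j))"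
    by (rule sum.swap)
  finally show ?thesis by (simp add: pairing_def tact_def cplx_def sum_distrib_left)
qed

lemma cplx_simps [simp]: "cplx (x + y) = cplx x + cplx y" "cplx (x - y) = cplx x - cplx y" "cplx 0 = 0"
  "cplx (- x) = - cplx x" "cplx (c *\<^sub>R x) = of_real c *s cplx x" "cplx (axis i 1) = axis i 1"
  by (auto simp: cplx_def vec_eq_iff axis_def)

lemma cplx_eq_iff [simp]: "cplx x = cplx y \<longleftrightarrow> x = y"
  by (auto simp: cplx_def vec_eq_iff)

lemma cact_simps: "cact w (x + y) = cact w x + cact w y" "cact w (c *s x) = c *s cact w x"
  by (simp_all add: cact_def vec_eq_iff algebra_simps sum.distrib sum_distrib_left)

lemma cact_cplx: assumes "linear w" shows "cact w (cplx x) = cplx (w x)"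
proof -
  have "x = (\<Sum>i\<in>UNIV. x $ i *\<^sub>R axis i 1)" by (simp add: vec_eq_iff axis_def if_distrib if_distribR cong: if_cong)
  then have "w x = (\<Sum>i\<in>UNIV. x $ i *\<^sub>R w (axis i 1))"
    by (metis (no_types, lifting) assms linear_scale linear_sum sum.cong)
  then show ?thesis by (simp add: cact_def cplx_def vec_eq_iff)
qed

lemma vec_expand: "(x :: complex^'n::finite) = (\<Sum>i\<in>UNIV. x $ i *s axis i 1)"
  by (simp add: vec_eq_iff axis_def if_distrib if_distribR cong: if_cong)

lemma lin_poly_simps: "lin_poly (x + y) = lin_poly x + lin_poly y" "lin_poly (c *s x) = const_poly c * lin_poly x"
  "lin_poly (x - y) = lin_poly x - lin_poly y" "lin_poly 0 = 0"
  by (simp_all add: lin_poly_def single_add single_diff sum.distrib sum_subtractf sum_distrib_left const_poly_def mult_single)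

lemma lin_poly_sum: "lin_poly (sum f A) = (\<Sum>i\<in>A. lin_poly (f i))"
  by (induction A rule: infinite_finite_induct) (auto simp: lin_poly_simps)

lemma lin_poly_axis: "lin_poly (axis i 1) = pvar i"
  by (simp add: lin_poly_def axis_def if_distrib if_distribR cong: if_cong)

lemma lin_poly_expand: "lin_poly x = (\<Sum>i\<in>UNIV. const_poly (x $ i) * pvar i)"
  by (simp add: lin_poly_def const_poly_def mult_single)

lemma poly_act_lin: "poly_act w (lin_poly x) = lin_poly (cact w x)"
proof -
  have "cact w x = (\<Sum>i\<in>UNIV. x $ i *s cplx (w (axis i 1)))"
    by (simp add: vec_eq_iff cact_def cplx_def)
  then show ?thesis
    by (simp add: lin_poly_expand[of x] poly_act_var lin_poly_sum lin_poly_simps)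
qed

lemma poly_act_comp: assumes "linear w" shows "poly_act (w \<circ> w') p = poly_act w (poly_act w' p)"
proof (induction p rule: mpoly_induct)
  case (var i p)
  then show ?case by (simp add: poly_act_var poly_act_lin cact_cplx assms)
qed auto

lemma poly_act_id: "poly_act id p = p"
proof (induction p rule: mpoly_induct)
  case (var i p)
  then show ?case by (simp add: poly_act_var lin_poly_axis)
qed auto

lemma cact_comp:
  assumes "linear w" shows "cact (w \<circ> w') x = cact w (cact w' (x :: complex^'n::finite))"
proof -
  have e: "cact w' x = (\<Sum>i\<in>UNIV. x $ i *s cplx (w' (axis i 1)))" for w' x
    by (simp add: vec_eq_iff cact_def cplx_def)
  have s: "cact w (sum f A) = (\<Sum>i\<in>A. cact w (f i))" for f :: "'n \<Rightarrow> complex^'n" and A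
    by (induction A rule: infinite_finite_induct) (auto simp: cact_simps, auto simp: cact_def vec_eq_iff)
  show ?thesis unfolding e[of "w \<circ> w'"] e[of w'] s by (simp add: cact_simps cact_cplx assms)
qed

lemma cact_id: "cact id x = x"
  by (simp add: cact_def vec_eq_iff axis_def if_distrib if_distribR cong: if_cong)

lemma pev_poly_act: assumes "linear w" shows "pev x (poly_act w p) = pev (adjoint w x) p"
proof (induction p rule: mpoly_induct)
  case (var i p)
  have "w (axis i 1) \<bullet> x = adjoint w x $ i"
    using adjoint_works[OF assms, of "axis i 1" x] by (simp add: inner_axis' )
  with var show ?case by (simp add: poly_act_var pairing_cplx)
qed auto


section \<open>Derivatives\<close>

lemma partial_deriv_add: "partial_deriv i (p + q) = partial_deriv i p + partial_deriv i q"
  unfolding partial_deriv_def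
  by (rule setsum_keys_plus_distrib) (auto simp: single_add algebra_simps)

lemma partial_deriv_sum: "partial_deriv i (sum f A) = (\<Sum>x\<in>A. partial_deriv i (f x))"
proof (induction A rule: infinite_finite_induct)
qed (auto simp: partial_deriv_add, simp_all add: partial_deriv_def)

lemma partial_deriv_single: "partial_deriv i (Poly_Mapping.single m c) =
    Poly_Mapping.single (m - Poly_Mapping.single i 1) (of_nat (Poly_Mapping.lookup m i) * c)"
  by (simp add: partial_deriv_def)

lemma partial_deriv_const: "partial_deriv i (const_poly c) = 0"
  by (simp add: const_poly_def partial_deriv_single)

lemma partial_deriv_var_mult: "partial_deriv j (pvar i * p) = (if i = j then p else 0) + pvar i * partial_deriv j p"
proof -
  have s: "partial_deriv j (pvar i * Poly_Mapping.single m c) =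
    (if i = j then Poly_Mapping.single m c else 0) + pvar i * partial_deriv j (Poly_Mapping.single m c)" for m c
  proof (cases "i = j")
    case True
    have a: "Poly_Mapping.single i 1 + m - Poly_Mapping.single i 1 = m"
      by (rule poly_mapping_eqI) (simp add: lookup_minus lookup_add)
    have b: "Poly_Mapping.single i 1 + (m - Poly_Mapping.single i 1) = m" if "Poly_Mapping.lookup m i \<noteq> 0"
      using that by (intro poly_mapping_eqI) (auto simp: lookup_minus lookup_add lookup_single when_def)
    show ?thesis
    proof (cases "Poly_Mapping.lookup m i = 0")
      case True
      then show ?thesis using \<open>i = j\<close> by (simp add: mult_single partial_deriv_single a lookup_add)
    next
      case False
      then show ?thesis using \<open>i = j\<close> b
        by (simp add: mult_single partial_deriv_single a lookup_add single_add algebra_simps)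
    qed
  next
    case False
    then have "Poly_Mapping.single i 1 + m - Poly_Mapping.single j 1 = Poly_Mapping.single i 1 + (m - Poly_Mapping.single j 1)"
      by (intro poly_mapping_eqI) (auto simp: lookup_minus lookup_add lookup_single when_def)
    then show ?thesis using False by (simp add: mult_single partial_deriv_single lookup_add lookup_single)
  qed
  show ?thesis
    by (subst (1 2 3) poly_mapping_sum_single[of p])
      (simp add: sum_distrib_left partial_deriv_sum s sum.distrib del: One_nat_def)
qed

lemma partial_deriv_scale: "partial_deriv i (const_poly c * p) = const_poly c * partial_deriv i p"
proof (induction p rule: mpoly_induct)
  case (const d)
  then show ?case using partial_deriv_const[of i "c * d"] by (simp add: partial_deriv_const)
next
  case (var j p)
  have "partial_deriv i (const_poly c * (pvar j * p)) = partial_deriv i (pvar j * (const_poly c * p))"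
    by (simp only: mult.left_commute)
  with var show ?case by (simp only: partial_deriv_var_mult) (simp add: algebra_simps)
qed (simp only: distrib_left partial_deriv_add)

lemma dir_deriv_add: "dir_deriv y (p + q) = dir_deriv y p + dir_deriv y q"
  by (simp add: dir_deriv_def partial_deriv_add pm_scale_eq algebra_simps sum.distrib)

lemma dir_deriv_scale: "dir_deriv y (const_poly c * p) = const_poly c * dir_deriv y p"
  by (simp add: dir_deriv_def partial_deriv_scale pm_scale_eq mult.left_commute sum_distrib_left)

lemma dir_deriv_const: "dir_deriv y (const_poly c) = 0"
  by (simp add: dir_deriv_def partial_deriv_const)

lemma dir_deriv_var_mult: "dir_deriv y (pvar i * p) = const_poly (y $ i) * p + pvar i * dir_deriv y p"
proof -
  have "dir_deriv y (pvar i * p) = (\<Sum>j\<in>UNIV. const_poly (y $ j) * (if i = j then p else 0)) + pvar i * dir_deriv y p"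
    by (simp add: dir_deriv_def partial_deriv_var_mult pm_scale_eq distrib_left mult.left_commute sum.distrib sum_distrib_left)
  also have "(\<Sum>j\<in>UNIV. const_poly (y $ j) * (if i = j then p else 0)) = const_poly (y $ i) * p"
    by (simp add: if_distrib cong: if_cong)
  finally show ?thesis .
qed

lemma dir_deriv_mult: "dir_deriv y (p * q) = dir_deriv y p * q + p * dir_deriv y q"
proof (induction p rule: mpoly_induct)
  case (const c)
  then show ?case by (simp add: dir_deriv_const dir_deriv_scale)
next
  case (var i p)
  have "dir_deriv y (pvar i * p * q) = dir_deriv y (pvar i * (p * q))" by (simp only: mult.assoc)
  with var show ?case by (simp only: dir_deriv_var_mult) (simp add: algebra_simps)
qed (auto simp: dir_deriv_add algebra_simps)

lemma dir_deriv_lin: "dir_deriv y (lin_poly x) = const_poly (pairing x y)"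
proof -
  have s: "dir_deriv y (sum f A) = (\<Sum>i\<in>A. dir_deriv y (f i))" for f :: "'a \<Rightarrow> 'a mpoly" and A
    by (induction A rule: infinite_finite_induct) (use dir_deriv_const[of y 0] in \<open>auto simp: dir_deriv_add\<close>)
  have c: "const_poly (sum f A) = (\<Sum>i\<in>A. const_poly (f i))" for f :: "'a \<Rightarrow> complex" and A
    by (induction A rule: infinite_finite_induct) auto
  have "dir_deriv y (const_poly (x $ i) * pvar i) = const_poly (x $ i * y $ i)" for i
    using dir_deriv_var_mult[of y i 1] dir_deriv_const[of y 1] by (simp add: dir_deriv_scale)
  then show ?thesis by (simp add: lin_poly_expand s c pairing_def)
qed

lemma dir_deriv_linear: "dir_deriv (y + y') p = dir_deriv y p + dir_deriv y' p" "dir_deriv (c *s y) p = const_poly c * dir_deriv y p"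
  by (simp_all add: dir_deriv_def pm_scale_eq algebra_simps sum.distrib sum_distrib_left)

lemma dir_deriv_poly_act: "dir_deriv y (poly_act w p) = poly_act w (dir_deriv (tact w y) p)"
proof (induction p rule: mpoly_induct)
  case (const c)
  then show ?case by (simp add: dir_deriv_const)
next
  case (var i p)
  have "pairing (cplx (w (axis i 1))) y = tact w y $ i" by (simp add: tact_def)
  with var show ?case
    unfolding poly_act_simps poly_act_var dir_deriv_var_mult dir_deriv_mult[of _ "lin_poly _"] dir_deriv_lin by simp
qed (auto simp: dir_deriv_add)

section \<open>Root systems\<close>

lemma linear_hyp_refl: "linear (hyp_refl \<alpha> h)"
  by (intro linearI) (auto simp: hyp_refl_def inner_add_left algebra_simps)

locale roots =
  fixes R :: "(real^'n::finite) set"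
  assumes root_system: "reduced_root_system R"
begin

lemma fin_R: "finite R" and R_nonzero: "0 \<notin> R" and span_R: "span R = UNIV"
  using root_system by (auto simp: reduced_root_system_def)

lemma root_nonzero: "\<alpha> \<in> R \<Longrightarrow> \<alpha> \<noteq> 0"
  using R_nonzero by auto

text \<open>The composition of two reflections at \<open>\<alpha>\<close> is a transvection; it permutes the finite set \<open>R\<close>, so it is trivial.\<close>

lemma coroot_unique:
  assumes "\<alpha> \<bullet> h = 2" "hyp_refl \<alpha> h ` R = R" "\<alpha> \<bullet> h' = 2" "hyp_refl \<alpha> h' ` R = R"
    and "\<alpha> \<noteq> 0"
  shows "h = h'"
proof -
  have "\<beta> \<bullet> (h' - h) = 0" if \<beta>: "\<beta> \<in> R" for \<beta>
  proof (rule ccontr)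
    assume c: "\<beta> \<bullet> (h' - h) \<noteq> 0"
    define d where "d = \<beta> \<bullet> (h' - h)"
    have R: "\<beta> + (real n * d) *\<^sub>R \<alpha> \<in> R" for n
    proof (induction n)
      case (Suc n)
      let ?x = "\<beta> + (real n * d) *\<^sub>R \<alpha>"
      have "hyp_refl \<alpha> h (hyp_refl \<alpha> h' ?x) \<in> R" using Suc assms(2,4) by blast
      also have "hyp_refl \<alpha> h (hyp_refl \<alpha> h' ?x) = ?x + (?x \<bullet> (h' - h)) *\<^sub>R \<alpha>"
        using assms(1,3) by (simp add: hyp_refl_def inner_diff_left inner_add_left inner_diff_right vec_eq_iff algebra_simps)
      also have "?x \<bullet> (h' - h) = d"
        using assms(1,3) by (simp add: d_def inner_add_left inner_diff_right)
      finally show ?case by (simp add: algebra_simps)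
    qed (use \<beta> in simp)
    have "inj (\<lambda>n. \<beta> + (real n * d) *\<^sub>R \<alpha>)"
      using c assms(5) by (intro injI) (auto simp: d_def)
    then have "infinite (range (\<lambda>n. \<beta> + (real n * d) *\<^sub>R \<alpha>))" by (rule range_inj_infinite)
    then show False using R fin_R by (meson finite_subset image_subsetI)
  qed
  note perp = this
  have "x \<bullet> (h' - h) = 0" if "x \<in> span R" for x
    using that
  proof (induction rule: span_induct_alt)
    case (step c u y)
    then show ?case using perp[of u] by (simp add: inner_add_left)
  qed (simp_all only: inner_zero_left)
  then have "(h' - h) \<bullet> (h' - h) = 0" using span_R by blast
  then show ?thesis by simp
qed

lemma coroot_props:
  assumes "\<alpha> \<in> R"
  shows root_coroot: "\<alpha> \<bullet> coroot R \<alpha> = 2" and root_refl_image: "root_refl R \<alpha> ` R = R"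
proof -
  obtain h where h: "\<alpha> \<bullet> h = 2" "hyp_refl \<alpha> h ` R = R"
    using root_system assms unfolding reduced_root_system_def by blast
  then have "coroot R \<alpha> = h"
    unfolding coroot_def using coroot_unique root_nonzero[OF assms] by (intro the_equality) blast+
  with h show "\<alpha> \<bullet> coroot R \<alpha> = 2" "root_refl R \<alpha> ` R = R" by (auto simp: root_refl_def)
qed

lemma coroot_eq:
  assumes "\<alpha> \<in> R" "\<alpha> \<bullet> h = 2" "hyp_refl \<alpha> h ` R = R"
  shows "coroot R \<alpha> = h"
  using coroot_unique[OF _ _ assms(2,3)] coroot_props[OF assms(1)] root_nonzero[OF assms(1)]
  by (metis root_refl_def)

lemma root_refl_linear: "linear (root_refl R \<alpha>)"
  by (simp add: root_refl_def linear_hyp_refl)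

lemma root_refl_apply: "root_refl R \<alpha> x = x - (x \<bullet> coroot R \<alpha>) *\<^sub>R \<alpha>"
  by (simp add: root_refl_def hyp_refl_def)

lemma root_refl_self: "\<alpha> \<in> R \<Longrightarrow> root_refl R \<alpha> \<alpha> = - \<alpha>"
  by (simp add: root_refl_apply root_coroot scaleR_2)

lemma root_refl_invol: "\<alpha> \<in> R \<Longrightarrow> root_refl R \<alpha> \<circ> root_refl R \<alpha> = id"
  by (rule ext) (simp add: root_refl_apply inner_diff_left root_coroot algebra_simps)

abbreviation W where "W \<equiv> weyl_group R"

lemma W_id: "id \<in> W" by (rule weyl_id)

lemma W_refl: "\<alpha> \<in> R \<Longrightarrow> root_refl R \<alpha> \<in> W"
  using weyl_refl[OF _ weyl_id] by force

lemma W_linear: "w \<in> W \<Longrightarrow> linear w"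
  by (induction rule: weyl_group.induct) (simp_all only: linear_compose root_refl_linear linear_id)

lemma W_image: "w \<in> W \<Longrightarrow> w ` R = R"
  by (induction rule: weyl_group.induct) (simp_all only: image_comp[symmetric] root_refl_image image_id image_ident id_apply)

lemma W_root: "w \<in> W \<Longrightarrow> \<alpha> \<in> R \<Longrightarrow> w \<alpha> \<in> R"
  using W_image by blast

lemma W_comp: "w \<in> W \<Longrightarrow> w' \<in> W \<Longrightarrow> w \<circ> w' \<in> W"
  by (induction rule: weyl_group.induct) (auto simp: comp_assoc weyl_refl)

lemma W_inverse: "w \<in> W \<Longrightarrow> \<exists>w'\<in>W. w \<circ> w' = id \<and> w' \<circ> w = id"
proof (induction rule: weyl_group.induct)
  case weyl_id
  show ?case using W_id by (intro bexI[of _ id]) simp_all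
next
  case (weyl_refl \<alpha> w)
  then obtain w' where w': "w' \<in> W" "w \<circ> w' = id" "w' \<circ> w = id" by blast
  have "w' \<circ> root_refl R \<alpha> \<in> W" using W_comp[OF w'(1) W_refl[OF weyl_refl(1)]] .
  moreover have "(root_refl R \<alpha> \<circ> w) \<circ> (w' \<circ> root_refl R \<alpha>) = id" "(w' \<circ> root_refl R \<alpha>) \<circ> (root_refl R \<alpha> \<circ> w) = id"
    using w'(2,3) root_refl_invol[OF weyl_refl(1)] by (simp_all add: fun_eq_iff)
  ultimately show ?case by blast
qed

lemma W_inv: assumes "w \<in> W" shows "inv w \<in> W" and "w \<circ> inv w = id" and "inv w \<circ> w = id"
proof -
  obtain w' where w': "w' \<in> W" "w \<circ> w' = id" "w' \<circ> w = id" using W_inverse[OF assms] by blast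
  then have "inv w = w'" by (metis inv_unique_comp)
  with w' show "inv w \<in> W" and "w \<circ> inv w = id" and "inv w \<circ> w = id" by auto
qed

lemma W_bij: "w \<in> W \<Longrightarrow> bij w"
  using W_inv(2,3) o_bij by blast

lemma W_inv_simps: "w \<in> W \<Longrightarrow> w (inv w x) = x" "w \<in> W \<Longrightarrow> inv w (w x) = x"
  using fun_cong[OF W_inv(2), of w x] fun_cong[OF W_inv(3), of w x] by simp_all

lemma W_inv_inv: "w \<in> W \<Longrightarrow> inv (inv w) = w"
  by (simp add: W_bij inv_inv_eq)

text \<open>An element of W is determined by the permutation that it induces on the finite spanning
  set R.\<close>

lemma W_finite: "finite W"
proof -
  have "inj_on (\<lambda>w. restrict w R) W"
  proof (rule inj_onI)
    fix w w' assume w: "w \<in> W" "w' \<in> W" "restrict w R = restrict w' R"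
    have "w x = w' x" for x
    proof (rule linear_eq_on_span[OF W_linear[OF w(1)] W_linear[OF w(2)], of R])
      show "w y = w' y" if "y \<in> R" for y using fun_cong[OF w(3), of y] that by simp
    qed (simp add: span_R)
    then show "w = w'" by auto
  qed
  moreover have "(\<lambda>w. restrict w R) ` W \<subseteq> R \<rightarrow>\<^sub>E R" using W_root by auto
  ultimately show ?thesis
    by (meson finite_PiE fin_R finite_imageD finite_subset)
qed

text \<open>The functional transported by w has the two properties that characterise the coroot of w
  \<alpha>, so uniqueness identifies the two.\<close>

lemma coroot_W:
  assumes "w \<in> W" "\<alpha> \<in> R"
  shows "w x \<bullet> coroot R (w \<alpha>) = x \<bullet> coroot R \<alpha>"
proof -
  note lw = W_linear[OF assms(1)] and li = W_linear[OF W_inv(1)[OF assms(1)]]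
  let ?h = "adjoint (inv w) (coroot R \<alpha>)"
  have h: "y \<bullet> ?h = inv w y \<bullet> coroot R \<alpha>" for y by (rule adjoint_works[OF li])
  have "hyp_refl (w \<alpha>) ?h y = w (root_refl R \<alpha> (inv w y))" for y
    by (simp add: hyp_refl_def h root_refl_apply linear_diff[OF lw] linear_scale[OF lw] W_inv_simps[OF assms(1)])
  then have "hyp_refl (w \<alpha>) ?h = w \<circ> root_refl R \<alpha> \<circ> inv w" by (simp add: fun_eq_iff)
  then have "hyp_refl (w \<alpha>) ?h ` R = R"
    by (simp only: image_comp[symmetric] W_image W_inv root_refl_image assms)
  moreover have "w \<alpha> \<bullet> ?h = 2" unfolding h W_inv_simps[OF assms(1)] by (rule root_coroot[OF assms(2)])
  ultimately have "coroot R (w \<alpha>) = ?h" by (intro coroot_eq[OF W_root[OF assms]])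
  then show ?thesis using h[of "w x"] by (simp only: W_inv_simps[OF assms(1)])
qed

lemma root_refl_W:
  assumes "w \<in> W" "\<alpha> \<in> R"
  shows "root_refl R (w \<alpha>) \<circ> w = w \<circ> root_refl R \<alpha>"
  by (rule ext)
    (simp add: root_refl_apply coroot_W[OF assms] linear_diff[OF W_linear[OF assms(1)]] linear_scale[OF W_linear[OF assms(1)]])

lemma root_uminus:
  assumes "\<alpha> \<in> R"
  shows "- \<alpha> \<in> R" and coroot_uminus: "coroot R (- \<alpha>) = - coroot R \<alpha>"
    and root_refl_uminus: "root_refl R (- \<alpha>) = root_refl R \<alpha>"
proof -
  show m: "- \<alpha> \<in> R" using W_root[OF W_refl[OF assms] assms] root_refl_self[OF assms] by simp
  have e: "hyp_refl (- \<alpha>) (- coroot R \<alpha>) = root_refl R \<alpha>"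
    by (simp add: hyp_refl_def root_refl_def fun_eq_iff)
  show c: "coroot R (- \<alpha>) = - coroot R \<alpha>"
    by (rule coroot_eq[OF m]) (simp_all add: e root_refl_image assms root_coroot)
  show "root_refl R (- \<alpha>) = root_refl R \<alpha>" using e c by (simp add: root_refl_def)
qed

lemma pairing_coroot_W:
  assumes "w \<in> W" "\<alpha> \<in> R"
  shows "pairing (cact w x) (cplx (coroot R (w \<alpha>))) = pairing x (cplx (coroot R \<alpha>))"
proof -
  have "tact w (cplx (coroot R (w \<alpha>))) = cplx (coroot R \<alpha>)"
    using coroot_W[OF assms] by (simp add: tact_def pairing_cplx vec_eq_iff) (simp add: cplx_def inner_axis')
  then show ?thesis by (simp add: pairing_cact)
qed

lemma cact_refl: "cact (root_refl R \<alpha>) x = x - pairing x (cplx (coroot R \<alpha>)) *s cplx \<alpha>"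
proof -
  have "cact (root_refl R \<alpha>) x = (\<Sum>i\<in>UNIV. x $ i *s cplx (root_refl R \<alpha> (axis i 1)))"
    by (simp add: vec_eq_iff cact_def cplx_def)
  also have "\<dots> = (\<Sum>i\<in>UNIV. x $ i *s axis i 1) - (\<Sum>i\<in>UNIV. (x $ i * (cplx (coroot R \<alpha>) $ i)) *s cplx \<alpha>)"
    by (simp add: root_refl_apply inner_axis' vec_eq_iff algebra_simps sum_subtractf sum_distrib_left) (simp add: cplx_def)
  also have "\<dots> = x - pairing x (cplx (coroot R \<alpha>)) *s cplx \<alpha>"
    by (simp add: vec_expand[symmetric] pairing_def vec.scale_sum_left)
  finally show ?thesis .
qed

end

section \<open>Positive systems and invariant parameters\<close>

locale root_params = roots R for R :: "(real^'n::finite) set" +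
  fixes Rp :: "(real^'n) set" and k :: "real^'n \<Rightarrow> complex"
  assumes pos_system: "positive_system R Rp" and inv_k: "invariant_mult R k"
begin

lemma Rp_R: "\<alpha> \<in> Rp \<Longrightarrow> \<alpha> \<in> R"
  using pos_system by (auto simp: positive_system_def)

lemma fin_Rp: "finite Rp"
  using fin_R Rp_R by (meson finite_subset subsetI)

lemma Rp_cases: "\<alpha> \<in> R \<Longrightarrow> (\<alpha> \<in> Rp \<and> - \<alpha> \<notin> Rp) \<or> (\<alpha> \<notin> Rp \<and> - \<alpha> \<in> Rp)"
  using pos_system root_uminus(1)[of \<alpha>] unfolding positive_system_def by force

lemma k_W: "w \<in> W \<Longrightarrow> \<alpha> \<in> R \<Longrightarrow> k (w \<alpha>) = k \<alpha>"
  using inv_k by (auto simp: invariant_mult_def)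

lemma k_uminus: "\<alpha> \<in> R \<Longrightarrow> k (- \<alpha>) = k \<alpha>"
  using k_W[OF W_refl] root_refl_self by metis

text \<open>The image of the positive roots under w contains exactly one root of each pair
  \<plusminus>\<alpha>, and an even summand does not see which one.\<close>

lemma sum_Rp_W:
  assumes w: "w \<in> W" and ev: "\<And>\<alpha>. \<alpha> \<in> R \<Longrightarrow> g (- \<alpha>) = g \<alpha>"
  shows "(\<Sum>\<alpha>\<in>Rp. g (w \<alpha>)) = (\<Sum>\<alpha>\<in>Rp. g \<alpha>)"
proof -
  \<comment> \<open>The positive one among \<plusminus>w \<alpha>; it gives a permutation of the
    positive roots.\<close>
  define t where "t \<alpha> = (if w \<alpha> \<in> Rp then w \<alpha> else - w \<alpha>)" for \<alpha>
  have lw: "w (- x) = - w x" for x using W_linear[OF w] by (rule linear_neg)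
  have "inj w" using W_bij[OF w] by (simp add: bij_def)
  have inj: "inj_on t Rp"
  proof (rule inj_onI)
    fix \<alpha> \<beta> assume ab: "\<alpha> \<in> Rp" "\<beta> \<in> Rp" "t \<alpha> = t \<beta>"
    then have "w \<alpha> = w \<beta> \<or> w \<alpha> = w (- \<beta>)" unfolding t_def lw by (auto split: if_splits) (metis minus_minus)
    then have "\<alpha> = \<beta> \<or> \<alpha> = - \<beta>" using \<open>inj w\<close> by (auto dest: injD)
    then show "\<alpha> = \<beta>" using Rp_cases[OF Rp_R[OF ab(2)]] ab by auto
  qed
  have "t ` Rp \<subseteq> Rp" using Rp_cases[OF W_root[OF w Rp_R]] by (auto simp: t_def)
  then have im: "t ` Rp = Rp" using inj fin_Rp by (metis card_image card_subset_eq)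
  have "(\<Sum>\<alpha>\<in>Rp. g \<alpha>) = (\<Sum>\<alpha>\<in>Rp. g (t \<alpha>))" using sum.reindex[OF inj, of g] im by simp
  also have "\<dots> = (\<Sum>\<alpha>\<in>Rp. g (w \<alpha>))"
    by (intro sum.cong refl) (auto simp: t_def ev W_root w Rp_R)
  finally show ?thesis ..
qed

end

section \<open>The invariant form B and its orthonormal basis\<close>

locale root_basis = roots R for R :: "(real^'n::finite) set" +
  fixes z :: "'n \<Rightarrow> real^'n"
  assumes B_basis: "B_orthonormal_basis R z"
begin

lemma B_form_simps:
  "B_form R (x + x') y = B_form R x y + B_form R x' y" "B_form R x (y + y') = B_form R x y + B_form R x y'"
  "B_form R (c *s x) y = c * B_form R x y" "B_form R x (c *s y) = c * B_form R x y"
  by (simp_all add: B_form_def pairing_simps algebra_simps sum.distrib sum_distrib_left)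

lemma B_form_commute: "B_form R x y = B_form R y x"
  by (simp add: B_form_def mult.commute)

lemma B_form_zero: "B_form R 0 y = 0"
  using B_form_simps(3)[of 0 0 y] by simp

lemma B_form_sum: "B_form R (sum f A) y = (\<Sum>i\<in>A. B_form R (f i) y)" "B_form R x (sum f A) = (\<Sum>i\<in>A. B_form R x (f i))"
proof -
  show *: "B_form R (sum f A) y = (\<Sum>i\<in>A. B_form R (f i) y)" for f y
    by (induction A rule: infinite_finite_induct) (auto simp: B_form_simps B_form_zero)
  show "B_form R x (sum f A) = (\<Sum>i\<in>A. B_form R x (f i))"
    using *[of f x] by (simp add: B_form_commute)
qed

lemma pairing_B_map: "pairing y (B_map R x) = B_form R x y"
proof -
  have "B_form R x y = B_form R x (\<Sum>i\<in>UNIV. y $ i *s axis i 1)" by (simp flip: vec_expand)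
  then show ?thesis by (simp add: pairing_def B_map_def B_form_sum B_form_simps)
qed

lemma B_form_W: assumes w: "w \<in> W" shows "B_form R (cact w x) (cact w y) = B_form R x y"
proof -
  have inj: "inj_on w R" using W_bij[OF w] by (auto simp: bij_def intro: inj_on_subset)
  have "B_form R (cact w x) (cact w y) = (\<Sum>\<alpha>\<in>R. pairing (cact w x) (cplx (coroot R (w \<alpha>))) * pairing (cact w y) (cplx (coroot R (w \<alpha>))))"
    unfolding B_form_def
    using sum.reindex[OF inj, of "\<lambda>\<alpha>. pairing (cact w x) (cplx (coroot R \<alpha>)) * pairing (cact w y) (cplx (coroot R \<alpha>))"]
    by (simp add: W_image w)
  also have "\<dots> = B_form R x y" unfolding B_form_def by (intro sum.cong) (auto simp: pairing_coroot_W w)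
  finally show ?thesis .
qed

abbreviation zc where "zc j \<equiv> cplx (z j)"

lemma B_ortho: "B_form R (zc i) (zc j) = (if i = j then 1 else 0)"
  using B_basis by (simp add: B_orthonormal_basis_def)

text \<open>A real orthonormal basis is also a complex one: the expansion holds for real vectors, in
  particular for the unit vectors, and extends by complex linearity.\<close>

lemma B_expand: "x = (\<Sum>j\<in>UNIV. B_form R x (zc j) *s zc j)"
proof -
  have r: "cplx y = (\<Sum>j\<in>UNIV. B_form R (cplx y) (zc j) *s zc j)" if "y \<in> span (range z)" for y
    using that
  proof (induction rule: span_induct_alt)
    case base
    then show ?case by (simp add: B_form_zero)
  next
    case (step c u y)
    then obtain i where "u = z i" by auto
    have "(\<Sum>j\<in>UNIV. B_form R (zc i) (zc j) *s zc j) = zc i"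
      by (simp add: B_ortho if_distrib if_distribR cong: if_cong)
    moreover have "(\<Sum>j\<in>UNIV. B_form R (cplx (c *\<^sub>R u + y)) (zc j) *s zc j)
      = of_real c *s (\<Sum>j\<in>UNIV. B_form R (zc i) (zc j) *s zc j) + (\<Sum>j\<in>UNIV. B_form R (cplx y) (zc j) *s zc j)"
      unfolding \<open>u = z i\<close>
      by (simp add: B_form_simps vec.scale_sum_right vec.scale_left_distrib sum.distrib)
    ultimately show ?case
      by (simp only: step.IH(1)[symmetric] cplx_simps \<open>u = z i\<close>)
  qed
  have a: "axis i 1 = (\<Sum>j\<in>UNIV. B_form R (axis i 1) (zc j) *s zc j)" for i
    using r[of "axis i 1"] B_basis unfolding B_orthonormal_basis_def cplx_simps by blast
  have "x = (\<Sum>i\<in>UNIV. x $ i *s (\<Sum>j\<in>UNIV. B_form R (axis i 1) (zc j) *s zc j))"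
    by (subst vec_expand) (simp flip: a)
  also have "\<dots> = (\<Sum>j\<in>UNIV. \<Sum>i\<in>UNIV. (x $ i * B_form R (axis i 1) (zc j)) *s zc j)"
    unfolding vec.scale_sum_right by (subst sum.swap) simp
  also have "\<dots> = (\<Sum>j\<in>UNIV. B_form R (\<Sum>i\<in>UNIV. x $ i *s axis i 1) (zc j) *s zc j)"
    by (simp add: B_form_sum B_form_simps vec.scale_sum_left)
  finally show ?thesis unfolding vec_expand[symmetric] .
qed

lemma B_map_bij: "bij (B_map R)"
proof (rule bijI)
  show "inj (B_map R)"
  proof (rule injI)
    fix x y assume "B_map R x = B_map R y"
    then have "B_form R x (zc j) = B_form R y (zc j)" for j by (metis pairing_B_map)
    then have "(\<Sum>j\<in>UNIV. B_form R x (zc j) *s zc j) = (\<Sum>j\<in>UNIV. B_form R y (zc j) *s zc j)" by simp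
    then show "x = y" by (simp only: B_expand[symmetric])
  qed
  show "surj (B_map R)"
  proof (rule surjI)
    fix y
    show "B_map R (\<Sum>j\<in>UNIV. pairing (zc j) y *s zc j) = y"
    proof (rule pairing_eqI)
      fix x
      have "pairing x (B_map R (\<Sum>j\<in>UNIV. pairing (zc j) y *s zc j)) = (\<Sum>j\<in>UNIV. pairing (zc j) y * B_form R (zc j) x)"
        by (simp add: pairing_B_map B_form_sum B_form_simps)
      also have "\<dots> = pairing (\<Sum>j\<in>UNIV. B_form R x (zc j) *s zc j) y"
        by (simp add: pairing_sum pairing_simps B_form_commute mult.commute)
      finally show "pairing x (B_map R (\<Sum>j\<in>UNIV. pairing (zc j) y *s zc j)) = pairing x y"
        by (simp flip: B_expand)
    qed
  qed
qed

lemma B_inv: "B_map R (inv (B_map R) y) = y" "inv (B_map R) (B_map R x) = x"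
  using B_map_bij by (simp_all add: bij_is_surj surj_f_inv_f bij_is_inj)

lemma B_map_simps: "B_map R (x + y) = B_map R x + B_map R y" "B_map R (c *s x) = c *s B_map R x"
  by (simp_all add: B_map_def B_form_simps vec_eq_iff)

lemma B_inv_simps: "inv (B_map R) (x + y) = inv (B_map R) x + inv (B_map R) y" "inv (B_map R) (c *s x) = c *s inv (B_map R) x"
proof -
  show "inv (B_map R) (x + y) = inv (B_map R) x + inv (B_map R) y"
    using B_inv(2)[of "inv (B_map R) x + inv (B_map R) y"] by (simp only: B_map_simps B_inv(1))
  show "inv (B_map R) (c *s x) = c *s inv (B_map R) x"
    using B_inv(2)[of "c *s inv (B_map R) x"] by (simp only: B_map_simps B_inv(1))
qed

lemma B_form_inv: "B_form R (inv (B_map R) y) x = pairing x y"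
  by (metis B_inv(1) pairing_B_map)

text \<open>The reflection preserves B and negates \<alpha>, which forces B(\<alpha>, x) to be
  proportional to the value of x on the coroot. The factor is nonzero because B(\<alpha>, \<alpha>)
  is a sum of real squares, one of which is 4.\<close>

lemma B_root: assumes "\<alpha> \<in> R"
  shows "B_form R (cplx \<alpha>) x = B_form R (cplx \<alpha>) (cplx \<alpha>) / 2 * pairing x (cplx (coroot R \<alpha>))"
    and "B_form R (cplx \<alpha>) (cplx \<alpha>) \<noteq> 0"
proof -
  let ?r = "root_refl R \<alpha>"
  have "cact ?r (cplx \<alpha>) = - cplx \<alpha>" by (simp add: cact_cplx root_refl_linear root_refl_self assms)
  moreover have "B_form R (- cplx \<alpha>) y = - B_form R (cplx \<alpha>) y" for y
    using B_form_simps(3)[of "-1" "cplx \<alpha>" y] by simp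
  moreover have "B_form R x (- y) = - B_form R x y" for x y
    using B_form_simps(4)[of x "-1" y] by simp
  ultimately have "B_form R (cplx \<alpha>) x = - B_form R (cplx \<alpha>) (x - pairing x (cplx (coroot R \<alpha>)) *s cplx \<alpha>)"
    using B_form_W[OF W_refl[OF assms], of "cplx \<alpha>" x] by (simp only: cact_refl[of \<alpha> x])
  also have "\<dots> = - B_form R (cplx \<alpha>) x + pairing x (cplx (coroot R \<alpha>)) * B_form R (cplx \<alpha>) (cplx \<alpha>)"
    unfolding diff_conv_add_uminus B_form_simps \<open>\<And>y x. B_form R x (- y) = - B_form R x y\<close> by simp
  finally have "2 * B_form R (cplx \<alpha>) x = pairing x (cplx (coroot R \<alpha>)) * B_form R (cplx \<alpha>) (cplx \<alpha>)"
    by algebra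
  then show "B_form R (cplx \<alpha>) x = B_form R (cplx \<alpha>) (cplx \<alpha>) / 2 * pairing x (cplx (coroot R \<alpha>))"
    by (simp only: times_divide_eq_left eq_divide_eq_numeral1) (simp add: mult.commute)
  have "B_form R (cplx \<alpha>) (cplx \<alpha>) = of_real (\<Sum>\<beta>\<in>R. (\<alpha> \<bullet> coroot R \<beta>)\<^sup>2)"
    by (simp add: B_form_def pairing_cplx power2_eq_square)
  moreover have "(\<Sum>\<beta>\<in>R. (\<alpha> \<bullet> coroot R \<beta>)\<^sup>2) \<ge> (\<alpha> \<bullet> coroot R \<alpha>)\<^sup>2"
    using fin_R assms by (intro member_le_sum) auto
  moreover have "(\<alpha> \<bullet> coroot R \<alpha>)\<^sup>2 > 0" by (simp add: root_coroot assms)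
  ultimately show "B_form R (cplx \<alpha>) (cplx \<alpha>) \<noteq> 0" by (simp only: of_real_eq_0_iff)
qed

text \<open>B carries \<alpha> to a multiple of its coroot. This symmetry is what makes the
  reflection terms in the relation between T_y and x compatible with \<sigma>.\<close>

lemma B_root_swap:
  assumes "\<alpha> \<in> R"
  shows "pairing (cplx \<alpha>) (B_map R x) * pairing (inv (B_map R) y) (cplx (coroot R \<alpha>))
    = pairing (cplx \<alpha>) y * pairing x (cplx (coroot R \<alpha>))"
proof -
  let ?b = "B_form R (cplx \<alpha>) (cplx \<alpha>) / 2"
  have 1: "pairing (cplx \<alpha>) (B_map R x) = ?b * pairing x (cplx (coroot R \<alpha>))"
    using B_root(1)[OF assms, of x] by (simp only: pairing_B_map B_form_commute[of x])
  have 2: "pairing (cplx \<alpha>) y = ?b * pairing (inv (B_map R) y) (cplx (coroot R \<alpha>))"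
    using B_root(1)[OF assms, of "inv (B_map R) y"] B_form_inv[of y "cplx \<alpha>"] by (simp only: B_form_commute[of "cplx \<alpha>" "inv (B_map R) y"])
  show ?thesis unfolding 1 2 by simp
qed

lemma cact_inv: "w \<in> W \<Longrightarrow> cact w (cact (inv w) x) = x" "w \<in> W \<Longrightarrow> cact (inv w) (cact w x) = x"
  using cact_comp[of w "inv w" x] cact_comp[of "inv w" w x] by (simp_all only: W_inv W_linear cact_id)

lemma B_form_adj: "w \<in> W \<Longrightarrow> B_form R (cact w x) y = B_form R x (cact (inv w) y)"
  using B_form_W[of w x "cact (inv w) y"] cact_inv by simp

lemma B_map_cact: "w \<in> W \<Longrightarrow> B_map R (cact w x) = tact (inv w) (B_map R x)"
  by (rule pairing_eqI) (simp add: pairing_B_map pairing_cact[symmetric] B_form_adj)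

lemma B_inv_tact: "w \<in> W \<Longrightarrow> inv (B_map R) (tact w y) = cact (inv w) (inv (B_map R) y)"
  using B_map_cact[of "inv w" "inv (B_map R) y"] B_inv(2)[of "cact (inv w) (inv (B_map R) y)"]
  by (simp only: W_inv(1) W_inv_inv B_inv)

lemma dual_basis_sum: "(\<Sum>i\<in>UNIV. pairing a (B_map R (zc i)) * pairing (zc i) b) = pairing a b"
proof -
  have "pairing a b = pairing (\<Sum>j\<in>UNIV. B_form R a (zc j) *s zc j) b" by (simp flip: B_expand)
  then show ?thesis by (simp add: pairing_sum pairing_simps pairing_B_map B_form_commute)
qed

end

section \<open>Algebras with the Cherednik relations\<close>

context roots
begin

text \<open>The Demazure divided difference (1 - r_\<alpha>)/\<alpha>.\<close>

definition dq :: "real^'n \<Rightarrow> 'n mpoly \<Rightarrow> 'n mpoly"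
  where "dq \<alpha> p = exact_div (p - poly_act (root_refl R \<alpha>) p) (lin_poly (cplx \<alpha>))"

lemma var_minus_refl:
  "pvar i - poly_act (root_refl R \<alpha>) (pvar i) = lin_poly (cplx \<alpha>) * const_poly (cplx (coroot R \<alpha>) $ i)"
  using poly_act_lin[of "root_refl R \<alpha>" "axis i 1"]
  by (simp add: cact_refl lin_poly_simps lin_poly_axis mult.commute)

text \<open>Divisibility by \<alpha> is propagated by the twisted Leibniz rule x p - r(x p) = x (p -
  r p) + (x - r x) r(p), in which x - r x is a multiple of \<alpha> for a variable x.\<close>

lemma dq_exists: "\<exists>r. lin_poly (cplx \<alpha>) * r = p - poly_act (root_refl R \<alpha>) p"
proof (induction p rule: mpoly_induct)
  case (const c)
  then show ?case by (intro exI[of _ 0]) simp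
next
  case (add p q)
  then obtain r s where "lin_poly (cplx \<alpha>) * r = p - poly_act (root_refl R \<alpha>) p"
     "lin_poly (cplx \<alpha>) * s = q - poly_act (root_refl R \<alpha>) q" by blast
  then show ?case by (intro exI[of _ "r + s"]) (simp add: algebra_simps)
next
  case (var i p)
  then obtain r where r: "lin_poly (cplx \<alpha>) * r = p - poly_act (root_refl R \<alpha>) p" by blast
  have D: "pvar i * p - poly_act (root_refl R \<alpha>) (pvar i * p)
     = pvar i * (p - poly_act (root_refl R \<alpha>) p) + (pvar i - poly_act (root_refl R \<alpha>) (pvar i)) * poly_act (root_refl R \<alpha>) p"
    by (simp add: algebra_simps)
  show ?case unfolding D r[symmetric] var_minus_refl
    by (intro exI[of _ "pvar i * r + const_poly (cplx (coroot R \<alpha>) $ i) * poly_act (root_refl R \<alpha>) p"]) (simp add: algebra_simps)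
qed

lemma dq_spec: "\<alpha> \<in> R \<Longrightarrow> lin_poly (cplx \<alpha>) * dq \<alpha> p = p - poly_act (root_refl R \<alpha>) p"
  using dq_exists[of \<alpha> p] exact_div_eq[OF root_nonzero] unfolding dq_def by metis

lemma dq_eqI: "\<alpha> \<in> R \<Longrightarrow> lin_poly (cplx \<alpha>) * r = p - poly_act (root_refl R \<alpha>) p \<Longrightarrow> dq \<alpha> p = r"
  unfolding dq_def using exact_div_eq[OF root_nonzero] by blast

lemma dq_add: "\<alpha> \<in> R \<Longrightarrow> dq \<alpha> (p + q) = dq \<alpha> p + dq \<alpha> q"
  by (rule dq_eqI) (simp_all add: distrib_left dq_spec)

lemma dq_const: "\<alpha> \<in> R \<Longrightarrow> dq \<alpha> (const_poly c) = 0"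
  by (rule dq_eqI) simp_all

lemma dq_scale: "\<alpha> \<in> R \<Longrightarrow> dq \<alpha> (const_poly c * p) = const_poly c * dq \<alpha> p"
  by (rule dq_eqI) (simp_all add: mult.left_commute[of "lin_poly _"] dq_spec right_diff_distrib)

lemma dq_var_mult: "\<alpha> \<in> R \<Longrightarrow>
    dq \<alpha> (pvar i * p) = pvar i * dq \<alpha> p + const_poly (cplx (coroot R \<alpha>) $ i) * poly_act (root_refl R \<alpha>) p"
proof (rule dq_eqI)
  assume a: "\<alpha> \<in> R"
  have "lin_poly (cplx \<alpha>) * (pvar i * dq \<alpha> p + const_poly (cplx (coroot R \<alpha>) $ i) * poly_act (root_refl R \<alpha>) p)
     = pvar i * (lin_poly (cplx \<alpha>) * dq \<alpha> p) + (lin_poly (cplx \<alpha>) * const_poly (cplx (coroot R \<alpha>) $ i)) * poly_act (root_refl R \<alpha>) p"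
    by (simp add: algebra_simps)
  also have "\<dots> = pvar i * p - poly_act (root_refl R \<alpha>) (pvar i * p)"
    unfolding dq_spec[OF a] var_minus_refl[symmetric] by (simp add: algebra_simps)
  finally show "lin_poly (cplx \<alpha>) * (pvar i * dq \<alpha> p + const_poly (cplx (coroot R \<alpha>) $ i) * poly_act (root_refl R \<alpha>) p)
     = pvar i * p - poly_act (root_refl R \<alpha>) (pvar i * p)" .
qed

lemma dq_W:
  assumes w: "w \<in> W" and \<alpha>: "\<alpha> \<in> R"
  shows "dq (w \<alpha>) (poly_act w p) = poly_act w (dq \<alpha> p)"
proof (rule dq_eqI[OF W_root[OF w \<alpha>]])
  have "lin_poly (cplx (w \<alpha>)) * poly_act w (dq \<alpha> p) = poly_act w (lin_poly (cplx \<alpha>) * dq \<alpha> p)"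
    by (simp add: poly_act_lin cact_cplx W_linear w)
  also have "\<dots> = poly_act w p - poly_act (root_refl R (w \<alpha>)) (poly_act w p)"
    by (simp add: dq_spec \<alpha> root_refl_W[OF w \<alpha>] W_linear w root_refl_linear flip: poly_act_comp)
  finally show "lin_poly (cplx (w \<alpha>)) * poly_act w (dq \<alpha> p) = poly_act w p - poly_act (root_refl R (w \<alpha>)) (poly_act w p)" .
qed

lemma dq_uminus: "\<alpha> \<in> R \<Longrightarrow> dq (- \<alpha>) p = - dq \<alpha> p"
  using lin_poly_simps(2)[of "-1" "cplx \<alpha>"] lin_poly_simps(3)[of 0 "cplx \<alpha>"]
  by (intro dq_eqI) (simp_all add: root_uminus dq_spec lin_poly_simps(4))

end

text \<open>All defining relations except commutativity of the \<open>Y y\<close>, which in the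
  concrete modules is deduced from the others. Scalars are given by a map \<open>\<kappa>\<close>
  whose values commute with the generators, so that operators, opposite rings and products can be
  treated alike.\<close>

locale cher_pre = root_params R Rp k + scalar_hom \<kappa>
  for R Rp :: "(real^'n::finite) set" and k :: "real^'n \<Rightarrow> complex" and \<kappa> :: "complex \<Rightarrow> 'r::unital_ring" +
  fixes X :: "complex^'n \<Rightarrow> 'r" and Wd :: "'n lin \<Rightarrow> 'r" and Y :: "complex^'n \<Rightarrow> 'r"
  assumes \<kappa>_X: "\<kappa> c * X x = X x * \<kappa> c" and \<kappa>_W: "w \<in> W \<Longrightarrow> \<kappa> c * Wd w = Wd w * \<kappa> c"
    and \<kappa>_Y: "\<kappa> c * Y y = Y y * \<kappa> c"
    and X_add: "X (x + x') = X x + X x'" and X_scale: "X (c *s x) = \<kappa> c * X x"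
    and Y_add: "Y (y + y') = Y y + Y y'" and Y_scale: "Y (c *s y) = \<kappa> c * Y y"
    and XX: "X x * X x' = X x' * X x"
    and Wd_id: "Wd id = 1" and Wd_comp: "w \<in> W \<Longrightarrow> w' \<in> W \<Longrightarrow> Wd (w \<circ> w') = Wd w * Wd w'"
    and WX: "w \<in> W \<Longrightarrow> Wd w * X x = X (cact w x) * Wd w"
    and WY: "w \<in> W \<Longrightarrow> Y y * Wd w = Wd w * Y (tact w y)"
    and YX: "Y y * X x = X x * Y y + \<kappa> (pairing x y) +
      (\<Sum>\<alpha>\<in>Rp. \<kappa> (k \<alpha> * pairing (cplx \<alpha>) y * pairing x (cplx (coroot R \<alpha>))) * Wd (root_refl R \<alpha>))"
begin

lemma X_zero: "X 0 = 0" and Y_zero: "Y 0 = 0"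
  using X_add[of 0 0] Y_add[of 0 0] by simp_all

lemma X_sum: "X (sum f A) = (\<Sum>i\<in>A. X (f i))" and Y_sum: "Y (sum f A) = (\<Sum>i\<in>A. Y (f i))"
  by (induction A rule: infinite_finite_induct) (simp_all add: X_zero Y_zero X_add Y_add)

lemma X_expand: "X x = (\<Sum>i\<in>UNIV. \<kappa> (x $ i) * X (axis i 1))"
  by (subst vec_expand[of x]) (simp only: X_sum X_scale)

lemma Y_expand: "Y y = (\<Sum>i\<in>UNIV. \<kappa> (y $ i) * Y (axis i 1))"
  by (subst vec_expand[of y]) (simp only: Y_sum Y_scale)

definition "Xp = cev \<kappa> (\<lambda>i. X (axis i 1))"

sublocale xe: comm_eval \<kappa> "\<lambda>i. X (axis i 1)"
  by unfold_locales (simp_all add: XX \<kappa>_X)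

lemmas Xp_simps = xe.cev_add[folded Xp_def] xe.cev_mult[folded Xp_def] xe.cev_const[folded Xp_def]
  xe.cev_zero[folded Xp_def] xe.cev_one[folded Xp_def] xe.cev_sum[folded Xp_def] xe.cev_power[folded Xp_def]
lemmas Xp_cmult = xe.cev_cmult[folded Xp_def]
lemmas Xp_vmult = xe.cev_vmult[folded Xp_def]

lemma Xp_lin: "Xp (lin_poly x) = X x"
  unfolding Xp_def xe.cev_lin_poly by (rule X_expand[symmetric])

lemma Xp_var: "Xp (pvar i) = X (axis i 1)"
  unfolding Xp_def by (rule xe.cev_var)

lemma W_Xp: "w \<in> W \<Longrightarrow> Wd w * Xp p = Xp (poly_act w p) * Wd w"
proof (induction p rule: mpoly_induct)
  case (const c)
  then show ?case by (simp add: Xp_simps \<kappa>_W)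
next
  case (add p q)
  then show ?case by (simp add: Xp_simps algebra_simps)
next
  case (var i p)
  have "Wd w * (X (axis i 1) * Xp p) = X (cact w (axis i 1)) * (Wd w * Xp p)"
    by (simp only: mult.assoc[symmetric] WX var.prems)
  also have "\<dots> = Xp (poly_act w (pvar i * p)) * Wd w"
    by (simp only: var.IH var.prems poly_act_simps Xp_simps poly_act_lin lin_poly_axis[symmetric] Xp_lin mult.assoc)
  finally show ?case by (simp only: Xp_vmult)
qed

text \<open>The formula of the Dunkl operator, read as a commutation rule in an arbitrary algebra.
  It grows out of the rule for one variable by the Leibniz rules for derivatives and divided
  differences.\<close>

lemma Y_Xp: "Y y * Xp p = Xp p * Y y + Xp (dir_deriv y p) +
   (\<Sum>\<alpha>\<in>Rp. \<kappa> (k \<alpha> * pairing (cplx \<alpha>) y) * Xp (dq \<alpha> p) * Wd (root_refl R \<alpha>))"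
proof (induction p rule: mpoly_induct)
  case (const c)
  then show ?case by (simp add: Xp_simps dir_deriv_const dq_const Rp_R \<kappa>_Y)
next
  case (add p q)
  have "(\<Sum>\<alpha>\<in>Rp. \<kappa> (k \<alpha> * pairing (cplx \<alpha>) y) * Xp (dq \<alpha> (p + q)) * Wd (root_refl R \<alpha>))
    = (\<Sum>\<alpha>\<in>Rp. \<kappa> (k \<alpha> * pairing (cplx \<alpha>) y) * Xp (dq \<alpha> p) * Wd (root_refl R \<alpha>)) +
      (\<Sum>\<alpha>\<in>Rp. \<kappa> (k \<alpha> * pairing (cplx \<alpha>) y) * Xp (dq \<alpha> q) * Wd (root_refl R \<alpha>))"
    unfolding sum.distrib[symmetric]
    by (intro sum.cong refl) (simp add: dq_add Rp_R Xp_simps algebra_simps)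
  with add show ?case by (simp add: Xp_simps dir_deriv_add distrib_left distrib_right)
next
  case (var i p)
  let ?X = "X (axis i 1)"
  let ?k = "\<lambda>\<alpha>. k \<alpha> * pairing (cplx \<alpha>) y"
  let ?r = "\<lambda>\<alpha>. Wd (root_refl R \<alpha>)"
  let ?h = "\<lambda>\<alpha>. cplx (coroot R \<alpha>) $ i"
  have s: "\<kappa> (?k \<alpha>) * Xp (dq \<alpha> (pvar i * p)) * ?r \<alpha>
    = ?X * (\<kappa> (?k \<alpha>) * Xp (dq \<alpha> p) * ?r \<alpha>) + \<kappa> (?k \<alpha> * ?h \<alpha>) * ?r \<alpha> * Xp p" if "\<alpha> \<in> Rp" for \<alpha>
  proof -
    have "?r \<alpha> * Xp p = Xp (poly_act (root_refl R \<alpha>) p) * ?r \<alpha>"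
      using that by (intro W_Xp W_refl Rp_R)
    moreover have "\<kappa> c * (?X * a) = ?X * (\<kappa> c * a)" for c a by (simp only: mult.assoc[symmetric] \<kappa>_X)
    ultimately show ?thesis
      using that by (simp add: dq_var_mult Rp_R Xp_simps Xp_var Xp_cmult mult.assoc \<kappa>_mult distrib_left distrib_right)
  qed
  have "Y y * Xp (pvar i * p) = (Y y * ?X) * Xp p" by (simp only: Xp_vmult mult.assoc)
  also have "\<dots> = ?X * (Y y * Xp p) + \<kappa> (y $ i) * Xp p + (\<Sum>\<alpha>\<in>Rp. \<kappa> (?k \<alpha> * ?h \<alpha>) * ?r \<alpha> * Xp p)"
    by (simp add: YX distrib_right mult.assoc sum_distrib_right)
  also have "\<dots> = Xp (pvar i * p) * Y y + Xp (dir_deriv y (pvar i * p)) +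
      (\<Sum>\<alpha>\<in>Rp. ?X * (\<kappa> (?k \<alpha>) * Xp (dq \<alpha> p) * ?r \<alpha>) + \<kappa> (?k \<alpha> * ?h \<alpha>) * ?r \<alpha> * Xp p)"
    unfolding var dir_deriv_var_mult
    by (simp add: Xp_simps Xp_var Xp_cmult distrib_left mult.assoc sum_distrib_left sum.distrib)
  also have "(\<Sum>\<alpha>\<in>Rp. ?X * (\<kappa> (?k \<alpha>) * Xp (dq \<alpha> p) * ?r \<alpha>) + \<kappa> (?k \<alpha> * ?h \<alpha>) * ?r \<alpha> * Xp p)
     = (\<Sum>\<alpha>\<in>Rp. \<kappa> (?k \<alpha>) * Xp (dq \<alpha> (pvar i * p)) * ?r \<alpha>)"
    by (intro sum.cong refl) (simp only: s)
  finally show ?case .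
qed

text \<open>A Jacobi argument: with S the reflection part of [Y, x], the commutator of [Y_y, Y_y']
  with x is [Y_y, S y'] - [Y_y', S y]. By \<open>YS\<close> the expression [Y_y, S y'] is symmetric
  in y and y', so the difference vanishes.\<close>

lemma commutator_X: "(Y y * Y y' - Y y' * Y y) * X x = X x * (Y y * Y y' - Y y' * Y y)"
proof -
  define S where "S y = (\<Sum>\<alpha>\<in>Rp. \<kappa> (k \<alpha> * pairing (cplx \<alpha>) y * pairing x (cplx (coroot R \<alpha>))) * Wd (root_refl R \<alpha>))" for y
  have yx: "Y y * X x = X x * Y y + \<kappa> (pairing x y) + S y" for y using YX S_def by simp
  have YS: "Y y * S y' - S y' * Y y = - (\<Sum>\<alpha>\<in>Rp. \<kappa> (k \<alpha> * pairing (cplx \<alpha>) y * pairing (cplx \<alpha>) y' * pairing x (cplx (coroot R \<alpha>)))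
      * Wd (root_refl R \<alpha>) * Y (cplx (coroot R \<alpha>)))" for y y'
  proof -
    have "Y y * (\<kappa> (k \<alpha> * pairing (cplx \<alpha>) y' * pairing x (cplx (coroot R \<alpha>))) * Wd (root_refl R \<alpha>))
        - \<kappa> (k \<alpha> * pairing (cplx \<alpha>) y' * pairing x (cplx (coroot R \<alpha>))) * Wd (root_refl R \<alpha>) * Y y
      = - (\<kappa> (k \<alpha> * pairing (cplx \<alpha>) y * pairing (cplx \<alpha>) y' * pairing x (cplx (coroot R \<alpha>)))
         * Wd (root_refl R \<alpha>) * Y (cplx (coroot R \<alpha>)))" if a: "\<alpha> \<in> Rp" for \<alpha>
    proof -
      let ?w = "root_refl R \<alpha>" and ?c = "k \<alpha> * pairing (cplx \<alpha>) y' * pairing x (cplx (coroot R \<alpha>))"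
      have w: "?w \<in> W" using a by (intro W_refl Rp_R)
      \<comment> \<open>A reflection moves y by a multiple of the coroot; commuting Y_y past it
        therefore produces a single term, whose coefficient contains \<alpha>(y).\<close>
      have t: "tact ?w y = y + (- pairing (cplx \<alpha>) y) *s cplx (coroot R \<alpha>)"
        by (rule pairing_eqI) (simp add: pairing_cact[symmetric] cact_refl pairing_simps)
      have "Y y * Wd ?w = Wd ?w * Y y - Wd ?w * (\<kappa> (pairing (cplx \<alpha>) y) * Y (cplx (coroot R \<alpha>)))"
        by (simp only: WY[OF w] t Y_add Y_scale \<kappa>_minus distrib_left mult_minus_left mult_minus_right diff_conv_add_uminus)
      also have "Wd ?w * (\<kappa> (pairing (cplx \<alpha>) y) * Y (cplx (coroot R \<alpha>))) = \<kappa> (pairing (cplx \<alpha>) y) * Wd ?w * Y (cplx (coroot R \<alpha>))"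
        by (simp only: mult.assoc[symmetric] \<kappa>_W[OF w])
      finally have "Y y * (\<kappa> ?c * Wd ?w) - \<kappa> ?c * Wd ?w * Y y = - (\<kappa> ?c * \<kappa> (pairing (cplx \<alpha>) y) * Wd ?w * Y (cplx (coroot R \<alpha>)))"
        by (simp add: mult.assoc[symmetric] \<kappa>_Y[symmetric]) (simp add: mult.assoc right_diff_distrib)
      also have "\<kappa> ?c * \<kappa> (pairing (cplx \<alpha>) y) = \<kappa> (k \<alpha> * pairing (cplx \<alpha>) y * pairing (cplx \<alpha>) y' * pairing x (cplx (coroot R \<alpha>)))"
        by (simp add: \<kappa>_mult[symmetric] mult_ac)
      finally show ?thesis .
    qed
    then show ?thesis
      unfolding S_def sum_distrib_left sum_distrib_right sum_subtractf[symmetric] sum_negf[symmetric]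
      by (intro sum.cong refl)
  qed
  have "Y y * S y' - S y' * Y y = Y y' * S y - S y * Y y'"
    unfolding YS by (simp add: mult_ac)
  moreover have "Y y * Y y' * X x = X x * Y y * Y y' + \<kappa> (pairing x y) * Y y' + S y * Y y' + \<kappa> (pairing x y') * Y y + Y y * S y'" for y y'
    by (simp add: mult.assoc yx distrib_left) (simp add: mult.assoc[symmetric] yx distrib_right \<kappa>_Y)
  ultimately show ?thesis by (simp add: algebra_simps)
qed

lemma commutator_Xp: "(Y y * Y y' - Y y' * Y y) * Xp p = Xp p * (Y y * Y y' - Y y' * Y y)"
proof (induction p rule: mpoly_induct)
  case (const c)
  have "\<kappa> c * (Y y * Y y') = Y y * Y y' * \<kappa> c" for y y' by (metis \<kappa>_Y mult.assoc)
  then show ?case by (simp add: Xp_simps left_diff_distrib right_diff_distrib)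
next
  case (add p q)
  then show ?case by (simp only: Xp_simps distrib_left distrib_right)
next
  case (var i p)
  then show ?case by (simp only: Xp_vmult mult.assoc[symmetric] commutator_X) (simp only: mult.assoc)
qed

end

section \<open>Normal forms in an arbitrary target\<close>

locale cher_target = cher_pre R Rp k \<kappa> X Wd Y
  for R Rp :: "(real^'n::finite) set" and k :: "real^'n \<Rightarrow> complex" and \<kappa> :: "complex \<Rightarrow> 'r::unital_ring"
    and X :: "complex^'n \<Rightarrow> 'r" and Wd :: "'n lin \<Rightarrow> 'r" and Y :: "complex^'n \<Rightarrow> 'r" +
  assumes YY: "Y y * Y y' = Y y' * Y y"
begin

sublocale ye: comm_eval \<kappa> "\<lambda>i. Y (axis i 1)"
  by unfold_locales (simp_all only: YY \<kappa>_Y)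

abbreviation "Ymon \<equiv> mon_ev (\<lambda>i. Y (axis i 1))"

text \<open>Normal forms are coded by their coefficients in \<open>P\<close> with respect to the elements \<open>w T\<^sup>b\<close>.\<close>

definition NF :: "(('n lin \<times> ('n \<Rightarrow>\<^sub>0 nat)) \<Rightarrow>\<^sub>0 'n mpoly) \<Rightarrow> 'r"
  where "NF c = (\<Sum>x\<in>Poly_Mapping.keys c. Xp (Poly_Mapping.lookup c x) * (Wd (fst x) * Ymon (snd x)))"

lemma NF_add: "NF (c + d) = NF c + NF d"
  unfolding NF_def by (rule setsum_keys_plus_distrib) (auto simp: Xp_simps distrib_right)

lemma NF_zero: "NF 0 = 0" by (simp add: NF_def)

lemma NF_diff: "NF (c - d) = NF c - NF d"
  using NF_add[of "c - d" d] by (simp add: eq_diff_eq)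

lemma NF_single: "NF (Poly_Mapping.single (w, b) p) = Xp p * (Wd w * Ymon b)"
  by (simp add: NF_def Xp_simps)

text \<open>The keys are confined to W because the type of linear maps contains many others, for
  which \<open>Wd\<close> obeys no relation.\<close>

definition "NFs = {NF c | c. Poly_Mapping.keys c \<subseteq> W \<times> UNIV}"

lemma NFs_add: "a \<in> NFs \<Longrightarrow> b \<in> NFs \<Longrightarrow> a + b \<in> NFs"
  unfolding NFs_def using keys_add NF_add by (smt (verit) Un_least mem_Collect_eq subset_trans)

lemma NFs_zero: "0 \<in> NFs"
  unfolding NFs_def using NF_zero by (metis (mono_tags, lifting) empty_subsetI keys_zero mem_Collect_eq)

lemma NFs_sum: "(\<And>i. i \<in> A \<Longrightarrow> f i \<in> NFs) \<Longrightarrow> sum f A \<in> NFs"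
  by (induction A rule: infinite_finite_induct) (auto intro: NFs_add NFs_zero)

lemma NFs_term: assumes "w \<in> W" shows "Xp p * (Wd w * Ymon b) \<in> NFs"
proof -
  have "Poly_Mapping.keys (Poly_Mapping.single (w, b) p) \<subseteq> W \<times> UNIV" using assms by simp
  then show ?thesis unfolding NFs_def using NF_single by (metis (mono_tags, lifting) mem_Collect_eq)
qed

lemma NFs_lmult:
  assumes "\<And>p w b. w \<in> W \<Longrightarrow> r * (Xp p * (Wd w * Ymon b)) \<in> NFs" and "s \<in> NFs"
  shows "r * s \<in> NFs"
proof -
  obtain c where c: "Poly_Mapping.keys c \<subseteq> W \<times> UNIV" "s = NF c" using assms(2) by (auto simp: NFs_def)
  show ?thesis unfolding c(2) NF_def sum_distrib_left
    by (intro NFs_sum assms(1)) (use c(1) in auto)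
qed

lemma NFs_X: "s \<in> NFs \<Longrightarrow> X x * s \<in> NFs"
proof (erule NFs_lmult[rotated])
  fix p w b assume w: "w \<in> W"
  have "X x * (Xp p * (Wd w * Ymon b)) = Xp (lin_poly x * p) * (Wd w * Ymon b)"
    by (simp only: Xp_simps Xp_lin mult.assoc)
  then show "X x * (Xp p * (Wd w * Ymon b)) \<in> NFs" by (simp only: NFs_term w)
qed

lemma NFs_Xp: "s \<in> NFs \<Longrightarrow> Xp p * s \<in> NFs"
proof (erule NFs_lmult[rotated])
  fix q w b assume w: "w \<in> W"
  have "Xp p * (Xp q * (Wd w * Ymon b)) = Xp (p * q) * (Wd w * Ymon b)"
    by (simp only: Xp_simps mult.assoc)
  then show "Xp p * (Xp q * (Wd w * Ymon b)) \<in> NFs" by (simp only: NFs_term w)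
qed

lemma NFs_\<kappa>: "s \<in> NFs \<Longrightarrow> \<kappa> c * s \<in> NFs"
  using NFs_Xp[of s "const_poly c"] by (simp add: Xp_simps)

lemma NFs_W: "s \<in> NFs \<Longrightarrow> w \<in> W \<Longrightarrow> Wd w * s \<in> NFs"
proof (erule NFs_lmult[rotated])
  fix p v b assume w: "w \<in> W" "v \<in> W"
  have "Wd w * (Xp p * (Wd v * Ymon b)) = Xp (poly_act w p) * (Wd (w \<circ> v) * Ymon b)"
    by (simp only: mult.assoc[symmetric] W_Xp w Wd_comp)
  then show "Wd w * (Xp p * (Wd v * Ymon b)) \<in> NFs" by (simp add: NFs_term W_comp w)
qed

text \<open>\<open>Y_Xp\<close> carries Y past the polynomial at the cost of terms without a new Y.
  Past w it goes by \<open>WY\<close>, after which it is absorbed into the monomial in the commuting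
  Y.\<close>

lemma NFs_Y: "s \<in> NFs \<Longrightarrow> Y y * s \<in> NFs"
proof (erule NFs_lmult[rotated])
  fix p v b assume v: "v \<in> W"
  have *: "Y y * Ymon b = (\<Sum>i\<in>UNIV. \<kappa> (y $ i) * Ymon (Poly_Mapping.single i 1 + b))" for y
    by (subst Y_expand) (simp only: ye.mon_ev_Suc sum_distrib_right mult.assoc)
  have "Wd v * (Y y * Ymon b) \<in> NFs" for y
    unfolding * sum_distrib_left
  proof (intro NFs_sum)
    fix i
    have "Wd v * (\<kappa> (y $ i) * Ymon (Poly_Mapping.single i 1 + b)) = \<kappa> (y $ i) * (Xp 1 * (Wd v * Ymon (Poly_Mapping.single i 1 + b)))"
      by (simp add: Xp_simps) (simp only: mult.assoc[symmetric] \<kappa>_W v)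
    then show "Wd v * (\<kappa> (y $ i) * Ymon (Poly_Mapping.single i 1 + b)) \<in> NFs"
      using NFs_\<kappa>[OF NFs_term[OF v]] by simp
  qed
  then have 1: "Y y * (Wd v * Ymon b) \<in> NFs" by (simp only: mult.assoc[symmetric] WY v)
  have "Y y * (Xp p * (Wd v * Ymon b)) = Xp p * (Y y * (Wd v * Ymon b)) + Xp (dir_deriv y p) * (Wd v * Ymon b) +
   (\<Sum>\<alpha>\<in>Rp. \<kappa> (k \<alpha> * pairing (cplx \<alpha>) y) * (Xp (dq \<alpha> p) * (Wd (root_refl R \<alpha>) * (Wd v * Ymon b))))"
    by (simp only: mult.assoc[symmetric] Y_Xp) (simp only: mult.assoc distrib_right sum_distrib_right)
  moreover have t: "Wd v * Ymon b \<in> NFs" using NFs_term[OF v, of 1 b] by (simp add: Xp_simps)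
  have "\<kappa> (k \<alpha> * pairing (cplx \<alpha>) y) * (Xp (dq \<alpha> p) * (Wd (root_refl R \<alpha>) * (Wd v * Ymon b))) \<in> NFs" if "\<alpha> \<in> Rp" for \<alpha>
    using that by (intro NFs_\<kappa> NFs_Xp NFs_W[OF t] W_refl Rp_R)
  ultimately show "Y y * (Xp p * (Wd v * Ymon b)) \<in> NFs"
    using 1 v by (auto intro!: NFs_add NFs_sum NFs_Xp NFs_term)
qed

text \<open>The graph of the homomorphism from the Cherednik algebra given by the universal property.  It is
  single-valued because the product of the target with the polynomial representation is again a target, so
  that the independence of normal forms in the first factor controls the second one.\<close>

inductive hrel :: "'n oper \<Rightarrow> 'r \<Rightarrow> bool" where
  hrel_W: "w \<in> W \<Longrightarrow> hrel (poly_act w) (Wd w)"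
| hrel_X: "hrel (mult_op (lin_poly x)) (X x)"
| hrel_Y: "hrel (dunkl R Rp k y) (Y y)"
| hrel_add: "hrel a r \<Longrightarrow> hrel b s \<Longrightarrow> hrel (a + b) (r + s)"
| hrel_scale: "hrel a r \<Longrightarrow> hrel (op_scale c a) (\<kappa> c * r)"
| hrel_comp: "hrel a r \<Longrightarrow> hrel b s \<Longrightarrow> hrel (a \<circ> b) (r * s)"

lemma hrel_exists: "h \<in> cherednik R Rp k \<Longrightarrow> \<exists>r. hrel h r"
  by (induction rule: cherednik.induct) (blast intro: hrel.intros)+

lemma hrel_cherednik: "hrel h r \<Longrightarrow> h \<in> cherednik R Rp k"
  by (induction rule: hrel.induct) (blast intro: cherednik.intros)+

text \<open>Normal forms contain 1 and are stable under sums and under left multiplication by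
  generators, so they contain every value of the relation.\<close>

lemma hrel_NFs: assumes "hrel h r" shows "r \<in> NFs"
proof -
  have "r * s \<in> NFs" if "s \<in> NFs" for s
    using assms that
    by (induction arbitrary: s rule: hrel.induct)
       (simp_all add: NFs_W NFs_X NFs_Y NFs_\<kappa> distrib_right NFs_add mult.assoc)
  from this[of 1] show ?thesis using NFs_term[OF W_id, of 1 0] by (simp add: Xp_simps Wd_id)
qed

end

section \<open>Operators on the polynomial ring\<close>

definition eX :: "'n mpoly \<Rightarrow> 'n mpoly endo" where "eX p = Endo (\<lambda>q. p * q)"
definition eK :: "complex \<Rightarrow> 'n mpoly endo" where "eK c = eX (const_poly c)"
definition eW :: "'n::finite lin \<Rightarrow> 'n mpoly endo" where "eW w = Endo (poly_act w)"
definition eD :: "complex^'n::finite \<Rightarrow> 'n mpoly endo" where "eD y = Endo (dir_deriv y)"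

lemma app_e [simp]: "app (eX p) q = p * q" "app (eK c) q = const_poly c * q" "app (eW w) q' = poly_act w q'"
  "app (eD y) q' = dir_deriv y q'"
  by (simp_all add: eX_def eK_def eW_def eD_def app_Endo distrib_left dir_deriv_add)

lemma eX_simps: "eX (p + q) = eX p + eX q" "eX (p * q) = eX p * eX q" "eX 1 = 1" "eX 0 = 0"
  by (rule endo_eqI; simp add: algebra_simps)+

lemma eK_simps: "eK (c + d) = eK c + eK d" "eK (c * d) = eK c * eK d" "eK 1 = 1"
  by (rule endo_eqI; simp add: algebra_simps)+

lemma eX_commute: "eX p * eX q = eX q * eX p"
  by (rule endo_eqI) (simp add: mult_ac)

context roots
begin

definition eQ :: "real^'n \<Rightarrow> 'n mpoly endo" where "eQ \<alpha> = Endo (dq \<alpha>)"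

lemma app_eQ: "\<alpha> \<in> R \<Longrightarrow> app (eQ \<alpha>) q = dq \<alpha> q"
  unfolding eQ_def by (subst app_Endo) (auto simp: dq_add)

lemma dq_lin_mult:
  assumes "\<alpha> \<in> R"
  shows "dq \<alpha> (lin_poly x * p) = lin_poly x * dq \<alpha> p + const_poly (pairing x (cplx (coroot R \<alpha>))) * poly_act (root_refl R \<alpha>) p"
proof (rule dq_eqI[OF assms])
  have "lin_poly (cplx \<alpha>) * (lin_poly x * dq \<alpha> p + const_poly (pairing x (cplx (coroot R \<alpha>))) * poly_act (root_refl R \<alpha>) p)
    = lin_poly x * (lin_poly (cplx \<alpha>) * dq \<alpha> p) + lin_poly (pairing x (cplx (coroot R \<alpha>)) *s cplx \<alpha>) * poly_act (root_refl R \<alpha>) p"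
    by (simp add: algebra_simps lin_poly_simps)
  also have "\<dots> = lin_poly x * p - poly_act (root_refl R \<alpha>) (lin_poly x * p)"
    unfolding dq_spec[OF assms] poly_act_simps poly_act_lin cact_refl lin_poly_simps by (simp add: algebra_simps)
  finally show "lin_poly (cplx \<alpha>) * (lin_poly x * dq \<alpha> p + const_poly (pairing x (cplx (coroot R \<alpha>))) * poly_act (root_refl R \<alpha>) p)
    = lin_poly x * p - poly_act (root_refl R \<alpha>) (lin_poly x * p)" .
qed

end

text \<open>The Dunkl operators on \<open>P \<otimes> V\<close> are obtained from \<open>L\<close>, the action of operators on the first factor,
  and \<open>M\<close>, the action of the group on the second one.  The polynomial representation is the case \<open>M = 1\<close>.\<close>

locale dunkl_model = root_params R Rp k
  for R Rp :: "(real^'n::finite) set" and k :: "real^'n \<Rightarrow> complex" +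
  fixes L :: "'n mpoly endo \<Rightarrow> 'r::unital_ring" and M :: "'n lin \<Rightarrow> 'r"
  assumes L_add: "L (a + b) = L a + L b" and L_mult: "L (a * b) = L a * L b" and L_one: "L 1 = 1"
    and M_id: "M id = 1" and M_comp: "w \<in> W \<Longrightarrow> w' \<in> W \<Longrightarrow> M (w \<circ> w') = M w * M w'"
    and M_L: "w \<in> W \<Longrightarrow> (\<And>c. a * eK c = eK c * a) \<Longrightarrow> M w * L a = L a * M w"
begin

definition mK where "mK c = L (eK c)"
definition mX where "mX x = L (eX (lin_poly x))"
definition mW where "mW w = M w * L (eW w)"
definition mY where "mY y = L (eD y) + (\<Sum>\<alpha>\<in>Rp. mK (k \<alpha> * pairing (cplx \<alpha>) y) * (M (root_refl R \<alpha>) * L (eQ \<alpha>)))"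

lemma L_zero: "L 0 = 0" using L_add[of 0 0] by simp
lemma L_minus: "L (- a) = - L a" using L_add[of a "- a"] by (simp add: L_zero eq_neg_iff_add_eq_0 add.commute)

lemma M_X: "w \<in> W \<Longrightarrow> M w * L (eX p) = L (eX p) * M w"
  by (erule M_L) (simp add: eK_def eX_commute)

lemma M_K: "w \<in> W \<Longrightarrow> M w * mK c = mK c * M w"
  unfolding mK_def eK_def by (rule M_X)

lemma M_W: "w \<in> W \<Longrightarrow> M w * L (eW w') = L (eW w') * M w"
  by (erule M_L, rule endo_eqI) simp

lemma M_D: "w \<in> W \<Longrightarrow> M w * L (eD y) = L (eD y) * M w"
  by (erule M_L, rule endo_eqI) (simp add: dir_deriv_scale)

lemma M_Q: "w \<in> W \<Longrightarrow> \<alpha> \<in> R \<Longrightarrow> M w * L (eQ \<alpha>) = L (eQ \<alpha>) * M w"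
  by (erule M_L, rule endo_eqI) (simp add: app_eQ dq_scale)

lemma mK_central_L: "(\<And>c. a * eK c = eK c * a) \<Longrightarrow> mK c * L a = L a * mK c"
  unfolding mK_def L_mult[symmetric] by simp

lemma mK_L: "mK c * L (eX p) = L (eX p) * mK c" "mK c * L (eW w) = L (eW w) * mK c"
   "mK c * L (eD y) = L (eD y) * mK c"
  by (rule mK_central_L, rule endo_eqI, simp add: dir_deriv_scale mult.left_commute)+

lemma mK_Q: "\<alpha> \<in> R \<Longrightarrow> mK c * L (eQ \<alpha>) = L (eQ \<alpha>) * mK c"
  by (rule mK_central_L, rule endo_eqI, simp add: app_eQ dq_scale)

lemma scalar_hom: "scalar_hom mK"
  by unfold_locales (simp_all add: mK_def eK_simps L_add L_mult L_one)

lemma eD_lin: "eD y * eX (lin_poly x) = eX (lin_poly x) * eD y + eK (pairing x y)"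
  by (rule endo_eqI) (simp add: dir_deriv_mult dir_deriv_lin)

lemma eQ_lin: "\<alpha> \<in> R \<Longrightarrow> eQ \<alpha> * eX (lin_poly x) = eX (lin_poly x) * eQ \<alpha> + eK (pairing x (cplx (coroot R \<alpha>))) * eW (root_refl R \<alpha>)"
  by (rule endo_eqI) (simp add: app_eQ dq_lin_mult)

text \<open>\<open>eQ_lin\<close> produces a reflection acting on polynomials only; together with
  the factor \<open>M\<close> already present in \<open>mY\<close> it becomes the diagonal
  reflection \<open>mW\<close>.\<close>

lemma model_YX: "mY y * mX x = mX x * mY y + mK (pairing x y) +
      (\<Sum>\<alpha>\<in>Rp. mK (k \<alpha> * pairing (cplx \<alpha>) y * pairing x (cplx (coroot R \<alpha>))) * mW (root_refl R \<alpha>))"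
proof -
  interpret scalar_hom mK by (rule scalar_hom)
  have "mK c * (M (root_refl R \<alpha>) * L (eQ \<alpha>)) * mX x = mX x * (mK c * (M (root_refl R \<alpha>) * L (eQ \<alpha>)))
     + mK (c * pairing x (cplx (coroot R \<alpha>))) * mW (root_refl R \<alpha>)" if a: "\<alpha> \<in> Rp" for \<alpha> c
  proof -
    let ?r = "root_refl R \<alpha>" let ?h = "pairing x (cplx (coroot R \<alpha>))"
    have w: "?r \<in> W" and aR: "\<alpha> \<in> R" using a by (auto intro: W_refl Rp_R)
    have "mK c * (M ?r * L (eQ \<alpha>)) * mX x = mK c * (M ?r * L (eQ \<alpha> * eX (lin_poly x)))"
      by (simp only: mX_def L_mult mult.assoc)
    also have "\<dots> = mK c * (M ?r * (L (eX (lin_poly x)) * L (eQ \<alpha>))) + mK c * (M ?r * (mK ?h * L (eW ?r)))"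
      by (simp only: eQ_lin[OF aR] L_add L_mult distrib_left mK_def)
    also have "mK c * (M ?r * (mK ?h * L (eW ?r))) = mK (c * ?h) * mW ?r"
      by (simp only: mult.assoc[symmetric] M_K[OF w] \<kappa>_mult mW_def)
    also have "mK c * (M ?r * (L (eX (lin_poly x)) * L (eQ \<alpha>))) = mX x * (mK c * (M ?r * L (eQ \<alpha>)))"
      by (simp only: mX_def mult.assoc[symmetric] M_X[OF w] mK_L(1)[symmetric])
    finally show ?thesis .
  qed
  moreover have "L (eD y) * mX x = mX x * L (eD y) + mK (pairing x y)"
    unfolding mX_def mK_def L_mult[symmetric] L_add[symmetric] eD_lin ..
  ultimately show ?thesis
    unfolding mY_def distrib_left distrib_right sum_distrib_left sum_distrib_right
    by (simp add: sum.distrib)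
qed

lemma model_WY: assumes w: "w \<in> W" shows "mY y * mW w = mW w * mY (tact w y)"
proof -
  interpret scalar_hom mK by (rule scalar_hom)
  \<comment> \<open>The summand of Y_y w with the operators on V collected to the left. It is even
    in \<beta>, since the pairing and the divided difference both change sign, so
    \<open>sum_Rp_W\<close> can compare the two sides.\<close>
  define g where "g \<beta> = mK (k \<beta> * pairing (cplx \<beta>) y) * (M (root_refl R \<beta>) * M w * L (eQ \<beta> * eW w))" for \<beta>
  have eQ_m: "eQ (- \<beta>) = - eQ \<beta>" if "\<beta> \<in> R" for \<beta>
    using that by (intro endo_eqI) (simp add: app_eQ dq_uminus root_uminus(1))
  have ev: "g (- \<beta>) = g \<beta>" if b: "\<beta> \<in> R" for \<beta>
    unfolding g_def eQ_m[OF b] k_uminus[OF b] root_refl_uminus[OF b]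
    using pairing_simps(3)[of "-1" "cplx \<beta>" y] by (simp add: \<kappa>_minus L_minus)
  have eDW: "eD y * eW w = eW w * eD (tact w y)"
    by (rule endo_eqI) (simp add: dir_deriv_poly_act)
  have 1: "mK (k \<alpha> * pairing (cplx \<alpha>) y) * (M (root_refl R \<alpha>) * L (eQ \<alpha>)) * mW w = g \<alpha>" if a: "\<alpha> \<in> Rp" for \<alpha>
    unfolding g_def mW_def L_mult
    by (simp only: mult.assoc) (simp only: M_Q[OF w Rp_R[OF a], symmetric] mult.assoc[symmetric])
  have 2: "mW w * (mK (k \<alpha> * pairing (cplx \<alpha>) (tact w y)) * (M (root_refl R \<alpha>) * L (eQ \<alpha>))) = g (w \<alpha>)" if a: "\<alpha> \<in> Rp" for \<alpha>
  proof -
    let ?c = "k \<alpha> * pairing (cplx \<alpha>) (tact w y)" and ?r = "root_refl R \<alpha>"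
    have aR: "\<alpha> \<in> R" and r: "?r \<in> W" using a by (auto intro: W_refl Rp_R)
    have c: "k (w \<alpha>) * pairing (cplx (w \<alpha>)) y = ?c"
      by (simp add: k_W[OF w aR] pairing_cact[symmetric] cact_cplx W_linear[OF w])
    have q: "eQ (w \<alpha>) * eW w = eW w * eQ \<alpha>"
      by (rule endo_eqI) (simp add: app_eQ aR W_root[OF w aR] dq_W[OF w aR])
    have m: "M (root_refl R (w \<alpha>)) * M w = M w * M ?r"
      using root_refl_W[OF w aR] M_comp[OF W_refl[OF W_root[OF w aR]] w] M_comp[OF w r] by simp
    have lw: "L (eW w) * (M ?r * a) = M ?r * (L (eW w) * a)" for a
      by (simp only: mult.assoc[symmetric] M_W[OF r])
    have "mW w * (mK ?c * (M ?r * L (eQ \<alpha>))) = M w * mK ?c * L (eW w) * M ?r * L (eQ \<alpha>)"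
      unfolding mW_def by (simp only: mult.assoc[symmetric]) (simp only: mult.assoc mK_L(2))
    also have "\<dots> = mK ?c * (M w * M ?r * L (eW w * eQ \<alpha>))"
      by (simp only: M_K[OF w] L_mult mult.assoc lw)
    finally show ?thesis unfolding g_def m q c .
  qed
  have "mY y * mW w = L (eD y) * mW w + (\<Sum>\<alpha>\<in>Rp. g \<alpha>)"
    unfolding mY_def distrib_right sum_distrib_right using 1 by (simp cong: sum.cong)
  moreover have "mW w * mY (tact w y) = mW w * L (eD (tact w y)) + (\<Sum>\<alpha>\<in>Rp. g (w \<alpha>))"
    unfolding mY_def distrib_left sum_distrib_left using 2 by (simp cong: sum.cong)
  moreover have "L (eD y) * mW w = mW w * L (eD (tact w y))"
  proof -
    have "L (eD y) * mW w = M w * L (eD y * eW w)"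
      unfolding mW_def L_mult by (simp only: mult.assoc[symmetric] M_D[OF w])
    then show ?thesis unfolding eDW mW_def L_mult by (simp only: mult.assoc)
  qed
  ultimately show ?thesis using sum_Rp_W[OF w, of g] ev by simp
qed

lemma eD_linear: "eD (y + y') = eD y + eD y'" "eD (c *s y) = eK c * eD y"
  by (rule endo_eqI; simp add: dir_deriv_linear)+

lemma cher_pre: "cher_pre R Rp k mK mX mW mY"
proof -
  interpret scalar_hom mK by (rule scalar_hom)
  show ?thesis
  proof unfold_locales
    fix c x w w' y y' x'
    show "mK c * mX x = mX x * mK c" by (simp only: mX_def mK_L)
    show "mK c * mW w = mW w * mK c" if "w \<in> W"
      unfolding mW_def by (simp only: mult.assoc mK_L(2)[symmetric]) (simp only: mult.assoc[symmetric] M_K[OF that])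
    have "mK c * (mK d * (M (root_refl R \<alpha>) * L (eQ \<alpha>))) = mK d * (M (root_refl R \<alpha>) * L (eQ \<alpha>)) * mK c"
      if "\<alpha> \<in> Rp" for \<alpha> d
    proof -
      have w: "root_refl R \<alpha> \<in> W" and aR: "\<alpha> \<in> R" using that by (auto intro: W_refl Rp_R)
      have "mK d * (M (root_refl R \<alpha>) * L (eQ \<alpha>)) * mK c = mK d * (mK c * (M (root_refl R \<alpha>) * L (eQ \<alpha>)))"
        by (simp only: mult.assoc mK_Q[OF aR, symmetric]) (simp only: mult.assoc[symmetric] M_K[OF w])
      then show ?thesis by (simp only: mult.assoc[symmetric] \<kappa>_mult[symmetric] mult.commute)
    qed
    then show "mK c * mY y = mY y * mK c"
      unfolding mY_def distrib_left distrib_right sum_distrib_left sum_distrib_right mK_L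
      by (simp cong: sum.cong)
    show "mX (x + x') = mX x + mX x'" "mX (c *s x) = mK c * mX x"
      by (simp_all add: mX_def mK_def eK_def lin_poly_simps eX_simps L_add L_mult)
    show "mY (y + y') = mY y + mY y'"
      by (simp add: mY_def eD_linear L_add pairing_simps distrib_left \<kappa>_add distrib_right sum.distrib)
    have c: "k \<alpha> * pairing (cplx \<alpha>) (c *s y) = c * (k \<alpha> * pairing (cplx \<alpha>) y)" for \<alpha>
      by (simp add: pairing_simps)
    have "L (eD (c *s y)) = mK c * L (eD y)" by (simp only: eD_linear L_mult mK_def)
    then show "mY (c *s y) = mK c * mY y"
      by (simp only: mY_def distrib_left c \<kappa>_mult[of c] sum_distrib_left mult.assoc)
    show "mX x * mX x' = mX x' * mX x"
      unfolding mX_def L_mult[symmetric] by (simp only: eX_commute)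
    have "eW (id :: 'n lin) = 1" by (rule endo_eqI) (simp add: poly_act_id)
    then show "mW id = 1" by (simp only: mW_def L_one M_id mult_1)
    show "mW (w \<circ> w') = mW w * mW w'" if w: "w \<in> W" "w' \<in> W"
    proof -
      have "eW (w \<circ> w') = eW w * eW w'"
        by (rule endo_eqI) (simp only: app_e app_simps poly_act_comp[OF W_linear[OF w(1)]])
      then show ?thesis
        unfolding mW_def M_comp[OF w] by (simp only: L_mult mult.assoc) (simp only: mult.assoc[symmetric] M_W[OF w(2), symmetric])
    qed
    show "mW w * mX x = mX (cact w x) * mW w" if w: "w \<in> W"
    proof -
      have "eW w * eX (lin_poly x) = eX (lin_poly (cact w x)) * eW w"
        by (rule endo_eqI) (simp add: poly_act_lin)
      then have "L (eW w) * L (eX (lin_poly x)) = L (eX (lin_poly (cact w x))) * L (eW w)" by (simp flip: L_mult)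
      then show ?thesis unfolding mW_def mX_def by (simp only: mult.assoc) (simp only: mult.assoc[symmetric] M_X[OF w])
    qed
    show "mY y * mW w = mW w * mY (tact w y)" if "w \<in> W" using that by (rule model_WY)
    show "mY y * mX x = mX x * mY y + mK (pairing x y) +
      (\<Sum>\<alpha>\<in>Rp. mK (k \<alpha> * pairing (cplx \<alpha>) y * pairing x (cplx (coroot R \<alpha>))) * mW (root_refl R \<alpha>))"
      by (rule model_YX)
  qed
qed

lemma model_Xp: "cev mK (\<lambda>i. mX (axis i 1)) p = L (eX p)"
proof -
  interpret cher_pre R Rp k mK mX mW mY by (rule cher_pre)
  show ?thesis
    by (rule xe.cev_unique[symmetric])
      (simp_all add: mK_def eK_def eX_simps L_add L_mult mX_def lin_poly_axis)
qed

end

section \<open>The polynomial representation\<close>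

context root_params
begin

definition eY :: "complex^'n \<Rightarrow> 'n mpoly endo" where "eY y = Endo (dunkl R Rp k y)"

lemma dunkl_dq: "dunkl R Rp k y p = dir_deriv y p + (\<Sum>\<alpha>\<in>Rp. const_poly (k \<alpha> * pairing (cplx \<alpha>) y) * dq \<alpha> p)"
  by (simp only: dunkl_def dq_def pm_scale_eq)

lemma app_eY [simp]: "app (eY y) p = dunkl R Rp k y p"
  unfolding eY_def
proof (subst app_Endo)
  show "dunkl R Rp k y (p + q) = dunkl R Rp k y p + dunkl R Rp k y q" for p q
    unfolding dunkl_dq by (simp add: dir_deriv_add dq_add Rp_R distrib_left sum.distrib)
qed simp

lemma poly_model: "dunkl_model R Rp k (\<lambda>a. a) (\<lambda>_. 1)"
  by unfold_locales simp_all

lemma poly_model_eqs: "dunkl_model.mK (\<lambda>a. a) = (eK :: complex \<Rightarrow> 'n mpoly endo)"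
  "dunkl_model.mX (\<lambda>a. a) = (\<lambda>x :: complex^'n. eX (lin_poly x))"
  "dunkl_model.mW (\<lambda>a. a) (\<lambda>_. 1) = (eW :: 'n lin \<Rightarrow> 'n mpoly endo)" "dunkl_model.mY R Rp k (\<lambda>a. a) (\<lambda>_. 1) = eY"
proof -
  interpret dunkl_model R Rp k "\<lambda>a. a" "\<lambda>_. 1" by (rule poly_model)
  show "mK = eK" "mX = (\<lambda>x. eX (lin_poly x))" "mW = eW" by (auto simp: mK_def mX_def mW_def)
  show "mY = eY"
  proof (rule ext, rule endo_eqI)
    fix y p show "app (mY y) p = app (eY y) p"
      by (simp add: mY_def mK_def app_sum_left dunkl_dq app_eQ Rp_R cong: sum.cong)
  qed
qed

lemma poly_cher_pre: "cher_pre R Rp k eK (\<lambda>x. eX (lin_poly x)) eW eY"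
  using dunkl_model.cher_pre[OF poly_model] by (simp only: poly_model_eqs)

lemma poly_Xp: "cev eK (\<lambda>i. eX (lin_poly (axis i 1))) p = eX (p :: 'n mpoly)"
  using dunkl_model.model_Xp[OF poly_model] by (simp only: poly_model_eqs)

sublocale P: cher_target R Rp k eK "\<lambda>x. eX (lin_poly x)" eW eY
proof -
  interpret cher_pre R Rp k eK "\<lambda>x. eX (lin_poly x)" eW eY by (rule poly_cher_pre)
  show "cher_target R Rp k eK (\<lambda>x. eX (lin_poly x)) eW eY"
  proof unfold_locales
    fix y y'
    let ?C = "eY y * eY y' - eY y' * eY y"
    have d1: "dunkl R Rp k y 1 = 0" for y
      using dir_deriv_const[of y 1] dq_const[of _ 1] by (simp add: dunkl_dq Rp_R)
    have d0: "dunkl R Rp k y 0 = 0" for y by (metis app_eY app_zero)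
    \<comment> \<open>The commutator commutes with all multiplications and annihilates 1, from which
      multiplications generate P.\<close>
    have "app ?C p = 0" for p
    proof -
      have "?C * eX p = eX p * ?C" using commutator_Xp by (simp only: Xp_def poly_Xp)
      then have "app (?C * eX p) 1 = app (eX p * ?C) 1" by simp
      then show ?thesis by (simp add: d1 d0)
    qed
    then have "?C = 0" by (intro endo_eqI) simp
    then show "eY y * eY y' = eY y' * eY y" by simp
  qed
qed

lemma P_Xp: "P.Xp p = eX p"
  unfolding P.Xp_def by (rule poly_Xp)

end

section \<open>Linear independence of normal forms\<close>

text \<open>A product of affine functions, one for each point of S.\<close>

lemma separating_poly:
  fixes y :: "real^'n::finite"
  assumes "finite S" "y \<notin> S"
  shows "\<exists>s. pev y s = 1 \<and> (\<forall>x\<in>S. pev x s = 0)"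
  using assms
proof (induction S rule: finite_induct)
  case empty
  then show ?case by (intro exI[of _ 1]) simp
next
  case (insert a S)
  then obtain s where s: "pev y s = 1" "\<forall>x\<in>S. pev x s = 0" by auto
  let ?u = "y - a"
  \<comment> \<open>The affine function with gradient proportional to y - a that takes the values 1
    at y and 0 at a.\<close>
  let ?l = "const_poly (of_real (inverse (?u \<bullet> ?u))) * (lin_poly (cplx ?u) - const_poly (of_real (?u \<bullet> a)))"
  have nz: "?u \<bullet> ?u \<noteq> 0" using insert.prems by auto
  have "pev y ?l = of_real (inverse (?u \<bullet> ?u) * (?u \<bullet> ?u))"
    by (simp only: pev_simps pev_diff pev_lin_poly pairing_cplx of_real_diff[symmetric] of_real_mult[symmetric] inner_diff_right[symmetric])
  then have "pev y ?l = 1" unfolding left_inverse[OF nz] of_real_1 .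
  moreover have "pev a ?l = 0" by (simp only: pev_simps pev_diff pev_lin_poly pairing_cplx) simp
  ultimately show ?case using s
    by (intro exI[of _ "?l * s"]) (auto simp only: pev_simps(3) mult_1_right mult_zero_left mult_zero_right)
qed

definition comm_with :: "'r::unital_ring \<Rightarrow> 'r \<Rightarrow> 'r"
  where "comm_with f a = a * f - f * a"

lemma comm_with_simps: "comm_with f (a + b) = comm_with f a + comm_with f b"
  "comm_with f (a * b) = comm_with f a * b + a * comm_with f b" "comm_with f 0 = 0"
  by (simp_all add: comm_with_def algebra_simps)

lemma comm_with_pow_simps: "(comm_with f ^^ n) (a + b) = (comm_with f ^^ n) a + (comm_with f ^^ n) b"
  "(comm_with f ^^ n) 0 = 0"
  by (induction n) (simp_all add: comm_with_simps)

lemma comm_with_pow_sum: "(comm_with f ^^ n) (sum g A) = (\<Sum>i\<in>A. (comm_with f ^^ n) (g i))"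
  by (induction A rule: infinite_finite_induct) (auto simp: comm_with_pow_simps)

lemma comm_with_pow_central: "u * f = f * u \<Longrightarrow> (comm_with f ^^ n) (u * a) = u * (comm_with f ^^ n) a"
  by (induction n) (simp_all add: comm_with_simps(2), simp add: comm_with_def)

lemma comm_with_central: "u * f = f * u \<Longrightarrow> comm_with f (u * a) = u * comm_with f a"
  by (simp add: comm_with_simps(2)) (simp add: comm_with_def)

context root_params
begin

text \<open>The commutator with an invariant polynomial \<open>f\<close> lowers the filtration by the degree in the Dunkl
  operators and replaces, in top degree, \<open>T\<^sub>y\<close> by \<open>\<partial>\<^sub>y f\<close>.\<close>

lemma comm_with_Y_pow:
  assumes g: "comm_with (eX f) (eY y) = eX g"
  shows "(comm_with (eX f) ^^ Suc n) (eY y * a)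
    = eY y * (comm_with (eX f) ^^ Suc n) a + eK (of_nat (Suc n)) * (eX g * (comm_with (eX f) ^^ n) a)"
proof (induction n)
  case 0
  then show ?case using g by (simp add: comm_with_simps(2) eK_simps add.commute)
next
  case (Suc n)
  let ?D = "comm_with (eX f)"
  have "(?D ^^ Suc (Suc n)) (eY y * a) = ?D (eY y * (?D ^^ Suc n) a) + ?D (eK (of_nat (Suc n)) * (eX g * (?D ^^ n) a))"
    using Suc by (simp add: comm_with_simps(1))
  also have "?D (eK (of_nat (Suc n)) * (eX g * (?D ^^ n) a)) = eK (of_nat (Suc n)) * (eX g * (?D ^^ Suc n) a)"
  proof -
    have "?D (eK c * b) = eK c * ?D b" "?D (eX g * b) = eX g * ?D b" for c b
      by (simp_all only: comm_with_central eX_commute eK_def)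
    then show ?thesis by simp
  qed
  also have "?D (eY y * (?D ^^ Suc n) a) = eX g * (?D ^^ Suc n) a + eY y * (?D ^^ Suc (Suc n)) a"
    by (simp add: comm_with_simps(2) g)
  finally have "(?D ^^ Suc (Suc n)) (eY y * a) = eX g * (?D ^^ Suc n) a + eY y * (?D ^^ Suc (Suc n)) a
     + eK (of_nat (Suc n)) * (eX g * (?D ^^ Suc n) a)" .
  moreover have k: "eK (of_nat (Suc (Suc n))) = 1 + eK (of_nat (Suc n))"
    by (simp only: of_nat_Suc[of "Suc n"] eK_simps)
  ultimately show ?case unfolding k distrib_right mult_1_left by (simp only: ac_simps)
qed

text \<open>Divided differences of an invariant f vanish, so [T_y, f] is multiplication by a
  derivative of f; n! counts the orders in which the commutators reach the n factors. The last
  alternative is a tautology that allows a single equation, valid for all n, to serve as induction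
  statement.\<close>

lemma comm_with_Ymon:
  assumes f: "\<And>w. w \<in> W \<Longrightarrow> poly_act w f = f"
  shows "(comm_with (eX f) ^^ n) (P.Ymon b) =
    (if mdeg b < n then 0 else if mdeg b = n then eK (of_nat (fact n)) * eX (mon_ev (\<lambda>i. dir_deriv (axis i 1) f) b)
     else (comm_with (eX f) ^^ n) (P.Ymon b))"
proof (induction b arbitrary: n rule: monomial_induct)
  case zero
  have "comm_with (eX f) 1 = 0" by (simp add: comm_with_def)
  then have "(comm_with (eX f) ^^ Suc n) 1 = 0" for n
    by (simp only: funpow_Suc_right o_apply comm_with_pow_simps)
  then show ?case by (cases n) (auto simp: eK_simps eX_simps)
next
  case (step i b)
  have dq0: "dq \<alpha> f = 0" if "\<alpha> \<in> Rp" for \<alpha>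
    by (rule dq_eqI) (use that in \<open>auto simp: f W_refl Rp_R\<close>)
  have g: "comm_with (eX f) (eY y) = eX (dir_deriv y f)" for y
    unfolding comm_with_def using P.Y_Xp[of y f] dq0 by (simp add: P_Xp eX_simps)
  have m: "P.Ymon (Poly_Mapping.single i 1 + b) = eY (axis i 1) * P.Ymon b"
    by (rule P.ye.mon_ev_Suc)
  have d: "mdeg (Poly_Mapping.single i 1 + b) = Suc (mdeg b)" by (simp add: mdeg_add)
  show ?case
  proof (cases n)
    case 0
    then show ?thesis by (simp add: d)
  next
    case (Suc n')
    have s: "mon_ev (\<lambda>i. dir_deriv (axis i 1) f) (Poly_Mapping.single i 1 + b)
       = dir_deriv (axis i 1) f * mon_ev (\<lambda>i. dir_deriv (axis i 1) f) b"
      by (rule mon_ev_step) (simp add: mult.commute)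
    note e = comm_with_Y_pow[OF g[of "axis i 1"], of n' "P.Ymon b", folded m]
    show ?thesis
    proof (cases "mdeg b < Suc n'")
      case True
      then have z: "(comm_with (eX f) ^^ Suc n') (P.Ymon b) = 0" by (subst step) simp
      show ?thesis
      proof (cases "mdeg b = n'")
        case True
        have k: "eX p * (eK c * a) = eK c * (eX p * a)" for p c a
          unfolding eK_def mult.assoc[symmetric] by (simp only: eX_commute)
        have kk: "eK d * (eK c * a) = eK c * (eK d * a)" for d c a
          using k[of "const_poly d"] by (simp add: eK_def)
        have "(comm_with (eX f) ^^ n') (P.Ymon b) = eK (of_nat (fact n')) * eX (mon_ev (\<lambda>i. dir_deriv (axis i 1) f) b)"
          using True by (subst step) simp
        then show ?thesis using True
          unfolding Suc d e z s by (simp add: k eX_simps eK_simps algebra_simps kk[of "of_nat n'"])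
      next
        case False
        then have "(comm_with (eX f) ^^ n') (P.Ymon b) = 0" using True by (subst step) simp
        then show ?thesis using False True unfolding Suc d e z by simp
      qed
    next
      case False
      then show ?thesis by (simp add: Suc d)
    qed
  qed
qed

lemma dir_deriv_sum: "dir_deriv y (sum f A) = (\<Sum>i\<in>A. dir_deriv y (f i))"
  by (induction A rule: infinite_finite_induct) (use dir_deriv_const[of y 0] in \<open>auto simp: dir_deriv_add\<close>)

text \<open>Average s^2 l over the group, where l is affine with gradient \<xi> and l(y) = 0, while
  s is 1 at y and 0 at the other points of its orbit. The square makes first derivatives vanish at
  those points, so only the identity contributes to the gradient at y.\<close>

lemma invariant_with_gradient:
  fixes y \<xi> :: "real^'n"
  assumes free: "\<And>w. w \<in> W \<Longrightarrow> w \<noteq> id \<Longrightarrow> adjoint w y \<noteq> y"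
  obtains f where "\<And>w. w \<in> W \<Longrightarrow> poly_act w f = f" "\<And>i. pev y (dir_deriv (axis i 1) f) = of_real (\<xi> $ i)"
proof -
  let ?S = "(\<lambda>w. adjoint w y) ` (W - {id})"
  have "finite ?S" "y \<notin> ?S" using W_finite free by (simp, metis (no_types, lifting) DiffE imageE singletonI)
  then obtain s where s: "pev y s = 1" "\<forall>x\<in>?S. pev x s = 0" using separating_poly by blast
  define l where "l = lin_poly (cplx \<xi>) - const_poly (of_real (\<xi> \<bullet> y))"
  define g where "g = s * (s * l)"
  define f where "f = (\<Sum>w\<in>W. poly_act w g)"
  have inv: "poly_act u f = f" if u: "u \<in> W" for u
  proof -
    have "poly_act u f = (\<Sum>w\<in>W. poly_act (u \<circ> w) g)"
      unfolding f_def poly_act_simps by (intro sum.cong refl) (simp only: poly_act_comp[OF W_linear[OF u]])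
    also have "\<dots> = f" unfolding f_def
      by (rule sum.reindex_bij_witness[of _ "\<lambda>w. inv u \<circ> w" "\<lambda>w. u \<circ> w"])
        (auto simp: W_comp W_inv(1)[OF u] u comp_assoc[symmetric] W_inv(2,3)[OF u])
    finally show ?thesis .
  qed
  have ly: "pev y l = 0" by (simp add: l_def pairing_cplx)
  have dl: "pev x (dir_deriv e l) = pairing (cplx \<xi>) e" for x e
  proof -
    have "l = lin_poly (cplx \<xi>) + const_poly (- of_real (\<xi> \<bullet> y))"
      unfolding l_def using const_poly_simps(3)[of "of_real (\<xi> \<bullet> y)" "- of_real (\<xi> \<bullet> y)"]
      by (simp add: eq_neg_iff_add_eq_0 diff_eq_eq algebra_simps del: const_poly_simps(3))
    then show ?thesis by (simp add: dir_deriv_add dir_deriv_lin dir_deriv_const)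
  qed
  have "pev y (dir_deriv (axis i 1) f) = of_real (\<xi> $ i)" for i
  proof -
    let ?e = "axis i 1 :: complex^'n"
    have "pev y (dir_deriv ?e (poly_act w g)) = (if w = id then of_real (\<xi> $ i) else 0)" if w: "w \<in> W" for w
    proof (cases "w = id")
      case True
      have "pev y (dir_deriv ?e g) = pairing (cplx \<xi>) ?e"
        by (simp add: g_def dir_deriv_mult s ly dl)
      then show ?thesis using True by (simp add: poly_act_id cplx_def)
    next
      case False
      then have "pev (adjoint w y) s = 0" using s w by blast
      then show ?thesis using False
        by (simp add: dir_deriv_poly_act pev_poly_act W_linear w g_def dir_deriv_mult)
    qed
    then show ?thesis by (simp add: f_def dir_deriv_sum W_finite W_id cong: sum.cong)
  qed
  with inv show thesis using that by blast
qed

lemma W_differ: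
  fixes w w' :: "'n lin"
  assumes "w \<noteq> w'" "linear w" "linear w'" obtains i where "w (axis i 1) \<noteq> (w' (axis i 1) :: real^'n)"
proof -
  have "w = w'" if a: "\<And>i. w (axis i 1) = w' (axis i 1)"
    by (rule linear_eq_stdbasis[OF assms(2,3)]) (auto simp: Basis_vec_def a)
  then show thesis using that assms(1) by blast
qed

text \<open>It suffices that x avoids one hyperplane for every nonzero vector w e_i - w' e_i, of
  which there are finitely many.\<close>

lemma generic_point:
  assumes "p \<noteq> 0"
  obtains x where "pev x p \<noteq> 0" "inj_on (\<lambda>w. adjoint w x) W"
proof -
  define A where "A = (\<lambda>(w, w', i). w (axis i 1) - w' (axis i 1)) ` (W \<times> W \<times> (UNIV :: 'n set)) - {0 :: real^'n}"
  have "finite A" "0 \<notin> A" by (auto simp: A_def W_finite)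
  then obtain x where x: "pev x p \<noteq> 0" "\<forall>a\<in>A. a \<bullet> x \<noteq> 0" using pev_nonzero_generic[OF assms] by blast
  have "inj_on (\<lambda>w. adjoint w x) W"
  proof (rule inj_onI, rule ccontr)
    fix w w' assume w: "w \<in> W" "w' \<in> W" "adjoint w x = adjoint w' x" "w \<noteq> w'"
    obtain i where i: "w (axis i 1) \<noteq> w' (axis i 1)" using W_differ[OF w(4) W_linear[OF w(1)] W_linear[OF w(2)]] .
    then have "w (axis i 1) - w' (axis i 1) \<in> A" unfolding A_def using w by force
    then have "(w (axis i 1) - w' (axis i 1)) \<bullet> x \<noteq> 0" using x by blast
    then show False using w(3) adjoint_works[OF W_linear[OF w(1)], of "axis i 1" x] adjoint_works[OF W_linear[OF w(2)], of "axis i 1" x]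
      by (simp add: inner_diff_left)
  qed
  with x show thesis using that by blast
qed

lemma adjoint_comp: "w \<in> W \<Longrightarrow> w' \<in> W \<Longrightarrow> adjoint (w \<circ> w') x = adjoint w' (adjoint w x)"
proof -
  assume w: "w \<in> W" "w' \<in> W"
  have "y \<bullet> adjoint (w \<circ> w') x = y \<bullet> adjoint w' (adjoint w x)" for y
    by (simp add: adjoint_works W_linear w W_comp)
  then show ?thesis by (metis vector_eq_ldot)
qed

text \<open>Let N be the top degree in the Dunkl operators. The N-fold commutator with an invariant
  f leaves N! times the sum of p w (grad f)^b over the terms with |b| = N. Applied to a function s
  that separates one orbit point, and evaluated at x, only the terms of w0 survive; they form a
  polynomial in the gradient of f at that point. The gradient can be prescribed, so this polynomial
  is zero.\<close>

theorem P_NF_independent: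
  assumes keys: "Poly_Mapping.keys c \<subseteq> W \<times> UNIV" and z: "P.NF c = 0"
  shows "c = 0"
proof (rule ccontr)
  assume "c \<noteq> 0"
  let ?K = "Poly_Mapping.keys c"
  let ?c = "Poly_Mapping.lookup c"
  have "?K \<noteq> {}" using \<open>c \<noteq> 0\<close> by simp
  define N where "N = Max ((\<lambda>x. mdeg (snd x)) ` ?K)"
  have le: "mdeg (snd x) \<le> N" if "x \<in> ?K" for x using that by (simp add: N_def)
  have "N \<in> (\<lambda>x. mdeg (snd x)) ` ?K" unfolding N_def using \<open>?K \<noteq> {}\<close> by (intro Max_in) auto
  then obtain w0 b0 where wb: "(w0, b0) \<in> ?K" "mdeg b0 = N" by auto
  have w0: "w0 \<in> W" using wb keys by auto
  have "?c (w0, b0) \<noteq> 0" using wb by (simp add: in_keys_iff)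
  then obtain x where x: "pev x (?c (w0, b0)) \<noteq> 0" "inj_on (\<lambda>w. adjoint w x) W" using generic_point by blast
  let ?y = "adjoint w0 x"
  have free: "adjoint w ?y \<noteq> ?y" if "w \<in> W" "w \<noteq> id" for w
  proof
    assume "adjoint w ?y = ?y"
    then have "w0 \<circ> w = w0" using x(2) that w0 by (auto simp flip: adjoint_comp dest!: inj_onD simp: W_comp)
    then have "inv w0 \<circ> (w0 \<circ> w) = inv w0 \<circ> w0" by simp
    then show False using that W_inv(3)[OF w0] by (simp add: comp_assoc[symmetric])
  qed
  let ?S = "(\<lambda>w. adjoint w x) ` (W - {w0})"
  have "finite ?S" "?y \<notin> ?S" using W_finite x(2) w0 by (auto dest: inj_onD)
  then obtain s where s: "pev ?y s = 1" "\<forall>x\<in>?S. pev x s = 0" using separating_poly by blast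
  let ?KK = "{b \<in> snd ` ?K. mdeg b = N \<and> (w0, b) \<in> ?K}"
  \<comment> \<open>The symbol of the top part belonging to w0, with its coefficients frozen at x,
    as a polynomial in the covariable \<xi>.\<close>
  define q where "q = (\<Sum>b\<in>?KK. Poly_Mapping.single b (pev x (?c (w0, b))))"
  have fin: "finite ?KK" by simp
  have "pev \<xi> q = 0" for \<xi>
  proof -
    \<comment> \<open>Choosing f with gradient \<xi> at ?y makes q(\<xi>) readable from the
      commutator with f.\<close>
    obtain f where f: "\<And>w. w \<in> W \<Longrightarrow> poly_act w f = f" "\<And>i. pev ?y (dir_deriv (axis i 1) f) = of_real (\<xi> $ i)"
      using invariant_with_gradient[OF free] by blast
    let ?D = "comm_with (eX f)"
    let ?G = "mon_ev (\<lambda>i. dir_deriv (axis i 1) f)"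
    have t: "(?D ^^ N) (eX p * (eW w * P.Ymon b)) = (if mdeg b = N then eX p * (eW w * (eK (of_nat (fact N)) * eX (?G b))) else 0)"
      if "w \<in> W" "mdeg b \<le> N" for p w b
    proof -
      have "eW w * eX f = eX f * eW w" by (rule endo_eqI) (simp add: f that)
      then have "(?D ^^ N) (eX p * (eW w * P.Ymon b)) = eX p * (eW w * (?D ^^ N) (P.Ymon b))"
        by (simp add: comm_with_pow_central eX_commute)
      moreover have "(?D ^^ N) (P.Ymon b) = (if mdeg b = N then eK (of_nat (fact N)) * eX (?G b) else 0)"
        by (subst comm_with_Ymon[OF f(1)]) (use that in auto)
      ultimately show ?thesis by simp
    qed
    have "(\<Sum>k\<in>?K. if mdeg (snd k) = N then eX (?c k) * (eW (fst k) * (eK (of_nat (fact N)) * eX (?G (snd k)))) else 0) = (?D ^^ N) (P.NF c)"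
      unfolding P.NF_def comm_with_pow_sum P_Xp
      by (intro sum.cong refl, subst t) (use keys le in auto)
    also have "\<dots> = 0" by (simp add: z comm_with_pow_simps)
    finally have "pev x (app (\<Sum>k\<in>?K. if mdeg (snd k) = N then eX (?c k) * (eW (fst k) * (eK (of_nat (fact N)) * eX (?G (snd k)))) else 0) s) = 0"
      by simp
    then have "(\<Sum>k\<in>?K. if mdeg (snd k) = N then pev x (?c k) * (of_nat (fact N) * (pev (adjoint (fst k) x) (?G (snd k)) * pev (adjoint (fst k) x) s)) else 0) = 0"
      unfolding app_sum_left pev_simps
    proof (rule trans[OF sum.cong[OF refl], rotated])
      fix k assume "k \<in> ?K"
      then have w: "linear (fst k)" using keys W_linear by auto
      show "(if mdeg (snd k) = N then pev x (?c k) * (of_nat (fact N) * (pev (adjoint (fst k) x) (?G (snd k)) * pev (adjoint (fst k) x) s)) else 0)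
        = pev x (app (if mdeg (snd k) = N then eX (?c k) * (eW (fst k) * (eK (of_nat (fact N)) * eX (?G (snd k)))) else 0) s)"
        by (simp add: pev_poly_act[OF w])
    qed
    moreover have "(\<Sum>k\<in>?K. if mdeg (snd k) = N then pev x (?c k) * (of_nat (fact N) * (pev (adjoint (fst k) x) (?G (snd k)) * pev (adjoint (fst k) x) s)) else 0)
       = (\<Sum>k\<in>Pair w0 ` ?KK. pev x (?c k) * (of_nat (fact N) * (pev ?y (?G (snd k)))))"
    proof (rule sum.mono_neutral_cong_right)
      show "\<forall>k\<in>?K - Pair w0 ` ?KK. (if mdeg (snd k) = N then pev x (?c k) * (of_nat (fact N) * (pev (adjoint (fst k) x) (?G (snd k)) * pev (adjoint (fst k) x) s)) else 0) = 0"
      proof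
        fix k assume k: "k \<in> ?K - Pair w0 ` ?KK"
        show "(if mdeg (snd k) = N then pev x (?c k) * (of_nat (fact N) * (pev (adjoint (fst k) x) (?G (snd k)) * pev (adjoint (fst k) x) s)) else 0) = 0"
        proof (cases "mdeg (snd k) = N")
          case True
          then have "fst k \<noteq> w0" using k by (cases k) force
          then have "pev (adjoint (fst k) x) s = 0" using s k keys by auto
          then show ?thesis by simp
        qed simp
      qed
    qed (auto simp: s)
    ultimately have "(\<Sum>b\<in>?KK. pev x (?c (w0, b)) * (of_nat (fact N) * (pev ?y (?G b)))) = 0"
      by (subst (asm) sum.reindex) (auto simp: inj_on_def)
    then have "of_nat (fact N) * (\<Sum>b\<in>?KK. pev x (?c (w0, b)) * pev ?y (?G b)) = 0"
      by (simp add: sum_distrib_left mult.left_commute)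
    then have "(\<Sum>b\<in>?KK. pev x (?c (w0, b)) * pev ?y (?G b)) = 0" by simp
    moreover have "pev \<xi> (Poly_Mapping.single b a) = a * pev ?y (?G b)" for a b
    proof -
      have "pev \<xi> (Poly_Mapping.single b a) = a * (\<Prod>i\<in>UNIV. of_real (\<xi> $ i) ^ Poly_Mapping.lookup b i)"
        by (simp add: pev_expand)
      then show ?thesis by (simp add: mon_ev_prod f(2))
    qed
    ultimately show ?thesis by (simp add: q_def)
  qed
  then have "q = 0" using pev_nonzero by blast
  moreover have "Poly_Mapping.lookup q b0 = pev x (?c (w0, b0))"
  proof -
    have "b0 \<in> ?KK" using wb by force
    then show ?thesis unfolding q_def lookup_sum lookup_single when_def
      using fin by (simp add: sum.delta)
  qed
  ultimately show False using x by simp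
qed

end

section \<open>The universal property of the Cherednik algebra\<close>

lemma cher_target_prod:
  assumes "cher_target R Rp k \<kappa>1 X1 W1 Y1" "cher_target R Rp k \<kappa>2 X2 W2 Y2"
  shows "cher_target R Rp k (\<lambda>c. (\<kappa>1 c, \<kappa>2 c)) (\<lambda>x. (X1 x, X2 x)) (\<lambda>w. (W1 w, W2 w)) (\<lambda>y. (Y1 y, Y2 y))"
proof -
  interpret a: cher_target R Rp k \<kappa>1 X1 W1 Y1 by fact
  interpret b: cher_target R Rp k \<kappa>2 X2 W2 Y2 by fact
  have fs: "fst (sum f A) = (\<Sum>i\<in>A. fst (f i))" "snd (sum f A) = (\<Sum>i\<in>A. snd (f i))" for f :: "real^'a \<Rightarrow> 'b \<times> 'c" and A
    by (induction A rule: infinite_finite_induct) auto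
  show ?thesis
    by unfold_locales
      (simp_all add: prod_eq_iff fs a.\<kappa>_add b.\<kappa>_add a.\<kappa>_mult b.\<kappa>_mult a.\<kappa>_one b.\<kappa>_one a.\<kappa>_X b.\<kappa>_X a.\<kappa>_Y b.\<kappa>_Y
        a.\<kappa>_W b.\<kappa>_W a.X_add b.X_add a.X_scale b.X_scale a.Y_add b.Y_add a.Y_scale b.Y_scale a.XX b.XX
        a.Wd_id b.Wd_id a.Wd_comp b.Wd_comp a.WX b.WX a.WY b.WY a.YX b.YX a.YY b.YY)
qed

context cher_target
begin

text \<open>In the product target, h is related to the pair of \<open>Endo h\<close> and r, and a
  normal form there has one coefficient family for both components. The equation
  \<open>app (Endo h) = h\<close> records that h is additive, on which the meaning of
  \<open>Endo h\<close> rests.\<close>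

lemma hrel_NF:
  assumes "hrel h r"
  obtains c where "Poly_Mapping.keys c \<subseteq> W \<times> UNIV" "Endo h = P.NF c" "r = NF c" "app (Endo h) = h"
proof -
  interpret Q: cher_target R Rp k "\<lambda>c. (eK c, \<kappa> c)" "\<lambda>x. (eX (lin_poly x), X x)" "\<lambda>w. (eW w, Wd w)" "\<lambda>y. (eY y, Y y)"
    by (rule cher_target_prod) (rule P.cher_target_axioms cher_target_axioms)+
  have "Q.hrel h (Endo h, r) \<and> app (Endo h) = h"
    using assms
  proof (induction rule: hrel.induct)
    case (hrel_W w)
    then show ?case using Q.hrel_W[of w] by (simp add: eW_def[symmetric] fun_eq_iff)
  next
    case (hrel_X x)
    then show ?case using Q.hrel_X[of x] by (simp add: eX_def mult_op_def) (auto simp: fun_eq_iff app_Endo distrib_left)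
  next
    case (hrel_Y y)
    then show ?case using Q.hrel_Y[of y] by (simp add: eY_def[symmetric] fun_eq_iff)
  next
    case (hrel_add a r b s)
    then have "Endo (a + b) = Endo a + Endo b" and "app (Endo (a + b)) = a + b"
    proof -
      have l: "(a + b) (x + y) = (a + b) x + (a + b) y" for x y
        using hrel_add.IH app_add[of "Endo a" x y] app_add[of "Endo b" x y] by simp
      show e: "app (Endo (a + b)) = a + b" by (rule app_Endo) (rule l)
      show "Endo (a + b) = Endo a + Endo b" by (rule endo_eqI) (use hrel_add.IH in \<open>simp add: e\<close>)
    qed
    then show ?case using Q.hrel_add[of a "(Endo a, r)" b "(Endo b, s)"] hrel_add.IH by (simp only: add_Pair simp_thms)
  next
    case (hrel_scale a r c)
    have e: "app (Endo (op_scale c a)) = op_scale c a"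
      by (rule app_Endo) (use hrel_scale.IH app_add[of "Endo a"] in \<open>simp add: op_scale_def pm_scale_eq distrib_left\<close>)
    have "Endo (op_scale c a) = eK c * Endo a"
      by (rule endo_eqI) (use hrel_scale.IH in \<open>simp add: e, simp add: op_scale_def pm_scale_eq\<close>)
    then show ?case using Q.hrel_scale[of a "(Endo a, r)" c] hrel_scale.IH e by (simp add: times_prod_def)
  next
    case (hrel_comp a r b s)
    have e: "app (Endo (a \<circ> b)) = a \<circ> b"
      by (rule app_Endo) (use hrel_comp.IH app_add[of "Endo a"] app_add[of "Endo b"] in simp)
    have "Endo (a \<circ> b) = Endo a * Endo b"
      by (rule endo_eqI) (use hrel_comp.IH in \<open>simp add: e\<close>)
    then show ?case using Q.hrel_comp[of a "(Endo a, r)" b "(Endo b, s)"] hrel_comp.IH e by (simp only: times_prod_def fst_conv snd_conv simp_thms)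
  qed
  then have "(Endo h, r) \<in> Q.NFs" and ap: "app (Endo h) = h" using Q.hrel_NFs by blast+
  then obtain c where c: "Poly_Mapping.keys c \<subseteq> W \<times> UNIV" "(Endo h, r) = Q.NF c" unfolding Q.NFs_def by auto
  have fs: "fst (sum f A) = (\<Sum>i\<in>A. fst (f i))" "snd (sum f A) = (\<Sum>i\<in>A. snd (f i))" for f :: "_ \<Rightarrow> 'n mpoly endo \<times> 'r" and A
    by (induction A rule: infinite_finite_induct) auto
  have xp: "Q.Xp p = (P.Xp p, Xp p)" for p
    unfolding Q.Xp_def
    by (rule Q.xe.cev_unique[symmetric])
      (simp_all add: prod_eq_iff Xp_simps(1,3) P.Xp_simps(1,3) Xp_vmult P.Xp_vmult del: P.Xp_simps(2))
  have ym: "Q.Ymon b = (P.Ymon b, Ymon b)" for b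
  proof (induction b rule: monomial_induct)
    case (step i m)
    then show ?case by (simp add: Q.ye.mon_ev_Suc ye.mon_ev_Suc P.ye.mon_ev_Suc prod_eq_iff)
  qed (simp add: prod_eq_iff)
  have "Q.NF c = (P.NF c, NF c)"
    unfolding Q.NF_def P.NF_def NF_def xp ym by (simp add: prod_eq_iff fs)
  with c ap show thesis using that by auto
qed

lemma hrel_unique: assumes "hrel h r" "hrel h s" shows "r = s"
proof -
  obtain c where c: "Poly_Mapping.keys c \<subseteq> W \<times> UNIV" "Endo h = P.NF c" "r = NF c" using hrel_NF[OF assms(1)] .
  obtain d where d: "Poly_Mapping.keys d \<subseteq> W \<times> UNIV" "Endo h = P.NF d" "s = NF d" using hrel_NF[OF assms(2)] .
  have "Poly_Mapping.keys (c - d) \<subseteq> W \<times> UNIV"   proof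
    fix x assume "x \<in> Poly_Mapping.keys (c - d)"
    then have "x \<in> Poly_Mapping.keys c \<or> x \<in> Poly_Mapping.keys d" by (auto simp: in_keys_iff lookup_minus)
    then show "x \<in> W \<times> UNIV" using c(1) d(1) by blast
  qed
  moreover have "P.NF (c - d) = 0" using c(2) d(2) by (simp add: P.NF_diff)
  ultimately have "c - d = 0" by (rule P_NF_independent)
  then show ?thesis using c(3) d(3) by simp
qed

definition \<Phi> :: "'n oper \<Rightarrow> 'r" where "\<Phi> h = (THE r. hrel h r)"

abbreviation "H \<equiv> cherednik R Rp k"

lemma \<Phi>_eq: "hrel h r \<Longrightarrow> \<Phi> h = r"
  unfolding \<Phi>_def using hrel_unique by blast

lemma hrel_\<Phi>: "h \<in> H \<Longrightarrow> hrel h (\<Phi> h)"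
  using hrel_exists \<Phi>_eq by metis

lemma \<Phi>_simps: "w \<in> W \<Longrightarrow> \<Phi> (poly_act w) = Wd w" "\<Phi> (mult_op (lin_poly x)) = X x" "\<Phi> (dunkl R Rp k y) = Y y"
  "a \<in> H \<Longrightarrow> b \<in> H \<Longrightarrow> \<Phi> (a + b) = \<Phi> a + \<Phi> b" "a \<in> H \<Longrightarrow> \<Phi> (op_scale c a) = \<kappa> c * \<Phi> a"
  "a \<in> H \<Longrightarrow> b \<in> H \<Longrightarrow> \<Phi> (a \<circ> b) = \<Phi> a * \<Phi> b"
  by (blast intro: \<Phi>_eq hrel.intros hrel_\<Phi>)+

end

context cher_target
begin

lemma scale_H: "a \<in> H \<Longrightarrow> op_scale c a \<in> H" by (rule cherednik_scale)

lemma hrel_Xp: "hrel (mult_op p) (Xp p)"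
proof (induction p rule: mpoly_induct)
  case (const c)
  have e: "mult_op (const_poly c) = op_scale c (poly_act id)"
    by (rule ext) (simp add: mult_op_def op_scale_def poly_act_id pm_scale_eq)
  show ?case unfolding e using hrel_scale[OF hrel_W[OF W_id], of c] by (simp only: Xp_simps Wd_id mult_1_right)
next
  case (add p q)
  have "mult_op (p + q) = mult_op p + mult_op q" by (rule ext) (simp add: mult_op_def distrib_right)
  then show ?case using hrel_add[OF add] by (simp only: Xp_simps)
next
  case (var i p)
  have "mult_op (pvar i * p) = mult_op (lin_poly (axis i 1)) \<circ> mult_op p"
    by (rule ext) (simp add: mult_op_def lin_poly_axis mult.assoc)
  then show ?case using hrel_comp[OF hrel_X var, of "axis i 1"] by (simp only: Xp_vmult)
qed

lemma \<Phi>_mult: "\<Phi> (mult_op p) = Xp p" and mult_H: "mult_op p \<in> H"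
  using hrel_Xp \<Phi>_eq hrel_cherednik by blast+

lemma dunkl_H: "dunkl R Rp k y \<in> H" and poly_act_H: "w \<in> W \<Longrightarrow> poly_act w \<in> H"
  by (rule cherednik.intros, assumption?)+

lemma id_eq: "poly_act id = (id :: 'n oper)" by (rule ext) (simp add: poly_act_id)

lemma id_H: "id \<in> H" using poly_act_H[OF W_id] by (simp only: id_eq)

lemma zero_H: "0 \<in> H"
proof -
  have "(0 :: 'n oper) = op_scale 0 id" by (rule ext) (simp add: op_scale_def)
  then show ?thesis using scale_H[OF id_H] by metis
qed

lemma \<Phi>_zero: "\<Phi> 0 = 0" using \<Phi>_simps(4)[OF zero_H zero_H] by simp
lemma \<Phi>_id: "\<Phi> id = 1" using \<Phi>_simps(1)[OF W_id] by (simp only: id_eq Wd_id)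

lemma H_sum: "(\<And>i. i \<in> A \<Longrightarrow> f i \<in> H) \<Longrightarrow> sum f A \<in> H"
  by (induction A rule: infinite_finite_induct) (auto intro: cherednik_add zero_H)

lemma minus_H: "a \<in> H \<Longrightarrow> b \<in> H \<Longrightarrow> a - b \<in> H"
proof -
  assume "a \<in> H" "b \<in> H"
  moreover have "a - b = a + op_scale (- 1) b"
    by (rule ext) (simp add: op_scale_def pm.scale_minus_left)
  ultimately show ?thesis using scale_H cherednik_add by metis
qed

end

section \<open>Products of Dunkl operators and induction over the algebra\<close>

context root_params
begin

definition dlist :: "(complex^'n) list \<Rightarrow> 'n oper"
  where "dlist ys = foldr (\<circ>) (map (dunkl R Rp k) ys) id"

lemma dlist_Nil: "dlist [] = id"
  unfolding dlist_def list.map foldr.simps(1) by (rule id_apply)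

lemma dlist_Cons: "dlist (y # ys) = dunkl R Rp k y \<circ> dlist ys"
  unfolding dlist_def list.map foldr.simps(2) by (rule comp_apply)

lemma dlist_H: "dlist ys \<in> cherednik R Rp k"
proof (induction ys)
  case Nil
  show ?case unfolding dlist_Nil by (rule P.id_H)
next
  case (Cons y ys)
  then show ?case unfolding dlist_Cons by (rule cherednik_comp[OF P.dunkl_H])
qed

lemma app_Ymon: "\<exists>ys. length ys = mdeg b \<and> app (P.Ymon b) = dlist ys"
proof (induction b rule: monomial_induct)
  case zero
  then show ?case by (intro exI[of _ "[]"]) (simp add: fun_eq_iff dlist_Nil)
next
  case (step i m)
  then obtain ys where "length ys = mdeg m" "app (P.Ymon m) = dlist ys" by blast
  then show ?case unfolding P.ye.mon_ev_Suc
    by (intro exI[of _ "axis i 1 # ys"] conjI ext) (simp_all add: mdeg_add dlist_Cons)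
qed

lemma hrel_Endo: assumes "h \<in> cherednik R Rp k"
  obtains c where "Poly_Mapping.keys c \<subseteq> W \<times> UNIV" "h = app (P.NF c)"
proof -
  obtain r where "P.hrel h r" using P.hrel_exists[OF assms] by blast
  then obtain c where "Poly_Mapping.keys c \<subseteq> W \<times> UNIV" "Endo h = P.NF c" "app (Endo h) = h"
    by (rule P.hrel_NF)
  then show thesis using that by metis
qed

lemma H_linear: assumes "h \<in> cherednik R Rp k"
  shows "h (p + q) = h p + h q" "h (const_poly c * p) = const_poly c * h p"
proof -
  obtain r where "P.hrel h r" using P.hrel_exists[OF assms] by blast
  then have "app (Endo h) = h" using P.hrel_NF by metis
  then show "h (p + q) = h p + h q" using app_add by metis
  show "h (const_poly c * p) = const_poly c * h p"
    using assms
  proof (induction arbitrary: p rule: cherednik.induct)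
    case (cherednik_dunkl y)
    have "eK c * eY y = eY y * eK c" by (rule P.\<kappa>_Y)
    then have "app (eK c * eY y) p = app (eY y * eK c) p" by simp
    then show ?case by simp
  qed (simp_all add: mult_op_def op_scale_def pm_scale_eq algebra_simps)
qed

text \<open>The spanning half of the decomposition P CW S in the shape of an induction principle: a
  statement about H reduces to additivity and to single products.\<close>

lemma H_induct [consumes 1, case_names zero add trm]:
  assumes h: "h \<in> cherednik R Rp k" and z: "Q (0 :: 'n oper)"
    and a: "\<And>a b. a \<in> cherednik R Rp k \<Longrightarrow> b \<in> cherednik R Rp k \<Longrightarrow> Q a \<Longrightarrow> Q b \<Longrightarrow> Q (a + b)"
    and t: "\<And>p w ys. w \<in> W \<Longrightarrow> Q (mult_op p \<circ> (poly_act w \<circ> dlist ys))"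
  shows "Q h"
proof -
  obtain c where c: "Poly_Mapping.keys c \<subseteq> W \<times> UNIV" "h = app (P.NF c)" using hrel_Endo[OF h] .
  \<comment> \<open>Membership of the partial sums in H is carried along because the case of sums
    presupposes it.\<close>
  have "Q (app (\<Sum>x\<in>A. P.Xp (Poly_Mapping.lookup c x) * (eW (fst x) * P.Ymon (snd x)))) \<and>
     app (\<Sum>x\<in>A. P.Xp (Poly_Mapping.lookup c x) * (eW (fst x) * P.Ymon (snd x))) \<in> cherednik R Rp k"
    if "A \<subseteq> W \<times> UNIV" for A
    using that
  proof (induction A rule: infinite_finite_induct)
    case (infinite A)
    have e: "app (0 :: 'n mpoly endo) = 0" by (rule ext) simp
    show ?case unfolding sum.infinite[OF infinite(1)] e using z P.zero_H by blast
  next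
    case empty
    have e: "app (0 :: 'n mpoly endo) = 0" by (rule ext) simp
    show ?case unfolding sum.empty e using z P.zero_H by blast
  next
    case (insert x A)
    let ?t = "P.Xp (Poly_Mapping.lookup c x) * (eW (fst x) * P.Ymon (snd x))"
    let ?s = "\<Sum>x\<in>A. P.Xp (Poly_Mapping.lookup c x) * (eW (fst x) * P.Ymon (snd x))"
    obtain ys where ys: "app (P.Ymon (snd x)) = dlist ys" using app_Ymon by blast
    have w: "fst x \<in> W" using insert.prems by auto
    have e: "app ?t = mult_op (Poly_Mapping.lookup c x) \<circ> (poly_act (fst x) \<circ> dlist ys)"
      by (rule ext) (simp add: P_Xp mult_op_def ys)
    have tH: "app ?t \<in> cherednik R Rp k" unfolding e by (intro cherednik_comp P.mult_H P.poly_act_H w dlist_H)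
    have s: "app (\<Sum>x\<in>insert x A. P.Xp (Poly_Mapping.lookup c x) * (eW (fst x) * P.Ymon (snd x))) = app ?t + app ?s"
      by (rule ext) (simp add: insert.hyps)
    have IH: "Q (app ?s)" "app ?s \<in> cherednik R Rp k" using insert by auto
    have "Q (app ?t)" unfolding e by (rule t[OF w])
    then show ?case unfolding s using a[OF tH IH(2) _ IH(1)] cherednik_add[OF tH IH(2)] by blast
  qed
  then show ?thesis using c unfolding P.NF_def by blast
qed

end


section \<open>The anti-involution\<close>

locale root_pb = root_params R Rp k + root_basis R z
  for R Rp :: "(real^'n::finite) set" and k :: "real^'n \<Rightarrow> complex" and z :: "'n \<Rightarrow> real^'n"
begin

abbreviation "iB \<equiv> inv (B_map R)"

lemma inv_refl: "\<alpha> \<in> R \<Longrightarrow> inv (root_refl R \<alpha>) = root_refl R \<alpha>"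
  by (intro inv_unique_comp root_refl_invol)

text \<open>Reversal of products, together with x to T_{B(x)} and w to its inverse, permutes the
  defining relations: XX with YY and WX with WY. The mixed relation goes to itself by the symmetry
  of B and \<open>B_root_swap\<close>.\<close>

lemma opp_target: "cher_target R Rp k (\<lambda>c. Opp (eK c)) (\<lambda>x. Opp (eY (B_map R x)))
   (\<lambda>w. Opp (eW (inv w))) (\<lambda>y. Opp (eX (lin_poly (iB y))))"
proof unfold_locales
  fix c d x x' y y' w w'
  show "Opp (eK (c + d)) = Opp (eK c) + Opp (eK d)" "Opp (eK 1 :: 'n mpoly endo) = 1"
    by (rule opp_eqI; simp add: eK_simps)+
  show "Opp (eK (c * d) :: 'n mpoly endo) = Opp (eK c) * Opp (eK d)"
    using eK_simps(2)[of d c] by (intro opp_eqI) (simp add: mult.commute)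
  show "Opp (eK c) * Opp (eY (B_map R x)) = Opp (eY (B_map R x)) * Opp (eK c)"
    by (intro opp_eqI) (simp add: P.\<kappa>_Y)
  show "Opp (eK c) * Opp (eW (inv w)) = Opp (eW (inv w)) * Opp (eK c)" if "w \<in> W"
    using that by (intro opp_eqI) (simp add: P.\<kappa>_W W_inv(1))
  show "Opp (eK c) * Opp (eX (lin_poly (iB y))) = Opp (eX (lin_poly (iB y))) * Opp (eK c)"
    by (intro opp_eqI) (simp add: P.\<kappa>_X)
  show "Opp (eY (B_map R (x + x'))) = Opp (eY (B_map R x)) + Opp (eY (B_map R x'))"
    by (intro opp_eqI) (simp add: B_map_simps P.Y_add)
  show "Opp (eY (B_map R (c *s x))) = Opp (eK c) * Opp (eY (B_map R x))"
    by (intro opp_eqI) (simp add: B_map_simps P.Y_scale P.\<kappa>_Y)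
  show "Opp (eX (lin_poly (iB (y + y')))) = Opp (eX (lin_poly (iB y))) + Opp (eX (lin_poly (iB y')))"
    by (intro opp_eqI) (simp add: B_inv_simps P.X_add)
  show "Opp (eX (lin_poly (iB (c *s y)))) = Opp (eK c) * Opp (eX (lin_poly (iB y)))"
    by (intro opp_eqI) (simp add: B_inv_simps P.X_scale P.\<kappa>_X)
  show "Opp (eY (B_map R x)) * Opp (eY (B_map R x')) = Opp (eY (B_map R x')) * Opp (eY (B_map R x))"
    by (intro opp_eqI) (simp add: P.YY)
  show "Opp (eX (lin_poly (iB y))) * Opp (eX (lin_poly (iB y'))) = Opp (eX (lin_poly (iB y'))) * Opp (eX (lin_poly (iB y)))"
    by (intro opp_eqI) (simp add: eX_commute)
  have "inv (id :: 'n lin) = id" by simp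
  then show "Opp (eW (inv id) :: 'n mpoly endo) = 1" by (intro opp_eqI) (simp only: P.Wd_id unopp_simps opp.sel)
  show "Opp (eW (inv (w \<circ> w'))) = Opp (eW (inv w)) * Opp (eW (inv w'))" if "w \<in> W" "w' \<in> W"
  proof -
    have "inv (w \<circ> w') = inv w' \<circ> inv w" using that by (intro o_inv_distrib W_bij)
    then show ?thesis using that by (intro opp_eqI) (simp only: P.Wd_comp W_inv(1) unopp_simps opp.sel)
  qed
  show "Opp (eW (inv w)) * Opp (eY (B_map R x)) = Opp (eY (B_map R (cact w x))) * Opp (eW (inv w))" if "w \<in> W"
    using that by (intro opp_eqI) (simp only: P.WY W_inv(1) B_map_cact unopp_simps opp.sel)
  show "Opp (eX (lin_poly (iB y))) * Opp (eW (inv w)) = Opp (eW (inv w)) * Opp (eX (lin_poly (iB (tact w y))))" if "w \<in> W"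
    using that by (intro opp_eqI) (simp only: P.WX W_inv(1) B_inv_tact unopp_simps opp.sel)
  show "Opp (eX (lin_poly (iB y))) * Opp (eY (B_map R x)) =
      Opp (eY (B_map R x)) * Opp (eX (lin_poly (iB y))) + Opp (eK (pairing x y)) +
      (\<Sum>\<alpha>\<in>Rp. Opp (eK (k \<alpha> * pairing (cplx \<alpha>) y * pairing x (cplx (coroot R \<alpha>)))) * Opp (eW (inv (root_refl R \<alpha>))))"
  proof (rule opp_eqI)
    have "pairing (iB y) (B_map R x) = pairing x y"
      by (simp add: pairing_B_map B_form_commute[of x] B_form_inv)
    moreover have "eK (k \<alpha> * pairing (cplx \<alpha>) (B_map R x) * pairing (iB y) (cplx (coroot R \<alpha>))) * eW (root_refl R \<alpha>)
      = eW (inv (root_refl R \<alpha>)) * eK (k \<alpha> * pairing (cplx \<alpha>) y * pairing x (cplx (coroot R \<alpha>)))" if "\<alpha> \<in> Rp" for \<alpha>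
      using B_root_swap[OF Rp_R[OF that], of x y]
      by (simp only: mult.assoc inv_refl[OF Rp_R[OF that]] P.\<kappa>_W[OF W_refl[OF Rp_R[OF that]]])
    ultimately show "unopp (Opp (eX (lin_poly (iB y))) * Opp (eY (B_map R x))) =
      unopp (Opp (eY (B_map R x)) * Opp (eX (lin_poly (iB y))) + Opp (eK (pairing x y)) +
      (\<Sum>\<alpha>\<in>Rp. Opp (eK (k \<alpha> * pairing (cplx \<alpha>) y * pairing x (cplx (coroot R \<alpha>)))) * Opp (eW (inv (root_refl R \<alpha>)))))"
      using P.YX[of "B_map R x" "iB y"] by (simp add: unopp_sum cong: sum.cong)
  qed
qed

abbreviation "HH \<equiv> cherednik R Rp k"

text \<open>\<sigma> is the map \<open>S.\<Phi>\<close> into the opposite ring. That it preserves H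
  and squares to the identity is then an induction over the generators.\<close>

lemma sigma_exists: "\<exists>s. is_sigma R Rp k s"
proof -
  interpret S: cher_target R Rp k "\<lambda>c. Opp (eK c)" "\<lambda>x. Opp (eY (B_map R x))"
    "\<lambda>w. Opp (eW (inv w))" "\<lambda>y. Opp (eX (lin_poly (iB y)))" by (rule opp_target)
  define s where "s h = app (unopp (S.\<Phi> h))" for h
  have g: "s (mult_op (lin_poly x)) = dunkl R Rp k (B_map R x)" "s (dunkl R Rp k y) = mult_op (lin_poly (iB y))"
    "w \<in> W \<Longrightarrow> s (poly_act w) = poly_act (inv w)" for x y w
    by (rule ext; simp only: s_def S.\<Phi>_simps app_e app_eY opp.sel; simp only: mult_op_def)+
  have sadd: "s (a + b) = s a + s b" and scomp: "s (a \<circ> b) = s b \<circ> s a" if "a \<in> HH" "b \<in> HH" for a b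
    by (rule ext; simp only: s_def S.\<Phi>_simps that o_apply plus_fun_apply unopp_simps app_simps)+
  \<comment> \<open>In the opposite ring the scalar ends up on the right; \<open>H_linear\<close>
    moves it to the left once the image is known to lie in H.\<close>
  have ssc: "s (op_scale c a) = s a \<circ> op_scale c id" if "a \<in> HH" for a c
    by (rule ext) (simp only: s_def S.\<Phi>_simps that o_apply id_apply op_scale_def[of c id] unopp_simps app_simps opp.sel app_e pm_scale_eq)
  have sH: "s a \<in> HH" if "a \<in> HH" for a
    using that
  proof (induction rule: cherednik.induct)
    case (cherednik_weyl w)
    then show ?case by (simp only: g P.poly_act_H W_inv(1))
  next
    case (cherednik_scale a c)
    then show ?case by (simp only: ssc) (intro cherednik_comp P.scale_H P.id_H)
  qed (simp_all only: g sadd scomp P.mult_H P.dunkl_H cherednik_add cherednik_comp)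
  have ssc': "s (op_scale c a) = op_scale c (s a)" if "a \<in> HH" for a c
    using ssc[OF that] H_linear(2)[OF sH[OF that]] by (simp add: fun_eq_iff op_scale_def pm_scale_eq)
  have ss: "s (s a) = a" if "a \<in> HH" for a
    using that
  proof (induction rule: cherednik.induct)
    case (cherednik_weyl w)
    then show ?case by (simp only: g W_inv(1) W_inv_inv)
  qed (simp_all only: g B_inv sadd scomp ssc' sH)
  show ?thesis
    unfolding is_sigma_def
    by (intro exI[of _ s] conjI ballI allI) (simp_all only: g sadd scomp ssc' sH ss)
qed

definition "sg = ch_sigma R Rp k"

lemma is_sigma_sg: "is_sigma R Rp k sg"
  unfolding sg_def ch_sigma_def using sigma_exists by (rule someI_ex)

lemma sg_H: "a \<in> HH \<Longrightarrow> sg a \<in> HH" and sg_sg: "a \<in> HH \<Longrightarrow> sg (sg a) = a"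
  and sg_scale: "a \<in> HH \<Longrightarrow> sg (op_scale c a) = op_scale c (sg a)"
  and sg_add: "a \<in> HH \<Longrightarrow> b \<in> HH \<Longrightarrow> sg (a + b) = sg a + sg b"
  and sg_comp: "a \<in> HH \<Longrightarrow> b \<in> HH \<Longrightarrow> sg (a \<circ> b) = sg b \<circ> sg a"
  and sg_X: "sg (mult_op (lin_poly x)) = dunkl R Rp k (B_map R x)"
  and sg_Y: "sg (dunkl R Rp k y) = mult_op (lin_poly (iB y))"
  and sg_W: "w \<in> W \<Longrightarrow> sg (poly_act w) = poly_act (inv w)"
  using is_sigma_sg unfolding is_sigma_def by blast+

lemma sg_id: "sg id = id"
  using sg_W[OF W_id] by (simp only: P.id_eq inv_id)

lemma sg_zero: "sg 0 = 0"
  using sg_add[OF P.zero_H P.zero_H] by simp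

end

section \<open>Verma modules\<close>

lemma tens_nth [simp]: "tens p v $ i = const_poly (v $ i) * p"
  by (simp add: tens_def pm_scale_eq)

lemma vp_scale_nth [simp]: "vp_scale c u $ i = const_poly c * u $ i"
  by (simp add: vp_scale_def pm_scale_eq)

lemma tens_simps: "tens (p + q) v = tens p v + tens q v" "tens p (v + v') = tens p v + tens p v'"
  "tens p (c *s v) = vp_scale c (tens p v)" "tens (const_poly c * p) v = vp_scale c (tens p v)"
  "tens 0 v = 0" "tens p 0 = 0"
  by (simp_all add: vec_eq_iff algebra_simps)

lemma vpoly_expand: "u = (\<Sum>i\<in>UNIV. tens (u $ i) (axis i 1))"
proof -
  have "(\<Sum>i\<in>UNIV. const_poly ((axis i 1 :: complex^'b) $ j) * u $ i) = (\<Sum>i\<in>UNIV. if i = j then u $ j else 0)" for j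
    by (intro sum.cong) (auto simp: axis_def)
  then show ?thesis by (simp add: vec_eq_iff)
qed

lemma vec_linear_sum:
  assumes "Vector_Spaces.linear (*s) (*s) (f :: complex^'d::finite \<Rightarrow> complex^'d)"
  shows "f x = (\<Sum>l\<in>UNIV. x $ l *s f (axis l 1))" "f (x + y) = f x + f y" "f (c *s x) = c *s f x"
proof -
  interpret l: Vector_Spaces.linear "(*s)" "(*s)" f by fact
  show "f (x + y) = f x + f y" "f (c *s x) = c *s f x" by (rule l.add l.scale)+
  have "f x = f (\<Sum>l\<in>UNIV. x $ l *s axis l 1)" by (simp flip: vec_expand)
  then show "f x = (\<Sum>l\<in>UNIV. x $ l *s f (axis l 1))" by (simp only: l.sum l.scale)
qed

text \<open>The operator a tensor 1.\<close>

definition Lv :: "'n mpoly endo \<Rightarrow> ('n, 'd::finite) vpoly endo"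
  where "Lv a = Endo (\<lambda>u. \<chi> i. app a (u $ i))"

lemma app_Lv [simp]: "app (Lv a) u $ i = app a (u $ i)"
  unfolding Lv_def by (subst app_Endo) (auto simp: vec_eq_iff)

text \<open>The operator 1 tensor \<open>\<rho> w\<close>, written with the matrix whose columns are
  the images of the unit vectors.\<close>

definition Mv :: "('n, 'd::finite) rep \<Rightarrow> 'n lin \<Rightarrow> ('n, 'd) vpoly endo"
  where "Mv \<rho> w = Endo (\<lambda>u. \<chi> i. \<Sum>j\<in>UNIV. const_poly (\<rho> w (axis j 1) $ i) * u $ j)"

lemma app_Mv [simp]: "app (Mv \<rho> w) u $ i = (\<Sum>j\<in>UNIV. const_poly (\<rho> w (axis j 1) $ i) * u $ j)"
  unfolding Mv_def by (subst app_Endo) (auto simp: vec_eq_iff distrib_left sum.distrib)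

locale verma = root_pb R Rp k z
  for R Rp :: "(real^'n::finite) set" and k :: "real^'n \<Rightarrow> complex" and z :: "'n \<Rightarrow> real^'n" +
  fixes \<rho> :: "('n, 'd::finite) rep"
  assumes rep: "is_rep R \<rho>"
begin

lemma rho_linear: "w \<in> W \<Longrightarrow> Vector_Spaces.linear (*s) (*s) (\<rho> w)"
  and rho_id: "\<rho> id = id"
  and rho_comp: "w \<in> W \<Longrightarrow> w' \<in> W \<Longrightarrow> \<rho> (w \<circ> w') = \<rho> w \<circ> \<rho> w'"
  using rep by (auto simp: is_rep_def)

lemmas rho_simps = vec_linear_sum(2,3)[OF rho_linear]
lemmas rho_expand = vec_linear_sum(1)[OF rho_linear]

lemma const_poly_sum: "const_poly (sum f A) = (\<Sum>i\<in>A. const_poly (f i))"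
  by (induction A rule: infinite_finite_induct) auto

sublocale dm: dunkl_model R Rp k Lv "Mv \<rho>"
proof unfold_locales
  fix a b :: "'n mpoly endo" and w w' :: "'n lin"
  show "Lv (a + b) = Lv a + Lv b" "Lv (a * b) = Lv a * Lv b" "Lv 1 = 1"
    by (rule endo_eqI; simp add: vec_eq_iff)+
  show "Mv \<rho> id = (1 :: ('n, 'd) vpoly endo)"
  proof (rule endo_eqI)
    fix u :: "('n, 'd) vpoly"
    have "app (Mv \<rho> id) u = (\<Sum>i\<in>UNIV. tens (u $ i) (axis i 1))"
      by (simp add: vec_eq_iff rho_id)
    then show "app (Mv \<rho> id) u = app 1 u" by (simp flip: vpoly_expand)
  qed
  show "Mv \<rho> (w \<circ> w') = Mv \<rho> w * Mv \<rho> w'" if w: "w \<in> W" "w' \<in> W"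
  proof (rule endo_eqI)
    fix u :: "('n, 'd) vpoly"
    have r: "\<rho> (w \<circ> w') (axis j 1) $ i = (\<Sum>l\<in>UNIV. \<rho> w' (axis j 1) $ l * \<rho> w (axis l 1) $ i)" for i j
      unfolding rho_comp[OF w] comp_apply rho_expand[OF w(1), of "\<rho> w' (axis j 1)"] by simp
    show "app (Mv \<rho> (w \<circ> w')) u = app (Mv \<rho> w * Mv \<rho> w') u"
      unfolding vec_eq_iff app_simps app_Mv r const_poly_sum const_poly_simps sum_distrib_left sum_distrib_right
      by (subst sum.swap) (simp add: mult_ac)
  qed
  show "Mv \<rho> w * Lv a = Lv a * Mv \<rho> w" if "\<And>c. a * eK c = eK c * a"
  proof -
    have "app a (const_poly c * p) = const_poly c * app a p" for c p
      using arg_cong[OF that[of c], of "\<lambda>a. app a p"] by simp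
    then show ?thesis by (intro endo_eqI) (simp add: vec_eq_iff app_sum)
  qed
qed

lemma dm_Y_const: "app (dm.mY y) (tens 1 v) = 0"
proof -
  have "dir_deriv y (const_poly c) = 0" "\<alpha> \<in> Rp \<Longrightarrow> dq \<alpha> (const_poly c) = 0" for c \<alpha>
    by (simp_all add: dir_deriv_const dq_const Rp_R)
  then show ?thesis
    by (simp add: dm.mY_def dm.mK_def vec_eq_iff app_sum_left app_eQ Rp_R cong: sum.cong)
qed

sublocale V: cher_target R Rp k dm.mK dm.mX dm.mW dm.mY
proof -
  interpret cher_pre R Rp k dm.mK dm.mX dm.mW dm.mY by (rule dm.cher_pre)
  show "cher_target R Rp k dm.mK dm.mX dm.mW dm.mY"
  proof unfold_locales
    fix y y'
    let ?C = "dm.mY y * dm.mY y' - dm.mY y' * dm.mY y"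
    have c: "?C * Lv (eX p) = Lv (eX p) * ?C" for p
      using commutator_Xp[of y y' p] unfolding Xp_def dm.model_Xp .
    have t: "tens p v = app (Lv (eX p)) (tens 1 v)" for p and v :: "complex^'d"
      by (simp add: vec_eq_iff mult.commute)
    \<comment> \<open>As in the polynomial representation, with the vectors 1 tensor v in the place
      of 1.\<close>
    have "app ?C (tens p v) = 0" for p v
    proof -
      have "app ?C (tens p v) = app (?C * Lv (eX p)) (tens 1 v)" by (simp only: t[of p] app_simps)
      also have "\<dots> = app (Lv (eX p)) (app ?C (tens 1 v))" by (simp only: c app_simps)
      finally show ?thesis by (simp add: dm_Y_const)
    qed
    then have "app ?C u = 0" for u by (subst vpoly_expand[of u]) (simp only: app_sum sum.neutral_const)
    then have "?C = 0" by (intro endo_eqI) simp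
    then show "dm.mY y * dm.mY y' = dm.mY y' * dm.mY y" by simp
  qed
qed

text \<open>The action on P tensor V supplied by the universal property. All computations use it;
  its agreement with the transported action \<open>verma_act\<close> follows once the induced module
  has been identified.\<close>

definition act :: "'n oper \<Rightarrow> ('n, 'd) vpoly \<Rightarrow> ('n, 'd) vpoly"
  where "act h u = app (V.\<Phi> h) u"

lemma mK_scale: "app (dm.mK c) u = vp_scale c u"
  by (simp add: dm.mK_def vec_eq_iff)

lemma act_right: "act h (u + u') = act h u + act h u'" "act h (u - u') = act h u - act h u'" "act h 0 = 0"
  "act h (sum f A) = (\<Sum>i\<in>A. act h (f i))"
  by (simp_all add: act_def app_sum)

lemma act_left: "a \<in> HH \<Longrightarrow> b \<in> HH \<Longrightarrow> act (a + b) u = act a u + act b u"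
  "a \<in> HH \<Longrightarrow> act (op_scale c a) u = vp_scale c (act a u)"
  "a \<in> HH \<Longrightarrow> b \<in> HH \<Longrightarrow> act (a \<circ> b) u = act a (act b u)"
  "act 0 u = 0" "act id u = u"
  by (simp_all only: act_def V.\<Phi>_simps app_simps mK_scale V.\<Phi>_zero V.\<Phi>_id)

lemma act_mult [simp]: "act (mult_op p) u $ i = p * u $ i"
  by (simp add: act_def V.\<Phi>_mult V.Xp_def dm.model_Xp)

lemma act_tens: "act (mult_op p) (tens q v) = tens (p * q) v"
  by (simp add: vec_eq_iff mult_ac)

lemma act_W: "w \<in> W \<Longrightarrow> act (poly_act w) u = tens_act \<rho> w u"
  by (simp add: act_def V.\<Phi>_simps dm.mW_def tens_act_def vec_eq_iff)

lemma tens_act_tens: "w \<in> W \<Longrightarrow> tens_act \<rho> w (tens p v) = tens (poly_act w p) (\<rho> w v)"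
  unfolding tens_act_def rho_expand[of w v]
  by (simp add: vec_eq_iff const_poly_sum sum_distrib_left sum_distrib_right mult_ac)

lemma act_W_tens: "w \<in> W \<Longrightarrow> act (poly_act w) (tens p v) = tens (poly_act w p) (\<rho> w v)"
  by (simp only: act_W tens_act_tens)

lemma act_Y: "act (dunkl R Rp k y) u = app (dm.mY y) u"
  by (simp only: act_def V.\<Phi>_simps)

lemma act_Y_const: "act (dunkl R Rp k y) (tens 1 v) = 0"
  by (simp only: act_Y dm_Y_const)

lemma act_scale_right: assumes "h \<in> HH" shows "act h (vp_scale c u) = vp_scale c (act h u)"
proof -
  have s: "op_scale c id \<in> HH" by (rule V.scale_H[OF V.id_H])
  have "h \<circ> op_scale c id = op_scale c id \<circ> h"
    by (rule ext) (simp add: op_scale_def pm_scale_eq H_linear(2)[OF assms])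
  then have "act (h \<circ> op_scale c id) u = act (op_scale c id \<circ> h) u" by (simp only:)
  then show ?thesis by (simp only: act_left assms s V.id_H)
qed

lemma act_dlist: "ys \<noteq> [] \<Longrightarrow> act (dlist ys) (tens 1 v) = 0"
proof (induction ys rule: rev_induct)
  case (snoc y ys)
  have "dlist (ys @ [y]) = dlist ys \<circ> dunkl R Rp k y" for ys
  proof (induction ys)
    case Nil
    show ?case unfolding append.simps dlist_Cons dlist_Nil comp_id id_comp ..
  next
    case (Cons a ys)
    show ?case unfolding append.simps dlist_Cons Cons by (rule comp_assoc[symmetric])
  qed
  then have "act (dlist (ys @ [y])) (tens 1 v) = act (dlist ys) (act (dunkl R Rp k y) (tens 1 v))"
    by (simp only: act_left dlist_H V.dunkl_H)
  then show ?case by (simp only: act_Y_const act_right)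
qed simp

lemma act_term: assumes "w \<in> W"
  shows "act (mult_op p \<circ> (poly_act w \<circ> dlist ys)) (tens 1 v) = (if ys = [] then tens p (\<rho> w v) else 0)"
proof -
  note H = V.mult_H cherednik_comp[OF V.poly_act_H[OF assms] dlist_H] V.poly_act_H[OF assms] dlist_H
  show ?thesis
  proof (cases "ys = []")
    case True
    show ?thesis unfolding act_left(3)[OF H(1,2)] act_left(3)[OF H(3,4)] unfolding True dlist_Nil act_left(5) act_W_tens[OF assms] act_tens
      by simp
  next
    case False
    then show ?thesis unfolding act_left(3)[OF H(1,2)] act_left(3)[OF H(3,4)] by (simp add: act_dlist act_right)
  qed
qed

section \<open>Identification of the induced module\<close>

abbreviation "IR \<equiv> ind_rels R Rp k \<rho>"

lemma IR_sub: "pm.subspace IR"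
  unfolding ind_rels_def by (rule pm.subspace_span)

lemma IR_gen:
  "g \<in> HH \<Longrightarrow> h \<in> HH \<Longrightarrow> isym (g + h) v - isym g v - isym h v \<in> IR"
  "h \<in> HH \<Longrightarrow> isym (op_scale c h) v - pm_scale c (isym h v) \<in> IR"
  "h \<in> HH \<Longrightarrow> isym h (u + v) - isym h u - isym h v \<in> IR"
  "h \<in> HH \<Longrightarrow> isym h (c *s v) - pm_scale c (isym h v) \<in> IR"
  "h \<in> HH \<Longrightarrow> s \<in> dunkl_pos R Rp k \<Longrightarrow> isym (h \<circ> s) v \<in> IR"
  "h \<in> HH \<Longrightarrow> w \<in> W \<Longrightarrow> isym (h \<circ> poly_act w) v - isym h (\<rho> w v) \<in> IR"
  unfolding ind_rels_def by (rule pm.span_base; blast)+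

text \<open>Equality in the induced module.\<close>

definition ieq :: "('n, 'd) free_ind \<Rightarrow> ('n, 'd) free_ind \<Rightarrow> bool"
  where "ieq s t \<longleftrightarrow> s - t \<in> IR"

lemma ieq_refl: "ieq s s" by (simp add: ieq_def pm.subspace_0[OF IR_sub])
lemma ieq_sym: "ieq s t \<Longrightarrow> ieq t s"
  using pm.subspace_neg[OF IR_sub, of "s - t"] by (simp add: ieq_def)
lemma ieq_trans: "ieq s t \<Longrightarrow> ieq t u \<Longrightarrow> ieq s u"
  using pm.subspace_add[OF IR_sub, of "s - t" "t - u"] by (simp add: ieq_def)
lemma ieq_add: "ieq s t \<Longrightarrow> ieq s' t' \<Longrightarrow> ieq (s + s') (t + t')"
  using pm.subspace_add[OF IR_sub, of "s - t" "s' - t'"] by (simp add: ieq_def algebra_simps)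
lemma ieq_sum: "(\<And>i. i \<in> A \<Longrightarrow> ieq (f i) (g i)) \<Longrightarrow> ieq (sum f A) (sum g A)"
  by (induction A rule: infinite_finite_induct) (auto simp: ieq_refl intro: ieq_add)

lemma isym_ieq:
  "g \<in> HH \<Longrightarrow> h \<in> HH \<Longrightarrow> ieq (isym (g + h) v) (isym g v + isym h v)"
  "h \<in> HH \<Longrightarrow> ieq (isym (op_scale c h) v) (pm_scale c (isym h v))"
  "h \<in> HH \<Longrightarrow> ieq (isym h (u + v)) (isym h u + isym h v)"
  "h \<in> HH \<Longrightarrow> ieq (isym h (c *s v)) (pm_scale c (isym h v))"
  "h \<in> HH \<Longrightarrow> s \<in> dunkl_pos R Rp k \<Longrightarrow> ieq (isym (h \<circ> s) v) 0"
  "h \<in> HH \<Longrightarrow> w \<in> W \<Longrightarrow> ieq (isym (h \<circ> poly_act w) v) (isym h (\<rho> w v))"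
  using IR_gen by (simp_all only: ieq_def diff_diff_eq diff_zero)

lemma isym_zero: "ieq (isym 0 v) 0" "h \<in> HH \<Longrightarrow> ieq (isym h 0) 0"
proof -
  have "op_scale 0 0 = (0 :: 'n oper)" by (rule ext) (simp add: op_scale_def)
  then show "ieq (isym 0 v) 0" using isym_ieq(2)[OF V.zero_H, of 0 v] by simp
  show "h \<in> HH \<Longrightarrow> ieq (isym h 0) 0" using isym_ieq(4)[of h 0 0] by simp
qed

lemma dlist_pos: "ys \<noteq> [] \<Longrightarrow> dlist ys \<in> dunkl_pos R Rp k"
proof -
  assume "ys \<noteq> []"
  then have "length ys \<in> {1..}" by (cases ys) auto
  moreover have "dlist ys \<in> dunkl_hom R Rp k (length ys)"
    unfolding dunkl_hom_def dlist_def by (rule opr.span_base) blast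
  ultimately show ?thesis unfolding dunkl_pos_def by (intro opr.span_base) blast
qed

lemma ind_embed_tens: "ieq (ind_embed (tens p v)) (isym (mult_op p) v)"
proof -
  have m: "mult_op (tens p v $ i) = op_scale (v $ i) (mult_op p)" for i
    by (rule ext) (simp add: mult_op_def op_scale_def pm_scale_eq mult.assoc)
  have s: "ieq (\<Sum>i\<in>A. isym (mult_op p) (f i)) (isym (mult_op p) (sum f A))" for f :: "'d \<Rightarrow> complex^'d" and A
  proof (induction A rule: infinite_finite_induct)
    case (insert x F)
    have "ieq (isym (mult_op p) (f x) + (\<Sum>i\<in>F. isym (mult_op p) (f i))) (isym (mult_op p) (f x + sum f F))"
      by (rule ieq_trans[OF ieq_add[OF ieq_refl insert.IH] ieq_sym[OF isym_ieq(3)[OF V.mult_H]]])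
    then show ?case using insert by simp
  qed (simp_all add: ieq_sym[OF isym_zero(2)] V.mult_H)
  have "ieq (ind_embed (tens p v)) (\<Sum>i\<in>UNIV. pm_scale (v $ i) (isym (mult_op p) (axis i 1)))"
    unfolding ind_embed_def m by (intro ieq_sum isym_ieq(2) V.mult_H)
  also have "ieq \<dots> (\<Sum>i\<in>UNIV. isym (mult_op p) (v $ i *s axis i 1))"
    by (intro ieq_sum ieq_sym[OF isym_ieq(4)] V.mult_H)
  finally (ieq_trans) have "ieq (ind_embed (tens p v)) (\<Sum>i\<in>UNIV. isym (mult_op p) (v $ i *s axis i 1))" .
  then show ?thesis using s[of "\<lambda>i. v $ i *s axis i 1" UNIV] by (simp only: vec_expand[symmetric]) (rule ieq_trans)
qed

lemma ind_embed_add: "ieq (ind_embed (u + u')) (ind_embed u + ind_embed u')"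
proof -
  have "mult_op ((u + u') $ i) = mult_op (u $ i) + mult_op (u' $ i)" for i
    by (rule ext) (simp add: mult_op_def distrib_right)
  then show ?thesis unfolding ind_embed_def sum.distrib[symmetric]
    by (simp only:) (intro ieq_sum isym_ieq(1) V.mult_H)
qed

lemma ind_embed_zero: "ieq (ind_embed 0) 0"
  using ind_embed_tens[of 0 0] isym_zero(2)[OF V.mult_H, of 0] by (simp only: tens_simps) (rule ieq_trans)

text \<open>Surjectivity of \<open>ind_embed\<close> modulo the relations: by
  \<open>H_induct\<close> a symbol may be taken with p w T^b, where a Dunkl factor makes it vanish
  and w is moved over to the vector.\<close>

lemma isym_act: assumes "g \<in> HH" shows "ieq (isym g v) (ind_embed (act g (tens 1 v)))"
  using assms
proof (induction rule: H_induct)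
  case zero
  show ?case unfolding act_left by (rule ieq_trans[OF isym_zero(1) ieq_sym[OF ind_embed_zero]])
next
  case (add a b)
  show ?case unfolding act_left(1)[OF add(1,2)]
    by (rule ieq_trans[OF isym_ieq(1)[OF add(1,2)] ieq_trans[OF ieq_add[OF add(3,4)] ieq_sym[OF ind_embed_add]]])
next
  case (trm p w ys)
  note H = V.mult_H[of p] V.poly_act_H[OF trm] dlist_H[of ys]
  show ?case
  proof (cases "ys = []")
    case True
    have "ieq (isym (mult_op p \<circ> poly_act w) v) (isym (mult_op p) (\<rho> w v))"
      by (rule isym_ieq(6)[OF H(1) trm])
    then have "ieq (isym (mult_op p \<circ> poly_act w) v) (ind_embed (tens p (\<rho> w v)))"
      using ieq_sym[OF ind_embed_tens] by (rule ieq_trans)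
    moreover have "mult_op p \<circ> (poly_act w \<circ> dlist ys) = mult_op p \<circ> poly_act w"
      unfolding True dlist_Nil comp_id ..
    ultimately show ?thesis unfolding act_term[OF trm] using True by (simp only: if_True simp_thms)
  next
    case False
    have "ieq (isym ((mult_op p \<circ> poly_act w) \<circ> dlist ys) v) 0"
      by (rule isym_ieq(5)[OF cherednik_comp[OF H(1,2)] dlist_pos[OF False]])
    then have "ieq (isym ((mult_op p \<circ> poly_act w) \<circ> dlist ys) v) (ind_embed 0)"
      by (rule ieq_trans[OF _ ieq_sym[OF ind_embed_zero]])
    then show ?thesis unfolding act_term[OF trm] comp_assoc using False
      by (simp only: if_False simp_thms)
  qed
qed

definition lin_ext :: "('n oper \<Rightarrow> complex^'d \<Rightarrow> 'v) \<Rightarrow> (complex \<Rightarrow> 'v \<Rightarrow> 'v) \<Rightarrow> ('n, 'd) free_ind \<Rightarrow> 'v::ab_group_add"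
  where "lin_ext F sc t = (\<Sum>x\<in>Poly_Mapping.keys t. sc (Poly_Mapping.lookup t x) (F (fst x) (snd x)))"

lemma lin_ext_add:
  assumes "vector_space sc"
  shows "lin_ext F sc (s + t) = lin_ext F sc s + lin_ext F sc t"
proof -
  interpret v: vector_space sc by fact
  show ?thesis unfolding lin_ext_def
    by (rule setsum_keys_plus_distrib) (auto simp: v.scale_left_distrib)
qed

lemma lin_ext_isym: assumes "vector_space sc" shows "lin_ext F sc (isym g v) = F g v"
proof -
  interpret v: vector_space sc by fact
  show ?thesis by (simp add: lin_ext_def isym_def)
qed

lemma lin_ext_scale: assumes "vector_space sc" shows "lin_ext F sc (pm_scale c t) = sc c (lin_ext F sc t)"
proof -
  interpret v: vector_space sc by fact
  have "lin_ext F sc (pm_scale c t) = (\<Sum>x\<in>Poly_Mapping.keys t. sc (c * Poly_Mapping.lookup t x) (F (fst x) (snd x)))"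
    unfolding lin_ext_def lookup_pm_scale[symmetric]
    by (rule sum.mono_neutral_left) (auto simp: in_keys_iff lookup_pm_scale)
  then show ?thesis by (simp add: lin_ext_def v.scale_sum_right)
qed

lemma lin_ext_diff: assumes "vector_space sc" shows "lin_ext F sc (s - t) = lin_ext F sc s - lin_ext F sc t"
  using lin_ext_add[OF assms, of F "s - t" t] by simp

text \<open>A linear retraction of \<open>ind_embed\<close>. Since it vanishes on the relations, the
  embedding is injective modulo them.\<close>

definition unind :: "('n, 'd) free_ind \<Rightarrow> ('n, 'd) vpoly"
  where "unind = lin_ext (\<lambda>g v. act g (tens 1 v)) vp_scale"

lemmas unind_simps = lin_ext_add[OF vp.vector_space_axioms, of "\<lambda>g v. act g (tens 1 v)", folded unind_def]
  lin_ext_diff[OF vp.vector_space_axioms, of "\<lambda>g v. act g (tens 1 v)", folded unind_def]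
  lin_ext_scale[OF vp.vector_space_axioms, of "\<lambda>g v. act g (tens 1 v)", folded unind_def]
  lin_ext_isym[OF vp.vector_space_axioms, of "\<lambda>g v. act g (tens 1 v)", folded unind_def]

lemma act_zero_on: "s \<in> dunkl_pos R Rp k \<Longrightarrow> s \<in> HH \<and> act s (tens 1 v) = 0"
proof -
  have hom: "s \<in> HH \<and> act s (tens 1 v) = 0" if "s \<in> dunkl_hom R Rp k n" "n \<ge> 1" for n s
    using that unfolding dunkl_hom_def
  proof (induction rule: opr.span_induct_alt)
    case base
    then show ?case by (simp only: V.zero_H act_left)
  next
    case (step c x y)
    then obtain ys where "x = dlist ys" "ys \<noteq> []" unfolding dlist_def by force
    then have "x \<in> HH" "act x (tens 1 v) = 0" using dlist_H act_dlist by auto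
    then show ?case using step by (simp add: act_left V.scale_H cherednik_add del: plus_fun_apply)
  qed
  assume "s \<in> dunkl_pos R Rp k"
  then show ?thesis unfolding dunkl_pos_def
  proof (induction rule: opr.span_induct_alt)
    case base
    then show ?case by (simp only: V.zero_H act_left)
  next
    case (step c x y)
    then have "x \<in> HH" "act x (tens 1 v) = 0" using hom by auto
    then show ?case using step by (simp add: act_left V.scale_H cherednik_add del: plus_fun_apply)
  qed
qed

lemma unind_IR: "t \<in> IR \<Longrightarrow> unind t = 0"
  unfolding ind_rels_def
proof (induction rule: pm.span_induct_alt)
  case base
  show ?case by (simp add: unind_def lin_ext_def)
next
  case (step c x y)
  from step(1) have "unind x = 0"
  proof (elim UnE CollectE exE conjE)
    fix g h v assume "x = isym (g + h) v - isym g v - isym h v" "g \<in> HH" "h \<in> HH"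
    then show ?thesis by (simp only: unind_simps act_left) simp
  next
    fix c h v assume "x = isym (op_scale c h) v - pm_scale c (isym h v)" "h \<in> HH"
    then show ?thesis by (simp only: unind_simps act_left) simp
  next
    fix h u v assume "x = isym h (u + v) - isym h u - isym h v" "h \<in> HH"
    then show ?thesis by (simp only: unind_simps tens_simps act_right) simp
  next
    fix c h v assume "x = isym h (c *s v) - pm_scale c (isym h v)" "h \<in> HH"
    then show ?thesis by (simp only: unind_simps tens_simps act_scale_right) simp
  next
    fix h s v assume "x = isym (h \<circ> s) v" "h \<in> HH" "s \<in> dunkl_pos R Rp k"
    then show ?thesis using act_zero_on[of s v] by (simp only: unind_simps act_left act_right simp_thms)
  next
    fix h w v assume "x = isym (h \<circ> poly_act w) v - isym h (\<rho> w v)" "h \<in> HH" "w \<in> W"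
    then show ?thesis by (simp only: unind_simps act_left V.poly_act_H act_W_tens poly_act_simps) simp
  qed
  with step show ?case by (simp add: unind_simps)
qed

lemma unind_sum: "unind (sum f A) = (\<Sum>i\<in>A. unind (f i))"
proof (induction A rule: infinite_finite_induct)
qed (auto simp: unind_simps, simp_all add: unind_def lin_ext_def)

lemma unind_embed: "unind (ind_embed u) = u"
  unfolding ind_embed_def unind_sum unind_simps act_tens by (simp flip: vpoly_expand)

lemma ind_left_lin_ext: "ind_left h = lin_ext (\<lambda>g v. isym (h \<circ> g) v) pm_scale"
  by (rule ext) (simp only: ind_left_def lin_ext_def case_prod_unfold prod.collapse)

lemma ind_left_sum: "ind_left h (sum f A) = (\<Sum>i\<in>A. ind_left h (f i :: ('n, 'd) free_ind))"
  unfolding ind_left_lin_ext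
proof (induction A rule: infinite_finite_induct)
  case (insert x F)
  then show ?case by (simp add: lin_ext_add[OF pm.vector_space_axioms])
qed (simp_all add: lin_ext_def)

text \<open>By \<open>isym_act\<close> the vector \<open>act h u\<close> satisfies the defining
  condition of \<open>verma_act\<close>, and by \<open>unind\<close> no other vector does.\<close>

theorem verma_act_eq: assumes h: "h \<in> HH" shows "verma_act R Rp k \<rho> h u = act h u"
proof -
  have "ieq (ind_left h (ind_embed u)) (\<Sum>i\<in>UNIV. ind_embed (act h (tens (u $ i) (axis i 1))))" (is ?L)
    unfolding ind_embed_def[of u] ind_left_sum unfolding ind_left_lin_ext lin_ext_isym[OF pm.vector_space_axioms]
  proof (rule ieq_sum)
    fix i
    have "act h (tens (u $ i) (axis i 1)) = act (h \<circ> mult_op (u $ i)) (tens 1 (axis i 1))"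
      by (simp only: act_left h V.mult_H act_tens mult_1_right)
    then show "ieq (isym (h \<circ> mult_op (u $ i)) (axis i 1)) (ind_embed (act h (tens (u $ i) (axis i 1))))"
      using isym_act[OF cherednik_comp[OF h V.mult_H]] by simp
  qed
  have s: "ieq (\<Sum>i\<in>A. ind_embed (f i)) (ind_embed (sum f A))" for f :: "'d \<Rightarrow> ('n, 'd) vpoly" and A
  proof (induction A rule: infinite_finite_induct)
    case (insert x F)
    have "ieq (ind_embed (f x) + (\<Sum>i\<in>F. ind_embed (f i))) (ind_embed (f x + sum f F))"
      by (rule ieq_trans[OF ieq_add[OF ieq_refl insert.IH] ieq_sym[OF ind_embed_add]])
    then show ?case using insert by simp
  qed (simp_all add: ieq_sym[OF ind_embed_zero])
  have "(\<Sum>i\<in>UNIV. act h (tens (u $ i) (axis i 1))) = act h u"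
    by (subst (2) vpoly_expand[of u]) (simp only: act_right)
  with s[of "\<lambda>i. act h (tens (u $ i) (axis i 1))" UNIV]
  have "ieq (\<Sum>i\<in>UNIV. ind_embed (act h (tens (u $ i) (axis i 1)))) (ind_embed (act h u))" by (simp only:)
  with \<open>?L\<close> have "ieq (ind_left h (ind_embed u)) (ind_embed (act h u))"
    by (rule ieq_trans)
  then have e: "ind_left h (ind_embed u) - ind_embed (act h u) \<in> IR" unfolding ieq_def .
  show ?thesis unfolding verma_act_def
  proof (rule the_equality[where a = "act h u"], rule e)
    fix u' assume "ind_left h (ind_embed u) - ind_embed u' \<in> IR"
    then have "ieq (ind_embed u') (ind_embed (act h u))" using e unfolding ieq_def[symmetric] by (meson ieq_sym ieq_trans)
    then have "unind (ind_embed u' - ind_embed (act h u)) = 0" unfolding ieq_def by (rule unind_IR)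
    then show "u' = act h u" by (simp add: unind_simps unind_embed)
  qed
qed

end

section \<open>The projection onto the group algebra\<close>

lemma pos_polys_base: "p \<in> hom_polys n \<Longrightarrow> n \<ge> 1 \<Longrightarrow> p \<in> pos_polys"
  unfolding pos_polys_def by (rule pm.span_base) auto

lemma pos_polys_simps: "p \<in> pos_polys \<Longrightarrow> q \<in> pos_polys \<Longrightarrow> p + q \<in> pos_polys"
  "p \<in> pos_polys \<Longrightarrow> const_poly c * p \<in> pos_polys" "0 \<in> pos_polys"
  unfolding pos_polys_def pm_scale_eq[symmetric] by (rule pm.span_add pm.span_scale pm.span_zero; assumption?)+

lemma hom_single: "Poly_Mapping.single m c \<in> hom_polys (mdeg m)"
  by (simp add: hom_polys_def)

lemma pvar_mult_hom: "p \<in> hom_polys n \<Longrightarrow> pvar i * p \<in> hom_polys (Suc n)"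
  unfolding hom_polys_def
proof (intro CollectI ballI)
  fix m assume p: "p \<in> {p. \<forall>m\<in>Poly_Mapping.keys p. mdeg m = n}" and m: "m \<in> Poly_Mapping.keys (pvar i * p)"
  obtain a b where "m = a + b" "a \<in> Poly_Mapping.keys (pvar i)" "b \<in> Poly_Mapping.keys p"
    using keys_mult[of "pvar i" p] m by blast
  then show "mdeg m = Suc n" using p by (simp add: mdeg_add)
qed

lemma pvar_mult_pos: "p \<in> pos_polys \<Longrightarrow> pvar i * p \<in> pos_polys"
  unfolding pos_polys_def
proof (induction rule: pm.span_induct_alt)
  case base
  then show ?case by (simp add: pm.span_zero)
next
  case (step c x y)
  then obtain n where "x \<in> hom_polys n" by auto
  then have "pvar i * x \<in> pm.span (\<Union> (hom_polys ` {1..}))"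
    by (intro pm.span_base UN_I[of "Suc n"] pvar_mult_hom) auto
  then have "pm_scale c (pvar i * x) + pvar i * y \<in> pm.span (\<Union> (hom_polys ` {1..}))"
    using step by (intro pm.span_add pm.span_scale)
  moreover have "pvar i * (pm_scale c x + y) = pm_scale c (pvar i * x) + pvar i * y"
    by (simp add: pm_scale_eq distrib_left mult.left_commute)
  ultimately show ?case by (simp only:)
qed

lemma const_plus_pos: "\<exists>p'\<in>pos_polys. p = const_poly (pev 0 p) + p'"
proof (induction p rule: mpoly_induct)
  case (const c)
  then show ?case by (intro bexI[of _ 0]) (simp_all add: pos_polys_simps)
next
  case (add p q)
  then obtain p' q' where pq: "p' \<in> pos_polys" "p = const_poly (pev 0 p) + p'" "q' \<in> pos_polys" "q = const_poly (pev 0 q) + q'"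
    by blast
  have "p + q = (const_poly (pev 0 p) + p') + (const_poly (pev 0 q) + q')"
    by (rule arg_cong2[OF pq(2,4)])
  also have "\<dots> = const_poly (pev 0 (p + q)) + (p' + q')" by (simp add: algebra_simps)
  finally show ?case using pos_polys_simps(1)[OF pq(1,3)] by blast
next
  case (var i p)
  then obtain p' where p': "p' \<in> pos_polys" "p = const_poly (pev 0 p) + p'" by blast
  have "pvar i \<in> pos_polys" using hom_single[of "Poly_Mapping.single i 1" 1] by (intro pos_polys_base) auto
  then have "const_poly (pev 0 p) * pvar i + pvar i * p' \<in> pos_polys"
    using p' by (intro pos_polys_simps pvar_mult_pos)
  also have "const_poly (pev 0 p) * pvar i + pvar i * p' = pvar i * p"
    by (subst (2) p'(2)) (simp add: algebra_simps)
  finally show ?case by (intro bexI[of _ "pvar i * p"]) simp_all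
qed

lemma pev_0_hom: "p \<in> hom_polys n \<Longrightarrow> n \<ge> 1 \<Longrightarrow> pev 0 p = 0"
proof -
  assume p: "p \<in> hom_polys n" "n \<ge> 1"
  have "(\<Prod>i\<in>UNIV. complex_of_real ((0 :: real^'a) $ i) ^ Poly_Mapping.lookup m i) = 0" if m: "m \<in> Poly_Mapping.keys p" for m
  proof -
    have "mdeg m \<noteq> 0" using p m by (auto simp: hom_polys_def)
    then obtain i where "Poly_Mapping.lookup m i \<noteq> 0" unfolding mdeg_def by (meson sum.neutral)
    then show ?thesis by (intro prod_zero) auto
  qed
  then show ?thesis unfolding pev_expand by (intro sum.neutral) auto
qed

lemma pev_0_pos: "p \<in> pos_polys \<Longrightarrow> pev 0 p = 0"
  unfolding pos_polys_def
proof (induction rule: pm.span_induct_alt)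
  case (step c x y)
  then show ?case using pev_0_hom by (auto simp: pm_scale_eq)
qed simp

lemma sum_fun_apply: "sum f A x = (\<Sum>i\<in>A. f i x)"
  by (induction A rule: infinite_finite_induct) auto

context root_params
begin

text \<open>An upper bound for \<open>pi_kernel\<close> that can be recognised from normal form
  coefficients: no bare group element occurs with a nonzero constant term. Independence of normal
  forms then separates it from the group algebra.\<close>

definition "K0 = {app (P.NF c) | c. Poly_Mapping.keys c \<subseteq> W \<times> UNIV \<and> (\<forall>w. pev 0 (Poly_Mapping.lookup c (w, 0)) = 0)}"

lemma K0_add: "a \<in> K0 \<Longrightarrow> b \<in> K0 \<Longrightarrow> a + b \<in> K0"
proof -
  assume "a \<in> K0" "b \<in> K0"
  then obtain c d where c: "a = app (P.NF c)" "Poly_Mapping.keys c \<subseteq> W \<times> UNIV" "\<forall>w. pev 0 (Poly_Mapping.lookup c (w, 0)) = 0"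
    and d: "b = app (P.NF d)" "Poly_Mapping.keys d \<subseteq> W \<times> UNIV" "\<forall>w. pev 0 (Poly_Mapping.lookup d (w, 0)) = 0"
    unfolding K0_def by blast
  have "a + b = app (P.NF (c + d))" by (rule ext) (simp add: c(1) d(1) P.NF_add)
  moreover have "Poly_Mapping.keys (c + d) \<subseteq> W \<times> UNIV" using keys_add[of c d] c(2) d(2) by blast
  moreover have "\<forall>w. pev 0 (Poly_Mapping.lookup (c + d) (w, 0)) = 0" using c(3) d(3) by (simp add: lookup_add)
  ultimately show ?thesis unfolding K0_def by blast
qed

lemma K0_zero: "0 \<in> K0"
proof -
  have "0 = app (P.NF 0)" by (rule ext) (simp add: P.NF_zero)
  then show ?thesis unfolding K0_def by (intro CollectI exI[of _ 0]) simp
qed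

lemma K0_term: assumes "w \<in> W" "b \<noteq> 0 \<or> pev 0 q = 0" shows "app (eX q * (eW w * P.Ymon b)) \<in> K0"
proof -
  have "app (eX q * (eW w * P.Ymon b)) = app (P.NF (Poly_Mapping.single (w, b) q))" by (simp only: P.NF_single P_Xp)
  moreover have "\<forall>w'. pev 0 (Poly_Mapping.lookup (Poly_Mapping.single (w, b) q) (w', 0)) = 0"
    using assms(2) by (auto simp: lookup_single when_def)
  moreover have "Poly_Mapping.keys (Poly_Mapping.single (w, b) q) \<subseteq> W \<times> UNIV" using assms(1) by simp
  ultimately show ?thesis unfolding K0_def by blast
qed

lemma app_sum_fun: "app (sum f A) = (\<Sum>i\<in>A. app (f i))"
proof (induction A rule: infinite_finite_induct)
  case (insert x F)
  show ?case unfolding sum.insert[OF insert.hyps] insert.IH[symmetric] by (rule ext) simp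
qed (auto simp: fun_eq_iff)

lemma K0_sum: "(\<And>i. i \<in> A \<Longrightarrow> f i \<in> K0) \<Longrightarrow> sum f A \<in> K0"
  by (induction A rule: infinite_finite_induct) (auto intro: K0_add K0_zero simp del: plus_fun_apply)

lemma K0_left: assumes "h \<in> cherednik R Rp k" "p \<in> pos_polys" shows "mult_op p \<circ> h \<in> K0"
proof -
  obtain c where c: "Poly_Mapping.keys c \<subseteq> W \<times> UNIV" "h = app (P.NF c)" using hrel_Endo[OF assms(1)] .
  have "eX p * P.NF c = (\<Sum>x\<in>Poly_Mapping.keys c. eX (p * Poly_Mapping.lookup c x) * (eW (fst x) * P.Ymon (snd x)))"
    unfolding P.NF_def sum_distrib_left P_Xp by (simp only: eX_simps mult.assoc)
  moreover have "mult_op p \<circ> h = app (eX p * P.NF c)" by (rule ext) (simp add: c mult_op_def)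
  ultimately have e: "mult_op p \<circ> h = (\<Sum>x\<in>Poly_Mapping.keys c. app (eX (p * Poly_Mapping.lookup c x) * (eW (fst x) * P.Ymon (snd x))))"
    by (simp only: app_sum_fun)
  show ?thesis unfolding e
    by (intro K0_sum K0_term) (use c pev_0_pos[OF assms(2)] in auto)
qed

text \<open>The Dunkl operators commute, so T_y on the right raises an exponent in every term of the
  normal form and no term free of them is left.\<close>

lemma K0_right1: assumes "h \<in> cherednik R Rp k" shows "h \<circ> dunkl R Rp k y \<in> K0"
proof -
  obtain c where c: "Poly_Mapping.keys c \<subseteq> W \<times> UNIV" "h = app (P.NF c)" using hrel_Endo[OF assms(1)] .
  have "P.Ymon b * eY y = (\<Sum>i\<in>UNIV. eK (y $ i) * P.Ymon (Poly_Mapping.single i 1 + b))" for b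
  proof -
    have "P.Ymon b * eY y = eY y * P.Ymon b"
    proof (induction b rule: monomial_induct)
      case (step i m)
      show ?case unfolding P.ye.mon_ev_Suc by (simp only: mult.assoc step) (simp only: mult.assoc[symmetric] P.YY[of y])
    qed simp
    also have "\<dots> = (\<Sum>i\<in>UNIV. eK (y $ i) * eY (axis i 1)) * P.Ymon b"
      by (rule arg_cong[where f = "\<lambda>r. r * P.Ymon b"], rule P.Y_expand)
    finally show ?thesis by (simp only: sum_distrib_right mult.assoc P.ye.mon_ev_Suc)
  qed
  then have "P.NF c * eY y = (\<Sum>x\<in>Poly_Mapping.keys c. \<Sum>i\<in>UNIV. eX (Poly_Mapping.lookup c x) * (eW (fst x) * (eK (y $ i) * P.Ymon (Poly_Mapping.single i 1 + snd x))))"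
    unfolding P.NF_def sum_distrib_right P_Xp by (simp only: mult.assoc sum_distrib_left)
  also have "\<dots> = (\<Sum>x\<in>Poly_Mapping.keys c. \<Sum>i\<in>UNIV. eX (Poly_Mapping.lookup c x * const_poly (y $ i)) * (eW (fst x) * P.Ymon (Poly_Mapping.single i 1 + snd x)))"
  proof (intro sum.cong refl)
    fix x i assume "x \<in> Poly_Mapping.keys c"
    then have w: "fst x \<in> W" using c by auto
    show "eX (Poly_Mapping.lookup c x) * (eW (fst x) * (eK (y $ i) * P.Ymon (Poly_Mapping.single i 1 + snd x)))
      = eX (Poly_Mapping.lookup c x * const_poly (y $ i)) * (eW (fst x) * P.Ymon (Poly_Mapping.single i 1 + snd x))"
      unfolding eX_simps eK_def[symmetric] mult.assoc[symmetric] by (simp only: mult.assoc P.\<kappa>_W[OF w])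
  qed
  finally have e: "h \<circ> dunkl R Rp k y = (\<Sum>x\<in>Poly_Mapping.keys c. \<Sum>i\<in>UNIV. app (eX (Poly_Mapping.lookup c x * const_poly (y $ i)) * (eW (fst x) * P.Ymon (Poly_Mapping.single i 1 + snd x))))"
  proof -
    assume a: "P.NF c * eY y = (\<Sum>x\<in>Poly_Mapping.keys c. \<Sum>i\<in>UNIV. eX (Poly_Mapping.lookup c x * const_poly (y $ i)) * (eW (fst x) * P.Ymon (Poly_Mapping.single i 1 + snd x)))"
    have "h \<circ> dunkl R Rp k y = app (P.NF c * eY y)" by (rule ext) (simp add: c)
    then show ?thesis unfolding a by (simp only: app_sum_fun)
  qed
  have nz: "Poly_Mapping.single i 1 + m \<noteq> 0" for i :: 'n and m :: "'n \<Rightarrow>\<^sub>0 nat"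
    using mdeg_add[of "Poly_Mapping.single i 1" m] by auto
  show ?thesis unfolding e
  proof (intro K0_sum K0_term disjI1 nz)
    fix x assume "x \<in> Poly_Mapping.keys c"
    then show "fst x \<in> W" using c(1) by auto
  qed
qed

lemma comp_add_right: "h \<in> cherednik R Rp k \<Longrightarrow> h \<circ> (a + b) = (h \<circ> a) + (h \<circ> b)"
  by (rule ext) (simp add: H_linear)

lemma dlist_snoc: "dlist (ys @ [y]) = dlist ys \<circ> dunkl R Rp k y"
proof (induction ys)
  case Nil
  show ?case unfolding append.simps dlist_Cons dlist_Nil comp_id id_comp ..
next
  case (Cons a ys)
  show ?case unfolding append.simps dlist_Cons Cons by (rule comp_assoc[symmetric])
qed

lemma comp_zero_right: assumes "h \<in> cherednik R Rp k" shows "h \<circ> 0 = (0 :: 'n oper)"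
  using H_linear(1)[OF assms, of 0 0] by (auto simp: fun_eq_iff)


lemma scale_comp_left: "op_scale c (h \<circ> a) = op_scale c h \<circ> a"
  by (rule ext) (simp add: op_scale_def)

lemma K0_right: assumes "s \<in> dunkl_pos R Rp k" "h \<in> cherednik R Rp k" shows "h \<circ> s \<in> K0"
proof -
  have hom: "h \<circ> s \<in> K0" if s: "s \<in> dunkl_hom R Rp k n" and n: "n \<ge> 1" and h: "h \<in> cherednik R Rp k" for n s h
    using s unfolding dunkl_hom_def
  proof (induction rule: opr.span_induct_alt)
    case base
    then show ?case by (simp only: comp_zero_right[OF h] K0_zero)
  next
    case (step c x y)
    then obtain ys where ys: "x = dlist ys" "ys \<noteq> []" using n unfolding dlist_def by force
    obtain zs a where zs: "ys = zs @ [a]" using ys(2) by (cases ys rule: rev_cases) auto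
    have "op_scale c h \<circ> (dlist zs \<circ> dunkl R Rp k a) \<in> K0"
      unfolding comp_assoc[symmetric] by (intro K0_right1 cherednik_comp cherednik_scale h dlist_H)
    moreover have "h \<circ> op_scale c x = op_scale c h \<circ> (dlist zs \<circ> dunkl R Rp k a)"
      unfolding ys zs dlist_snoc by (rule ext) (simp add: op_scale_def pm_scale_eq H_linear(2)[OF h])
    ultimately have "h \<circ> op_scale c x \<in> K0" by (simp only:)
    then show ?case unfolding comp_add_right[OF h] using step(2) by (rule K0_add)
  qed
  show ?thesis using assms(1) unfolding dunkl_pos_def
  proof (induction rule: opr.span_induct_alt)
    case base
    then show ?case by (simp only: comp_zero_right[OF assms(2)] K0_zero)
  next
    case (step c x y)
    then obtain n where n: "x \<in> dunkl_hom R Rp k n" "n \<ge> 1" by auto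
    have "op_scale c h \<circ> x \<in> K0" using hom[OF n cherednik_scale[OF assms(2)]] .
    moreover have "h \<circ> op_scale c x = op_scale c h \<circ> x"
      by (rule ext) (simp add: op_scale_def pm_scale_eq H_linear(2)[OF assms(2)])
    ultimately have "h \<circ> op_scale c x \<in> K0" by (simp only:)
    then show ?case unfolding comp_add_right[OF assms(2)] using step(2) by (rule K0_add)
  qed
qed

lemma pi_kernel_K0: "g \<in> pi_kernel R Rp k \<Longrightarrow> g \<in> K0"
  unfolding pi_kernel_def
proof (induction rule: opr.span_induct_alt)
  case base
  show ?case by (rule K0_zero)
next
  case (step c x y)
  from step(1) have "op_scale c x \<in> K0"
  proof (elim UnE CollectE exE conjE)
    fix p h assume x: "x = mult_op p \<circ> h" "p \<in> pos_polys" "h \<in> cherednik R Rp k"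
    have "op_scale c x = mult_op (const_poly c * p) \<circ> h"
      by (rule ext) (simp add: x op_scale_def mult_op_def pm_scale_eq mult.assoc)
    then show ?thesis using K0_left[OF x(3) pos_polys_simps(2)[OF x(2)]] by (simp only:)
  next
    fix h s assume x: "x = h \<circ> s" "h \<in> cherednik R Rp k" "s \<in> dunkl_pos R Rp k"
    show ?thesis unfolding x(1) scale_comp_left by (rule K0_right[OF x(3) cherednik_scale[OF x(2)]])
  qed
  then show ?case using step(2) by (rule K0_add)
qed

text \<open>The normal form d of the group algebra element has the constants f w as coefficients at
  exponent 0. It must coincide with a normal form from \<open>K0\<close>, whose coefficients there
  have no constant term.\<close>

lemma grp_alg_kernel:
  assumes f: "f \<in> grp_alg R" and g: "grp_alg_op R f \<in> pi_kernel R Rp k"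
  shows "f = (\<lambda>_. 0)"
proof -
  define d :: "('n lin \<times> ('n \<Rightarrow>\<^sub>0 nat)) \<Rightarrow>\<^sub>0 'n mpoly" where "d = (\<Sum>w\<in>W. Poly_Mapping.single (w, 0) (const_poly (f w)))"
  obtain c where c: "grp_alg_op R f = app (P.NF c)" "Poly_Mapping.keys c \<subseteq> W \<times> UNIV" "\<forall>w. pev 0 (Poly_Mapping.lookup c (w, 0)) = 0"
    using pi_kernel_K0[OF g] unfolding K0_def by blast
  have s: "P.NF (sum h A) = (\<Sum>x\<in>A. P.NF (h x))" for h :: "'n lin \<Rightarrow> _" and A
    by (induction A rule: infinite_finite_induct) (auto simp: P.NF_zero P.NF_add)
  have "app (P.NF d) = app (P.NF c)"
  proof (rule ext)
    fix p
    have "app (P.NF d) p = (\<Sum>w\<in>W. const_poly (f w) * poly_act w p)"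
      by (simp add: d_def s P.NF_single P_Xp app_sum_left)
    also have "\<dots> = grp_alg_op R f p"
      by (simp add: grp_alg_op_def sum_fun_apply op_scale_def pm_scale_eq)
    finally show "app (P.NF d) p = app (P.NF c) p" using c by simp
  qed
  then have z: "P.NF (d - c) = 0" by (simp add: P.NF_diff app_inject)
  have kd: "Poly_Mapping.keys d \<subseteq> W \<times> UNIV"
  proof
    fix x assume "x \<in> Poly_Mapping.keys d"
    then have "(\<Sum>w\<in>W. Poly_Mapping.lookup (Poly_Mapping.single (w, 0 :: 'n \<Rightarrow>\<^sub>0 nat) (const_poly (f w) :: 'n mpoly)) x) \<noteq> 0"
      by (simp add: in_keys_iff d_def lookup_sum)
    then obtain w where "w \<in> W" "Poly_Mapping.lookup (Poly_Mapping.single (w, 0 :: 'n \<Rightarrow>\<^sub>0 nat) (const_poly (f w) :: 'n mpoly)) x \<noteq> 0"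
      by (meson sum.neutral)
    then show "x \<in> W \<times> UNIV" by (auto simp: lookup_single when_def split: if_splits)
  qed
  have "Poly_Mapping.keys (d - c) \<subseteq> W \<times> UNIV"
  proof
    fix x assume "x \<in> Poly_Mapping.keys (d - c)"
    then have "x \<in> Poly_Mapping.keys c \<or> x \<in> Poly_Mapping.keys d" by (auto simp: in_keys_iff lookup_minus)
    then show "x \<in> W \<times> UNIV" using c(2) kd by blast
  qed
  then have "d - c = 0" using z by (rule P_NF_independent)
  then have "d = c" by simp
  show ?thesis
  proof (rule ext)
    fix w
    show "f w = 0"
    proof (cases "w \<in> W")
      case True
      have "Poly_Mapping.lookup d (w, 0) = (\<Sum>w'\<in>W. if w' = w then const_poly (f w) else 0)"
        unfolding d_def lookup_sum by (intro sum.cong) (auto simp: lookup_single when_def)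
      then have "Poly_Mapping.lookup d (w, 0) = const_poly (f w)" using True W_finite by simp
      then show ?thesis using c(3)[rule_format, of w] unfolding \<open>d = c\<close> by simp
    next
      case False
      then show ?thesis using f by (simp add: grp_alg_def)
    qed
  qed
qed

lemma grp_alg_op_H: "grp_alg_op R f \<in> cherednik R Rp k"
  unfolding grp_alg_op_def by (intro P.H_sum cherednik_scale cherednik_weyl)

lemma grp_alg_op_add: "grp_alg_op R (\<lambda>w. f w + g w) = grp_alg_op R f + grp_alg_op R g"
  by (rule ext) (simp add: grp_alg_op_def sum_fun_apply op_scale_def pm.scale_left_distrib sum.distrib)

lemma grp_alg_op_diff: "grp_alg_op R (\<lambda>w. f w - g w) = grp_alg_op R f - grp_alg_op R g"
  by (rule ext) (simp add: grp_alg_op_def sum_fun_apply op_scale_def pm.scale_left_diff_distrib sum_subtractf)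

lemma pi_kernel_sub: "opr.subspace (pi_kernel R Rp k)"
  unfolding pi_kernel_def by (rule opr.subspace_span)

lemma pi_exists: assumes "h \<in> cherednik R Rp k"
  shows "\<exists>f. f \<in> grp_alg R \<and> h - grp_alg_op R f \<in> pi_kernel R Rp k"
  using assms
proof (induction rule: H_induct)
  case zero
  have "0 - grp_alg_op R (\<lambda>_. 0) = (0 :: 'n oper)" by (rule ext) (simp add: grp_alg_op_def sum_fun_apply op_scale_def)
  then have "0 - grp_alg_op R (\<lambda>_. 0) \<in> pi_kernel R Rp k"
    using opr.subspace_0[OF pi_kernel_sub] by (simp only:)
  then show ?case by (intro exI[of _ "\<lambda>_. 0"]) (simp only: grp_alg_def mem_Collect_eq simp_thms)
next
  case (add a b)
  then obtain f g where fg: "f \<in> grp_alg R" "a - grp_alg_op R f \<in> pi_kernel R Rp k" "g \<in> grp_alg R" "b - grp_alg_op R g \<in> pi_kernel R Rp k"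
    by blast
  have "a + b - grp_alg_op R (\<lambda>w. f w + g w) = (a - grp_alg_op R f) + (b - grp_alg_op R g)"
    unfolding grp_alg_op_add by (rule add_diff_add)
  then have "a + b - grp_alg_op R (\<lambda>w. f w + g w) \<in> pi_kernel R Rp k"
    using opr.subspace_add[OF pi_kernel_sub fg(2,4)] by (simp only:)
  moreover have "(\<lambda>w. f w + g w) \<in> grp_alg R" using fg by (simp add: grp_alg_def)
  ultimately show ?case by blast
next
  case (trm p w ys)
  \<comment> \<open>A product with Dunkl factors has no group part, and p w has the group part p(0)
    w.\<close>
  define f where "f w' = (if ys = [] \<and> w' = w then pev 0 p else 0)" for w'
  have fg: "f \<in> grp_alg R" using trm by (auto simp: grp_alg_def f_def)
  have "(mult_op p \<circ> (poly_act w \<circ> dlist ys)) - grp_alg_op R f \<in> pi_kernel R Rp k"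
  proof (cases "ys = []")
    case True
    obtain p' where p': "p' \<in> pos_polys" "p = const_poly (pev 0 p) + p'" using const_plus_pos by blast
    have "grp_alg_op R f q = const_poly (pev 0 p) * poly_act w q" for q
    proof -
      have "grp_alg_op R f q = (\<Sum>w'\<in>W. if w' = w then const_poly (pev 0 p) * poly_act w q else 0)"
        unfolding grp_alg_op_def sum_fun_apply by (intro sum.cong) (auto simp: f_def True op_scale_def pm_scale_eq)
      then show ?thesis using trm W_finite by simp
    qed
    moreover have "p * q = const_poly (pev 0 p) * q + p' * q" for q
      by (subst p'(2)) (simp add: distrib_right)
    ultimately have "(mult_op p \<circ> (poly_act w \<circ> dlist ys)) - grp_alg_op R f = mult_op p' \<circ> poly_act w"
      by (intro ext) (simp add: True dlist_Nil mult_op_def)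
    moreover have "mult_op p' \<circ> poly_act w \<in> pi_kernel R Rp k"
      unfolding pi_kernel_def using p'(1) P.poly_act_H[OF trm] by (intro opr.span_base) blast
    ultimately show ?thesis by (simp only:)
  next
    case False
    have f0: "f = (\<lambda>_. 0)" using False by (auto simp: f_def)
    have "(mult_op p \<circ> (poly_act w \<circ> dlist ys)) - grp_alg_op R f = (mult_op p \<circ> poly_act w) \<circ> dlist ys"
      by (rule ext) (simp add: f0 grp_alg_op_def sum_fun_apply op_scale_def)
    moreover have "dlist ys \<in> dunkl_pos R Rp k"
    proof -
      have "length ys \<in> {1..}" using False by (cases ys) auto
      moreover have "dlist ys \<in> dunkl_hom R Rp k (length ys)"
        unfolding dunkl_hom_def dlist_def by (rule opr.span_base) blast
      ultimately show ?thesis unfolding dunkl_pos_def by (intro opr.span_base) blast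
    qed
    then have "(mult_op p \<circ> poly_act w) \<circ> dlist ys \<in> pi_kernel R Rp k"
      unfolding pi_kernel_def using cherednik_comp[OF P.mult_H P.poly_act_H[OF trm]] by (intro opr.span_base) blast
    ultimately show ?thesis by (simp only:)
  qed
  then show ?case using fg by blast
qed

lemma pi_proj_spec: assumes "h \<in> cherednik R Rp k"
  shows "h - grp_alg_op R (pi_proj R Rp k h) \<in> pi_kernel R Rp k"
proof -
  have "\<exists>!f. f \<in> grp_alg R \<and> h - grp_alg_op R f \<in> pi_kernel R Rp k"
  proof (rule ex_ex1I[OF pi_exists[OF assms]])
    fix f g assume fg: "f \<in> grp_alg R \<and> h - grp_alg_op R f \<in> pi_kernel R Rp k" "g \<in> grp_alg R \<and> h - grp_alg_op R g \<in> pi_kernel R Rp k"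
    have "grp_alg_op R (\<lambda>w. f w - g w) = (h - grp_alg_op R g) - (h - grp_alg_op R f)"
      unfolding grp_alg_op_diff by (rule ext) simp
    then have "grp_alg_op R (\<lambda>w. f w - g w) \<in> pi_kernel R Rp k"
      using opr.subspace_diff[OF pi_kernel_sub] fg by (simp only:)
    moreover have "(\<lambda>w. f w - g w) \<in> grp_alg R" using fg by (simp add: grp_alg_def)
    ultimately have "(\<lambda>w. f w - g w) = (\<lambda>_. 0)" by (intro grp_alg_kernel)
    then show "f = g" by (auto simp: fun_eq_iff)
  qed
  from theI'[OF this] show ?thesis unfolding pi_proj_def by blast
qed

end

section \<open>The contravariant form\<close>

text \<open>The projection of P tensor V onto its part of degree zero, identified with V.\<close>

definition ev0 :: "('n::finite, 'd::finite) vpoly \<Rightarrow> complex^'d"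
  where "ev0 u = (\<chi> i. pev 0 (u $ i))"

lemma ev0_simps: "ev0 (u + u') = ev0 u + ev0 u'" "ev0 (u - u') = ev0 u - ev0 u'" "ev0 0 = 0"
  "ev0 (vp_scale c u) = c *s ev0 u" "ev0 (tens p v) = pev 0 p *s v"
  by (simp_all add: ev0_def vec_eq_iff mult.commute)

lemma ev0_sum: "ev0 (sum f A) = (\<Sum>i\<in>A. ev0 (f i))"
  by (induction A rule: infinite_finite_induct) (simp_all add: ev0_simps)

locale verma_forms = verma R Rp k z \<rho>
  for R Rp :: "(real^'n::finite) set" and k :: "real^'n \<Rightarrow> complex" and z :: "'n \<Rightarrow> real^'n"
    and \<rho> :: "('n, 'd::finite) rep" +
  fixes b :: "complex^'d \<Rightarrow> complex^'d \<Rightarrow> complex" and v :: "complex^'d"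
  assumes irr: "irreducible_rep R \<rho>" and form_b: "nondeg_sym_inv_form R \<rho> b" and v_nz: "v \<noteq> 0"
begin

lemma b_sym: "b x y = b y x" and b_inv: "w \<in> W \<Longrightarrow> b (\<rho> w x) (\<rho> w y) = b x y"
  and b_nondeg: "(\<And>y. b x y = 0) \<Longrightarrow> x = 0" and b_lin: "Vector_Spaces.linear (*s) (*) (b x)"
  using form_b unfolding nondeg_sym_inv_form_def by blast+

lemma b_right: "b x (y + y') = b x y + b x y'" "b x (y - y') = b x y - b x y'" "b x (c *s y) = c * b x y" "b x 0 = 0"
  "b x (sum f A) = (\<Sum>i\<in>A. b x (f i))"
proof -
  interpret l: Vector_Spaces.linear "(*s)" "(*)" "b x" by (rule b_lin)
  show "b x (y + y') = b x y + b x y'" "b x (y - y') = b x y - b x y'" "b x (c *s y) = c * b x y" "b x 0 = 0"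
    "b x (sum f A) = (\<Sum>i\<in>A. b x (f i))"
    by (rule l.add l.diff l.scale l.zero l.sum)+
qed

lemma b_left: "b (y + y') x = b y x + b y' x" "b (c *s y) x = c * b y x" "b (sum f A) x = (\<Sum>i\<in>A. b (f i) x)"
proof -
  show "b (y + y') x = b y x + b y' x"
    using b_right(1)[of x y y'] unfolding b_sym[of x "y + y'"] b_sym[of x y] b_sym[of x y'] .
  show "b (c *s y) x = c * b y x"
    using b_right(3)[of x c y] unfolding b_sym[of x "c *s y"] b_sym[of x y] .
  have "b (sum f A) x = (\<Sum>i\<in>A. b x (f i))" unfolding b_sym[of "sum f A" x] by (rule b_right)
  also have "\<dots> = (\<Sum>i\<in>A. b (f i) x)" by (intro sum.cong refl b_sym)
  finally show "b (sum f A) x = (\<Sum>i\<in>A. b (f i) x)" .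
qed

lemma b_expand: "b x y = (\<Sum>i\<in>UNIV. x $ i * b (axis i 1) y)"
proof -
  have "b x y = b (\<Sum>i\<in>UNIV. x $ i *s axis i 1) y" by (simp flip: vec_expand)
  then show ?thesis by (simp only: b_left)
qed

lemma rho_inv: "w \<in> W \<Longrightarrow> \<rho> w (\<rho> (inv w) x) = x" "w \<in> W \<Longrightarrow> \<rho> (inv w) (\<rho> w x) = x"
  using fun_cong[OF rho_comp[of w "inv w"], of x] fun_cong[OF rho_comp[of "inv w" w], of x]
  by (simp_all only: W_inv rho_id comp_apply id_apply)

lemma b_adj: assumes "w \<in> W" shows "b x (\<rho> (inv w) y) = b (\<rho> w x) y"
  using b_inv[OF assms, of x "\<rho> (inv w) y"] rho_inv(1)[OF assms] by simp

text \<open>The shape in which irreducibility is applied: a linear condition stable under W that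
  holds for one nonzero vector holds for all vectors.\<close>

lemma invariant_subspace:
  assumes "vec.subspace U" "\<And>w u. w \<in> W \<Longrightarrow> u \<in> U \<Longrightarrow> \<rho> w u \<in> U" "u \<in> U" "u \<noteq> 0"
  shows "U = UNIV"
proof -
  have "\<rho> w ` U \<subseteq> U" if "w \<in> W" for w using assms(2)[OF that] by blast
  then have "U = {0} \<or> U = UNIV" using irr assms(1) unfolding irreducible_rep_def by blast
  with assms(3,4) show ?thesis by blast
qed

lemma ev0_W: assumes "w \<in> W" shows "ev0 (act (poly_act w) u) = \<rho> w (ev0 u)"
proof -
  have p0: "pev 0 (poly_act w p) = pev 0 p" for p
  proof -
    have "adjoint w 0 = 0" using adjoint_linear[OF W_linear[OF assms]] by (rule linear_0)
    then show ?thesis by (simp add: pev_poly_act W_linear[OF assms])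
  qed
  have "ev0 (act (poly_act w) u) = (\<Sum>j\<in>UNIV. pev 0 (u $ j) *s \<rho> w (axis j 1))"
    by (simp only: act_W[OF assms] tens_act_def ev0_sum ev0_simps p0)
  also have "\<dots> = \<rho> w (ev0 u)"
    by (subst rho_expand[OF assms, of "ev0 u"]) (simp add: ev0_def)
  finally show ?thesis .
qed

lemma ev0_mult: "ev0 (act (mult_op p) u) = pev 0 p *s ev0 u"
  by (simp add: ev0_def vec_eq_iff)

text \<open>The u for which 1 tensor u is reached from 1 tensor v form a W-stable subspace
  containing v, hence all of V; multiplications reach the rest. This supplies the representatives a
  and a' that \<open>verma_form\<close> asks for.\<close>

lemma cyclic: "\<exists>a\<in>HH. act a (tens 1 v) = x"
proof -
  let ?U = "{u. \<exists>a\<in>HH. act a (tens 1 v) = tens 1 u}"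
  have "?U = UNIV"
  proof (rule invariant_subspace[where u = v])
    show "vec.subspace ?U"
    proof (rule vec.subspaceI)
      show "0 \<in> ?U" by (intro CollectI bexI[OF _ V.zero_H]) (simp only: act_left tens_simps)
    next
      fix x y assume "x \<in> ?U" "y \<in> ?U"
      then obtain a b where "a \<in> HH" "act a (tens 1 v) = tens 1 x" "b \<in> HH" "act b (tens 1 v) = tens 1 y" by blast
      then show "x + y \<in> ?U"
        by (intro CollectI bexI[of _ "a + b"]) (simp_all only: act_left tens_simps cherednik_add)
    next
      fix c x assume "x \<in> ?U"
      then obtain a where "a \<in> HH" "act a (tens 1 v) = tens 1 x" by blast
      then show "c *s x \<in> ?U"
        by (intro CollectI bexI[of _ "op_scale c a"]) (simp_all only: act_left tens_simps cherednik_scale)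
    qed
    show "v \<in> ?U" by (intro CollectI bexI[OF _ V.id_H]) (simp only: act_left)
    fix w u assume w: "w \<in> W" and "u \<in> ?U"
    then obtain a where a: "a \<in> HH" "act a (tens 1 v) = tens 1 u" by blast
    have "act (poly_act w \<circ> a) (tens 1 v) = tens 1 (\<rho> w u)"
      by (simp only: act_left V.poly_act_H w a act_W_tens poly_act_simps)
    then show "\<rho> w u \<in> ?U" using cherednik_comp[OF V.poly_act_H[OF w] a(1)] by blast
  qed (rule v_nz)
  then have "\<exists>a. a \<in> HH \<and> act a (tens 1 v) = tens 1 u" for u by blast
  then obtain a where a: "\<And>u. a u \<in> HH" "\<And>u. act (a u) (tens 1 v) = tens 1 u" by metis
  let ?g = "\<Sum>i\<in>UNIV. mult_op (x $ i) \<circ> a (axis i 1)"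
  have s: "act (sum f A) u = (\<Sum>i\<in>A. act (f i) u)" if "\<And>i. f i \<in> HH" for f :: "'d \<Rightarrow> _" and A u
  proof (induction A rule: infinite_finite_induct)
    case (insert x F)
    show ?case unfolding sum.insert[OF insert.hyps] insert.IH[symmetric] using V.H_sum[of F f] that by (simp only: act_left)
  qed (simp_all only: sum.infinite sum.empty act_left simp_thms not_False_eq_True)
  have "act ?g (tens 1 v) = (\<Sum>i\<in>UNIV. tens (x $ i) (axis i 1))"
    by (simp only: s cherednik_comp V.mult_H a act_left act_tens mult_1_right)
  also have "\<dots> = x" by (rule vpoly_expand[symmetric])
  finally show ?thesis using V.H_sum[of UNIV "\<lambda>i. mult_op (x $ i) \<circ> a (axis i 1)"] cherednik_comp[OF V.mult_H a(1)] by blast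
qed

text \<open>One half of \<open>pi_kernel\<close> produces values without constant term and the other
  half annihilates 1 tensor u, so only the group part of h contributes in degree zero.\<close>

lemma grp_alg_act_ev0: assumes "h \<in> HH"
  shows "grp_alg_act R \<rho> (pi_proj R Rp k h) u = ev0 (act h (tens 1 u))"
proof -
  let ?f = "pi_proj R Rp k h"
  have ker: "g \<in> HH \<and> ev0 (act g (tens 1 u)) = 0" if "g \<in> pi_kernel R Rp k" for g
    using that unfolding pi_kernel_def
  proof (induction rule: opr.span_induct_alt)
    case base
    then show ?case by (simp only: V.zero_H act_left ev0_simps)
  next
    case (step c x y)
    from step(1) have "x \<in> HH \<and> ev0 (act x (tens 1 u)) = 0"
    proof (elim UnE CollectE exE conjE)
      fix p h assume x: "x = mult_op p \<circ> h" "p \<in> pos_polys" "h \<in> HH"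
      have "ev0 (act x (tens 1 u)) = 0"
        unfolding x(1) act_left(3)[OF V.mult_H x(3)] ev0_mult pev_0_pos[OF x(2)] by simp
      then show ?thesis using cherednik_comp[OF V.mult_H x(3)] x(1) by blast
    next
      fix h s assume x: "x = h \<circ> s" "h \<in> HH" "s \<in> dunkl_pos R Rp k"
      note s = act_zero_on[OF x(3), of u]
      have "ev0 (act x (tens 1 u)) = 0"
        unfolding x(1) act_left(3)[OF x(2) conjunct1[OF s]] conjunct2[OF s] act_right ev0_simps ..
      then show ?thesis using cherednik_comp[OF x(2) conjunct1[OF s]] x(1) by blast
    qed
    then have x: "x \<in> HH" "ev0 (act x (tens 1 u)) = 0" by blast+
    have y: "y \<in> HH" "ev0 (act y (tens 1 u)) = 0" using step(2) by blast+
    have "ev0 (act (op_scale c x + y) (tens 1 u)) = 0"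
      unfolding act_left(1)[OF cherednik_scale[OF x(1)] y(1)] act_left(2)[OF x(1)] ev0_simps x(2) y(2) by simp
    then show ?case using cherednik_add[OF cherednik_scale[OF x(1)] y(1)] by blast
  qed
  note g = grp_alg_op_H[of ?f]
  have "ev0 (act (grp_alg_op R ?f) (tens 1 u)) = grp_alg_act R \<rho> ?f u"
  proof -
    have s: "act (\<Sum>w\<in>A. op_scale (?f w) (poly_act w)) (tens 1 u) = (\<Sum>w\<in>A. vp_scale (?f w) (tens 1 (\<rho> w u)))"
      if "A \<subseteq> W" for A
      using that
    proof (induction A rule: infinite_finite_induct)
      case (insert w F)
      have w: "w \<in> W" using insert.prems by blast
      have F: "(\<Sum>w\<in>F. op_scale (?f w) (poly_act w)) \<in> HH"
        using insert.prems by (intro V.H_sum cherednik_scale V.poly_act_H) blast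
      have IH: "act (\<Sum>w\<in>F. op_scale (?f w) (poly_act w)) (tens 1 u) = (\<Sum>w\<in>F. vp_scale (?f w) (tens 1 (\<rho> w u)))"
        using insert by blast
      show ?case unfolding sum.insert[OF insert.hyps] act_left(1)[OF cherednik_scale[OF V.poly_act_H[OF w]] F]
          act_left(2)[OF V.poly_act_H[OF w]] act_W_tens[OF w] poly_act_simps IH ..
    qed (simp_all only: sum.infinite sum.empty act_left simp_thms not_False_eq_True)
    show ?thesis unfolding grp_alg_op_def s[OF subset_refl] ev0_sum ev0_simps grp_alg_act_def by simp
  qed
  moreover have "h = (h - grp_alg_op R ?f) + grp_alg_op R ?f" by (rule ext) simp
  then have "act h (tens 1 u) = act (h - grp_alg_op R ?f) (tens 1 u) + act (grp_alg_op R ?f) (tens 1 u)"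
    using act_left(1)[OF V.minus_H[OF assms g] g] by metis
  ultimately show ?thesis using ker[OF pi_proj_spec[OF assms]] by (simp only: ev0_simps) simp
qed

text \<open>A formula that chooses no element of H representing x; well-definedness of
  \<open>verma_form\<close> can therefore be proved by comparison with it.\<close>

definition form :: "('n, 'd) vpoly \<Rightarrow> ('n, 'd) vpoly \<Rightarrow> complex"
  where "form x y = (\<Sum>i\<in>UNIV. b (axis i 1) (ev0 (act (sg (mult_op (x $ i))) y)))"

lemma mult_op_simps: "mult_op (p + q) = mult_op p + mult_op (q :: 'n mpoly)" "mult_op (const_poly c * p) = op_scale c (mult_op p)"
  "mult_op (p * q) = mult_op p \<circ> mult_op q" "mult_op 0 = (0 :: 'n oper)" "mult_op 1 = (id :: 'n oper)"
  by (rule ext; simp add: mult_op_def op_scale_def pm_scale_eq distrib_right mult.assoc)+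

lemma form_left: "form (x + x') y = form x y + form x' y" "form (vp_scale c x) y = c * form x y" "form 0 y = 0"
proof -
  show "form (x + x') y = form x y + form x' y"
    unfolding form_def vector_add_component mult_op_simps sg_add[OF V.mult_H V.mult_H]
      act_left(1)[OF sg_H[OF V.mult_H] sg_H[OF V.mult_H]] ev0_simps b_right sum.distrib ..
  show s: "form (vp_scale c x) y = c * form x y" for c x
    unfolding form_def vp_scale_nth mult_op_simps(2) sg_scale[OF V.mult_H]
      act_left(2)[OF sg_H[OF V.mult_H]] ev0_simps b_right sum_distrib_left ..
  show "form 0 y = 0" using s[of 0 0] by simp
qed

lemma form_right: "form x (y + y') = form x y + form x y'" "form x (y - y') = form x y - form x y'"
  "form x (vp_scale c y) = c * form x y" "form x 0 = 0"
  unfolding form_def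
  by (simp_all only: act_right act_scale_right[OF sg_H[OF V.mult_H]] ev0_simps b_right sum.distrib sum_subtractf sum_distrib_left)
    simp_all

lemma form_tens: "form (tens p u) y = b u (ev0 (act (sg (mult_op p)) y))"
proof -
  have "form (tens p u) y = (\<Sum>i\<in>UNIV. u $ i * b (axis i 1) (ev0 (act (sg (mult_op p)) y)))"
    unfolding form_def tens_nth mult_op_simps(2) sg_scale[OF V.mult_H] act_left(2)[OF sg_H[OF V.mult_H]] ev0_simps b_right ..
  then show ?thesis by (simp only: b_expand[of u])
qed

lemma sg_dlist: "\<exists>q. sg (dlist ys) = mult_op q \<and> (ys \<noteq> [] \<longrightarrow> pev 0 q = 0)"
proof (induction ys)
  case Nil
  have "sg (dlist []) = mult_op 1" unfolding dlist_Nil sg_id mult_op_simps ..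
  then show ?case by blast
next
  case (Cons y ys)
  then obtain q where q: "sg (dlist ys) = mult_op q" by blast
  have "sg (dlist (y # ys)) = mult_op (q * lin_poly (iB y))"
    unfolding dlist_Cons sg_comp[OF V.dunkl_H dlist_H] q sg_Y mult_op_simps ..
  moreover have "pev 0 (q * lin_poly (iB y)) = 0" by (simp add: pairing_def cplx_def)
  ultimately show ?case by blast
qed

lemma sg_term: assumes "w \<in> W"
  shows "sg (mult_op p \<circ> (poly_act w \<circ> dlist ys)) = sg (dlist ys) \<circ> (poly_act (inv w) \<circ> sg (mult_op p))"
  unfolding sg_comp[OF V.mult_H cherednik_comp[OF V.poly_act_H[OF assms] dlist_H]]
    sg_comp[OF V.poly_act_H[OF assms] dlist_H] sg_W[OF assms] by (rule comp_assoc)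

text \<open>\<sigma> turns a nonempty product of Dunkl operators into multiplication by a polynomial
  that vanishes at 0.\<close>

lemma ev0_sg_term: assumes w: "w \<in> W"
  shows "ev0 (act (sg (mult_op p \<circ> (poly_act w \<circ> dlist ys))) y) =
    (if ys = [] then \<rho> (inv w) (ev0 (act (sg (mult_op p)) y)) else 0)"
proof -
  have H: "poly_act (inv w) \<in> HH" "sg (mult_op p) \<in> HH" "sg (dlist ys) \<in> HH"
    by (intro V.poly_act_H W_inv(1) w sg_H V.mult_H dlist_H)+
  obtain q where q: "sg (dlist ys) = mult_op q" "ys \<noteq> [] \<longrightarrow> pev 0 q = 0" using sg_dlist by blast
  have e: "act (sg (mult_op p \<circ> (poly_act w \<circ> dlist ys))) y = act (sg (dlist ys)) (act (poly_act (inv w)) (act (sg (mult_op p)) y))"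
    unfolding sg_term[OF w] act_left(3)[OF H(3) cherednik_comp[OF H(1,2)]] act_left(3)[OF H(1,2)] ..
  show ?thesis
  proof (cases "ys = []")
    case True
    have "sg (dlist ys) = id" unfolding True dlist_Nil by (rule sg_id)
    then show ?thesis using True e act_left(5) ev0_W[OF W_inv(1)[OF w]] by simp
  next
    case False
    then show ?thesis using q e by (simp add: ev0_mult)
  qed
qed

text \<open>The right-hand side thus depends on a only through the vector a.(1 tensor u), which is
  the well-definedness of the contravariant form.\<close>

lemma form_act: assumes "a \<in> HH"
  shows "form (act a (tens 1 u)) y = b u (ev0 (act (sg a) y))"
  using assms
proof (induction rule: H_induct)
  case zero
  show ?case by (simp only: act_left form_left sg_zero ev0_simps b_right)
next
  case (add a a')
  show ?case unfolding act_left(1)[OF add(1,2)] sg_add[OF add(1,2)] act_left(1)[OF sg_H[OF add(1)] sg_H[OF add(2)]]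
    form_left ev0_simps b_right add(3,4) ..
next
  case (trm p w ys)
  show ?case unfolding ev0_sg_term[OF trm] act_term[OF trm]
    by (cases "ys = []") (simp_all only: if_True if_False simp_thms form_tens form_left b_right b_adj[OF trm])
qed

theorem verma_form_eq: "verma_form R Rp k \<rho> b v x y = form x y"
proof -
  have *: "b v (grp_alg_act R \<rho> (ch_beta R Rp k a a') v) = form (act a (tens 1 v)) (act a' (tens 1 v))"
    if "a \<in> HH" "a' \<in> HH" for a a'
    unfolding ch_beta_def sg_def[symmetric] grp_alg_act_ev0[OF cherednik_comp[OF sg_H[OF that(1)] that(2)]]
      act_left(3)[OF sg_H[OF that(1)] that(2)] form_act[OF that(1)] ..
  obtain a a' where a: "a \<in> HH" "act a (tens 1 v) = x" "a' \<in> HH" "act a' (tens 1 v) = y" using cyclic by blast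
  show ?thesis unfolding verma_form_def
  proof (rule the_equality)
    show "\<exists>a\<in>HH. \<exists>a'\<in>HH. x = verma_act R Rp k \<rho> a (tens 1 v) \<and> y = verma_act R Rp k \<rho> a' (tens 1 v) \<and>
       form x y = b v (grp_alg_act R \<rho> (ch_beta R Rp k a a') v)"
      using a *[OF a(1,3)] verma_act_eq[OF a(1)] verma_act_eq[OF a(3)] by metis
  next
    fix c assume "\<exists>a\<in>HH. \<exists>a'\<in>HH. x = verma_act R Rp k \<rho> a (tens 1 v) \<and> y = verma_act R Rp k \<rho> a' (tens 1 v) \<and>
       c = b v (grp_alg_act R \<rho> (ch_beta R Rp k a a') v)"
    then obtain a a' where "a \<in> HH" "a' \<in> HH" "x = verma_act R Rp k \<rho> a (tens 1 v)" "y = verma_act R Rp k \<rho> a' (tens 1 v)"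
       "c = b v (grp_alg_act R \<rho> (ch_beta R Rp k a a') v)" by blast
    then show "c = form x y" using *[of a a'] by (simp add: verma_act_eq)
  qed
qed

lemma form_contravariant: assumes h: "h \<in> HH" shows "form (act h x) y = form x (act (sg h) y)"
proof -
  obtain a where a: "a \<in> HH" "act a (tens 1 v) = x" using cyclic by blast
  have "form (act h x) y = form (act (h \<circ> a) (tens 1 v)) y" unfolding act_left(3)[OF h a(1)] a(2) ..
  also have "\<dots> = b v (ev0 (act (sg a) (act (sg h) y)))"
    unfolding form_act[OF cherednik_comp[OF h a(1)]] sg_comp[OF h a(1)] act_left(3)[OF sg_H[OF a(1)] sg_H[OF h]] ..
  also have "\<dots> = form x (act (sg h) y)" unfolding a(2)[symmetric] form_act[OF a(1)] ..
  finally show ?thesis .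
qed

lemma sg_mult_const: "act (sg (mult_op p)) (tens 1 u) = tens (const_poly (pev 0 p)) u"
proof (induction p rule: mpoly_induct)
  case (const c)
  have "mult_op (const_poly c) = op_scale c (id :: 'n oper)"
    using mult_op_simps(2)[of c 1] mult_op_simps(5) by simp
  then show ?case unfolding pev_simps
    by (simp only: sg_scale V.id_H sg_id act_left) (simp add: vec_eq_iff)
next
  case (add p q)
  show ?case unfolding mult_op_simps sg_add[OF V.mult_H V.mult_H] act_left(1)[OF sg_H[OF V.mult_H] sg_H[OF V.mult_H]]
    pev_simps const_poly_simps tens_simps add ..
next
  case (var i p)
  have "act (sg (mult_op (pvar i * p))) (tens 1 u) = act (sg (mult_op p)) (act (dunkl R Rp k (B_map R (axis i 1))) (tens 1 u))"
    unfolding mult_op_simps(3) sg_comp[OF V.mult_H V.mult_H]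
      lin_poly_axis[symmetric] sg_X act_left(3)[OF sg_H[OF V.mult_H] V.dunkl_H] ..
  then show ?case unfolding act_Y_const act_right by (simp add: tens_simps)
qed

text \<open>Contravariance reduces symmetry to (v | \<sigma>(g) v) = (v | g v) in degree zero. There
  only the products p w without Dunkl factors count, and \<sigma> inverts w, which the invariance
  and symmetry of \<open>b\<close> compensate.\<close>

lemma form_sym: "form x y = form y x"
proof -
  have T: "b v (ev0 (act (sg g) (tens 1 v))) = b v (ev0 (act g (tens 1 v)))" if "g \<in> HH" for g
    using that
  proof (induction rule: H_induct)
    case zero
    show ?case by (simp only: sg_zero)
  next
    case (add a a')
    show ?case unfolding sg_add[OF add(1,2)] act_left(1)[OF sg_H[OF add(1)] sg_H[OF add(2)]]
      act_left(1)[OF add(1,2)] ev0_simps b_right add(3,4) ..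
  next
    case (trm p w ys)
    show ?case unfolding ev0_sg_term[OF trm] act_term[OF trm] sg_mult_const
    proof (cases "ys = []")
      case True
      have "b v (\<rho> (inv w) (pev 0 p *s v)) = pev 0 p * b v (\<rho> w v)"
        unfolding b_adj[OF trm] b_right by (subst b_sym) simp
      then show "b v (if ys = [] then \<rho> (inv w) (ev0 (tens (const_poly (pev 0 p)) v)) else 0) = b v (ev0 (if ys = [] then tens p (\<rho> w v) else 0))"
        using True by (simp add: ev0_simps b_right)
    next
      case False
      then show "b v (if ys = [] then \<rho> (inv w) (ev0 (tens (const_poly (pev 0 p)) v)) else 0) = b v (ev0 (if ys = [] then tens p (\<rho> w v) else 0))"
        by (simp add: ev0_simps b_right)
    qed
  qed
  obtain a a' where a: "a \<in> HH" "act a (tens 1 v) = x" "a' \<in> HH" "act a' (tens 1 v) = y" using cyclic by blast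
  have 1: "form x y = b v (ev0 (act (sg a \<circ> a') (tens 1 v)))" if "a \<in> HH" "act a (tens 1 v) = x" "a' \<in> HH" "act a' (tens 1 v) = y" for a a' x y
    unfolding act_left(3)[OF sg_H[OF that(1)] that(3)] that(4) that(2)[symmetric] by (rule form_act[OF that(1)])
  have "sg (sg a \<circ> a') = sg a' \<circ> a" unfolding sg_comp[OF sg_H[OF a(1)] a(3)] sg_sg[OF a(1)] ..
  then show ?thesis
    using T[OF cherednik_comp[OF sg_H[OF a(1)] a(3)]] 1[OF a] 1[OF a(3,4,1,2)] by simp
qed

section \<open>The radical as a proper submodule\<close>

definition "Rad = {x. \<forall>y. form x y = 0}"

lemma form_radical_eq: "form_radical R Rp k \<rho> b v = Rad"
  unfolding form_radical_def Rad_def verma_form_eq ..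

lemma Rad_sub: "x \<in> Rad \<Longrightarrow> x' \<in> Rad \<Longrightarrow> x + x' \<in> Rad" "x \<in> Rad \<Longrightarrow> vp_scale c x \<in> Rad" "0 \<in> Rad"
  by (simp_all add: Rad_def form_left)

lemma Rad_diff: "x \<in> Rad \<Longrightarrow> x' \<in> Rad \<Longrightarrow> x - x' \<in> Rad"
proof -
  have e: "vp_scale (- 1) x' = - x'" using const_poly_simps(3)[of 1 "- 1"]
    by (simp add: vec_eq_iff eq_neg_iff_add_eq_0 add.commute del: const_poly_simps(3))
  show "x \<in> Rad \<Longrightarrow> x' \<in> Rad \<Longrightarrow> x - x' \<in> Rad" using Rad_sub(1)[of x "- x'"] Rad_sub(2)[of x' "- 1"] e by simp
qed

lemma Rad_act: "h \<in> HH \<Longrightarrow> x \<in> Rad \<Longrightarrow> act h x \<in> Rad"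
  by (simp add: Rad_def form_contravariant)

lemma Rad_submodule: "verma_submodule R Rp k \<rho> Rad"
  unfolding verma_submodule_def vp.subspace_def
  using Rad_sub Rad_act by (auto simp: verma_act_eq)

lemma Rad_proper: "Rad \<noteq> UNIV"
proof
  assume "Rad = UNIV"
  then have "form (tens 1 v) (tens 1 u) = 0" for u unfolding Rad_def by blast
  then have "b v u = 0" for u unfolding form_tens sg_mult_const by (simp add: ev0_simps)
  then show False using b_nondeg v_nz by blast
qed

end

declare One_nat_def [simp]

section \<open>Gradings\<close>

lemma hom_polys_simps: "p \<in> hom_polys n \<Longrightarrow> q \<in> hom_polys n \<Longrightarrow> p + q \<in> hom_polys n"
  "p \<in> hom_polys n \<Longrightarrow> const_poly c * p \<in> hom_polys n" "0 \<in> hom_polys n"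
proof -
  show "p + q \<in> hom_polys n" if "p \<in> hom_polys n" "q \<in> hom_polys n"
    using that keys_add[of p q] by (auto simp: hom_polys_def)
  show "const_poly c * p \<in> hom_polys n" if "p \<in> hom_polys n"
    using that by (auto simp: hom_polys_def pm_scale_eq[symmetric] in_keys_iff lookup_pm_scale)
qed (simp add: hom_polys_def)

lemma hom_polys_sum: "(\<And>i. i \<in> A \<Longrightarrow> f i \<in> hom_polys n) \<Longrightarrow> sum f A \<in> hom_polys n"
  by (induction A rule: infinite_finite_induct) (simp_all add: hom_polys_simps)

lemma hom_polys_mult: assumes "p \<in> hom_polys n" "q \<in> hom_polys m" shows "p * q \<in> hom_polys (n + m)"
  unfolding hom_polys_def
proof (intro CollectI ballI)
  fix x assume "x \<in> Poly_Mapping.keys (p * q)"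
  then obtain a b where "x = a + b" "a \<in> Poly_Mapping.keys p" "b \<in> Poly_Mapping.keys q"
    using keys_mult[of p q] by blast
  then show "mdeg x = n + m" using assms by (simp add: mdeg_add hom_polys_def)
qed

lemma hom_polys_one: "1 \<in> hom_polys 0"
  by (simp add: hom_polys_def)

lemma hom_polys_power: "p \<in> hom_polys n \<Longrightarrow> p ^ m \<in> hom_polys (n * m)"
  by (induction m) (auto simp: hom_polys_one intro: hom_polys_mult)

lemma lin_poly_hom: "lin_poly x \<in> hom_polys 1"
  unfolding lin_poly_def by (intro hom_polys_sum) (auto simp: hom_polys_def)

text \<open>Degree n - 1, with the zero space standing for degree -1; plain truncated subtraction
  would leave the constants there.\<close>

definition low :: "nat \<Rightarrow> ('n::finite) mpoly set"
  where "low n = (if n = 0 then {0} else hom_polys (n - 1))"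

lemma low_sum: "(\<And>i. i \<in> A \<Longrightarrow> f i \<in> low n) \<Longrightarrow> sum f A \<in> low n"
  by (cases "n = 0") (auto simp: low_def intro: hom_polys_sum)

lemma low_const: "p \<in> low n \<Longrightarrow> const_poly c * p \<in> low n"
  by (auto simp: low_def hom_polys_simps split: if_splits)

lemma low_add: "p \<in> low n \<Longrightarrow> q \<in> low n \<Longrightarrow> p + q \<in> low n"
  by (auto simp: low_def hom_polys_simps split: if_splits)

text \<open>The common argument for derivatives and divided differences: constants are annihilated,
  and the failure to commute with a variable has the degree of the monomial that is multiplied by
  it.\<close>

lemma lowering:
  assumes add: "\<And>p q. f (p + q) = f p + (f q :: 'n::finite mpoly)"
    and const: "\<And>c. f (const_poly c) = 0"
    and var: "\<And>i m c. f (pvar i * Poly_Mapping.single m c) - pvar i * f (Poly_Mapping.single m c) \<in> hom_polys (mdeg m)"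
    and p: "p \<in> hom_polys n"
  shows "f p \<in> low n"
proof -
  have m: "f (Poly_Mapping.single m c) \<in> low (mdeg m)" for m c
  proof (induction m rule: monomial_induct)
    case zero
    then show ?case using const[of c] by (simp add: const_poly_def low_def)
  next
    case (step i m)
    have "pvar i * f (Poly_Mapping.single m c) \<in> hom_polys (mdeg m)"
    proof (cases "mdeg m")
      case 0
      then show ?thesis using step by (simp add: low_def hom_polys_simps)
    next
      case (Suc k)
      then show ?thesis using step pvar_mult_hom[of "f (Poly_Mapping.single m c)" k i] by (simp add: low_def)
    qed
    from hom_polys_simps(1)[OF this var[of i m c]] show ?case
      by (simp add: low_def mdeg_add mult_single)
  qed
  have f0: "f 0 = 0" using add[of 0 0] by simp
  have s: "f (sum g A) = (\<Sum>i\<in>A. f (g i))" for g :: "('n \<Rightarrow>\<^sub>0 nat) \<Rightarrow> _" and A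
    by (induction A rule: infinite_finite_induct) (simp_all add: f0 add)
  have e: "f p = (\<Sum>m\<in>Poly_Mapping.keys p. f (Poly_Mapping.single m (Poly_Mapping.lookup p m)))"
    unfolding s[symmetric] poly_mapping_sum_single[symmetric] ..
  show ?thesis unfolding e
  proof (rule low_sum)
    fix x assume "x \<in> Poly_Mapping.keys p"
    then have "mdeg x = n" using p by (simp add: hom_polys_def)
    then show "f (Poly_Mapping.single x (Poly_Mapping.lookup p x)) \<in> low n" using m[of x] by simp
  qed
qed

lemma dir_deriv_low: "p \<in> hom_polys n \<Longrightarrow> dir_deriv y p \<in> low n"
proof (rule lowering[where f = "dir_deriv y"])
  show "dir_deriv y (pvar i * Poly_Mapping.single m c) - pvar i * dir_deriv y (Poly_Mapping.single m c) \<in> hom_polys (mdeg m)" for i m c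
    by (simp only: dir_deriv_var_mult add_diff_cancel_right') (intro hom_polys_simps hom_single)
qed (simp_all add: dir_deriv_add dir_deriv_const)

lemma poly_act_hom: assumes "p \<in> hom_polys n" shows "poly_act w p \<in> hom_polys n"
proof -
  have m: "poly_act w (Poly_Mapping.single m c) \<in> hom_polys (mdeg m)" for m c
  proof (induction m rule: monomial_induct)
    case zero
    then show ?case using poly_act_simps(1)[of w c] hom_single[of 0 c] by (simp add: const_poly_def)
  next
    case (step i m)
    have e: "Poly_Mapping.single (Poly_Mapping.single i 1 + m) c = pvar i * Poly_Mapping.single m c" by (simp add: mult_single)
    show ?case unfolding e poly_act_simps poly_act_var mdeg_add mdeg_single
      by (intro hom_polys_mult lin_poly_hom step)
  qed
  have "poly_act w p = (\<Sum>m\<in>Poly_Mapping.keys p. poly_act w (Poly_Mapping.single m (Poly_Mapping.lookup p m)))"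
    unfolding poly_act_simps(6)[symmetric] poly_mapping_sum_single[symmetric] ..
  also have "\<dots> \<in> hom_polys n"
  proof (rule hom_polys_sum)
    fix x assume "x \<in> Poly_Mapping.keys p"
    then have "mdeg x = n" using assms by (simp add: hom_polys_def)
    then show "poly_act w (Poly_Mapping.single x (Poly_Mapping.lookup p x)) \<in> hom_polys n" using m[of x] by metis
  qed
  finally show ?thesis .
qed

lemma (in roots) dq_low: "\<alpha> \<in> R \<Longrightarrow> p \<in> hom_polys n \<Longrightarrow> dq \<alpha> p \<in> low n"
proof (rule lowering[where f = "dq \<alpha>"])
  assume a: "\<alpha> \<in> R"
  show "dq \<alpha> (pvar i * Poly_Mapping.single m c) - pvar i * dq \<alpha> (Poly_Mapping.single m c) \<in> hom_polys (mdeg m)" for i m c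
    by (simp only: dq_var_mult[OF a] add_diff_cancel_left') (intro hom_polys_simps poly_act_hom hom_single)
qed (simp_all add: dq_add dq_const)

lemma M_hom_iff: "u \<in> M_hom n \<longleftrightarrow> (\<forall>i. u $ i \<in> hom_polys n)"
proof
  assume "u \<in> M_hom n"
  then show "\<forall>i. u $ i \<in> hom_polys n" unfolding M_hom_def
  proof (induction rule: vp.span_induct_alt)
    case (step c x y)
    then show ?case by (auto simp: hom_polys_simps)
  qed (simp add: hom_polys_simps)
next
  assume a: "\<forall>i. u $ i \<in> hom_polys n"
  have "(\<Sum>i\<in>UNIV. tens (u $ i) (axis i 1)) \<in> M_hom n"
    unfolding M_hom_def using a by (intro vp.span_sum vp.span_base) blast
  then show "u \<in> M_hom n" by (simp flip: vpoly_expand)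
qed

lemma M_hom_sub: "vp.subspace (M_hom n)"
  unfolding M_hom_def by (rule vp.subspace_span)

lemmas M_hom_simps = vp.subspace_add[OF M_hom_sub] vp.subspace_scale[OF M_hom_sub] vp.subspace_0[OF M_hom_sub]
  vp.subspace_diff[OF M_hom_sub] vp.subspace_sum[OF M_hom_sub]

lemma tens_hom: "p \<in> hom_polys n \<Longrightarrow> tens p v \<in> M_hom n"
  by (simp add: M_hom_iff hom_polys_simps)

lemma ev0_hom: "u \<in> M_hom n \<Longrightarrow> n \<noteq> 0 \<Longrightarrow> ev0 u = 0"
  by (simp add: M_hom_iff ev0_def vec_eq_iff pev_0_hom[of _ n])

lemma M_hom_0: assumes "u \<in> M_hom 0" shows "u = tens 1 (ev0 u)"
proof -
  have "p = const_poly (pev 0 p)" if "p \<in> hom_polys 0" for p :: "'a mpoly"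
  proof -
    have k: "m = 0" if "m \<in> Poly_Mapping.keys p" for m using that \<open>p \<in> hom_polys 0\<close> by (auto simp: hom_polys_def mdeg_eq_0_iff)
    have "p = Poly_Mapping.single 0 (Poly_Mapping.lookup p 0)"
    proof (rule poly_mapping_eqI)
      fix m show "Poly_Mapping.lookup p m = Poly_Mapping.lookup (Poly_Mapping.single 0 (Poly_Mapping.lookup p 0)) m"
        using k[of m] by (cases "m = 0") (auto simp: lookup_single when_def in_keys_iff)
    qed
    then obtain c where "p = const_poly c" unfolding const_poly_def by blast
    then show ?thesis by simp
  qed
  then have "u $ i = const_poly (pev 0 (u $ i))" for i using assms by (simp add: M_hom_iff)
  then show ?thesis by (simp add: vec_eq_iff ev0_def)
qed

lemma hom_decomp:
  fixes u :: "('n::finite, 'd::finite) vpoly"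
  obtains N f where "u = (\<Sum>j\<le>N. f j)" "\<And>j. f j \<in> M_hom j"
proof -
  let ?K = "\<Union>i. Poly_Mapping.keys (u $ i)"
  define N where "N = Max (insert 0 (mdeg ` ?K))"
  have fin: "finite ?K" by simp
  define f where "f j = (\<chi> i. \<Sum>m\<in>{m \<in> Poly_Mapping.keys (u $ i). mdeg m = j}. Poly_Mapping.single m (Poly_Mapping.lookup (u $ i) m))" for j
  have 1: "f j \<in> M_hom j" for j
    unfolding M_hom_iff f_def vec_lambda_beta
  proof (intro allI hom_polys_sum)
    fix i m assume "m \<in> {m \<in> Poly_Mapping.keys (u $ i). mdeg m = j}"
    then show "Poly_Mapping.single m (Poly_Mapping.lookup (u $ i) m) \<in> hom_polys j" using hom_single[of m] by auto
  qed
  have 2: "u = (\<Sum>j\<le>N. f j)"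
  proof (subst vec_eq_iff, rule allI)
    fix i
    have "mdeg ` Poly_Mapping.keys (u $ i) \<subseteq> {..N}"
    proof
      fix x assume "x \<in> mdeg ` Poly_Mapping.keys (u $ i)"
      then have "x \<in> insert 0 (mdeg ` ?K)" by auto
      then show "x \<in> {..N}" unfolding N_def using fin by (simp only: atMost_iff) (intro Max_ge finite.insertI finite_imageI)
    qed
    then have "(\<Sum>j\<le>N. f j $ i) = (\<Sum>m\<in>Poly_Mapping.keys (u $ i). Poly_Mapping.single m (Poly_Mapping.lookup (u $ i) m))"
      unfolding f_def vec_lambda_beta by (intro sum.group) auto
    also have "\<dots> = u $ i" by (rule poly_mapping_sum_single[symmetric])
    finally show "u $ i = (\<Sum>j\<le>N. f j) $ i" by simp
  qed
  show thesis by (rule that[OF 2 1])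
qed


section \<open>Eigenvalues\<close>

text \<open>The vector q(f) x, computed by Horner's rule.\<close>

definition peval :: "(complex^'d \<Rightarrow> complex^'d) \<Rightarrow> complex poly \<Rightarrow> complex^'d::finite \<Rightarrow> complex^'d"
  where "peval f q x = fold_coeffs (\<lambda>a y. a *s x + f y) q 0"

context
  fixes f :: "complex^'d::finite \<Rightarrow> complex^'d"
  assumes fadd: "\<And>x y. f (x + y) = f x + f y" and fsc: "\<And>c x. f (c *s x) = c *s f x"
begin

lemma f_zero: "f 0 = 0" using fadd[of 0 0] by simp

lemma peval_0: "peval f 0 x = 0" by (simp add: peval_def)

lemma peval_pCons: "peval f (pCons a q) x = a *s x + f (peval f q x)"
  by (cases "q = 0 \<and> a = 0") (auto simp: peval_def f_zero)

lemma peval_add: "peval f (p + q) x = peval f p x + peval f q x"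
  by (induction p q rule: poly_induct2) (simp_all add: peval_0 peval_pCons fadd vec.scale_left_distrib)

lemma peval_smult: "peval f (smult c p) x = c *s peval f p x"
  by (induction p) (simp_all add: peval_0 peval_pCons fsc vec.scale_right_distrib)

lemma peval_sum: "peval f (sum g A) x = (\<Sum>i\<in>A. peval f (g i) x)"
  by (induction A rule: infinite_finite_induct) (simp_all add: peval_0 peval_add)

lemma peval_monom: "peval f (monom c n) x = c *s (f ^^ n) x"
  by (induction n) (simp_all add: monom_0 monom_Suc peval_pCons peval_0 f_zero fsc)

text \<open>The vectors x, f x, ..., f^d x are one too many to be independent. A repetition among
  them is treated apart because linear dependence is a property of sets, in which repetitions are
  lost.\<close>

lemma annihilating_poly: "\<exists>q. q \<noteq> 0 \<and> peval f q x = 0"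
proof (cases "inj_on (\<lambda>i. (f ^^ i) x) {..CARD('d)}")
  case False
  then obtain i j where ij: "i \<noteq> j" "(f ^^ i) x = (f ^^ j) x" unfolding inj_on_def by blast
  have "monom 1 i + monom (- 1) j \<noteq> (0 :: complex poly)"
  proof
    assume "monom 1 i + monom (- 1) j = (0 :: complex poly)"
    then have "coeff (monom 1 i + monom (- 1) j) i = (0 :: complex)" by simp
    then show False using ij by simp
  qed
  moreover have "peval f (monom 1 i + monom (- 1) j) x = 0" by (simp add: peval_add peval_monom ij)
  ultimately show ?thesis by blast
next
  case True
  let ?S = "(\<lambda>i. (f ^^ i) x) ` {..CARD('d)}"
  have "card ?S = Suc CARD('d)" using card_image[OF True] by simp
  then have dep: "vec.dependent ?S"
    using vec.independent_card_le_dim[of ?S UNIV] by (auto simp: card_cart_basis)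
  obtain c where c: "\<exists>w\<in>?S. c w \<noteq> 0" "(\<Sum>w\<in>?S. c w *s w) = 0"
    using dep by (subst (asm) vec.dependent_finite) auto
  define q where "q = (\<Sum>i\<le>CARD('d). monom (c ((f ^^ i) x)) i)"
  have "peval f q x = (\<Sum>w\<in>?S. c w *s w)"
    unfolding q_def peval_sum peval_monom by (subst sum.reindex[OF True]) simp
  moreover have "q \<noteq> 0"
  proof
    assume "q = 0"
    obtain i where i: "i \<le> CARD('d)" "c ((f ^^ i) x) \<noteq> 0" using c(1) by auto
    have "coeff q i = c ((f ^^ i) x)" unfolding q_def coeff_sum using i(1) by (simp add: sum.delta)
    then show False using i \<open>q = 0\<close> by simp
  qed
  ultimately show ?thesis using c(2) by metis
qed

text \<open>Take an annihilating polynomial of least degree and a root \<mu> of it. By minimality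
  the cofactor of X - \<mu> does not annihilate x, and it sends x to an eigenvector.\<close>

lemma eigenvector_exists: assumes "(x :: complex^'d) \<noteq> 0" obtains \<mu> u where "u \<noteq> 0" "f u = \<mu> *s u"
proof -
  obtain q0 where q0: "q0 \<noteq> 0 \<and> peval f q0 x = 0" using annihilating_poly by blast
  define q where "q = arg_min degree (\<lambda>q. q \<noteq> 0 \<and> peval f q x = 0)"
  have q: "q \<noteq> 0" "peval f q x = 0" and min: "\<And>p. p \<noteq> 0 \<and> peval f p x = 0 \<Longrightarrow> degree q \<le> degree p"
    using arg_min_nat_lemma[of "\<lambda>q. q \<noteq> 0 \<and> peval f q x = 0" q0 degree] q0 unfolding q_def by blast+
  have "degree q \<noteq> 0"
  proof
    assume "degree q = 0"
    then obtain a where "q = [:a:]" by (rule degree_eq_zeroE)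
    then show False using q assms by (simp add: peval_pCons peval_0 f_zero)
  qed
  then have "\<not> constant (poly q)" by (simp add: constant_degree)
  then obtain \<mu> where "poly q \<mu> = 0" using fundamental_theorem_of_algebra by blast
  then obtain p where p: "q = [:- \<mu>, 1:] * p" unfolding poly_eq_0_iff_dvd by (auto simp: dvd_def)
  have "p \<noteq> 0" using q(1) p by auto
  have "degree q = degree [:- \<mu>, 1:] + degree p" unfolding p using \<open>p \<noteq> 0\<close> by (intro degree_mult_eq) auto
  then have "degree p < degree q" by simp
  then have nz: "peval f p x \<noteq> 0" using min[of p] \<open>p \<noteq> 0\<close> by fastforce
  have "peval f q x = - \<mu> *s peval f p x + f (peval f p x)"
  proof -
    have e: "q = smult (- \<mu>) p + pCons 0 p" unfolding p by simp
    show ?thesis unfolding e peval_add peval_smult peval_pCons by simp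
  qed
  then have "f (peval f p x) = \<mu> *s peval f p x" using q(2) by (simp add: vec_eq_iff)
  with nz show thesis using that by blast
qed

end

section \<open>The sl2-triple and the radical\<close>

context root_pb
begin

abbreviation "Ep \<equiv> E_poly z"
abbreviation "yz i \<equiv> B_map R (zc i)"

lemma E_poly_eq: "Ep = const_poly (1/2) * (\<Sum>i\<in>UNIV. lin_poly (zc i) * lin_poly (zc i))"
  by (simp only: E_poly_def pm_scale_eq power2_eq_square)

lemma Ep_hom: "Ep \<in> hom_polys 2"
proof -
  have "lin_poly (zc i) * lin_poly (zc i) \<in> hom_polys 2" for i
    using hom_polys_mult[OF lin_poly_hom lin_poly_hom, of "zc i" "zc i"] by (simp only: one_add_one)
  then show ?thesis unfolding E_poly_eq by (intro hom_polys_simps hom_polys_sum)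
qed

lemma Ep_power_hom: "Ep ^ m \<in> hom_polys (2 * m)"
  by (rule hom_polys_power[OF Ep_hom])

text \<open>One factor of each square is expanded as w z_i = sum of B(z_i, w^-1 z_j) z_j. Summation
  over i then turns the other factor into w (w^-1 z_j) = z_j.\<close>

lemma Ep_invariant: assumes w: "w \<in> W" shows "poly_act w Ep = Ep"
proof -
  have wz: "cact w (zc i) = (\<Sum>j\<in>UNIV. B_form R (zc i) (cact (inv w) (zc j)) *s zc j)" for i
    by (subst B_expand[of "cact w (zc i)"]) (simp only: B_form_adj[OF w])
  have "(\<Sum>i\<in>UNIV. lin_poly (cact w (zc i)) * lin_poly (cact w (zc i)))
    = (\<Sum>i\<in>UNIV. \<Sum>j\<in>UNIV. lin_poly (zc j) * (const_poly (B_form R (zc i) (cact (inv w) (zc j))) * lin_poly (cact w (zc i))))"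
    by (subst (1) wz) (simp add: lin_poly_sum lin_poly_simps sum_distrib_left sum_distrib_right mult_ac)
  also have "\<dots> = (\<Sum>j\<in>UNIV. lin_poly (zc j) * (\<Sum>i\<in>UNIV. const_poly (B_form R (zc i) (cact (inv w) (zc j))) * lin_poly (cact w (zc i))))"
    by (subst sum.swap) (simp only: sum_distrib_left)
  also have "\<dots> = (\<Sum>j\<in>UNIV. lin_poly (zc j) * lin_poly (zc j))"
  proof (intro sum.cong refl)
    fix j
    have "(\<Sum>i\<in>UNIV. const_poly (B_form R (zc i) (cact (inv w) (zc j))) * lin_poly (cact w (zc i)))
      = poly_act w (lin_poly (\<Sum>i\<in>UNIV. B_form R (cact (inv w) (zc j)) (zc i) *s zc i))"
      by (simp add: lin_poly_sum lin_poly_simps poly_act_lin B_form_commute[of "zc _"])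
    also have "\<dots> = lin_poly (zc j)"
      unfolding B_expand[symmetric] poly_act_lin cact_inv(1)[OF w] ..
    finally show "lin_poly (zc j) * (\<Sum>i\<in>UNIV. const_poly (B_form R (zc i) (cact (inv w) (zc j))) * lin_poly (cact w (zc i))) = lin_poly (zc j) * lin_poly (zc j)"
      by simp
  qed
  finally show ?thesis unfolding E_poly_eq by (simp only: poly_act_simps poly_act_lin)
qed

lemma B_dual: "pairing (zc j) (yz i) = (if i = j then 1 else 0)"
  by (simp add: pairing_B_map B_ortho)

lemma dir_deriv_Ep: "dir_deriv (yz i) Ep = lin_poly (zc i)"
proof -
  have "dir_deriv (yz i) Ep = const_poly (1/2) * (\<Sum>j\<in>UNIV. if j = i then const_poly 2 * lin_poly (zc i) else 0)"
    unfolding E_poly_eq dir_deriv_scale dir_deriv_sum unfolding dir_deriv_mult dir_deriv_lin B_dual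
  proof (intro arg_cong2[where f = "(*)"] refl sum.cong)
    fix j
    have c2: "const_poly 2 = (1 + 1 :: 'n mpoly)"
      unfolding const_poly_simps(2)[symmetric] const_poly_simps(3)[symmetric] one_add_one ..
    show "const_poly (if i = j then 1 else 0) * lin_poly (zc j) + lin_poly (zc j) * const_poly (if i = j then 1 else 0)
       = (if j = i then const_poly 2 * lin_poly (zc i) else 0)"
    proof (cases "j = i")
      case True
      show ?thesis unfolding True c2
        by (simp only: refl if_True const_poly_simps distrib_right mult_1_left mult_1_right)
    qed simp
  qed
  also have "\<dots> = (const_poly (1/2) * const_poly 2) * lin_poly (zc i)" by (simp add: mult.assoc)
  also have "const_poly (1/2) * const_poly 2 = (1 :: 'n mpoly)" by (simp only: const_poly_simps(4)[symmetric]) simp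
  finally show ?thesis by simp
qed

lemma euler: assumes "p \<in> hom_polys n"
  shows "(\<Sum>i\<in>UNIV. lin_poly (zc i) * dir_deriv (yz i) p) = const_poly (of_nat n) * p"
proof -
  let ?e = "\<lambda>p. \<Sum>i\<in>UNIV. lin_poly (zc i) * dir_deriv (yz i) p"
  have ad: "?e (p + q) = ?e p + ?e q" for p q by (simp add: dir_deriv_add distrib_left sum.distrib)
  have x: "pvar j = (\<Sum>i\<in>UNIV. lin_poly (zc i) * const_poly (yz i $ j))" for j
  proof -
    have "pvar j = lin_poly (\<Sum>i\<in>UNIV. B_form R (axis j 1) (zc i) *s zc i)"
      unfolding B_expand[symmetric] lin_poly_axis ..
    moreover have "B_form R (axis j 1) (zc i) = yz i $ j" for i
      using pairing_B_map[of "axis j 1" "zc i"] B_form_commute[of "axis j 1" "zc i"] by simp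
    ultimately show ?thesis by (simp add: lin_poly_sum lin_poly_simps mult.commute)
  qed
  have m: "?e (Poly_Mapping.single m c) = const_poly (of_nat (mdeg m)) * Poly_Mapping.single m c" for m c
  proof (induction m rule: monomial_induct)
    case zero
    show ?case unfolding const_poly_def[symmetric] by (simp add: dir_deriv_const)
  next
    case (step j m)
    have e: "Poly_Mapping.single (Poly_Mapping.single j 1 + m) c = pvar j * Poly_Mapping.single m c" by (simp add: mult_single)
    have "?e (pvar j * Poly_Mapping.single m c)
      = (\<Sum>i\<in>UNIV. lin_poly (zc i) * const_poly (yz i $ j)) * Poly_Mapping.single m c + pvar j * ?e (Poly_Mapping.single m c)"
      unfolding dir_deriv_var_mult sum_distrib_right sum_distrib_left sum.distrib[symmetric]
      by (intro sum.cong refl) (simp only: distrib_left mult_ac)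
    also have "\<dots> = const_poly (of_nat (mdeg (Poly_Mapping.single j 1 + m))) * (pvar j * Poly_Mapping.single m c)"
      unfolding step x[symmetric] mdeg_add mdeg_single of_nat_add of_nat_1 const_poly_simps
      by (simp add: algebra_simps del: mult_single)
    finally show ?case unfolding e .
  qed
  have e0: "?e 0 = 0" using ad[of 0 0] by simp
  have s: "?e (sum g A) = (\<Sum>x\<in>A. ?e (g x))" for g :: "('n \<Rightarrow>\<^sub>0 nat) \<Rightarrow> _" and A
    by (induction A rule: infinite_finite_induct) (simp_all add: e0 ad del: poly_mapping_sum_single)
  have "?e p = (\<Sum>m\<in>Poly_Mapping.keys p. ?e (Poly_Mapping.single m (Poly_Mapping.lookup p m)))"
    unfolding s[symmetric] poly_mapping_sum_single[symmetric] ..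
  also have "\<dots> = (\<Sum>m\<in>Poly_Mapping.keys p. const_poly (of_nat n) * Poly_Mapping.single m (Poly_Mapping.lookup p m))"
    unfolding m using assms by (intro sum.cong refl) (simp add: hom_polys_def)
  also have "\<dots> = const_poly (of_nat n) * p"
    unfolding sum_distrib_left[symmetric] poly_mapping_sum_single[symmetric] ..
  finally show ?thesis .
qed

end

context verma
begin

lemma vp_simps: "vp_scale c (vp_scale d u) = vp_scale (c * d) u" "vp_scale c (u + u') = vp_scale c u + vp_scale c u'"
  "vp_scale (c + d) u = vp_scale c u + vp_scale d u" "vp_scale 1 u = u" "vp_scale 0 u = 0"
  by (simp_all add: vec_eq_iff algebra_simps)

lemma act_Y_low: assumes "u \<in> M_hom n"
  shows "n \<noteq> 0 \<Longrightarrow> act (dunkl R Rp k y) u \<in> M_hom (n - 1)" "n = 0 \<Longrightarrow> act (dunkl R Rp k y) u = 0"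
proof -
  have "act (dunkl R Rp k y) u $ i \<in> low n" for i
  proof -
    have d1: "(\<Sum>j\<in>UNIV. const_poly (\<rho> (root_refl R \<alpha>) (axis j 1) $ i) * dq \<alpha> (u $ j)) \<in> low n" if "\<alpha> \<in> Rp" for \<alpha>
    proof (intro low_sum low_const)
      fix j show "dq \<alpha> (u $ j) \<in> low n"
        using assms by (intro dq_low[OF Rp_R[OF that]]) (simp add: M_hom_iff)
    qed
    have "(\<Sum>\<alpha>\<in>Rp. const_poly (k \<alpha> * pairing (cplx \<alpha>) y) * (\<Sum>j\<in>UNIV. const_poly (\<rho> (root_refl R \<alpha>) (axis j 1) $ i) * dq \<alpha> (u $ j))) \<in> low n"
      by (rule low_sum, rule low_const, rule d1)
    moreover have "dir_deriv y (u $ i) \<in> low n" using assms by (intro dir_deriv_low) (simp add: M_hom_iff)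
    ultimately have "dir_deriv y (u $ i) + (\<Sum>\<alpha>\<in>Rp. const_poly (k \<alpha> * pairing (cplx \<alpha>) y) * (\<Sum>j\<in>UNIV. const_poly (\<rho> (root_refl R \<alpha>) (axis j 1) $ i) * dq \<alpha> (u $ j))) \<in> low n"
      by (intro low_add)
    also have "dir_deriv y (u $ i) + (\<Sum>\<alpha>\<in>Rp. const_poly (k \<alpha> * pairing (cplx \<alpha>) y) * (\<Sum>j\<in>UNIV. const_poly (\<rho> (root_refl R \<alpha>) (axis j 1) $ i) * dq \<alpha> (u $ j)))
       = act (dunkl R Rp k y) u $ i"
      unfolding act_Y dm.mY_def app_simps app_sum_left vector_add_component sum_component app_Lv dm.mK_def app_Mv app_e
      by (intro arg_cong2[where f = "(+)"] refl sum.cong) (simp add: app_eQ Rp_R)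
    finally show ?thesis .
  qed
  then show "n \<noteq> 0 \<Longrightarrow> act (dunkl R Rp k y) u \<in> M_hom (n - 1)" "n = 0 \<Longrightarrow> act (dunkl R Rp k y) u = 0"
    by (auto simp: low_def M_hom_iff vec_eq_iff)
qed

lemma act_mult_hom: "u \<in> M_hom n \<Longrightarrow> p \<in> hom_polys m \<Longrightarrow> act (mult_op p) u \<in> M_hom (m + n)"
  by (simp add: M_hom_iff hom_polys_mult)

lemma act_W_hom: assumes "w \<in> W" "u \<in> M_hom n" shows "act (poly_act w) u \<in> M_hom n"
  unfolding act_W[OF assms(1)] tens_act_def
  using assms(2) by (intro M_hom_simps(5) tens_hom poly_act_hom) (simp add: M_hom_iff)

text \<open>E is invariant, so its divided differences vanish and only its derivative z_i remains of
  the commutator.\<close>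

lemma act_Y_E: "act (dunkl R Rp k (yz i)) (act (mult_op Ep) u)
  = act (mult_op Ep) (act (dunkl R Rp k (yz i)) u) + act (mult_op (lin_poly (zc i))) u"
proof -
  have q: "dq \<alpha> Ep = 0" if "\<alpha> \<in> Rp" for \<alpha>
    using that by (intro dq_eqI Rp_R) (simp_all add: Ep_invariant W_refl Rp_R)
  have "(\<Sum>\<alpha>\<in>Rp. dm.mK (k \<alpha> * pairing (cplx \<alpha>) (yz i)) * V.Xp (dq \<alpha> Ep) * dm.mW (root_refl R \<alpha>)) = 0"
    by (intro sum.neutral ballI) (simp add: q V.Xp_simps)
  then have "dm.mY (yz i) * V.Xp Ep = V.Xp Ep * dm.mY (yz i) + V.Xp (lin_poly (zc i))"
    using V.Y_Xp[of "yz i" Ep] by (simp only: dir_deriv_Ep add_0_right)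
  from arg_cong[OF this, of "\<lambda>r. app r u"] show ?thesis
    by (simp only: act_def V.\<Phi>_simps V.\<Phi>_mult app_simps)
qed

text \<open>The action of F = \<sigma>(E), written out for the orthonormal basis as half the sum of
  squares of Dunkl operators; in this shape its dependence on k can be read off.\<close>

definition FE :: "('n, 'd) vpoly \<Rightarrow> ('n, 'd) vpoly"
  where "FE u = vp_scale (1/2) (\<Sum>i\<in>UNIV. act (dunkl R Rp k (yz i)) (act (dunkl R Rp k (yz i)) u))"

lemma act_sg_mult: "act (sg (mult_op (p + q))) u = act (sg (mult_op p)) u + act (sg (mult_op q)) u"
  "act (sg (mult_op (p * q))) u = act (sg (mult_op q)) (act (sg (mult_op p)) u)"
  "act (sg (mult_op (const_poly c))) u = vp_scale c u"
  "act (sg (mult_op (lin_poly x))) u = act (dunkl R Rp k (B_map R x)) u"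
proof -
  have "mult_op (p + q) = mult_op p + mult_op q" by (rule ext) (simp add: mult_op_def distrib_right)
  then show "act (sg (mult_op (p + q))) u = act (sg (mult_op p)) u + act (sg (mult_op q)) u"
    by (simp only: sg_add V.mult_H act_left sg_H)
  have "mult_op (p * q) = mult_op p \<circ> mult_op q" by (rule ext) (simp add: mult_op_def mult.assoc)
  then show "act (sg (mult_op (p * q))) u = act (sg (mult_op q)) (act (sg (mult_op p)) u)"
    by (simp only: sg_comp V.mult_H act_left sg_H)
  have "mult_op (const_poly c) = op_scale c (id :: 'n oper)"
    by (rule ext) (simp add: mult_op_def op_scale_def pm_scale_eq)
  then show "act (sg (mult_op (const_poly c))) u = vp_scale c u"
    by (simp only: sg_scale V.id_H sg_id act_left)
  show "act (sg (mult_op (lin_poly x))) u = act (dunkl R Rp k (B_map R x)) u" by (simp only: sg_X)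
qed

lemma act_sg_sum: "act (sg (mult_op (sum f A))) u = (\<Sum>i\<in>A. act (sg (mult_op (f i))) u)"
proof -
  have "act (sg (mult_op 0)) u = 0" using act_sg_mult(3)[of 0 u] by (simp only: const_poly_simps vp_simps)
  then show ?thesis by (induction A rule: infinite_finite_induct) (simp_all add: act_sg_mult(1))
qed

lemma act_sg_E: "act (sg (mult_op Ep)) u = FE u"
proof -
  have "act (sg (mult_op Ep)) u = (\<Sum>i\<in>UNIV. act (dunkl R Rp k (yz i)) (act (dunkl R Rp k (yz i)) (vp_scale (1/2) u)))"
    unfolding E_poly_eq act_sg_mult(2) act_sg_mult(3) act_sg_sum act_sg_mult(4) ..
  also have "\<dots> = FE u"
    unfolding FE_def act_scale_right[OF V.dunkl_H] vp.scale_sum_right ..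
  finally show ?thesis .
qed

lemma act_sg_E_power: "act (sg (mult_op (Ep ^ m))) u = (FE ^^ m) u"
proof (induction m arbitrary: u)
  case 0
  then show ?case using act_sg_mult(3)[of 1 u] by (simp add: vp_simps)
next
  case (Suc m)
  have "act (sg (mult_op (Ep ^ Suc m))) u = (FE ^^ m) (FE u)"
    unfolding power_Suc act_sg_mult(2) act_sg_E Suc ..
  then show ?case by (simp only: funpow_Suc_right o_apply)
qed

text \<open>The grading element of the sl2-triple.\<close>

definition hop :: "('n, 'd) vpoly \<Rightarrow> ('n, 'd) vpoly"
  where "hop u = FE (act (mult_op Ep) u) - act (mult_op Ep) (FE u)"

text \<open>Summed over the dual bases z_i and B(z_i), the coefficient of r_\<alpha> becomes
  k_\<alpha> times \<alpha> paired with its coroot, that is 2 k_\<alpha>; the factor 1/2 of E leaves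
  k_\<alpha>. The identity terms add up to half the dimension.\<close>

lemma hop_eq: "hop u = (\<Sum>i\<in>UNIV. act (mult_op (lin_poly (zc i))) (act (dunkl R Rp k (yz i)) u))
   + vp_scale (of_nat CARD('n) / 2) u + (\<Sum>\<alpha>\<in>Rp. vp_scale (k \<alpha>) (act (poly_act (root_refl R \<alpha>)) u))"
proof -
  let ?T = "\<lambda>i. act (dunkl R Rp k (yz i))" and ?Z = "\<lambda>i. act (mult_op (lin_poly (zc i)))" and ?E = "act (mult_op Ep)"
  have TZ: "?T i (?Z i u) = ?Z i (?T i u) + u + (\<Sum>\<alpha>\<in>Rp. vp_scale (k \<alpha> * pairing (cplx \<alpha>) (yz i) * pairing (zc i) (cplx (coroot R \<alpha>))) (act (poly_act (root_refl R \<alpha>)) u))" for i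
  proof -
    have "(\<Sum>\<alpha>\<in>Rp. app (dm.mK (k \<alpha> * pairing (cplx \<alpha>) (yz i) * pairing (zc i) (cplx (coroot R \<alpha>))) * dm.mW (root_refl R \<alpha>)) u)
       = (\<Sum>\<alpha>\<in>Rp. vp_scale (k \<alpha> * pairing (cplx \<alpha>) (yz i) * pairing (zc i) (cplx (coroot R \<alpha>))) (act (poly_act (root_refl R \<alpha>)) u))"
      by (intro sum.cong refl) (simp only: app_simps mK_scale act_def V.\<Phi>_simps W_refl Rp_R)
    moreover have "app (dm.mK (pairing (zc i) (yz i))) u = u" by (simp only: B_dual refl if_True mK_scale vp_simps)
    ultimately show ?thesis
      using arg_cong[OF V.YX[of "yz i" "zc i"], of "\<lambda>r. app r u"]
      by (simp only: act_def V.\<Phi>_simps app_simps app_sum_left)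
  qed
  have "FE (?E u) = vp_scale (1/2) (\<Sum>i\<in>UNIV. ?E (?T i (?T i u)) + ?Z i (?T i u) + ?T i (?Z i u))"
    unfolding FE_def act_Y_E act_right by (simp only: ac_simps)
  also have "\<dots> = ?E (FE u) + vp_scale (1/2) (\<Sum>i\<in>UNIV. ?Z i (?T i u) + ?T i (?Z i u))"
    unfolding FE_def act_scale_right[OF V.mult_H] act_right vp_simps(2)[symmetric] sum.distrib by (simp only: add.assoc)
  finally have "hop u = vp_scale (1/2) (\<Sum>i\<in>UNIV. ?Z i (?T i u) + ?T i (?Z i u))" unfolding hop_def by simp
  also have "(\<Sum>i\<in>UNIV. ?Z i (?T i u) + ?T i (?Z i u)) = vp_scale 2 (\<Sum>i\<in>UNIV. ?Z i (?T i u)) + vp_scale (of_nat CARD('n)) u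
     + (\<Sum>\<alpha>\<in>Rp. \<Sum>i\<in>UNIV. vp_scale (k \<alpha> * pairing (cplx \<alpha>) (yz i) * pairing (zc i) (cplx (coroot R \<alpha>))) (act (poly_act (root_refl R \<alpha>)) u))"
  proof -
    have "finite A \<Longrightarrow> (\<Sum>i\<in>A. u) = vp_scale (of_nat (card A)) u" for A :: "'n set"
      by (induction A rule: finite_induct) (simp_all add: vp_simps vec_eq_iff algebra_simps del: sum_constant)
    then have n: "(\<Sum>i\<in>(UNIV :: 'n set). u) = vp_scale (of_nat CARD('n)) u" by (simp only: finite)
    have t: "vp_scale 2 x = x + x" for x :: "('n, 'd) vpoly" using vp_simps(3)[of 1 1 x] by (simp add: vp_simps(4))
    show ?thesis unfolding TZ sum.distrib n t by (subst sum.swap) (simp only: ac_simps)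
  qed
  also have "(\<Sum>\<alpha>\<in>Rp. \<Sum>i\<in>UNIV. vp_scale (k \<alpha> * pairing (cplx \<alpha>) (yz i) * pairing (zc i) (cplx (coroot R \<alpha>))) (act (poly_act (root_refl R \<alpha>)) u))
     = (\<Sum>\<alpha>\<in>Rp. vp_scale (2 * k \<alpha>) (act (poly_act (root_refl R \<alpha>)) u))"
  proof (intro sum.cong refl)
    fix \<alpha> assume a: "\<alpha> \<in> Rp"
    have "pairing (cplx \<alpha>) (cplx (coroot R \<alpha>)) = 2" by (simp add: pairing_cplx root_coroot Rp_R a)
    then have "(\<Sum>i\<in>UNIV. k \<alpha> * pairing (cplx \<alpha>) (yz i) * pairing (zc i) (cplx (coroot R \<alpha>))) = 2 * k \<alpha>"
      using dual_basis_sum[of "cplx \<alpha>" "cplx (coroot R \<alpha>)"] by (simp add: sum_distrib_left[symmetric] mult.assoc)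
    then show "(\<Sum>i\<in>UNIV. vp_scale (k \<alpha> * pairing (cplx \<alpha>) (yz i) * pairing (zc i) (cplx (coroot R \<alpha>))) (act (poly_act (root_refl R \<alpha>)) u)) = vp_scale (2 * k \<alpha>) (act (poly_act (root_refl R \<alpha>)) u)"
      unfolding vp.scale_sum_left[symmetric] by simp
  qed
  finally show ?thesis by (simp add: vp_simps vp.scale_sum_right del: vp.scale_scale)
qed

text \<open>The sum of the \<alpha>(B(z_i)) z_i is \<alpha> and cancels the denominators of the
  Dunkl operators. So the sum of the z_i T_i is the Euler operator plus the sum of k_\<alpha> (1
  tensor r_\<alpha> - r_\<alpha>). The diagonal reflections cancel against those in
  \<open>hop_eq\<close>, and an operator acting on V alone is left.\<close>

lemma hop_hom: assumes u: "u \<in> M_hom n"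
  shows "hop u = vp_scale (of_nat n + of_nat CARD('n) / 2) u + (\<Sum>\<alpha>\<in>Rp. vp_scale (k \<alpha>) (app (Mv \<rho> (root_refl R \<alpha>)) u))"
proof -
  let ?M = "\<lambda>\<alpha>. app (Mv \<rho> (root_refl R \<alpha>))"
  have "(\<Sum>i\<in>UNIV. act (mult_op (lin_poly (zc i))) (act (dunkl R Rp k (yz i)) u))
     = vp_scale (of_nat n) u + (\<Sum>\<alpha>\<in>Rp. vp_scale (k \<alpha>) (?M \<alpha> u - act (poly_act (root_refl R \<alpha>)) u))"
  proof -
    have d: "act (dunkl R Rp k y) u = app (Lv (eD y)) u + (\<Sum>\<alpha>\<in>Rp. vp_scale (k \<alpha> * pairing (cplx \<alpha>) y) (?M \<alpha> (app (Lv (eQ \<alpha>)) u)))" for y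
      unfolding act_Y dm.mY_def app_simps app_sum_left mK_scale ..
    have 1: "(\<Sum>i\<in>UNIV. act (mult_op (lin_poly (zc i))) (app (Lv (eD (yz i))) u)) = vp_scale (of_nat n) u"
      using u euler[of "u $ _" n] by (simp add: vec_eq_iff M_hom_iff)
    have 2: "(\<Sum>i\<in>UNIV. act (mult_op (lin_poly (zc i))) (vp_scale (k \<alpha> * pairing (cplx \<alpha>) (yz i)) (?M \<alpha> (app (Lv (eQ \<alpha>)) u))))
       = vp_scale (k \<alpha>) (?M \<alpha> u - act (poly_act (root_refl R \<alpha>)) u)" if a: "\<alpha> \<in> Rp" for \<alpha>
    proof -
      have aR: "\<alpha> \<in> R" and w: "root_refl R \<alpha> \<in> W" using a by (auto intro: W_refl Rp_R)
      have l: "(\<Sum>i\<in>UNIV. lin_poly (zc i) * const_poly (pairing (cplx \<alpha>) (yz i))) = lin_poly (cplx \<alpha>)"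
      proof -
        have "lin_poly (cplx \<alpha>) = lin_poly (\<Sum>i\<in>UNIV. B_form R (cplx \<alpha>) (zc i) *s zc i)" unfolding B_expand[symmetric] ..
        then show ?thesis by (simp add: lin_poly_sum lin_poly_simps pairing_B_map B_form_commute[of "zc _"] mult.commute)
      qed
      have "(\<Sum>i\<in>UNIV. act (mult_op (lin_poly (zc i))) (vp_scale (k \<alpha> * pairing (cplx \<alpha>) (yz i)) x)) = vp_scale (k \<alpha>) (act (mult_op (lin_poly (cplx \<alpha>))) x)" for x
        unfolding l[symmetric] by (simp add: vec_eq_iff sum_distrib_left sum_distrib_right mult_ac)
      then have "(\<Sum>i\<in>UNIV. act (mult_op (lin_poly (zc i))) (vp_scale (k \<alpha> * pairing (cplx \<alpha>) (yz i)) (?M \<alpha> (app (Lv (eQ \<alpha>)) u))))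
         = vp_scale (k \<alpha>) (act (mult_op (lin_poly (cplx \<alpha>))) (?M \<alpha> (app (Lv (eQ \<alpha>)) u)))" .
      also have "act (mult_op (lin_poly (cplx \<alpha>))) (?M \<alpha> (app (Lv (eQ \<alpha>)) u)) = ?M \<alpha> u - act (poly_act (root_refl R \<alpha>)) u"
      proof -
        have "act (mult_op (lin_poly (cplx \<alpha>))) (?M \<alpha> x) = ?M \<alpha> (act (mult_op (lin_poly (cplx \<alpha>))) x)" for x
          by (simp add: vec_eq_iff sum_distrib_left mult.left_commute)
        moreover have "act (mult_op (lin_poly (cplx \<alpha>))) (app (Lv (eQ \<alpha>)) u) = u - app (Lv (eW (root_refl R \<alpha>))) u"
          by (simp add: vec_eq_iff app_eQ aR dq_spec)
        moreover have "?M \<alpha> (app (Lv (eW (root_refl R \<alpha>))) u) = act (poly_act (root_refl R \<alpha>)) u"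
          by (simp only: act_def V.\<Phi>_simps w dm.mW_def app_simps)
        ultimately show ?thesis by (simp only: app_diff)
      qed
      finally show ?thesis .
    qed
    have "(\<Sum>i\<in>UNIV. act (mult_op (lin_poly (zc i))) (act (dunkl R Rp k (yz i)) u))
       = vp_scale (of_nat n) u + (\<Sum>\<alpha>\<in>Rp. \<Sum>i\<in>UNIV. act (mult_op (lin_poly (zc i))) (vp_scale (k \<alpha> * pairing (cplx \<alpha>) (yz i)) (?M \<alpha> (app (Lv (eQ \<alpha>)) u))))"
      unfolding d act_right sum.distrib 1 by (subst sum.swap) (rule refl)
    then show ?thesis using 2 by (simp cong: sum.cong)
  qed
  then show ?thesis unfolding hop_eq
    by (simp add: vp_simps vp.scale_right_diff_distrib sum_subtractf)
qed

end

lemma hom_decomp_ex: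
  fixes u :: "('n::finite, 'd::finite) vpoly"
  shows "\<exists>N f. u = (\<Sum>j\<le>N. f j) \<and> (\<forall>j. f j \<in> M_hom j)"
proof (rule hom_decomp[of u])
  fix N f assume "u = (\<Sum>j\<le>N. f j)" "\<And>j. f j \<in> M_hom j"
  then show ?thesis by (intro exI conjI allI)
qed

context verma_forms
begin

text \<open>An eigenspace of f is a nonzero invariant subspace.\<close>

lemma schur:
  assumes fadd: "\<And>x y. f (x + y) = f x + f y" and fsc: "\<And>c x. f (c *s x) = c *s f x"
    and comm: "\<And>w x. w \<in> W \<Longrightarrow> f (\<rho> w x) = \<rho> w (f x)"
  obtains c where "\<And>x. f x = c *s x"
proof -
  obtain \<mu> u where mu: "u \<noteq> 0" "f u = \<mu> *s u" using eigenvector_exists[OF fadd fsc v_nz] .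
  have "{x. f x = \<mu> *s x} = UNIV"
  proof (rule invariant_subspace)
    have f0: "f 0 = 0" using fadd[of 0 0] by simp
    show "vec.subspace {x. f x = \<mu> *s x}"
      by (rule vec.subspaceI) (simp_all add: f0 fadd fsc vec.scale_right_distrib mult.commute)
    show "\<rho> w x \<in> {x. f x = \<mu> *s x}" if "w \<in> W" "x \<in> {x. f x = \<mu> *s x}" for w x
      using that(2) by (simp add: comm[OF that(1)] rho_simps[OF that(1)])
    show "u \<in> {x. f x = \<mu> *s x}" using mu by simp
  qed (rule mu(1))
  then show thesis by (intro that[of \<mu>]) blast
qed

text \<open>The sum of k_\<alpha> r_\<alpha> over positive roots is central in CW, since conjugation
  permutes the reflections and preserves k. By Schur's lemma it acts on V as a scalar, to which half
  the dimension is added.\<close>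

lemma hop_scalar: obtains c where "\<And>n u. u \<in> M_hom n \<Longrightarrow> hop u = vp_scale (of_nat n + c) u"
proof -
  define f where "f x = (\<Sum>\<alpha>\<in>Rp. k \<alpha> *s \<rho> (root_refl R \<alpha>) x)" for x
  have r: "root_refl R \<alpha> \<in> W" if "\<alpha> \<in> Rp" for \<alpha> using that by (intro W_refl Rp_R)
  have fadd: "f (x + y) = f x + f y" for x y
    unfolding f_def sum.distrib[symmetric] by (intro sum.cong refl) (simp add: rho_simps[OF r] vec.scale_right_distrib)
  have fsc: "f (c *s x) = c *s f x" for c x
    unfolding f_def vec.scale_sum_right by (intro sum.cong refl) (simp add: rho_simps[OF r] mult.commute)
  have comm: "f (\<rho> w x) = \<rho> w (f x)" if w: "w \<in> W" for w x
  proof -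
    have r0: "\<rho> w 0 = 0" using rho_simps(1)[OF w, of 0 0] by simp
    have rs: "\<rho> w (sum g A) = (\<Sum>i\<in>A. \<rho> w (g i))" for g :: "real^'n \<Rightarrow> complex^'d" and A
      by (induction A rule: infinite_finite_induct) (simp_all add: r0 rho_simps[OF w])
    have "\<rho> w (f x) = (\<Sum>\<alpha>\<in>Rp. k (w \<alpha>) *s \<rho> (root_refl R (w \<alpha>)) (\<rho> w x))"
      unfolding f_def rs
    proof (intro sum.cong refl)
      fix \<alpha> assume a: "\<alpha> \<in> Rp"
      have "\<rho> w (\<rho> (root_refl R \<alpha>) x) = \<rho> (root_refl R (w \<alpha>)) (\<rho> w x)"
        using fun_cong[OF rho_comp[OF w r[OF a]], of x]
          fun_cong[OF rho_comp[OF W_refl[OF W_root[OF w Rp_R[OF a]]] w], of x] root_refl_W[OF w Rp_R[OF a]] by simp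
      then show "\<rho> w (k \<alpha> *s \<rho> (root_refl R \<alpha>) x) = k (w \<alpha>) *s \<rho> (root_refl R (w \<alpha>)) (\<rho> w x)"
        by (simp add: rho_simps[OF w] k_W[OF w Rp_R[OF a]])
    qed
    also have "\<dots> = (\<Sum>\<alpha>\<in>Rp. k \<alpha> *s \<rho> (root_refl R \<alpha>) (\<rho> w x))"
      by (rule sum_Rp_W[OF w]) (simp add: k_uminus root_refl_uminus)
    finally show ?thesis unfolding f_def by simp
  qed
  obtain c where c: "\<And>x. f x = c *s x" using schur[OF fadd fsc comm] by blast
  have "(\<Sum>\<alpha>\<in>Rp. vp_scale (k \<alpha>) (app (Mv \<rho> (root_refl R \<alpha>)) u)) = vp_scale c u" for u
  proof -
    have "(\<Sum>\<alpha>\<in>Rp. const_poly (k \<alpha>) * (\<Sum>j\<in>UNIV. const_poly (\<rho> (root_refl R \<alpha>) (axis j 1) $ i) * u $ j))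
      = (\<Sum>j\<in>UNIV. const_poly (f (axis j 1) $ i) * u $ j)" for i
      unfolding f_def sum_distrib_left
      by (subst sum.swap) (simp add: const_poly_sum sum_distrib_right mult.assoc)
    also have "(\<Sum>j\<in>UNIV. const_poly (f (axis j 1) $ i) * u $ j) = (\<Sum>j\<in>UNIV. if j = i then const_poly c * u $ i else 0)" for i
      unfolding c by (intro sum.cong refl) (simp add: axis_def)
    finally show ?thesis by (simp add: vec_eq_iff)
  qed
  then have "hop u = vp_scale (of_nat n + (of_nat CARD('n) / 2 + c)) u" if "u \<in> M_hom n" for n u
    unfolding hop_hom[OF that] by (simp add: vp_simps(3)[symmetric] add.assoc)
  then show thesis by (rule that)
qed

lemma FE_hom: assumes u: "u \<in> M_hom n" shows "n \<ge> 2 \<Longrightarrow> FE u \<in> M_hom (n - 2)" "n < 2 \<Longrightarrow> FE u = 0"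
proof -
  let ?T = "\<lambda>i. act (dunkl R Rp k (yz i))"
  have "?T i (?T i u) \<in> M_hom (n - 2)" if "n \<ge> 2" for i
    using act_Y_low(1)[OF act_Y_low(1)[OF u, of "yz i"], of "yz i"] that by (simp add: numeral_2_eq_2)
  then show "n \<ge> 2 \<Longrightarrow> FE u \<in> M_hom (n - 2)" unfolding FE_def by (intro M_hom_simps) blast
  have "?T i (?T i u) = 0" if "n < 2" for i
  proof (cases "n = 0")
    case True
    then show ?thesis using act_Y_low(2)[OF u] by (simp only: act_right)
  next
    case False
    then have "n - 1 = 0" using that by simp
    then show ?thesis using act_Y_low(1)[OF u False] act_Y_low(2) by metis
  qed
  then show "n < 2 \<Longrightarrow> FE u = 0" unfolding FE_def by simp
qed

lemma FE_zero: "FE 0 = 0"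
  unfolding FE_def by (simp only: act_right sum.neutral_const vp.scale_zero_right)

lemma FE_pow_hom: assumes "u \<in> M_hom n"
  shows "(2 * m \<le> n \<longrightarrow> (FE ^^ m) u \<in> M_hom (n - 2 * m)) \<and> (n < 2 * m \<longrightarrow> (FE ^^ m) u = 0)"
proof (induction m)
  case 0
  then show ?case using assms by simp
next
  case (Suc m)
  show ?case
  proof (cases "2 * m \<le> n")
    case True
    then have "(FE ^^ m) u \<in> M_hom (n - 2 * m)" using Suc by blast
    from FE_hom[OF this] show ?thesis by (auto simp: algebra_simps)
  next
    case False
    then show ?thesis using Suc by (auto simp: FE_zero)
  qed
qed

lemma FE_add: "FE (u + u') = FE u + FE u'" "FE (vp_scale c u) = vp_scale c (FE u)"
  unfolding FE_def act_right sum.distrib vp_simps(2) act_scale_right[OF V.dunkl_H] vp.scale_sum_right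
  by (simp_all add: vp_simps(1) mult.commute)

lemma FE_pow_add: "(FE ^^ m) (u + u') = (FE ^^ m) u + (FE ^^ m) u'" "(FE ^^ m) (vp_scale c u) = vp_scale c ((FE ^^ m) u)"
  by (induction m) (simp_all add: FE_add)

text \<open>Multiplication by the invariant E commutes with W, and \<sigma> transfers this to
  F.\<close>

lemma FE_W: assumes w: "w \<in> W" shows "FE (act (poly_act w) u) = act (poly_act w) (FE u)"
proof -
  note iw = V.poly_act_H[OF W_inv(1)[OF w]] and wH = V.poly_act_H[OF w] and m = V.mult_H[of Ep]
  have e: "poly_act (inv w) \<circ> mult_op Ep = mult_op Ep \<circ> poly_act (inv w)"
    by (rule ext) (simp add: mult_op_def Ep_invariant W_inv(1) w)
  have s: "sg (poly_act (inv w)) = poly_act w" by (simp only: sg_W W_inv(1) W_inv_inv w)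
  have "sg (mult_op Ep) \<circ> poly_act w = poly_act w \<circ> sg (mult_op Ep)"
    using sg_comp[OF iw m] sg_comp[OF m iw] unfolding e s by simp
  then have "act (sg (mult_op Ep) \<circ> poly_act w) u = act (poly_act w \<circ> sg (mult_op Ep)) u" by (simp only:)
  then show ?thesis by (simp only: act_left wH sg_H m act_sg_E)
qed

lemma FE_pow_W: "w \<in> W \<Longrightarrow> (FE ^^ m) (act (poly_act w) u) = act (poly_act w) ((FE ^^ m) u)"
  by (induction m) (simp_all add: FE_W)

section \<open>The equivariant map theta and the isotypic component\<close>

definition theta where "theta m u = ev0 ((FE ^^ m) u)"

lemma theta_simps: "theta m (u + u') = theta m u + theta m u'" "theta m (vp_scale c u) = c *s theta m u"
  "w \<in> W \<Longrightarrow> theta m (act (poly_act w) u) = \<rho> w (theta m u)"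
  by (simp_all only: theta_def FE_pow_add ev0_simps FE_pow_W ev0_W)

lemma theta_zero: "theta m 0 = 0"
  using theta_simps(2)[of m 0 0] by (simp add: vp_simps)

lemma theta_sum: "theta m (sum f A) = (\<Sum>i\<in>A. theta m (f i))"
  by (induction A rule: infinite_finite_induct) (simp_all add: theta_zero theta_simps(1))

lemma theta_hom: "u \<in> M_hom n \<Longrightarrow> n \<noteq> 2 * m \<Longrightarrow> theta m u = 0"
  using FE_pow_hom[of u n m] ev0_hom[of "(FE ^^ m) u" "n - 2 * m"] unfolding theta_def
  by (cases "2 * m \<le> n") (auto simp: ev0_simps)

lemma form_E: "form (tens (Ep ^ m) v) y = b v (theta m y)"
  unfolding form_tens act_sg_E_power theta_def ..

lemma E_power_vec_eq: "E_power_vec R Rp k \<rho> z m v = tens (Ep ^ m) v"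
  unfolding E_power_vec_def verma_act_eq[OF V.mult_H] act_tens by simp

text \<open>\<open>theta m\<close> annihilates homogeneous elements of every degree except 2m, so a
  test vector may be replaced by its component of that degree.\<close>

lemma E_Rad_iff: "tens (Ep ^ m) v \<in> Rad \<longleftrightarrow> (\<forall>y\<in>M_hom (2 * m). b v (theta m y) = 0)"
proof
  assume "tens (Ep ^ m) v \<in> Rad"
  then show "\<forall>y\<in>M_hom (2 * m). b v (theta m y) = 0" by (simp add: Rad_def form_E)
next
  assume a: "\<forall>y\<in>M_hom (2 * m). b v (theta m y) = 0"
  have "b v (theta m y) = 0" for y
  proof -
    obtain N f where f: "y = (\<Sum>j\<le>N. f j)" "\<And>j. f j \<in> M_hom j" using hom_decomp_ex[of y] by (elim exE conjE) (rule that, assumption, erule spec)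
    have "b v (theta m (f j)) = 0" for j
      using a f(2)[of j] theta_hom[OF f(2), of j m] by (cases "j = 2 * m") (auto simp: b_right)
    then show ?thesis unfolding f(1) theta_sum b_right by simp
  qed
  then show "tens (Ep ^ m) v \<in> Rad" by (simp add: Rad_def form_E)
qed

text \<open>If \<open>theta\<close> is not zero in the given degree, then it is onto; averaging a linear section over the group gives an
  equivariant section, whose image lies in the isotypic component.\<close>

lemma theta_isotypic:
  assumes a: "\<And>P. P \<in> M_isotypic R \<rho> n \<Longrightarrow> b v (theta m P) = 0" and u: "u \<in> M_hom n"
  shows "theta m u = 0"
proof (rule ccontr)
  assume nz: "theta m u \<noteq> 0"
  have "theta m ` M_hom n = UNIV"
  proof (rule invariant_subspace)
    show "vec.subspace (theta m ` M_hom n)"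
    proof (rule vec.subspaceI)
      show "0 \<in> theta m ` M_hom n" using theta_zero M_hom_simps(3) by (metis imageI)
    next
      fix x y assume "x \<in> theta m ` M_hom n" "y \<in> theta m ` M_hom n"
      then obtain x' y' where "x' \<in> M_hom n" "y' \<in> M_hom n" "x = theta m x'" "y = theta m y'" by blast
      then show "x + y \<in> theta m ` M_hom n"
        by (intro image_eqI[of _ _ "x' + y'"]) (simp_all add: theta_simps M_hom_simps)
    next
      fix c x assume "x \<in> theta m ` M_hom n"
      then obtain x' where "x' \<in> M_hom n" "x = theta m x'" by blast
      then show "c *s x \<in> theta m ` M_hom n"
        by (intro image_eqI[of _ _ "vp_scale c x'"]) (simp_all add: theta_simps M_hom_simps)
    qed
    show "\<rho> w x \<in> theta m ` M_hom n" if "w \<in> W" "x \<in> theta m ` M_hom n" for w x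
    proof -
      obtain x' where "x' \<in> M_hom n" "x = theta m x'" using \<open>x \<in> theta m ` M_hom n\<close> by blast
      then show ?thesis using \<open>w \<in> W\<close> by (intro image_eqI[of _ _ "act (poly_act w) x'"]) (simp_all add: theta_simps act_W_hom)
    qed
    show "theta m u \<in> theta m ` M_hom n" using u by blast
  qed (rule nz)
  then have "\<exists>g. g \<in> M_hom n \<and> theta m g = x" for x by (metis UNIV_I imageE)
  then obtain g where g: "\<And>x. g x \<in> M_hom n" "\<And>x. theta m (g x) = x" by metis
  define s where "s x = (\<Sum>i\<in>UNIV. vp_scale (x $ i) (g (axis i 1)))" for x
  have s_hom: "s x \<in> M_hom n" for x unfolding s_def by (intro M_hom_simps(5) M_hom_simps(2) g)
  have s_th: "theta m (s x) = x" for x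
    unfolding s_def theta_sum theta_simps g by (rule vec_expand[symmetric])
  have s_lin: "s (x + y) = s x + s y" "s (c *s x) = vp_scale c (s x)" for x y c
    by (simp_all add: s_def vp_simps(3) sum.distrib vp.scale_sum_right)
  define r where "r = (inverse (of_nat (card W)) :: complex)"
  have card: "of_nat (card W) \<noteq> (0 :: complex)" using W_finite W_id by auto
  define t where "t x = vp_scale r (\<Sum>w\<in>W. act (poly_act w) (s (\<rho> (inv w) x)))" for x
  have t_hom: "t x \<in> M_hom n" for x
    unfolding t_def by (intro M_hom_simps(2) M_hom_simps(5) act_W_hom s_hom)
  have t_th: "theta m (t x) = x" for x
  proof -
    have "theta m (t x) = r *s (\<Sum>w\<in>W. x)"
      unfolding t_def theta_simps(2) theta_sum
      by (intro arg_cong2[where f = "(*s)"] refl sum.cong) (simp add: theta_simps(3) s_th rho_inv)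
    also have "(\<Sum>w\<in>A. x) = of_nat (card A) *s x" if "finite A" for A :: "(real^'n \<Rightarrow> real^'n) set"
      using that by (induction A rule: finite_induct) (simp_all add: vec.scale_left_distrib del: sum_constant)
    then have "(\<Sum>w\<in>W. x) = of_nat (card W) *s x" using W_finite by blast
    finally show ?thesis using card by (simp add: r_def vec.scale_scale)
  qed
  have t_lin: "t (x + y) = t x + t y" "t (c *s x) = vp_scale c (t x)" for x y c
  proof -
    have "(\<Sum>w\<in>W. act (poly_act w) (s (\<rho> (inv w) (x + y)))) = (\<Sum>w\<in>W. act (poly_act w) (s (\<rho> (inv w) x))) + (\<Sum>w\<in>W. act (poly_act w) (s (\<rho> (inv w) y)))"
      unfolding sum.distrib[symmetric]
      by (intro sum.cong refl) (simp add: rho_simps[OF W_inv(1)] s_lin act_right)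
    then show "t (x + y) = t x + t y" unfolding t_def by (simp only: vp_simps(2))
    have "(\<Sum>w\<in>W. act (poly_act w) (s (\<rho> (inv w) (c *s x)))) = vp_scale c (\<Sum>w\<in>W. act (poly_act w) (s (\<rho> (inv w) x)))"
      unfolding vp.scale_sum_right
      by (intro sum.cong refl) (simp add: rho_simps[OF W_inv(1)] s_lin act_scale_right V.poly_act_H)
    then show "t (c *s x) = vp_scale c (t x)" unfolding t_def by (simp only: vp_simps(1) mult.commute)
  qed
  have t_W: "t (\<rho> u x) = tens_act \<rho> u (t x)" if u: "u \<in> W" for u x
  proof -
    have "act (poly_act u) (t x) = vp_scale r (\<Sum>w\<in>W. act (poly_act (u \<circ> w)) (s (\<rho> (inv w) x)))"
      unfolding t_def act_scale_right[OF V.poly_act_H[OF u]] act_right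
    proof (intro arg_cong2[where f = vp_scale] refl sum.cong)
      fix w assume w: "w \<in> W"
      have e: "poly_act (u \<circ> w) = poly_act u \<circ> poly_act w"
        by (rule ext) (simp only: poly_act_comp[OF W_linear[OF u]] comp_apply)
      show "act (poly_act u) (act (poly_act w) (s (\<rho> (inv w) x))) = act (poly_act (u \<circ> w)) (s (\<rho> (inv w) x))"
        unfolding e act_left(3)[OF V.poly_act_H[OF u] V.poly_act_H[OF w]] ..
    qed
    also have "(\<Sum>w\<in>W. act (poly_act (u \<circ> w)) (s (\<rho> (inv w) x))) = (\<Sum>w\<in>W. act (poly_act w) (s (\<rho> (inv w) (\<rho> u x))))"
    proof (rule sum.reindex_bij_witness[of _ "\<lambda>w. inv u \<circ> w" "\<lambda>w. u \<circ> w"])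
      fix w assume w: "w \<in> W"
      show "inv u \<circ> (u \<circ> w) = w" "u \<circ> (inv u \<circ> w) = w"
        by (simp_all only: comp_assoc[symmetric] W_inv(2,3)[OF u] id_comp)
      show "u \<circ> w \<in> W" "inv u \<circ> w \<in> W" by (intro W_comp W_inv(1) u w)+
      have "inv (u \<circ> w) = inv w \<circ> inv u" by (intro o_inv_distrib W_bij u w)
      then have "\<rho> (inv (u \<circ> w)) (\<rho> u x) = \<rho> (inv w) (\<rho> (inv u) (\<rho> u x))"
        using rho_comp[OF W_inv(1)[OF w] W_inv(1)[OF u]] by simp
      then show "act (poly_act (u \<circ> w)) (s (\<rho> (inv (u \<circ> w)) (\<rho> u x))) = act (poly_act (u \<circ> w)) (s (\<rho> (inv w) x))"
        by (simp only: rho_inv u)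
    qed
    finally show ?thesis unfolding act_W[OF u] t_def ..
  qed
  have "Vector_Spaces.linear (*s) vp_scale t"
    by (intro Vector_Spaces.linear.intro vec.vector_space_axioms vp.vector_space_axioms)
      (simp add: module_hom_iff vec.module_axioms vp.module_axioms t_lin)
  moreover have "inj t" by (rule inj_on_inverseI[of _ "theta m"]) (rule t_th)
  ultimately have "range t \<subseteq> M_isotypic R \<rho> n"
    unfolding M_isotypic_def using t_hom t_W
    by (intro subset_trans[OF _ vp.span_superset] Sup_upper CollectI exI[of _ t]) auto
  \<comment> \<open>Every x is \<open>theta m\<close> of the isotypic vector t x, so the assumption
    makes \<open>b v\<close> vanish identically.\<close>
  then have "b v x = 0" for x using a[of "t x"] by (auto simp: t_th)
  then show False using b_nondeg v_nz by blast
qed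

lemma M_isotypic_hom: "P \<in> M_isotypic R \<rho> n \<Longrightarrow> P \<in> M_hom n"
proof -
  have "M_isotypic R \<rho> n \<subseteq> M_hom n" unfolding M_isotypic_def
    by (rule vp.span_minimal[OF _ M_hom_sub]) blast
  then show "P \<in> M_isotypic R \<rho> n \<Longrightarrow> P \<in> M_hom n" by blast
qed

lemma E_Rad_isotypic: "tens (Ep ^ m) v \<in> Rad \<longleftrightarrow> (\<forall>P\<in>M_isotypic R \<rho> (2 * m). form (tens (Ep ^ m) v) P = 0)"
  unfolding E_Rad_iff form_E proof
  assume a: "\<forall>y\<in>M_hom (2 * m). b v (theta m y) = 0"
  show "\<forall>P\<in>M_isotypic R \<rho> (2 * m). b v (theta m P) = 0" using a M_isotypic_hom by blast
next
  assume a: "\<forall>P\<in>M_isotypic R \<rho> (2 * m). b v (theta m P) = 0"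
  show "\<forall>y\<in>M_hom (2 * m). b v (theta m y) = 0"
  proof
    fix y :: "('n, 'd) vpoly" assume "y \<in> M_hom (2 * m)"
    then have "theta m y = 0" using a by (intro theta_isotypic[of "2 * m" m y]) blast+
    then show "b v (theta m y) = 0" by (simp add: b_right)
  qed
qed

lemma act_sg_hom:
  assumes p: "p \<in> hom_polys i" and u: "u \<in> M_hom j" and ij: "i \<le> j"
  shows "act (sg (mult_op p)) u \<in> M_hom (j - i)"
proof -
  have m: "u \<in> M_hom j \<Longrightarrow> mdeg m \<le> j \<Longrightarrow> act (sg (mult_op (Poly_Mapping.single m c))) u \<in> M_hom (j - mdeg m)" for m c u j
  proof (induction m arbitrary: u j rule: monomial_induct)
    case zero
    then show ?case using act_sg_mult(3)[of c u] M_hom_simps(2)[OF zero(1)] by (simp add: const_poly_def)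
  next
    case (step i m)
    have e: "Poly_Mapping.single (Poly_Mapping.single i 1 + m) c = lin_poly (axis i 1) * Poly_Mapping.single m c"
      by (simp add: mult_single lin_poly_axis)
    have j: "j \<noteq> 0" "mdeg m \<le> j - 1" "j - mdeg (Poly_Mapping.single i 1 + m) = j - 1 - mdeg m"
      using step.prems(2) by (auto simp: mdeg_add)
    show ?case unfolding e act_sg_mult(2) act_sg_mult(4) j(3)
      by (rule step.IH[OF act_Y_low(1)[OF step.prems(1) j(1)] j(2)])
  qed
  have "act (sg (mult_op p)) u = (\<Sum>m\<in>Poly_Mapping.keys p. act (sg (mult_op (Poly_Mapping.single m (Poly_Mapping.lookup p m)))) u)"
    unfolding act_sg_sum[symmetric] poly_mapping_sum_single[symmetric] ..
  also have "\<dots> \<in> M_hom (j - i)"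
  proof (rule M_hom_simps(5))
    fix x assume "x \<in> Poly_Mapping.keys p"
    then have "mdeg x = i" using p by (simp add: hom_polys_def)
    then show "act (sg (mult_op (Poly_Mapping.single x (Poly_Mapping.lookup p x)))) u \<in> M_hom (j - i)"
      using m[OF u, of x] ij by simp
  qed
  finally show ?thesis .
qed

text \<open>\<sigma>(p) lowers degrees by the degree of p, so the positive degree j - i remains and
  evaluation at 0 gives zero.\<close>

lemma form_lower: assumes "f \<in> M_hom i" "y \<in> M_hom j" "i < j" shows "form f y = 0"
proof -
  have "ev0 (act (sg (mult_op (f $ l))) y) = 0" for l
    using assms by (intro ev0_hom[OF act_sg_hom[OF _ assms(2)]]) (auto simp: M_hom_iff)
  then show ?thesis unfolding form_def by (simp add: b_right)
qed

lemma form_sum_left: "form (sum f A) y = (\<Sum>i\<in>A. form (f i) y)"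
  by (induction A rule: infinite_finite_induct) (simp_all add: form_left)

lemma sub_diff: "verma_submodule R Rp k \<rho> U \<Longrightarrow> x \<in> U \<Longrightarrow> y \<in> U \<Longrightarrow> x - y \<in> U"
  unfolding verma_submodule_def by (blast intro: vp.subspace_diff)

lemma sub_scale: "verma_submodule R Rp k \<rho> U \<Longrightarrow> x \<in> U \<Longrightarrow> vp_scale c x \<in> U"
  unfolding verma_submodule_def by (blast intro: vp.subspace_scale)

lemma sub_act: "verma_submodule R Rp k \<rho> U \<Longrightarrow> h \<in> HH \<Longrightarrow> x \<in> U \<Longrightarrow> act h x \<in> U"
  unfolding verma_submodule_def using verma_act_eq by (metis image_subset_iff)

lemma sub_hop: "verma_submodule R Rp k \<rho> U \<Longrightarrow> x \<in> U \<Longrightarrow> hop x \<in> U"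
  unfolding hop_def act_sg_E[symmetric] by (intro sub_diff sub_act V.mult_H sg_H)

lemma hop_add: "hop (u + u') = hop u + hop u'"
  unfolding hop_def FE_add act_right by (simp add: algebra_simps)

lemma hop_sum: "hop (sum f A) = (\<Sum>i\<in>A. hop (f i))"
proof -
  have "hop 0 = 0" using hop_add[of 0 0] by simp
  then show ?thesis by (induction A rule: infinite_finite_induct) (simp_all add: hop_add)
qed

text \<open>The Euler-type operator \<open>hop\<close> separates degrees, so a submodule contains an element of degree zero as soon as
  one of its elements has a nonzero component of degree zero.\<close>

lemma submodule_degree_0:
  assumes U: "verma_submodule R Rp k \<rho> U"
    and f: "\<And>j. f j \<in> M_hom j" and "(\<Sum>j\<le>N. f j) \<in> U" and "f 0 \<noteq> 0"
  shows "\<exists>x. x \<noteq> 0 \<and> x \<in> M_hom 0 \<and> x \<in> U"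
  using assms(2-)
proof (induction N arbitrary: f)
  case 0
  then show ?case by auto
next
  case (Suc N)
  obtain c where c: "\<And>n u. u \<in> M_hom n \<Longrightarrow> hop u = vp_scale (of_nat n + c) u" using hop_scalar by blast
  \<comment> \<open>\<open>hop\<close> minus its eigenvalue in degree N + 1: the constant c cancels,
    the top component disappears, and the component of degree zero is multiplied by -(N +
    1).\<close>
  define g where "g j = vp_scale (of_nat j - of_nat (Suc N)) (f j)" for j
  let ?u = "\<Sum>j\<le>Suc N. f j"
  have "hop ?u - vp_scale (of_nat (Suc N) + c) ?u = (\<Sum>j\<le>Suc N. g j)"
    unfolding hop_sum vp.scale_sum_right sum_subtractf[symmetric]
    by (intro sum.cong refl) (simp add: c[OF Suc.prems(1)] g_def vp.scale_left_diff_distrib[symmetric])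
  also have "\<dots> = (\<Sum>j\<le>N. g j)" by (simp add: g_def vp_simps)
  finally have e: "hop ?u - vp_scale (of_nat (Suc N) + c) ?u = (\<Sum>j\<le>N. g j)" .
  have "(\<Sum>j\<le>N. g j) \<in> U"
    using sub_diff[OF U sub_hop[OF U Suc.prems(2)] sub_scale[OF U Suc.prems(2), of "of_nat (Suc N) + c"]] by (simp only: e)
  moreover have "g j \<in> M_hom j" for j unfolding g_def by (intro M_hom_simps(2) Suc.prems)
  moreover have "g 0 \<noteq> 0"
  proof
    assume "g 0 = 0"
    moreover have "(of_nat 0 - of_nat (Suc N) :: complex) \<noteq> 0" using of_nat_neq_0[of N, where 'a = complex] by (simp only: of_nat_0 diff_0 neg_equal_0_iff_equal not_False_eq_True)
    ultimately show False using Suc.prems(3) unfolding g_def vp.scale_eq_0_iff by blast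
  qed
  ultimately show ?case using Suc.IH by blast
qed

text \<open>If x in U pairs nontrivially with y = a.(1 tensor v), then \<sigma>(a) x lies in U and
  has a nonzero part of degree zero. Hence U meets 1 tensor V, contains it by irreducibility, and is
  everything.\<close>

lemma proper_submodule: assumes U: "verma_submodule R Rp k \<rho> U" "U \<noteq> UNIV" shows "U \<subseteq> Rad"
proof (rule ccontr)
  assume "\<not> U \<subseteq> Rad"
  then obtain x y where xy: "x \<in> U" "form x y \<noteq> 0" unfolding Rad_def by blast
  obtain a where a: "a \<in> HH" "act a (tens 1 v) = y" using cyclic by blast
  let ?u = "act (sg a) x"
  have uU: "?u \<in> U" by (rule sub_act[OF U(1) sg_H[OF a(1)] xy(1)])
  have "form x y = b v (ev0 ?u)" unfolding form_sym[of x] a(2)[symmetric] by (rule form_act[OF a(1)])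
  then have e: "ev0 ?u \<noteq> 0" using xy(2) by (auto simp: b_right)
  obtain N f where f: "?u = (\<Sum>j\<le>N. f j)" "\<And>j. f j \<in> M_hom j" using hom_decomp_ex[of ?u] by (elim exE conjE) (rule that, assumption, erule spec)
  have "ev0 ?u = (\<Sum>j\<le>N. if j = 0 then ev0 (f 0) else 0)"
    unfolding f(1) ev0_sum by (intro sum.cong refl) (auto simp: ev0_hom[OF f(2)])
  then have "f 0 \<noteq> 0" using e by (auto simp: ev0_simps)
  then obtain x0 where x0: "x0 \<noteq> 0" "x0 \<in> M_hom 0" "x0 \<in> U"
    using submodule_degree_0[OF U(1) f(2) uU[unfolded f(1)]] \<open>f 0 \<noteq> 0\<close> by blast
  have x0e: "x0 = tens 1 (ev0 x0)" using x0(2) by (rule M_hom_0)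
  have sub: "vp.subspace U" using U(1) by (simp add: verma_submodule_def)
  have "{x. tens 1 x \<in> U} = UNIV"
  proof (rule invariant_subspace)
    show "vec.subspace {x. tens 1 x \<in> U}"
      by (rule vec.subspaceI) (simp_all add: tens_simps vp.subspace_0[OF sub] vp.subspace_add[OF sub] vp.subspace_scale[OF sub])
    show "\<rho> w x \<in> {x. tens 1 x \<in> U}" if w: "w \<in> W" and x: "x \<in> {x. tens 1 x \<in> U}" for w x
    proof -
      have "act (poly_act w) (tens 1 x) \<in> U" using x by (intro sub_act[OF U(1)] V.poly_act_H w) simp
      then show ?thesis by (simp add: act_W_tens[OF w])
    qed
    show "ev0 x0 \<in> {x. tens 1 x \<in> U}" using x0(3) x0e by simp
    show "ev0 x0 \<noteq> 0"
    proof
      assume "ev0 x0 = 0"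
      then have "x0 = tens 1 0" using x0e by (simp only:)
      then show False using x0(1) by (simp add: tens_simps)
    qed
  qed
  then have t: "tens 1 x \<in> U" for x by blast
  have "u \<in> U" for u
  proof -
    have "act (mult_op (u $ i)) (tens 1 (axis i 1)) \<in> U" for i by (rule sub_act[OF U(1) V.mult_H t])
    then have "(\<Sum>i\<in>UNIV. tens (u $ i) (axis i 1)) \<in> U"
      by (intro vp.subspace_sum[OF sub]) (simp add: act_tens)
    then show ?thesis by (simp only: vpoly_expand[symmetric])
  qed
  then show False using U(2) by blast
qed

text \<open>The radical is proper and contains all proper submodules, so it is the only maximal one
  and resolves the definite description.\<close>

lemma L_kernel_eq: "L_kernel R Rp k \<rho> = Rad"
  unfolding L_kernel_def
proof (rule the_equality)
  show "simple_quotient R Rp k \<rho> Rad"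
    unfolding simple_quotient_def using Rad_submodule Rad_proper proper_submodule by blast
  show "J = Rad" if "simple_quotient R Rp k \<rho> J" for J
    using that unfolding simple_quotient_def using Rad_submodule Rad_proper proper_submodule by blast
qed

text \<open>Moving F past l + 1 factors E collects the eigenvalues n + 2j + c for 0 \<le> j \<le> l,
  whose sum is (l + 1)(n + c + l).\<close>

lemma FE_E_power: assumes c: "\<And>n u. u \<in> M_hom n \<Longrightarrow> hop u = vp_scale (of_nat n + c) u" and u: "u \<in> M_hom n"
  shows "FE (act (mult_op (Ep ^ Suc l)) u) = act (mult_op (Ep ^ Suc l)) (FE u)
     + vp_scale (of_nat (Suc l) * (of_nat n + c + of_nat l)) (act (mult_op (Ep ^ l)) u)"
proof -
  have FE1: "FE (act (mult_op Ep) x) = act (mult_op Ep) (FE x) + vp_scale (of_nat n + c) x" if "x \<in> M_hom n" for x n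
    using c[OF that] unfolding hop_def by (simp add: diff_eq_eq add.commute)
  have pw: "act (mult_op (Ep ^ Suc l)) x = act (mult_op Ep) (act (mult_op (Ep ^ l)) x)" for l x
    by (simp add: vec_eq_iff mult.assoc)
  have p0: "act (mult_op (Ep ^ 0)) x = x" for x by (simp add: vec_eq_iff)
  show ?thesis
  proof (induction l)
    case 0
    show ?case unfolding pw p0 FE1[OF u] by (simp add: vec_eq_iff)
  next
    case (Suc l)
    let ?c = "of_nat (Suc l) * (of_nat n + c + of_nat l)" and ?d = "of_nat (2 * Suc l + n) + c"
    have h: "act (mult_op (Ep ^ Suc l)) u \<in> M_hom (2 * Suc l + n)" by (rule act_mult_hom[OF u Ep_power_hom])
    have "FE (act (mult_op (Ep ^ Suc (Suc l))) u) = act (mult_op Ep) (FE (act (mult_op (Ep ^ Suc l)) u)) + vp_scale ?d (act (mult_op (Ep ^ Suc l)) u)"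
      unfolding pw[of "Suc l"] by (rule FE1[OF h])
    also have "act (mult_op Ep) (FE (act (mult_op (Ep ^ Suc l)) u)) = act (mult_op (Ep ^ Suc (Suc l))) (FE u) + vp_scale ?c (act (mult_op (Ep ^ Suc l)) u)"
      unfolding Suc.IH act_right act_scale_right[OF V.mult_H] pw[symmetric] ..
    finally have "FE (act (mult_op (Ep ^ Suc (Suc l))) u) = act (mult_op (Ep ^ Suc (Suc l))) (FE u) + vp_scale (?c + ?d) (act (mult_op (Ep ^ Suc l)) u)"
      by (simp only: vp_simps(3) add.assoc)
    moreover have "?c + ?d = of_nat (Suc (Suc l)) * (of_nat n + c + of_nat (Suc l))" by (simp add: algebra_simps)
    ultimately show ?case by (simp only:)
  qed
qed

lemma E_Rad_imp_degree: assumes E: "tens (Ep ^ m) v \<in> Rad"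
  shows "\<exists>N. \<forall>n\<ge>N. M_hom n \<subseteq> Rad"
proof -
  have sub: "vp.subspace Rad" using Rad_submodule by (simp add: verma_submodule_def)
  have "{x. tens (Ep ^ m) x \<in> Rad} = UNIV"
  proof (rule invariant_subspace)
    show "vec.subspace {x. tens (Ep ^ m) x \<in> Rad}"
      by (rule vec.subspaceI) (simp_all add: tens_simps Rad_sub)
    show "\<rho> w x \<in> {x. tens (Ep ^ m) x \<in> Rad}" if w: "w \<in> W" and x: "x \<in> {x. tens (Ep ^ m) x \<in> Rad}" for w x
    proof -
      have "act (poly_act w) (tens (Ep ^ m) x) \<in> Rad" using x by (intro Rad_act V.poly_act_H w) simp
      then show ?thesis by (simp add: act_W_tens[OF w] Ep_invariant[OF w])
    qed
    show "v \<in> {x. tens (Ep ^ m) x \<in> Rad}" using E by simp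
  qed (rule v_nz)
  then have t: "tens (Ep ^ m) x \<in> Rad" for x by blast
  have Em: "act (mult_op (Ep ^ m)) u \<in> Rad" for u
  proof -
    have "act (mult_op (u $ i)) (tens (Ep ^ m) (axis i 1)) \<in> Rad" for i by (rule Rad_act[OF V.mult_H t])
    then have "(\<Sum>i\<in>UNIV. act (mult_op (Ep ^ m)) (tens (u $ i) (axis i 1))) \<in> Rad"
      by (intro vp.subspace_sum[OF sub]) (simp add: act_tens mult.commute)
    then show ?thesis by (simp only: act_right(4)[symmetric] vpoly_expand[symmetric])
  qed
  obtain c where c: "\<And>n u. u \<in> M_hom n \<Longrightarrow> hop u = vp_scale (of_nat n + c) u" using hop_scalar by blast
  \<comment> \<open>The exponent goes down by one in each step, at the price of a larger bound on
    the degree.\<close>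
  have "\<exists>N. \<forall>n\<ge>N. \<forall>u\<in>M_hom n. act (mult_op (Ep ^ (m - j))) u \<in> Rad" if "j \<le> m" for j
    using that
  proof (induction j)
    case 0
    then show ?case using Em by auto
  next
    case (Suc j)
    then obtain N where N: "\<forall>n\<ge>N. \<forall>u\<in>M_hom n. act (mult_op (Ep ^ (m - j))) u \<in> Rad" by auto
    define l where "l = m - Suc j"
    have l: "m - j = Suc l" using Suc.prems by (simp add: l_def)
    obtain N2 :: nat where N2: "norm c < real N2" using reals_Archimedean2 by blast
    show ?case unfolding l_def[symmetric]
    \<comment> \<open>N2 exceeds |c| and so keeps n + c + l away from 0; the 2 makes up for the
      degrees lost under F.\<close>
    proof (intro exI[of _ "N + N2 + 2"] allI impI ballI)
      fix n :: nat and u :: "('n, 'd) vpoly" assume n: "N + N2 + 2 \<le> n" and u: "u \<in> M_hom n"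
      note N' = N[rule_format, unfolded l]
      have "FE u \<in> M_hom (n - 2)" "N \<le> n - 2" "N \<le> n" using FE_hom(1)[OF u] n by simp_all
      then have 1: "act (mult_op (Ep ^ Suc l)) (FE u) \<in> Rad" and "act (mult_op (Ep ^ Suc l)) u \<in> Rad"
        using N' u by blast+
      then have 2: "FE (act (mult_op (Ep ^ Suc l)) u) \<in> Rad"
        unfolding act_sg_E[symmetric] by (intro Rad_act[OF sg_H[OF V.mult_H]])
      let ?d = "of_nat (Suc l) * (of_nat n + c + of_nat l) :: complex"
      have 3: "vp_scale ?d (act (mult_op (Ep ^ l)) u) \<in> Rad"
        using Rad_diff[OF 2 1] by (simp only: FE_E_power[OF c u] add_diff_cancel_left')
      have "of_nat n + c + of_nat l \<noteq> 0"
      proof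
        assume "of_nat n + c + of_nat l = 0"
        then have "c + of_nat (n + l) = 0" by (simp add: add_ac)
        then have "c = - of_nat (n + l)" by (rule eq_neg_iff_add_eq_0[THEN iffD2])
        then have "norm c = real (n + l)" by (simp only: norm_minus_cancel norm_of_nat)
        then show False using N2 n by simp
      qed
      then have d: "?d \<noteq> 0" using of_nat_neq_0[of l, where 'a = complex] by (simp only: mult_eq_0_iff de_Morgan_disj not_False_eq_True)
      from 3 have "vp_scale (inverse ?d) (vp_scale ?d (act (mult_op (Ep ^ l)) u)) \<in> Rad" by (rule Rad_sub(2))
      then show "act (mult_op (Ep ^ l)) u \<in> Rad" by (simp only: vp.scale_scale left_inverse[OF d] vp.scale_one)
    qed
  qed
  from this[of m] obtain N where "\<forall>n\<ge>N. \<forall>u\<in>M_hom n. act (mult_op (Ep ^ 0)) u \<in> Rad" by auto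
  moreover have "act (mult_op (Ep ^ 0)) u = u" for u by (simp add: vec_eq_iff)
  ultimately show ?thesis by auto
qed

end

section \<open>Finite-dimensionality of the simple quotient\<close>

lemma finite_mdeg: "finite {m :: 'n::finite \<Rightarrow>\<^sub>0 nat. mdeg m < N}"
proof (rule finite_imageD)
  have "Poly_Mapping.lookup m i \<le> mdeg m" for m :: "'n \<Rightarrow>\<^sub>0 nat" and i
    unfolding mdeg_def by (rule member_le_sum) auto
  then have "Poly_Mapping.lookup ` {m :: 'n \<Rightarrow>\<^sub>0 nat. mdeg m < N} \<subseteq> UNIV \<rightarrow>\<^sub>E {..<N}"
    by (auto simp: PiE_def) (meson le_less_trans)
  then show "finite (Poly_Mapping.lookup ` {m :: 'n \<Rightarrow>\<^sub>0 nat. mdeg m < N})"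
    by (rule finite_subset) (simp add: finite_PiE)
qed (rule inj_onI, rule poly_mapping_eqI, simp)

lemma M_hom_finite_span:
  "\<exists>F :: ('n::finite, 'd::finite) vpoly set. finite F \<and> (\<forall>n<N. M_hom n \<subseteq> vp.span F)"
proof -
  let ?F = "(\<lambda>(m, i). tens (Poly_Mapping.single m 1) (axis i 1)) ` ({m :: 'n \<Rightarrow>\<^sub>0 nat. mdeg m < N} \<times> (UNIV :: 'd set))"
  have "u \<in> vp.span ?F" if u: "u \<in> M_hom n" "n < N" for n u
  proof -
    have "tens (u $ i) (axis i 1) \<in> vp.span ?F" for i
    proof -
      have "tens (u $ i) (axis i 1) = (\<Sum>m\<in>Poly_Mapping.keys (u $ i). vp_scale (Poly_Mapping.lookup (u $ i) m) (tens (Poly_Mapping.single m 1) (axis i 1)))"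
      proof -
        have "u $ i = (\<Sum>m\<in>Poly_Mapping.keys (u $ i). const_poly (Poly_Mapping.lookup (u $ i) m) * Poly_Mapping.single m 1)"
          by (rule trans[OF poly_mapping_sum_single]) (intro sum.cong refl single_eq_var)
        then have "tens (u $ i) (axis i 1) = tens (\<Sum>m\<in>Poly_Mapping.keys (u $ i). const_poly (Poly_Mapping.lookup (u $ i) m) * Poly_Mapping.single m 1) (axis i 1)"
          by (rule arg_cong)
        moreover have "tens (sum f A) x = (\<Sum>m\<in>A. tens (f m) x)" for f :: "('n \<Rightarrow>\<^sub>0 nat) \<Rightarrow> 'n mpoly" and A and x :: "complex^'d"
          by (induction A rule: infinite_finite_induct) (simp_all add: tens_simps)
        ultimately show ?thesis by (simp only: tens_simps(4))
      qed
      also have "\<dots> \<in> vp.span ?F"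
      proof (intro vp.span_sum vp.span_scale vp.span_base)
        fix m assume "m \<in> Poly_Mapping.keys (u $ i)"
        then have "mdeg m < N" using u by (auto simp: M_hom_iff hom_polys_def)
        then show "tens (Poly_Mapping.single m 1) (axis i 1) \<in> ?F" by (intro image_eqI[of _ _ "(m, i)"]) simp_all
      qed
      finally show ?thesis .
    qed
    then have "(\<Sum>i\<in>UNIV. tens (u $ i) (axis i 1)) \<in> vp.span ?F" by (intro vp.span_sum)
    then show ?thesis by (simp only: vpoly_expand[of u, symmetric])
  qed
  then have 1: "\<And>n. n < N \<Longrightarrow> M_hom n \<subseteq> vp.span ?F" by blast
  have 2: "finite ?F" by (intro finite_imageI finite_cartesian_product finite_mdeg finite)
  show ?thesis using 1 2 by (intro exI[of _ ?F]) blast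
qed

context verma_forms
begin

lemma L_finite_dim_iff: "L_finite_dim R Rp k \<rho> \<longleftrightarrow> (\<exists>m. tens (Ep ^ m) v \<in> Rad)"
proof
  have sub: "vp.subspace Rad" using Rad_submodule by (simp add: verma_submodule_def)
  assume "\<exists>m. tens (Ep ^ m) v \<in> Rad"
  then obtain N where N: "\<forall>n\<ge>N. M_hom n \<subseteq> Rad" using E_Rad_imp_degree by blast
  obtain F :: "('n, 'd) vpoly set" where F: "finite F" "\<And>n. n < N \<Longrightarrow> M_hom n \<subseteq> vp.span F"
    using M_hom_finite_span[of N] by blast
  have "\<exists>f\<in>vp.span F. u - f \<in> Rad" for u
  proof -
    obtain K f where f: "u = (\<Sum>j\<le>K. f j)" "\<And>j. f j \<in> M_hom j" using hom_decomp_ex[of u] by (elim exE conjE) (rule that, assumption, erule spec)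
    let ?A = "{j \<in> {..K}. j < N}" and ?B = "{j \<in> {..K}. \<not> j < N}"
    have "u = sum f ?A + sum f ?B" unfolding f(1) by (subst sum.union_disjoint[symmetric]) (auto intro: sum.cong)
    moreover have "sum f ?A \<in> vp.span F" using F(2) f(2) by (intro vp.span_sum) blast
    moreover have "sum f ?B \<in> Rad" using N f(2) by (intro vp.subspace_sum[OF sub]) (auto simp: not_less)
    ultimately show ?thesis by (intro bexI[of _ "sum f ?A"]) simp_all
  qed
  then show "L_finite_dim R Rp k \<rho>" unfolding L_finite_dim_def L_kernel_eq using F(1) by blast
next
  assume "L_finite_dim R Rp k \<rho>"
  then obtain F where F: "finite F" "\<And>u. \<exists>f\<in>vp.span F. u - f \<in> Rad" unfolding L_finite_dim_def L_kernel_eq by blast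
  \<comment> \<open>By \<open>form_lower\<close> the finitely many spanning vectors pair to zero
    with all high degrees, and the radical pairs to zero with everything. Hence E^D v pairs to zero
    with degree 2D, which is at least D.\<close>
  have "\<exists>D. \<forall>f\<in>F. \<forall>j\<ge>D. \<forall>y\<in>M_hom j. form f y = 0" using F(1)
  proof (induction F rule: finite_induct)
    case (insert x F)
    then obtain D where D: "\<forall>f\<in>F. \<forall>j\<ge>D. \<forall>y\<in>M_hom j. form f y = 0" by blast
    obtain K f where f: "x = (\<Sum>j\<le>K. f j)" "\<And>j. f j \<in> M_hom j" using hom_decomp_ex[of x] by (elim exE conjE) (rule that, assumption, erule spec)
    have "form x y = 0" if "j \<ge> Suc K" "y \<in> M_hom j" for j y
      unfolding f(1) form_sum_left using form_lower[OF f(2) that(2)] that(1) by (intro sum.neutral) auto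
    then show ?case using D by (intro exI[of _ "max D (Suc K)"]) auto
  qed simp
  then obtain D where D: "\<And>f j y. f \<in> F \<Longrightarrow> j \<ge> D \<Longrightarrow> y \<in> M_hom j \<Longrightarrow> form f y = 0" by blast
  obtain f where f: "f \<in> vp.span F" "tens (Ep ^ D) v - f \<in> Rad" using F(2) by blast
  have "form f y = 0" if y: "y \<in> M_hom (2 * D)" for y
    using f(1)
  proof (induction rule: vp.span_induct_alt)
    case (step c x u)
    then show ?case using D[OF _ _ y] by (simp add: form_left)
  qed (rule form_left)
  moreover have "form (tens (Ep ^ D) v) y = form (tens (Ep ^ D) v - f) y + form f y" for y
    using form_left(1)[of "tens (Ep ^ D) v - f" f y] by simp
  ultimately have "b v (theta D y) = 0" if "y \<in> M_hom (2 * D)" for y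
    using that f(2) unfolding form_E[symmetric] Rad_def by simp
  then show "\<exists>m. tens (Ep ^ m) v \<in> Rad" using E_Rad_iff by blast
qed

end

section \<open>Polynomial dependence on the parameters\<close>

lemma prod_keys_superset:
  assumes "finite A" "Poly_Mapping.keys m \<subseteq> A"
  shows "(\<Prod>x\<in>Poly_Mapping.keys m. f x ^ Poly_Mapping.lookup m x) = (\<Prod>x\<in>A. f x ^ Poly_Mapping.lookup m x :: complex)"
  using assms by (intro prod.mono_neutral_left) (auto simp: in_keys_iff)

lemma poly_eval_superset:
  assumes "finite A" "Poly_Mapping.keys p \<subseteq> A"
  shows "poly_eval f p = (\<Sum>m\<in>A. Poly_Mapping.lookup p m * (\<Prod>x\<in>Poly_Mapping.keys m. f x ^ Poly_Mapping.lookup m x))"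
  unfolding poly_eval_def using assms by (intro sum.mono_neutral_left) (auto simp: in_keys_iff)

lemma poly_eval_add: "poly_eval f (p + q) = poly_eval f p + poly_eval f q"
proof -
  let ?A = "Poly_Mapping.keys p \<union> Poly_Mapping.keys q"
  have "finite ?A" "Poly_Mapping.keys p \<subseteq> ?A" "Poly_Mapping.keys q \<subseteq> ?A" "Poly_Mapping.keys (p + q) \<subseteq> ?A"
    using Poly_Mapping.keys_add[of p q] by auto
  from this(2-4)[THEN poly_eval_superset[OF this(1)]] show ?thesis
    by (simp only: lookup_add distrib_right sum.distrib)
qed

lemma poly_eval_single: "poly_eval f (Poly_Mapping.single m c) = c * (\<Prod>x\<in>Poly_Mapping.keys m. f x ^ Poly_Mapping.lookup m x)"
  by (cases "c = 0") (simp_all add: poly_eval_def)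

lemma poly_eval_sum: "poly_eval f (sum p A) = (\<Sum>i\<in>A. poly_eval f (p i))"
proof (induction A rule: infinite_finite_induct)
  case (insert x F)
  then show ?case by (simp add: poly_eval_add)
qed (simp_all add: poly_eval_def)

text \<open>The variable \<alpha> may or may not occur in a monomial already, so both products are
  extended to a common set of variables containing \<alpha>.\<close>

lemma poly_eval_var_mult: "poly_eval f (pvar \<alpha> * p) = f \<alpha> * poly_eval f p"
proof -
  let ?s = "Poly_Mapping.single \<alpha> (1::nat)"
  have m: "poly_eval f (pvar \<alpha> * Poly_Mapping.single m c) = f \<alpha> * poly_eval f (Poly_Mapping.single m c)" for m c
  proof -
    let ?A = "insert \<alpha> (Poly_Mapping.keys m)"
    have A: "finite ?A" by simp
    have k: "Poly_Mapping.keys (?s + m) \<subseteq> ?A" using Poly_Mapping.keys_add[of ?s m] by auto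
    have "(\<Prod>x\<in>?A. f x ^ Poly_Mapping.lookup (?s + m) x)
        = (\<Prod>x\<in>?A. (if x = \<alpha> then f x else 1)) * (\<Prod>x\<in>?A. f x ^ Poly_Mapping.lookup m x)"
      unfolding prod.distrib[symmetric] by (intro prod.cong refl) (auto simp: lookup_add power_add lookup_single when_def)
    also have "(\<Prod>x\<in>?A. (if x = \<alpha> then f x else 1)) = f \<alpha>" using A by (simp add: prod.delta)
    finally have "(\<Prod>x\<in>Poly_Mapping.keys (?s + m). f x ^ Poly_Mapping.lookup (?s + m) x)
        = f \<alpha> * (\<Prod>x\<in>Poly_Mapping.keys m. f x ^ Poly_Mapping.lookup m x)"
      unfolding prod_keys_superset[OF A k] prod_keys_superset[OF A subset_insertI] .
    then show ?thesis by (simp add: mult_single poly_eval_single)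
  qed
  have "poly_eval f (pvar \<alpha> * (\<Sum>m\<in>A. Poly_Mapping.single m (g m))) = f \<alpha> * poly_eval f (\<Sum>m\<in>A. Poly_Mapping.single m (g m))" for A g
    by (simp only: sum_distrib_left poly_eval_sum m)
  from this[where A = "Poly_Mapping.keys p" and g = "Poly_Mapping.lookup p"] show ?thesis
    by (simp only: poly_mapping_sum_single[of p, symmetric])
qed

lemma poly_vars_simps: "poly_vars (p + q) \<subseteq> poly_vars p \<union> poly_vars q" "poly_vars (const_poly c) = {}"
  "poly_vars (pvar \<alpha> * p) \<subseteq> insert \<alpha> (poly_vars p)"
proof -
  show "poly_vars (p + q) \<subseteq> poly_vars p \<union> poly_vars q"
    unfolding poly_vars_def using Poly_Mapping.keys_add[of p q] by blast
  show "poly_vars (const_poly c) = {}" by (simp add: poly_vars_def const_poly_def)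
  show "poly_vars (pvar \<alpha> * p) \<subseteq> insert \<alpha> (poly_vars p)"
  proof
    fix x assume "x \<in> poly_vars (pvar \<alpha> * p)"
    then obtain m where m: "m \<in> Poly_Mapping.keys (pvar \<alpha> * p)" "x \<in> Poly_Mapping.keys m" by (auto simp: poly_vars_def)
    then obtain m' where m': "m = Poly_Mapping.single \<alpha> 1 + m'" "m' \<in> Poly_Mapping.keys p"
      using Poly_Mapping.keys_mult[of "pvar \<alpha>" p] by auto
    then have "x \<in> insert \<alpha> (Poly_Mapping.keys m')" using m(2) Poly_Mapping.keys_add[of "Poly_Mapping.single \<alpha> 1" m'] by auto
    then show "x \<in> insert \<alpha> (poly_vars p)" using m'(2) by (auto simp: poly_vars_def)
  qed
qed

text \<open>Polynomial functions of k with values in P tensor V and variables from A. Since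
  parameters are introduced one factor at a time, closure under linear maps free of k is a direct
  induction, and no coordinates are needed.\<close>

inductive poly_fun :: "(real^'n) set \<Rightarrow> ((real^'n \<Rightarrow> complex) \<Rightarrow> ('n::finite, 'd::finite) vpoly) \<Rightarrow> bool" for A
  where
    pf_const: "poly_fun A (\<lambda>_. u)"
  | pf_add: "poly_fun A g \<Longrightarrow> poly_fun A h \<Longrightarrow> poly_fun A (\<lambda>k. g k + h k)"
  | pf_scale: "\<alpha> \<in> A \<Longrightarrow> poly_fun A g \<Longrightarrow> poly_fun A (\<lambda>k. vp_scale (k \<alpha>) (g k))"

lemma poly_fun_map:
  assumes "poly_fun A g" and "\<And>u u'. T (u + u') = T u + T u'" "\<And>c u. T (vp_scale c u) = vp_scale c (T u)"
  shows "poly_fun A (\<lambda>k. T (g k))"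
  using assms(1)
proof (induction rule: poly_fun.induct)
  case (pf_add g h)
  show ?case unfolding assms(2) by (rule poly_fun.pf_add[OF pf_add.IH])
next
  case (pf_scale \<alpha> g)
  show ?case unfolding assms(3) by (rule poly_fun.pf_scale[OF pf_scale.hyps(1) pf_scale.IH])
qed (rule poly_fun.pf_const)

lemma poly_fun_sum: "(\<And>i. i \<in> I \<Longrightarrow> poly_fun A (g i)) \<Longrightarrow> poly_fun A (\<lambda>k. \<Sum>i\<in>I. g i k)"
proof (induction I rule: infinite_finite_induct)
  case (insert x F)
  have "poly_fun A (\<lambda>k. g x k + (\<Sum>i\<in>F. g i k))" by (intro poly_fun.pf_add insert) simp_all
  then show ?case using insert(1,2) by (simp only: sum.insert not_False_eq_True)
qed (simp_all add: poly_fun.pf_const)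

text \<open>Here an actual polynomial Q is produced. It is built along the generation of g and
  therefore is the same for all k.\<close>

lemma poly_fun_eval:
  assumes "poly_fun A g" and "\<And>u u'. l (u + u') = l u + l u'" "\<And>c u. l (vp_scale c u) = c * l u"
  shows "\<exists>Q. poly_vars Q \<subseteq> A \<and> (\<forall>k. l (g k) = poly_eval k Q)"
  using assms(1)
proof (induction rule: poly_fun.induct)
  case (pf_const u)
  show ?case by (intro exI[of _ "const_poly (l u)"]) (simp add: const_poly_def poly_eval_single poly_vars_def)
next
  case (pf_add g h)
  then obtain Q Q' where "poly_vars Q \<subseteq> A" "poly_vars Q' \<subseteq> A" "\<forall>k. l (g k) = poly_eval k Q" "\<forall>k. l (h k) = poly_eval k Q'"
    by (elim exE conjE) (rule that)
  then show ?case using poly_vars_simps(1)[of Q Q'] by (intro exI[of _ "Q + Q'"]) (auto simp: assms(2) poly_eval_add)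
next
  case (pf_scale \<alpha> g)
  then obtain Q where "poly_vars Q \<subseteq> A" "\<forall>k. l (g k) = poly_eval k Q" by (elim exE conjE) (rule that)
  then show ?case using pf_scale.hyps(1) poly_vars_simps(3)[of \<alpha> Q]
    by (intro exI[of _ "pvar \<alpha> * Q"]) (auto simp: assms(3) poly_eval_var_mult simp del: One_nat_def)
qed

context roots
begin

text \<open>The Dunkl operator on P tensor V as an explicit function of k, with each parameter as a
  separate scalar factor. No invariance of k enters, and k is an argument instead of being fixed by
  a locale, so that different values can be compared.\<close>

definition dunkl_k where
  "dunkl_k Rp \<rho> y k u = app (Lv (eD y)) u +
    (\<Sum>\<alpha>\<in>Rp. vp_scale (k \<alpha>) (vp_scale (pairing (cplx \<alpha>) y) (app (Mv \<rho> (root_refl R \<alpha>)) (app (Lv (eQ \<alpha>)) u))))"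

definition FE_k where
  "FE_k Rp \<rho> z k u = vp_scale (1/2) (\<Sum>i\<in>UNIV. dunkl_k Rp \<rho> (B_map R (cplx (z i))) k (dunkl_k Rp \<rho> (B_map R (cplx (z i))) k u))"

lemma dunkl_k_poly_fun:
  assumes g: "poly_fun Rp g" and Rp: "Rp \<subseteq> R"
  shows "poly_fun Rp (\<lambda>k. dunkl_k Rp \<rho> y k (g k))"
  unfolding dunkl_k_def
proof (rule poly_fun.pf_add[OF _ poly_fun_sum])
  show "poly_fun Rp (\<lambda>k. app (Lv (eD y)) (g k))"
    by (rule poly_fun_map[OF g]) (simp_all add: app_sum vec_eq_iff dir_deriv_add dir_deriv_scale)
  fix \<alpha> assume a: "\<alpha> \<in> Rp"
  have aR: "\<alpha> \<in> R" using a Rp by blast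
  show "poly_fun Rp (\<lambda>k. vp_scale (k \<alpha>) (vp_scale (pairing (cplx \<alpha>) y) (app (Mv \<rho> (root_refl R \<alpha>)) (app (Lv (eQ \<alpha>)) (g k)))))"
    by (rule poly_fun.pf_scale[OF a], rule poly_fun_map[OF g])
      (simp_all add: vec_eq_iff app_eQ aR dq_add dq_scale distrib_left sum.distrib sum_distrib_left mult_ac)
qed

lemma FE_k_poly_fun:
  assumes Rp: "Rp \<subseteq> R" shows "poly_fun Rp (\<lambda>k. (FE_k Rp \<rho> z k ^^ m) u)"
proof (induction m)
  case 0
  show ?case unfolding funpow_0 by (rule poly_fun.pf_const)
next
  case (Suc m)
  show ?case unfolding funpow.simps comp_apply FE_k_def[of _ _ _ _ "(FE_k Rp \<rho> z _ ^^ m) u"]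
    by (rule poly_fun_map[where T = "vp_scale (1/2)"], rule poly_fun_sum)
      (intro dunkl_k_poly_fun Suc.IH Rp, simp_all add: vp.scale_right_distrib vp.scale_scale mult.commute)
qed

end

text \<open>A basis of U is an independent set inside a finitely spanned space, hence
  finite.\<close>

lemma finite_span_subspace:
  assumes "vp.subspace U" "U \<subseteq> vp.span F" "finite F"
  shows "\<exists>F'. finite F' \<and> vp.span F' = U"
proof -
  obtain B where B: "B \<subseteq> U" "vp.independent B" "U \<subseteq> vp.span B" using vp.basis_exists[of U] .
  have "finite B" using vp.independent_span_bound[OF assms(3) B(2) subset_trans[OF B(1) assms(2)]] by (rule conjunct1)
  moreover have "vp.span B = U" by (rule antisym[OF vp.span_minimal[OF B(1) assms(1)] B(3)])
  ultimately show ?thesis by (intro exI[of _ B] conjI)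
qed

context verma_forms
begin

lemma FE_eq: "FE = FE_k Rp \<rho> z k"
proof
  have d: "act (dunkl R Rp k y) u = dunkl_k Rp \<rho> y k u" for y u
    unfolding act_Y dm.mY_def app_simps app_sum_left mK_scale dunkl_k_def vp.scale_scale ..
  show "FE u = FE_k Rp \<rho> z k u" for u unfolding FE_def FE_k_def d ..
qed

text \<open>The right-hand side mentions k in \<open>FE_k\<close> only, which makes a polynomial
  independent of the choice of k possible.\<close>

lemma form_E_eval: "verma_form R Rp k \<rho> b v (E_power_vec R Rp k \<rho> z m v) P = b v (ev0 ((FE_k Rp \<rho> z k ^^ m) P))"
  unfolding verma_form_eq E_power_vec_eq form_E theta_def FE_eq ..

lemma finite_dim_criterion: "L_finite_dim R Rp k \<rho> \<longleftrightarrow>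
  (\<exists>m. \<forall>P\<in>M_isotypic R \<rho> (2 * m). verma_form R Rp k \<rho> b v (E_power_vec R Rp k \<rho> z m v) P = 0)"
  unfolding L_finite_dim_iff E_Rad_isotypic verma_form_eq E_power_vec_eq ..

lemma radical_criterion:
  assumes Ps: "vp.span Ps = M_isotypic R \<rho> (2 * m)"
  shows "E_power_vec R Rp k \<rho> z m v \<in> form_radical R Rp k \<rho> b v \<inter> M_hom (2 * m) \<longleftrightarrow>
    (\<forall>P\<in>Ps. verma_form R Rp k \<rho> b v (E_power_vec R Rp k \<rho> z m v) P = 0)"
proof -
  let ?x = "tens (Ep ^ m) v"
  have h: "?x \<in> M_hom (2 * m)" by (intro tens_hom Ep_power_hom)
  have "form ?x P = 0" if z: "\<forall>P\<in>Ps. form ?x P = 0" and P: "P \<in> vp.span Ps" for P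
    using P
  proof (induction rule: vp.span_induct_alt)
    case base
    show ?case by (rule form_right)
  next
    case (step c y u)
    then have "form ?x y = 0" "form ?x u = 0" using z by blast+
    then show ?case by (simp add: form_right)
  qed
  then have iff: "(\<forall>P\<in>vp.span Ps. form ?x P = 0) \<longleftrightarrow> (\<forall>P\<in>Ps. form ?x P = 0)" using vp.span_base by blast
  show ?thesis unfolding form_radical_eq verma_form_eq E_power_vec_eq Int_iff E_Rad_isotypic Ps[symmetric] iff
    using h by (simp only: simp_thms)
qed

lemma isotypic_finite: "\<exists>F. finite F \<and> vp.span F = M_isotypic R \<rho> n"
proof -
  obtain F :: "('n, 'd) vpoly set" where F: "finite F" "M_hom n \<subseteq> vp.span F" using M_hom_finite_span[of "Suc n"] by blast
  have "M_isotypic R \<rho> n \<subseteq> vp.span F" using M_isotypic_hom F(2) by blast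
  then show ?thesis by (intro finite_span_subspace[OF _ _ F(1)]) (simp_all add: M_isotypic_def vp.subspace_span)
qed

lemma b_eval_poly_fun: assumes "poly_fun Rp g" shows "\<exists>Q. poly_vars Q \<subseteq> Rp \<and> (\<forall>k. b v (ev0 (g k)) = poly_eval k Q)"
  by (rule poly_fun_eval[OF assms]) (simp_all only: ev0_simps b_right)

end

theorem mainTheorem3:
  fixes R Rp :: "(real^'n) set"
    and ch :: "(real^'n \<Rightarrow> real^'n) \<Rightarrow> complex"
    and \<rho> :: "(real^'n \<Rightarrow> real^'n) \<Rightarrow> complex^'d \<Rightarrow> complex^'d"
    and b :: "complex^'d \<Rightarrow> complex^'d \<Rightarrow> complex"
    and v :: "complex^'d"
    and z :: "'n \<Rightarrow> real^'n"
  assumes "reduced_root_system R"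
    and "positive_system R Rp"
    and "irreducible_rep R \<rho>" and "has_character R \<rho> ch"
    and "nondeg_sym_inv_form R \<rho> b"
    and "v \<noteq> 0"
    and "B_orthonormal_basis R z"
  shows
    "(\<forall>k. invariant_mult R k \<longrightarrow>
        (L_finite_dim R Rp k \<rho> \<longleftrightarrow>
          (\<exists>m. \<forall>P\<in>M_isotypic R \<rho> (2 * m).
             verma_form R Rp k \<rho> b v (E_power_vec R Rp k \<rho> z m v) P = 0))) \<and>
     (\<forall>m.
        (\<exists>F. finite F \<and> vp.span F = M_isotypic R \<rho> (2 * m)) \<and>
        (\<forall>P\<in>M_isotypic R \<rho> (2 * m). \<exists>Q. poly_vars Q \<subseteq> Rp \<and>
           (\<forall>k. invariant_mult R k \<longrightarrow>
              verma_form R Rp k \<rho> b v (E_power_vec R Rp k \<rho> z m v) P = poly_eval k Q)) \<and>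
        (\<forall>Ps. vp.independent Ps \<and> vp.span Ps = M_isotypic R \<rho> (2 * m) \<longrightarrow>
           (\<exists>Q. (\<forall>P\<in>Ps. poly_vars (Q P) \<subseteq> Rp) \<and>
              (\<forall>k. invariant_mult R k \<longrightarrow>
                 (\<forall>P\<in>Ps. verma_form R Rp k \<rho> b v (E_power_vec R Rp k \<rho> z m v) P
                           = poly_eval k (Q P)) \<and>
                 (E_power_vec R Rp k \<rho> z m v
                    \<in> form_radical R Rp k \<rho> b v \<inter> M_hom (2 * m) \<longleftrightarrow>
                  (\<forall>P\<in>Ps. poly_eval k (Q P) = 0))))))"
proof -
  have rep: "is_rep R \<rho>" using assms(3) by (simp only: irreducible_rep_def)
  have VF: "verma_forms R Rp k z \<rho> b v" if "invariant_mult R k" for k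
    by (unfold_locales; (rule assms rep that))
  \<comment> \<open>k = 0 is an invariant parameter. Its instance gives access to the facts free of
    k: the finite spanning set, the inclusion of \<open>Rp\<close> in \<open>R\<close>, and the
    polynomials Q.\<close>
  have "invariant_mult R (\<lambda>_. 0)" by (simp add: invariant_mult_def)
  then interpret V0: verma_forms R Rp "\<lambda>_. 0" z \<rho> b v by (rule VF)
  have Rp: "Rp \<subseteq> R" using V0.Rp_R by blast
  have poly: "\<exists>Q. poly_vars Q \<subseteq> Rp \<and> (\<forall>k. invariant_mult R k \<longrightarrow>
      verma_form R Rp k \<rho> b v (E_power_vec R Rp k \<rho> z m v) P = poly_eval k Q)" for m P
  proof -
    \<comment> \<open>Although obtained in the instance k = 0, this Q represents the value for all
      k, because \<open>FE_k\<close> takes k as an argument.\<close>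
    obtain Q where "poly_vars Q \<subseteq> Rp" "\<forall>k. b v (ev0 ((V0.FE_k Rp \<rho> z k ^^ m) P)) = poly_eval k Q"
      using V0.b_eval_poly_fun[OF V0.FE_k_poly_fun[OF Rp, where \<rho> = \<rho> and z = z and m = m and u = P]] by (elim exE conjE) (rule that)
    then show ?thesis by (intro exI[of _ Q]) (simp add: verma_forms.form_E_eval[OF VF])
  qed
  have basis: "\<exists>Q. (\<forall>P\<in>Ps. poly_vars (Q P) \<subseteq> Rp) \<and> (\<forall>k. invariant_mult R k \<longrightarrow>
      (\<forall>P\<in>Ps. verma_form R Rp k \<rho> b v (E_power_vec R Rp k \<rho> z m v) P = poly_eval k (Q P)) \<and>
      (E_power_vec R Rp k \<rho> z m v \<in> form_radical R Rp k \<rho> b v \<inter> M_hom (2 * m) \<longleftrightarrow> (\<forall>P\<in>Ps. poly_eval k (Q P) = 0)))"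
    if Ps: "vp.span Ps = M_isotypic R \<rho> (2 * m)" for m Ps
  proof -
    have "\<forall>P. \<exists>Q. poly_vars Q \<subseteq> Rp \<and> (\<forall>k. invariant_mult R k \<longrightarrow>
        verma_form R Rp k \<rho> b v (E_power_vec R Rp k \<rho> z m v) P = poly_eval k Q)" using poly by blast
    \<comment> \<open>Q is selected for each P before k is fixed.\<close>
    from choice[OF this] obtain Q where Q: "\<forall>P. poly_vars (Q P) \<subseteq> Rp \<and> (\<forall>k. invariant_mult R k \<longrightarrow>
        verma_form R Rp k \<rho> b v (E_power_vec R Rp k \<rho> z m v) P = poly_eval k (Q P))" by (elim exE)
    show ?thesis
    proof (intro exI[of _ Q] conjI allI impI ballI)
      show "poly_vars (Q P) \<subseteq> Rp" for P using Q by blast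
      fix k assume k: "invariant_mult R k"
      have e: "verma_form R Rp k \<rho> b v (E_power_vec R Rp k \<rho> z m v) P = poly_eval k (Q P)" for P using Q k by blast
      show "verma_form R Rp k \<rho> b v (E_power_vec R Rp k \<rho> z m v) P = poly_eval k (Q P)" for P by (rule e)
      show "E_power_vec R Rp k \<rho> z m v \<in> form_radical R Rp k \<rho> b v \<inter> M_hom (2 * m) \<longleftrightarrow> (\<forall>P\<in>Ps. poly_eval k (Q P) = 0)"
        unfolding verma_forms.radical_criterion[OF VF[OF k] Ps] e ..
    qed
  qed
  show ?thesis
  proof (intro conjI allI impI)
    show "L_finite_dim R Rp k \<rho> \<longleftrightarrow> (\<exists>m. \<forall>P\<in>M_isotypic R \<rho> (2 * m).
        verma_form R Rp k \<rho> b v (E_power_vec R Rp k \<rho> z m v) P = 0)" if "invariant_mult R k" for k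
      by (rule verma_forms.finite_dim_criterion[OF VF[OF that]])
    fix m
    show "\<exists>F. finite F \<and> vp.span F = M_isotypic R \<rho> (2 * m)" by (rule V0.isotypic_finite)
    show "\<forall>P\<in>M_isotypic R \<rho> (2 * m). \<exists>Q. poly_vars Q \<subseteq> Rp \<and> (\<forall>k. invariant_mult R k \<longrightarrow>
        verma_form R Rp k \<rho> b v (E_power_vec R Rp k \<rho> z m v) P = poly_eval k Q)" by (intro ballI poly)
  qed (elim conjE, rule basis)
qed

end
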